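(* All matrices and Lie algebras are over $\mathbb{C}$. The following hold: (1) for any invertible square matrix $C$, the contragredient Lie algebra $G(C)\simeq G'(C)$ is isomorphic to a PC Lie algebra; (2) for any symmetrizable matrix $C$ which has a symmetrization with real entries (that is, $C=\Gamma S$ with $\Gamma$ an invertible diagonal matrix and $S$ a real symmetric matrix), the reduced contragredient Lie algebra $G'(C)$ is isomorphic to a symmetric PC Lie algebra; (3) for any square matrix $C$ (not necessarily a generalized Cartan matrix), the Lie algebra $\mathfrak{g}(C)$ is isomorphic to a PC Lie algebra; in particular, any Kac-Moody algebra is isomorphic to a PC Lie algebra; (4) for any square matrix $C$ (not necessarily a generalized Cartan matrix), there exists a PC Lie algebra whose derived algebra is isomorphic to the contragredient Lie algebra $G(C)$ with Cartan matrix $C$.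
   Context: Graded Lie algebras. A ($\mathbb{Z}$-)graded Lie algebra is $\bigoplus_{n\in\mathbb{Z}}V_n$ with $[V_n,V_m]\subset V_{n+m}$, assumed generated by its local part $V_{-1}\oplus V_0\oplus V_1$. It is minimal if for every graded Lie algebra $\bigoplus_n V_n'$, every isomorphism of local parts $V'_{-1}\oplus V'_0\oplus V'_1\to V_{-1}\oplus V_0\oplus V_1$ (preserving all brackets that land in degrees $-1,0,1$) extends to an epimorphism $\bigoplus_n V'_n\to\bigoplus_n V_n$. For every local Lie algebra there is a unique (up to isomorphism) minimal graded Lie algebra with that local part. Standard pentads. Let $\mathfrak{g}$ be a Lie algebra with a non-degenerate invariant bilinear form $B$ (not necessarily symmetric), $\rho:\mathfrak{g}\otimes V\to V$ a representation, and $(\varrho,\mathcal{V})$ a $\mathfrak{g}$-submodule of $\operatorname{Hom}(V,\mathbb{C})$. The pentad $(\mathfrak{g},\rho,V,\mathcal{V},B)$ is standard if the canonical pairing restricted to $V\times\mathcal{V}$ is non-degenerate and there is a linear map $\Phi_\rho:V\otimes\mathcal{V}\to\mathfrak{g}$ with $B(a,\Phi_\rho(v\otimes\phi))=\langle\rho(a\otimes v),\phi\rangle=-\langle v,\varrho(a\otimes\phi)\rangle$ for all $a\in\mathfrak{g},v\in V,\phi\in\mathcal{V}$. The Lie algebra $L(\mathfrak{g},\rho,V,\mathcal{V},B)=\bigoplus_n V_n$ associated with it is the minimal graded Lie algebra with $V_0=\mathfrak{g}$ (as Lie algebra), $V_1=V$, $V_{-1}=\mathcal{V}$ (as $\mathfrak{g}$-modules)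 and $[v,\phi]=\Phi_\rho(v\otimes\phi)$ for $v\in V_1$, $\phi\in V_{-1}$. PC Lie algebras. Let $r,n$ be positive integers, $A\in M(r,r)$ invertible, $D=(d_{ij})\in M(r,n)$, and $\Gamma=\operatorname{diag}(\gamma_1,\dots,\gamma_n)\in M(n,n)$ invertible. Let $\mathfrak{h}^r=\mathbb{C}^r$ (row vectors) be the $r$-dimensional commutative Lie algebra with standard basis $\epsilon_1,\dots,\epsilon_r$ and bilinear form $B_A(a,a')=a\cdot{}^tA^{-1}\cdot{}^ta'$. Let $\mathbb{C}_D=\bigoplus_{j=1}^n\mathbb{C}e_j$ and $\mathbb{C}_{-D}=\bigoplus_{j=1}^n\mathbb{C}f_j$ be the $\mathfrak{h}^r$-modules with actions $\Box_D(\epsilon_i\otimes e_j)=d_{ij}e_j$, $\Box_{-D}(\epsilon_i\otimes f_j)=-d_{ij}f_j$, and identify $\mathbb{C}_{-D}$ with $\operatorname{Hom}(\mathbb{C}_D,\mathbb{C})$ by the pairing $\langle e_i,f_j\rangle=\delta_{ij}\gamma_i$. Then $(\mathfrak{h}^r,\Box_D,\mathbb{C}_D,\mathbb{C}_{-D},B_A)$ is a standard pentad, and $L(r,n;A,D,\Gamma)$ denotes the associated Lie algebra. A PC Lie algebra is a Lie algebra of the form $L(r,n;A,D,\Gamma)$. A symmetric PC Lie algebra is one of the form $L(r,n;A,D,\Gamma)$ with $B_A$ symmetric. Contragredient Lie algebras. For an $n\times n$ matrix $C=(C_{ij})$, $G(C)$ is the minimal graded Lie algebra with local part $G_{-1}\oplus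 G_0\oplus G_1$, where $G_{-1},G_0,G_1$ have bases $\{f_i\},\{h_i\},\{e_i\}$ ($1\le i\le n$) and $[h_i,h_j]=0$, $[e_i,f_j]=\delta_{ij}h_i$, $[h_i,e_j]=C_{ij}e_j$, $[h_i,f_j]=-C_{ij}f_j$. The reduced contragredient Lie algebra is $G'(C)=G(C)/Z(C)$, where $Z(C)$ is the center of $G(C)$. The Lie algebra $\mathfrak{g}(C)$ (Kac). For an $n\times n$ matrix $C$ of rank $l$, take a realization $(\mathfrak{h},\{\alpha_1,\dots,\alpha_n\},\{\alpha_1^\vee,\dots,\alpha_n^\vee\})$: $\mathfrak{h}$ is a vector space of dimension $2n-l$, the $\alpha_i\in\mathfrak{h}^*$ are linearly independent, the $\alpha_i^\vee\in\mathfrak{h}$ are linearly independent, and $\alpha_j(\alpha_i^\vee)=C_{ij}$. Let $\tilde{\mathfrak{g}}(C)$ be the Lie algebra with generators $e_i,f_i$ ($1\le i\le n$), $\mathfrak{h}$ and relations $[e_i,f_j]=\delta_{ij}\alpha_i^\vee$, $[h,h']=0$, $[h,e_i]=\alpha_i(h)e_i$, $[h,f_i]=-\alpha_i(h)f_i$ for $h,h'\in\mathfrak{h}$. Then $\mathfrak{g}(C)$ is the quotient of $\tilde{\mathfrak{g}}(C)$ by its maximal ideal intersecting $\mathfrak{h}$ trivially. When $C$ is a generalized Cartan matrix, $\mathfrak{g}(C)$ is the Kac-Moody algebra of $C$.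
   Formalization: Part (2) excludes the 1×1 zero matrix, where G'(C) is abelian of dimension 2 while every PC Lie algebra has dimension at least 3; minimality is tested against graded Lie algebras on subsets of the algebra's own underlying type, which loses nothing by cardinality. *)

theory Defs
  imports Jordan_Normal_Form.DL_Rank Jordan_Normal_Form.Gauss_Jordan_Elimination
    "HOL-Algebra.QuotRing"
begin

section \<open>Lie algebras over the complex numbers\<close>

abbreviation complex_ring :: "complex ring"
  where "complex_ring \<equiv> class_ring"

abbreviation complex_line :: "(complex, complex) module"
  where "complex_line \<equiv>
    \<lparr>carrier = UNIV, mult = (*), one = 1, zero = 0, add = (+), smult = (*)\<rparr>"

abbreviation linear_maps ::
  "(complex, 'a) module \<Rightarrow> (complex, 'b) module \<Rightarrow> ('a \<Rightarrow> 'b) set"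
  where "linear_maps \<equiv> LinearCombinations.module_hom complex_ring"

definition bilinear_map ::
  "(complex, 'a) module \<Rightarrow> (complex, 'b) module \<Rightarrow> (complex, 'c) module
    \<Rightarrow> ('a \<Rightarrow> 'b \<Rightarrow> 'c) \<Rightarrow> bool"
  where "bilinear_map U V W b \<longleftrightarrow>
    (\<forall>x\<in>carrier U. b x \<in> linear_maps V W) \<and>
    (\<forall>y\<in>carrier V. (\<lambda>x. b x y) \<in> linear_maps U W)"

definition nondegenerate ::
  "(complex, 'a) module \<Rightarrow> (complex, 'b) module \<Rightarrow> ('a \<Rightarrow> 'b \<Rightarrow> complex) \<Rightarrow> bool"
  where "nondegenerate U V b \<longleftrightarrow>
    (\<forall>x\<in>carrier U. (\<forall>y\<in>carrier V. b x y = 0) \<longrightarrow> x = \<zero>\<^bsub>U\<^esub>) \<and>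
    (\<forall>y\<in>carrier V. (\<forall>x\<in>carrier U. b x y = 0) \<longrightarrow> y = \<zero>\<^bsub>V\<^esub>)"

text \<open>As for the locale \<^locale>\<open>algebra\<close>, the product is the field \<^const>\<open>mult\<close> of the module
  record: \<open>x \<otimes>\<^bsub>L\<^esub> y\<close> is the Lie bracket \<open>[x, y]\<close>. The field \<^const>\<open>one\<close> is not used.\<close>

locale lie_algebra = vectorspace complex_ring L for L :: "(complex, 'a) module" (structure) +
  assumes bracket_bilinear: "bilinear_map L L L (\<otimes>)"
    and bracket_alternating: "x \<in> carrier L \<Longrightarrow> x \<otimes> x = \<zero>"
    and jacobi: "\<lbrakk>x \<in> carrier L; y \<in> carrier L; z \<in> carrier L\<rbrakk> \<Longrightarrow>
      x \<otimes> (y \<otimes> z) \<oplus> (y \<otimes> (z \<otimes> x) \<oplus> z \<otimes> (x \<otimes> y)) = \<zero>"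

definition lie_hom :: "(complex, 'a) module \<Rightarrow> (complex, 'b) module \<Rightarrow> ('a \<Rightarrow> 'b) set"
  where "lie_hom L M = {f \<in> linear_maps L M.
    \<forall>x\<in>carrier L. \<forall>y\<in>carrier L. f (x \<otimes>\<^bsub>L\<^esub> y) = f x \<otimes>\<^bsub>M\<^esub> f y}"

definition lie_iso :: "(complex, 'a) module \<Rightarrow> (complex, 'b) module \<Rightarrow> ('a \<Rightarrow> 'b) set"
  where "lie_iso L M = {f \<in> lie_hom L M. bij_betw f (carrier L) (carrier M)}"

definition lie_isomorphic :: "(complex, 'a) module \<Rightarrow> (complex, 'b) module \<Rightarrow> bool"
    (infix \<open>\<simeq>\<^sub>L\<close> 50)
  where "L \<simeq>\<^sub>L M \<longleftrightarrow> lie_iso L M \<noteq> {}"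

definition lie_subalgebra :: "(complex, 'a) module \<Rightarrow> 'a set \<Rightarrow> bool"
  where "lie_subalgebra L S \<longleftrightarrow> VectorSpace.subspace complex_ring S L \<and>
    (\<forall>x\<in>S. \<forall>y\<in>S. x \<otimes>\<^bsub>L\<^esub> y \<in> S)"

definition lie_generated :: "(complex, 'a) module \<Rightarrow> 'a set \<Rightarrow> 'a set"
  where "lie_generated L X = \<Inter>{S. lie_subalgebra L S \<and> X \<subseteq> S}"

definition lie_ideal :: "(complex, 'a) module \<Rightarrow> 'a set \<Rightarrow> bool"
  where "lie_ideal L J \<longleftrightarrow> VectorSpace.subspace complex_ring J L \<and>
    (\<forall>x\<in>carrier L. \<forall>y\<in>J. x \<otimes>\<^bsub>L\<^esub> y \<in> J)"

definition lie_quotient :: "(complex, 'a) module \<Rightarrow> 'a set \<Rightarrow> (complex, 'a set) module"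
  where "lie_quotient L J =
    \<lparr>carrier = a_rcosets\<^bsub>L\<^esub> J, mult = rcoset_mult L J, one = undefined, zero = J,
     add = set_add L, smult = (\<lambda>c X. \<Union>x\<in>X. J +>\<^bsub>L\<^esub> (c \<odot>\<^bsub>L\<^esub> x))\<rparr>"

definition lie_center :: "(complex, 'a) module \<Rightarrow> 'a set"
  where "lie_center L = {z \<in> carrier L. \<forall>x\<in>carrier L. z \<otimes>\<^bsub>L\<^esub> x = \<zero>\<^bsub>L\<^esub>}"

definition derived_algebra :: "(complex, 'a) module \<Rightarrow> (complex, 'a) module"
  where "derived_algebra L = L\<lparr>carrier := LinearCombinations.module.span complex_ring L
    {x \<otimes>\<^bsub>L\<^esub> y | x y. x \<in> carrier L \<and> y \<in> carrier L}\<rparr>"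


section \<open>Graded Lie algebras\<close>

locale graded_lie_algebra = lie_algebra L for L :: "(complex, 'a) module" (structure) +
  fixes V :: "int \<Rightarrow> 'a set"
  assumes component_subspace: "VectorSpace.subspace complex_ring (V i) L"
    and components_span: "x \<in> carrier L \<Longrightarrow>
      \<exists>F v. finite F \<and> (\<forall>i\<in>F. v i \<in> V i) \<and> x = (\<Oplus>i\<in>F. v i)"
    and components_independent:
      "\<lbrakk>finite F; \<And>i. i \<in> F \<Longrightarrow> v i \<in> V i; (\<Oplus>i\<in>F. v i) = \<zero>; i \<in> F\<rbrakk> \<Longrightarrow> v i = \<zero>"
    and bracket_degree: "\<lbrakk>x \<in> V i; y \<in> V j\<rbrakk> \<Longrightarrow> x \<otimes> y \<in> V (i + j)"
    and generated_by_local_part: "lie_generated L (V (-1) \<union> V 0 \<union> V 1) = carrier L"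

text \<open>An isomorphism of local parts is encoded by its restrictions to the three components, so
  \<open>\<psi>\<close> matters only on \<open>V' (-1) \<union> V' 0 \<union> V' 1\<close>.\<close>

definition local_iso ::
  "(complex, 'a) module \<Rightarrow> (int \<Rightarrow> 'a set) \<Rightarrow> (complex, 'b) module \<Rightarrow> (int \<Rightarrow> 'b set)
    \<Rightarrow> ('a \<Rightarrow> 'b) \<Rightarrow> bool"
  where "local_iso L' V' L V \<psi> \<longleftrightarrow>
    (\<forall>i\<in>{-1, 0, 1}. \<psi> \<in> linear_maps (L'\<lparr>carrier := V' i\<rparr>) (L\<lparr>carrier := V i\<rparr>) \<and>
      bij_betw \<psi> (V' i) (V i)) \<and>
    (\<forall>i\<in>{-1, 0, 1}. \<forall>j\<in>{-1, 0, 1}. i + j \<in> {-1, 0, 1} \<longrightarrow>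
      (\<forall>x\<in>V' i. \<forall>y\<in>V' j. \<psi> (x \<otimes>\<^bsub>L'\<^esub> y) = \<psi> x \<otimes>\<^bsub>L\<^esub> \<psi> y))"

text \<open>The competing algebra \<open>L'\<close> ranges over structures, with arbitrary operations, on subsets
  of the type \<open>'a\<close> carrying \<open>L\<close>. This is no restriction: \<open>L'\<close> is generated by a local part
  isomorphic to that of \<open>L\<close>. If this local part is zero, so is \<open>L'\<close>; otherwise it is an infinite
  set, since it is a nonzero complex vector space, and its cardinality bounds the number of all
  finite expressions in its elements, hence the cardinality of \<open>L'\<close>. So every graded Lie algebra
  with the same local part is isomorphic to one on a subset of \<open>'a\<close>.\<close>

definition minimal_graded_lie_algebra ::
  "(complex, 'a) module \<Rightarrow> (int \<Rightarrow> 'a set) \<Rightarrow> bool"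
  where "minimal_graded_lie_algebra L V \<longleftrightarrow> graded_lie_algebra L V \<and>
    (\<forall>(L' :: (complex, 'a) module) V' \<psi>.
      graded_lie_algebra L' V' \<and> local_iso L' V' L V \<psi> \<longrightarrow>
      (\<exists>\<Psi> \<in> lie_hom L' L. \<Psi> ` carrier L' = carrier L \<and>
        (\<forall>i\<in>{-1, 0, 1}. \<forall>x\<in>V' i. \<Psi> x = \<psi> x)))"


section \<open>Standard pentads and their Lie algebras\<close>

definition lie_representation ::
  "(complex, 'g) module \<Rightarrow> (complex, 'v) module \<Rightarrow> ('g \<Rightarrow> 'v \<Rightarrow> 'v) \<Rightarrow> bool"
  where "lie_representation \<gg> V \<rho> \<longleftrightarrow> bilinear_map \<gg> V V \<rho> \<and>
    (\<forall>a\<in>carrier \<gg>. \<forall>b\<in>carrier \<gg>. \<forall>v\<in>carrier V.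
      \<rho> (a \<otimes>\<^bsub>\<gg>\<^esub> b) v = \<rho> a (\<rho> b v) \<ominus>\<^bsub>V\<^esub> \<rho> b (\<rho> a v))"

text \<open>The submodule \<open>\<V>\<close> of \<open>Hom(V, \<complex>)\<close> is given as a module \<open>W\<close> together with a pairing: by
  \<open>pairing_bilinear\<close>, \<open>pairing_nondegenerate\<close> and \<open>pairing_invariant\<close> the map
  \<open>\<phi> \<mapsto> \<langle>\<cdot>, \<phi>\<rangle>\<close> is an injective homomorphism of \<open>\<gg>\<close>-modules from \<open>W\<close> to \<open>Hom(V, \<complex>)\<close> with its
  contragredient action.\<close>

locale pentad = lie_algebra \<gg> + V: vectorspace complex_ring V + W: vectorspace complex_ring W
  for \<gg> :: "(complex, 'g) module" and V :: "(complex, 'v) module" and W :: "(complex, 'w) module" +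
  fixes \<rho> :: "'g \<Rightarrow> 'v \<Rightarrow> 'v" and \<sigma> :: "'g \<Rightarrow> 'w \<Rightarrow> 'w"
    and pairing :: "'v \<Rightarrow> 'w \<Rightarrow> complex" and B :: "'g \<Rightarrow> 'g \<Rightarrow> complex"
  assumes form_bilinear: "bilinear_map \<gg> \<gg> complex_line B"
    and form_nondegenerate: "nondegenerate \<gg> \<gg> B"
    and form_invariant: "\<lbrakk>a \<in> carrier \<gg>; b \<in> carrier \<gg>; c \<in> carrier \<gg>\<rbrakk> \<Longrightarrow>
      B (a \<otimes>\<^bsub>\<gg>\<^esub> b) c = B a (b \<otimes>\<^bsub>\<gg>\<^esub> c)"
    and rho_representation: "lie_representation \<gg> V \<rho>"
    and sigma_representation: "lie_representation \<gg> W \<sigma>"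
    and pairing_bilinear: "bilinear_map V W complex_line pairing"
    and pairing_nondegenerate: "nondegenerate V W pairing"
    and pairing_invariant: "\<lbrakk>a \<in> carrier \<gg>; v \<in> carrier V; \<phi> \<in> carrier W\<rbrakk> \<Longrightarrow>
      pairing (\<rho> a v) \<phi> = - pairing v (\<sigma> a \<phi>)"

definition pentad_map ::
  "(complex, 'g) module \<Rightarrow> (complex, 'v) module \<Rightarrow> (complex, 'w) module
    \<Rightarrow> ('g \<Rightarrow> 'v \<Rightarrow> 'v) \<Rightarrow> ('v \<Rightarrow> 'w \<Rightarrow> complex) \<Rightarrow> ('g \<Rightarrow> 'g \<Rightarrow> complex)
    \<Rightarrow> ('v \<Rightarrow> 'w \<Rightarrow> 'g) \<Rightarrow> bool"
  where "pentad_map \<gg> V W \<rho> pairing B \<Phi> \<longleftrightarrow> bilinear_map V W \<gg> \<Phi> \<and>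
    (\<forall>a\<in>carrier \<gg>. \<forall>v\<in>carrier V. \<forall>\<phi>\<in>carrier W. B a (\<Phi> v \<phi>) = pairing (\<rho> a v) \<phi>)"

locale standard_pentad = pentad +
  assumes ex_pentad_map: "\<exists>\<Phi>. pentad_map \<gg> V W \<rho> pairing B \<Phi>"

text \<open>\<open>L\<close> is, up to isomorphism, the Lie algebra associated with the given standard pentad. The
  map \<open>\<Phi>\<close> is unique because \<open>B\<close> is nondegenerate.\<close>

definition is_pentad_lie_algebra ::
  "(complex, 'g) module \<Rightarrow> (complex, 'v) module \<Rightarrow> (complex, 'w) module
    \<Rightarrow> ('g \<Rightarrow> 'v \<Rightarrow> 'v) \<Rightarrow> ('g \<Rightarrow> 'w \<Rightarrow> 'w) \<Rightarrow> ('v \<Rightarrow> 'w \<Rightarrow> complex)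
    \<Rightarrow> ('g \<Rightarrow> 'g \<Rightarrow> complex) \<Rightarrow> (complex, 'a) module \<Rightarrow> bool"
  where "is_pentad_lie_algebra \<gg> V W \<rho> \<sigma> pairing B L \<longleftrightarrow>
    standard_pentad \<gg> V W \<rho> \<sigma> pairing B \<and>
    (\<exists>L_comp \<Phi> i\<^sub>0 i\<^sub>1 j\<^sub>1.
      minimal_graded_lie_algebra L L_comp \<and>
      pentad_map \<gg> V W \<rho> pairing B \<Phi> \<and>
      i\<^sub>0 \<in> lie_iso \<gg> (L\<lparr>carrier := L_comp 0\<rparr>) \<and>
      i\<^sub>1 \<in> linear_maps V (L\<lparr>carrier := L_comp 1\<rparr>) \<and> bij_betw i\<^sub>1 (carrier V) (L_comp 1) \<and>
      j\<^sub>1 \<in> linear_maps W (L\<lparr>carrier := L_comp (-1)\<rparr>) \<and> bij_betw j\<^sub>1 (carrier W) (L_comp (-1)) \<and>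
      (\<forall>a\<in>carrier \<gg>. \<forall>v\<in>carrier V. i\<^sub>0 a \<otimes>\<^bsub>L\<^esub> i\<^sub>1 v = i\<^sub>1 (\<rho> a v)) \<and>
      (\<forall>a\<in>carrier \<gg>. \<forall>\<phi>\<in>carrier W. i\<^sub>0 a \<otimes>\<^bsub>L\<^esub> j\<^sub>1 \<phi> = j\<^sub>1 (\<sigma> a \<phi>)) \<and>
      (\<forall>v\<in>carrier V. \<forall>\<phi>\<in>carrier W. i\<^sub>1 v \<otimes>\<^bsub>L\<^esub> j\<^sub>1 \<phi> = i\<^sub>0 (\<Phi> v \<phi>)))"


section \<open>PC Lie algebras\<close>

definition cartan_space :: "nat \<Rightarrow> (complex, complex vec) module"
  where "cartan_space r = (module_vec TYPE(complex) r)\<lparr>mult := (\<lambda>_ _. 0\<^sub>v r)\<rparr>"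

definition pc_form :: "complex mat \<Rightarrow> complex vec \<Rightarrow> complex vec \<Rightarrow> complex"
  where "pc_form A a b = a \<bullet> (transpose_mat (the (mat_inverse A)) *\<^sub>v b)"

definition diagonal_action :: "complex mat \<Rightarrow> complex vec \<Rightarrow> complex vec \<Rightarrow> complex vec"
  where "diagonal_action D a x =
    vec (dim_col D) (\<lambda>j. (\<Sum>i<dim_row D. a $ i * D $$ (i, j)) * x $ j)"

definition pc_pairing :: "complex mat \<Rightarrow> complex vec \<Rightarrow> complex vec \<Rightarrow> complex"
  where "pc_pairing \<Gamma> x y = (\<Sum>j<dim_row \<Gamma>. x $ j * \<Gamma> $$ (j, j) * y $ j)"

definition pc_data ::
  "nat \<Rightarrow> nat \<Rightarrow> complex mat \<Rightarrow> complex mat \<Rightarrow> complex mat \<Rightarrow> bool"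
  where "pc_data r n A D \<Gamma> \<longleftrightarrow> 0 < r \<and> 0 < n \<and>
    A \<in> carrier_mat r r \<and> invertible_mat A \<and> D \<in> carrier_mat r n \<and>
    \<Gamma> \<in> carrier_mat n n \<and> diagonal_mat \<Gamma> \<and> invertible_mat \<Gamma>"

definition is_pc_algebra_of ::
  "nat \<Rightarrow> nat \<Rightarrow> complex mat \<Rightarrow> complex mat \<Rightarrow> complex mat \<Rightarrow> (complex, 'a) module \<Rightarrow> bool"
  where "is_pc_algebra_of r n A D \<Gamma> L \<longleftrightarrow>
    is_pentad_lie_algebra (cartan_space r) (module_vec TYPE(complex) n) (module_vec TYPE(complex) n)
      (diagonal_action D) (diagonal_action (- D)) (pc_pairing \<Gamma>) (pc_form A) L"

definition pc_lie_algebra :: "(complex, 'a) module \<Rightarrow> bool"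
  where "pc_lie_algebra L \<longleftrightarrow>
    (\<exists>r n A D \<Gamma>. pc_data r n A D \<Gamma> \<and> is_pc_algebra_of r n A D \<Gamma> L)"

definition symmetric_pc_lie_algebra :: "(complex, 'a) module \<Rightarrow> bool"
  where "symmetric_pc_lie_algebra L \<longleftrightarrow>
    (\<exists>r n A D \<Gamma>. pc_data r n A D \<Gamma> \<and>
      (\<forall>a\<in>carrier_vec r. \<forall>b\<in>carrier_vec r. pc_form A a b = pc_form A b a) \<and>
      is_pc_algebra_of r n A D \<Gamma> L)"


section \<open>Lie algebras given by generators and relations\<close>

datatype 'x lie_term =
    Gen 'x
  | Zero
  | Add "'x lie_term" "'x lie_term"
  | Scale complex "'x lie_term"
  | Bracket "'x lie_term" "'x lie_term"

text \<open>\<open>X\<close> is the set of generators. Terms may mention any element of the type, and the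
  elements outside \<open>X\<close> are set to zero.\<close>

inductive lie_eq :: "'x set \<Rightarrow> ('x lie_term \<times> 'x lie_term) set \<Rightarrow> 'x lie_term \<Rightarrow> 'x lie_term \<Rightarrow> bool"
  for X :: "'x set" and R :: "('x lie_term \<times> 'x lie_term) set"
  where
    relation: "(s, t) \<in> R \<Longrightarrow> lie_eq X R s t"
  | no_generator: "x \<notin> X \<Longrightarrow> lie_eq X R (Gen x) Zero"
  | refl: "lie_eq X R t t"
  | sym: "lie_eq X R s t \<Longrightarrow> lie_eq X R t s"
  | trans: "lie_eq X R s t \<Longrightarrow> lie_eq X R t u \<Longrightarrow> lie_eq X R s u"
  | Add_cong: "lie_eq X R s s' \<Longrightarrow> lie_eq X R t t' \<Longrightarrow> lie_eq X R (Add s t) (Add s' t')"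
  | Scale_cong: "lie_eq X R t t' \<Longrightarrow> lie_eq X R (Scale c t) (Scale c t')"
  | Bracket_cong:
      "lie_eq X R s s' \<Longrightarrow> lie_eq X R t t' \<Longrightarrow> lie_eq X R (Bracket s t) (Bracket s' t')"
  | Add_assoc: "lie_eq X R (Add (Add s t) u) (Add s (Add t u))"
  | Add_commute: "lie_eq X R (Add s t) (Add t s)"
  | Add_Zero: "lie_eq X R (Add t Zero) t"
  | Add_inverse: "lie_eq X R (Add t (Scale (-1) t)) Zero"
  | Scale_Add: "lie_eq X R (Scale c (Add s t)) (Add (Scale c s) (Scale c t))"
  | Scale_plus: "lie_eq X R (Scale (c + d) t) (Add (Scale c t) (Scale d t))"
  | Scale_Scale: "lie_eq X R (Scale c (Scale d t)) (Scale (c * d) t)"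
  | Scale_one: "lie_eq X R (Scale 1 t) t"
  | Bracket_Add_left: "lie_eq X R (Bracket (Add s t) u) (Add (Bracket s u) (Bracket t u))"
  | Bracket_Add_right: "lie_eq X R (Bracket u (Add s t)) (Add (Bracket u s) (Bracket u t))"
  | Bracket_Scale_left: "lie_eq X R (Bracket (Scale c s) t) (Scale c (Bracket s t))"
  | Bracket_Scale_right: "lie_eq X R (Bracket s (Scale c t)) (Scale c (Bracket s t))"
  | Bracket_self: "lie_eq X R (Bracket t t) Zero"
  | Jacobi: "lie_eq X R
      (Add (Bracket s (Bracket t u)) (Add (Bracket t (Bracket u s)) (Bracket u (Bracket s t)))) Zero"

definition lie_class ::
  "'x set \<Rightarrow> ('x lie_term \<times> 'x lie_term) set \<Rightarrow> 'x lie_term \<Rightarrow> 'x lie_term set"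
  where "lie_class X R t = {s. lie_eq X R t s}"

definition presented_lie_algebra ::
  "'x set \<Rightarrow> ('x lie_term \<times> 'x lie_term) set \<Rightarrow> (complex, 'x lie_term set) module"
  where "presented_lie_algebra X R =
    \<lparr>carrier = range (lie_class X R),
     mult = (\<lambda>S T. \<Union>s\<in>S. \<Union>t\<in>T. lie_class X R (Bracket s t)),
     one = undefined,
     zero = lie_class X R Zero,
     add = (\<lambda>S T. \<Union>s\<in>S. \<Union>t\<in>T. lie_class X R (Add s t)),
     smult = (\<lambda>c S. \<Union>s\<in>S. lie_class X R (Scale c s))\<rparr>"


section \<open>The Lie algebra \<open>\<gg>(C)\<close>\<close>

text \<open>Indices run over \<open>{..<n}\<close>, and \<open>\<alpha> i\<close>, \<open>\<alpha>\<^sub>c i\<close> are the simple roots and coroots.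
  Linear independence of the families is spelled out, because they are families rather
  than sets.\<close>

definition realization ::
  "nat \<Rightarrow> complex mat \<Rightarrow> (complex, 'h) module \<Rightarrow> (nat \<Rightarrow> 'h \<Rightarrow> complex) \<Rightarrow> (nat \<Rightarrow> 'h) \<Rightarrow> bool"
  where "realization n C H \<alpha> \<alpha>\<^sub>c \<longleftrightarrow>
    vectorspace complex_ring H \<and> vectorspace.fin_dim complex_ring H \<and>
    vectorspace.dim complex_ring H = 2 * n - vec_space.rank n C \<and>
    (\<forall>i<n. \<alpha> i \<in> linear_maps H complex_line) \<and>
    (\<forall>c. (\<forall>h\<in>carrier H. (\<Sum>i<n. c i * \<alpha> i h) = 0) \<longrightarrow> (\<forall>i<n. c i = 0)) \<and>
    (\<forall>i<n. \<alpha>\<^sub>c i \<in> carrier H) \<and>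
    (\<forall>c. (\<Oplus>\<^bsub>H\<^esub>i\<in>{..<n}. c i \<odot>\<^bsub>H\<^esub> \<alpha>\<^sub>c i) = \<zero>\<^bsub>H\<^esub> \<longrightarrow> (\<forall>i<n. c i = 0)) \<and>
    (\<forall>i<n. \<forall>j<n. \<alpha> j (\<alpha>\<^sub>c i) = C $$ (i, j))"

datatype 'h kac_generator = Gen_e nat | Gen_f nat | Gen_h 'h

definition kac_generators :: "nat \<Rightarrow> (complex, 'h) module \<Rightarrow> 'h kac_generator set"
  where "kac_generators n \<hh> = Gen_e ` {..<n} \<union> Gen_f ` {..<n} \<union> Gen_h ` carrier \<hh>"

text \<open>The last two relations express that \<open>\<hh>\<close> enters as a vector space.\<close>

inductive_set kac_relations ::
  "nat \<Rightarrow> (complex, 'h) module \<Rightarrow> (nat \<Rightarrow> 'h \<Rightarrow> complex) \<Rightarrow> (nat \<Rightarrow> 'h)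
    \<Rightarrow> ('h kac_generator lie_term \<times> 'h kac_generator lie_term) set"
  for n :: nat and \<hh> :: "(complex, 'h) module" and \<alpha> :: "nat \<Rightarrow> 'h \<Rightarrow> complex"
    and \<alpha>\<^sub>c :: "nat \<Rightarrow> 'h"
  where
    "\<lbrakk>i < n; j < n\<rbrakk> \<Longrightarrow>
      (Bracket (Gen (Gen_e i)) (Gen (Gen_f j)), if i = j then Gen (Gen_h (\<alpha>\<^sub>c i)) else Zero)
        \<in> kac_relations n \<hh> \<alpha> \<alpha>\<^sub>c"
  | "\<lbrakk>h \<in> carrier \<hh>; h' \<in> carrier \<hh>\<rbrakk> \<Longrightarrow>
      (Bracket (Gen (Gen_h h)) (Gen (Gen_h h')), Zero) \<in> kac_relations n \<hh> \<alpha> \<alpha>\<^sub>c"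
  | "\<lbrakk>h \<in> carrier \<hh>; i < n\<rbrakk> \<Longrightarrow>
      (Bracket (Gen (Gen_h h)) (Gen (Gen_e i)), Scale (\<alpha> i h) (Gen (Gen_e i))) \<in> kac_relations n \<hh> \<alpha> \<alpha>\<^sub>c"
  | "\<lbrakk>h \<in> carrier \<hh>; i < n\<rbrakk> \<Longrightarrow>
      (Bracket (Gen (Gen_h h)) (Gen (Gen_f i)), Scale (- \<alpha> i h) (Gen (Gen_f i))) \<in> kac_relations n \<hh> \<alpha> \<alpha>\<^sub>c"
  | "\<lbrakk>h \<in> carrier \<hh>; h' \<in> carrier \<hh>\<rbrakk> \<Longrightarrow>
      (Gen (Gen_h (h \<oplus>\<^bsub>\<hh>\<^esub> h')), Add (Gen (Gen_h h)) (Gen (Gen_h h'))) \<in> kac_relations n \<hh> \<alpha> \<alpha>\<^sub>c"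
  | "h \<in> carrier \<hh> \<Longrightarrow>
      (Gen (Gen_h (c \<odot>\<^bsub>\<hh>\<^esub> h)), Scale c (Gen (Gen_h h))) \<in> kac_relations n \<hh> \<alpha> \<alpha>\<^sub>c"

definition kac_tilde ::
  "nat \<Rightarrow> (complex, 'h) module \<Rightarrow> (nat \<Rightarrow> 'h \<Rightarrow> complex) \<Rightarrow> (nat \<Rightarrow> 'h)
    \<Rightarrow> (complex, 'h kac_generator lie_term set) module"
  where "kac_tilde n \<hh> \<alpha> \<alpha>\<^sub>c =
    presented_lie_algebra (kac_generators n \<hh>) (kac_relations n \<hh> \<alpha> \<alpha>\<^sub>c)"

definition kac_tilde_cartan ::
  "nat \<Rightarrow> (complex, 'h) module \<Rightarrow> (nat \<Rightarrow> 'h \<Rightarrow> complex) \<Rightarrow> (nat \<Rightarrow> 'h)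
    \<Rightarrow> 'h kac_generator lie_term set set"
  where "kac_tilde_cartan n \<hh> \<alpha> \<alpha>\<^sub>c =
    (\<lambda>h. lie_class (kac_generators n \<hh>) (kac_relations n \<hh> \<alpha> \<alpha>\<^sub>c) (Gen (Gen_h h))) ` carrier \<hh>"

definition kac_algebra ::
  "nat \<Rightarrow> (complex, 'h) module \<Rightarrow> (nat \<Rightarrow> 'h \<Rightarrow> complex) \<Rightarrow> (nat \<Rightarrow> 'h)
    \<Rightarrow> (complex, 'h kac_generator lie_term set set) module"
  where "kac_algebra n \<hh> \<alpha> \<alpha>\<^sub>c = lie_quotient (kac_tilde n \<hh> \<alpha> \<alpha>\<^sub>c)
    (GREATEST J. lie_ideal (kac_tilde n \<hh> \<alpha> \<alpha>\<^sub>c) J \<and>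
      J \<inter> kac_tilde_cartan n \<hh> \<alpha> \<alpha>\<^sub>c = {\<zero>\<^bsub>kac_tilde n \<hh> \<alpha> \<alpha>\<^sub>c\<^esub>})"

definition generalized_cartan_matrix :: "nat \<Rightarrow> complex mat \<Rightarrow> bool"
  where "generalized_cartan_matrix n C \<longleftrightarrow> C \<in> carrier_mat n n \<and>
    (\<forall>i<n. \<forall>j<n. C $$ (i, j) \<in> \<int>) \<and>
    (\<forall>i<n. C $$ (i, i) = 2) \<and>
    (\<forall>i<n. \<forall>j<n. i \<noteq> j \<longrightarrow> Re (C $$ (i, j)) \<le> 0) \<and>
    (\<forall>i<n. \<forall>j<n. C $$ (i, j) = 0 \<longrightarrow> C $$ (j, i) = 0)"

definition kac_moody_algebra :: "(complex, 'h kac_generator lie_term set set) module \<Rightarrow> bool"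
  where "kac_moody_algebra K \<longleftrightarrow>
    (\<exists>n C \<hh> \<alpha> \<alpha>\<^sub>c. 0 < n \<and> generalized_cartan_matrix n C \<and>
      realization n C \<hh> \<alpha> \<alpha>\<^sub>c \<and> K = kac_algebra n \<hh> \<alpha> \<alpha>\<^sub>c)"


section \<open>Contragredient Lie algebras\<close>

definition indexed_basis ::
  "(complex, 'a) module \<Rightarrow> 'a set \<Rightarrow> nat \<Rightarrow> (nat \<Rightarrow> 'a) \<Rightarrow> bool"
  where "indexed_basis L S n b \<longleftrightarrow> inj_on b {..<n} \<and>
    vectorspace.basis complex_ring (L\<lparr>carrier := S\<rparr>) (b ` {..<n})"

definition is_contragredient :: "nat \<Rightarrow> complex mat \<Rightarrow> (complex, 'a) module \<Rightarrow> bool"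
  where "is_contragredient n C L \<longleftrightarrow>
    (\<exists>G e f h. minimal_graded_lie_algebra L G \<and>
      indexed_basis L (G (-1)) n f \<and> indexed_basis L (G 0) n h \<and> indexed_basis L (G 1) n e \<and>
      (\<forall>i<n. \<forall>j<n.
        h i \<otimes>\<^bsub>L\<^esub> h j = \<zero>\<^bsub>L\<^esub> \<and>
        e i \<otimes>\<^bsub>L\<^esub> f j = (if i = j then h i else \<zero>\<^bsub>L\<^esub>) \<and>
        h i \<otimes>\<^bsub>L\<^esub> e j = C $$ (i, j) \<odot>\<^bsub>L\<^esub> e j \<and>
        h i \<otimes>\<^bsub>L\<^esub> f j = (- C $$ (i, j)) \<odot>\<^bsub>L\<^esub> f j))"

text \<open>\<open>G(C)\<close> is characterized up to isomorphism, and a representative is chosen on a type that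
  has room for it: \<open>\<gg>(C)\<close>, for a realization on some \<open>\<complex>\<^sup>r\<close>, lives on this type, and \<open>G(C)\<close> is
  isomorphic to its derived algebra.\<close>

type_synonym contragredient_carrier = "complex vec kac_generator lie_term set set"

definition contragredient :: "nat \<Rightarrow> complex mat \<Rightarrow> (complex, contragredient_carrier) module"
  where "contragredient n C = (SOME L. is_contragredient n C L)"

definition reduced_contragredient ::
  "nat \<Rightarrow> complex mat \<Rightarrow> (complex, contragredient_carrier set) module"
  where "reduced_contragredient n C =
    lie_quotient (contragredient n C) (lie_center (contragredient n C))"

definition has_real_symmetrization :: "nat \<Rightarrow> complex mat \<Rightarrow> bool"
  where "has_real_symmetrization n C \<longleftrightarrow>
    (\<exists>\<Gamma> S. \<Gamma> \<in> carrier_mat n n \<and> diagonal_mat \<Gamma> \<and> invertible_mat \<Gamma> \<and>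
      S \<in> carrier_mat n n \<and> transpose_mat S = S \<and> (\<forall>i<n. \<forall>j<n. S $$ (i, j) \<in> \<real>) \<and>
      C = \<Gamma> * S)"

end

theory Submission
  imports Defs
begin

text \<open>A graded Lie algebra is minimal as soon as it is transitive, that is, no nonzero element of
  degree \<open>k \<ge> 2\<close> commutes with degree \<open>-1\<close>, and symmetrically. The algebra \<open>\<gg>(C)\<close>, its derived
  algebra and the quotient of the latter by its center are transitive for the principal grading, and
  the derived algebra has the local part of \<open>G(C)\<close>. So all that remains is to write their local
  parts as those of PC Lie algebras: this requires a nondegenerate form on the degree 0 part whose
  Gram matrix \<open>B\<close> satisfies \<open>B X = D \<Gamma>\<close>, where the columns of \<open>X\<close> are the coordinates of the
  coroots and \<open>D\<close> holds the values of the roots on the chosen basis. For \<open>\<gg>(C)\<close>, choose a basis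
  that starts with the coroots; the roots are linearly independent, hence the first \<open>n\<close> columns of \<open>B\<close>
  extend to an invertible matrix. For invertible \<open>C\<close> take \<open>B = C\<close>. In the symmetrizable case the form
  determined by \<open>S\<close> descends to a nondegenerate symmetric form on the coroots modulo the center.\<close>

section \<open>Complex vector spaces and Lie algebras\<close>

text \<open>Minimality quantifies over all competing graded algebras, whereas transitivity is
  internal and follows from a maximality property of ideals; this is why it carries the argument. It
  is kept apart from the local conditions: in degrees 1 and -1 it comes from nonzero coroots, and
  degree 0 may have a center, as in G(C) for singular C. Two facts on the presented algebra are not
  formal. The Cartan part might collapse under the relations; a representation on functions on
  words, one for each weight, excludes this. And the ideal divided out must be homogeneous; an
  element \<rho> of the Cartan part on which all simple roots take the value 1 turns degrees into
  eigenvalues of ad \<rho>, so every ideal is. The span of the coroots need not contain such a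
  \<rho>, hence G(C) is reached through g(C) and its derived algebra. The same model shows that the
  choice in \<open>contragredient\<close> is not void. In the symmetrizable case C = 0 is set apart:
  all coroots are then central, and the reduced algebra has nothing left in degree 0.\<close>

locale complex_space = vectorspace complex_ring L for L :: "(complex, 'a) module" (structure)
begin

lemma cs_smult_closed [simp, intro]: "x \<in> carrier L \<Longrightarrow> c \<odot> x \<in> carrier L"
  using smult_closed[of c x] by simp

lemma smult_add_left: "x \<in> carrier L \<Longrightarrow> (c + d) \<odot> x = c \<odot> x \<oplus> d \<odot> x"
  using smult_l_distr[of c d x] by simp

lemma smult_add_right: "\<lbrakk>x \<in> carrier L; y \<in> carrier L\<rbrakk> \<Longrightarrow> c \<odot> (x \<oplus> y) = c \<odot> x \<oplus> c \<odot> y"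
  using smult_r_distr[of c x y] by simp

lemma smult_smult: "x \<in> carrier L \<Longrightarrow> c \<odot> (d \<odot> x) = (c * d) \<odot> x"
  using smult_assoc1[of c d x] by simp

lemma smult_1 [simp]: "x \<in> carrier L \<Longrightarrow> 1 \<odot> x = x"
  using smult_one[of x] by simp

lemma smult_0 [simp]: "x \<in> carrier L \<Longrightarrow> 0 \<odot> x = \<zero>"
  using lmult_0[of x] by simp

lemma smult_zero [simp]: "c \<odot> \<zero> = \<zero>"
  using rmult_0[of c] by simp

lemma smult_m1: "x \<in> carrier L \<Longrightarrow> (- 1) \<odot> x = \<ominus> x"
  using smult_minus_1[of x] by (simp add: class_ring_simps)

lemma smult_eq_zero: "\<lbrakk>c \<odot> x = \<zero>; x \<in> carrier L; c \<noteq> 0\<rbrakk> \<Longrightarrow> x = \<zero>"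
  using smult_smult[of x "inverse c" c] by simp

lemma finsum_smult:
  "\<lbrakk>f \<in> A \<rightarrow> carrier L\<rbrakk> \<Longrightarrow> c \<odot> (\<Oplus>i\<in>A. f i) = (\<Oplus>i\<in>A. c \<odot> f i)"
  by (induct A rule: infinite_finite_induct) (auto simp: smult_add_right Pi_def)

lemma sum_smult:
  "\<lbrakk>x \<in> carrier L\<rbrakk> \<Longrightarrow> (\<Sum>i\<in>A. c i) \<odot> x = (\<Oplus>i\<in>A. c i \<odot> x)"
  by (induct A rule: infinite_finite_induct) (auto simp: smult_add_left Pi_def)

abbreviation subspace :: "'a set \<Rightarrow> bool"
  where "subspace S \<equiv> VectorSpace.subspace complex_ring S L"

lemma subspace_iff: "subspace S \<longleftrightarrow> S \<subseteq> carrier L \<and> \<zero> \<in> S \<and>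
    (\<forall>x\<in>S. \<forall>y\<in>S. x \<oplus> y \<in> S) \<and> (\<forall>c. \<forall>x\<in>S. c \<odot> x \<in> S)"
  (is "_ \<longleftrightarrow> ?r")
proof
  assume "subspace S"
  then have s: "submodule complex_ring S L" by (rule is_module)
  interpret submodule complex_ring S L by (rule s)
  have "\<zero> \<in> S" using zero_closed[of] by auto
  then show ?r using subset m_closed smult_closed by auto
next
  assume r: ?r
  have "vectorspace complex_ring L" ..
  moreover have "submodule complex_ring S L"
    using r by (unfold_locales) (auto)
  ultimately show "subspace S" by (simp add: VectorSpace.subspace_def)
qed

lemma subspaceI:
  "\<lbrakk>S \<subseteq> carrier L; \<zero> \<in> S; \<And>x y. \<lbrakk>x \<in> S; y \<in> S\<rbrakk> \<Longrightarrow> x \<oplus> y \<in> S;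
    \<And>c x. x \<in> S \<Longrightarrow> c \<odot> x \<in> S\<rbrakk> \<Longrightarrow> subspace S"
  by (simp add: subspace_iff)

lemma subspaceD:
  assumes "subspace S"
  shows "x \<in> S \<Longrightarrow> x \<in> carrier L" "\<zero> \<in> S" "\<lbrakk>x \<in> S; y \<in> S\<rbrakk> \<Longrightarrow> x \<oplus> y \<in> S"
    "x \<in> S \<Longrightarrow> c \<odot> x \<in> S" "S \<subseteq> carrier L"
  using assms by (auto simp: subspace_iff)

lemma subspace_uminus: "\<lbrakk>subspace S; x \<in> S\<rbrakk> \<Longrightarrow> \<ominus> x \<in> S"
  using subspaceD(4)[of S x "-1"] subspaceD(1)[of S x] by (simp add: smult_m1)

lemma subspace_minus: "\<lbrakk>subspace S; x \<in> S; y \<in> S\<rbrakk> \<Longrightarrow> x \<ominus> y \<in> S"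
  by (simp add: a_minus_def subspaceD subspace_uminus)

lemma subspace_finsum:
  assumes "subspace S" "\<And>i. i \<in> A \<Longrightarrow> f i \<in> S"
  shows "(\<Oplus>i\<in>A. f i) \<in> S"
  using assms(2)
proof (induct A rule: infinite_finite_induct)
  case (insert x F)
  then show ?case
    using assms(1) subspaceD by (subst finsum_insert) (auto simp: Pi_def)
qed (auto simp: subspaceD[OF assms(1)])

lemma subspace_carrier: "subspace (carrier L)"
  by (rule subspaceI) auto

lemma subspace_zero: "subspace {\<zero>}"
  by (rule subspaceI) auto

lemma subspace_Int: "\<lbrakk>subspace S; subspace T\<rbrakk> \<Longrightarrow> subspace (S \<inter> T)"
  by (auto simp: subspace_iff)

lemma subspace_span: "X \<subseteq> carrier L \<Longrightarrow> subspace (span X)"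
  by (rule span_is_subspace)

lemma span_superset: "X \<subseteq> carrier L \<Longrightarrow> x \<in> X \<Longrightarrow> x \<in> span X"
  using in_own_span by auto

lemma span_minimal: "\<lbrakk>X \<subseteq> S; subspace S\<rbrakk> \<Longrightarrow> span X \<subseteq> S"
  by (rule span_is_subset) (auto intro: is_module)

lemma span_induct_sub: "\<lbrakk>x \<in> span X; X \<subseteq> carrier L; subspace {y \<in> carrier L. P y}; \<And>y. y \<in> X \<Longrightarrow> P y\<rbrakk> \<Longrightarrow> P x"
  using span_minimal[of X "{y \<in> carrier L. P y}"] by auto

lemma restrict_complex_space: "subspace S \<Longrightarrow> complex_space (L\<lparr>carrier := S\<rparr>)"
  unfolding complex_space_def by (rule subspace_is_vs)

lemma finsum_restrict_carrier:
  assumes "subspace S" "finite A" "\<And>i. i \<in> A \<Longrightarrow> f i \<in> S"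
  shows "finsum (L\<lparr>carrier := S\<rparr>) f A = finsum L f A"
proof -
  interpret S: complex_space "L\<lparr>carrier := S\<rparr>" by (rule restrict_complex_space[OF assms(1)])
  show ?thesis
    using assms(2,3)
  proof (induct A)
    case (insert x F)
    then show ?case
      using subspaceD[OF assms(1)]
      by (subst finsum_insert) (auto simp: Pi_def S.finsum_insert)
  qed auto
qed

end

text \<open>Negatives are required in the form \<open>(- 1) \<odot> x\<close>, which is how the
  presented algebra supplies them (\<open>Add_inverse\<close>).\<close>

lemma complex_spaceI:
  fixes L (structure)
  assumes "\<zero> \<in> carrier L"
    and "\<And>x y. \<lbrakk>x \<in> carrier L; y \<in> carrier L\<rbrakk> \<Longrightarrow> x \<oplus> y \<in> carrier L"
    and "\<And>c x. x \<in> carrier L \<Longrightarrow> c \<odot> x \<in> carrier L"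
    and "\<And>x y z. \<lbrakk>x \<in> carrier L; y \<in> carrier L; z \<in> carrier L\<rbrakk> \<Longrightarrow> (x \<oplus> y) \<oplus> z = x \<oplus> (y \<oplus> z)"
    and "\<And>x y. \<lbrakk>x \<in> carrier L; y \<in> carrier L\<rbrakk> \<Longrightarrow> x \<oplus> y = y \<oplus> x"
    and "\<And>x. x \<in> carrier L \<Longrightarrow> x \<oplus> \<zero> = x"
    and "\<And>x. x \<in> carrier L \<Longrightarrow> x \<oplus> (- 1) \<odot> x = \<zero>"
    and "\<And>c x y. \<lbrakk>x \<in> carrier L; y \<in> carrier L\<rbrakk> \<Longrightarrow> c \<odot> (x \<oplus> y) = c \<odot> x \<oplus> c \<odot> y"
    and "\<And>c d x. x \<in> carrier L \<Longrightarrow> (c + d) \<odot> x = c \<odot> x \<oplus> d \<odot> x"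
    and "\<And>c d x. x \<in> carrier L \<Longrightarrow> c \<odot> (d \<odot> x) = (c * d) \<odot> x"
    and "\<And>x. x \<in> carrier L \<Longrightarrow> 1 \<odot> x = x"
  shows "complex_space L"
proof -
  have "vectorspace complex_ring L"
    apply (rule vs_criteria)
    using class_field.field_axioms assms apply (auto simp: class_field)
    by (metis assms(3) assms(5) assms(7))
  then show ?thesis by (simp add: complex_space_def)
qed

sublocale lie_algebra \<subseteq> complex_space ..

lemma linear_maps_iff: "f \<in> linear_maps L M \<longleftrightarrow> f \<in> carrier L \<rightarrow> carrier M \<and>
   (\<forall>x\<in>carrier L. \<forall>y\<in>carrier L. f (x \<oplus>\<^bsub>L\<^esub> y) = f x \<oplus>\<^bsub>M\<^esub> f y) \<and>
   (\<forall>c. \<forall>x\<in>carrier L. f (c \<odot>\<^bsub>L\<^esub> x) = c \<odot>\<^bsub>M\<^esub> f x)"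
  by (auto simp: LinearCombinations.module_hom_def)

context lie_algebra
begin

lemma bracket_linear_right: "x \<in> carrier L \<Longrightarrow> (\<otimes>) x \<in> linear_maps L L"
  using bracket_bilinear by (auto simp: bilinear_map_def)

lemma bracket_linear_left: "y \<in> carrier L \<Longrightarrow> (\<lambda>x. x \<otimes> y) \<in> linear_maps L L"
  using bracket_bilinear by (auto simp: bilinear_map_def)

lemma bracket_closed [simp, intro]: "\<lbrakk>x \<in> carrier L; y \<in> carrier L\<rbrakk> \<Longrightarrow> x \<otimes> y \<in> carrier L"
  using bracket_linear_right[of x] by (auto simp: linear_maps_iff)

lemma bracket_add_right: "\<lbrakk>x \<in> carrier L; y \<in> carrier L; z \<in> carrier L\<rbrakk> \<Longrightarrow>
    x \<otimes> (y \<oplus> z) = x \<otimes> y \<oplus> x \<otimes> z"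
  using bracket_linear_right[of x] by (auto simp: linear_maps_iff)

lemma bracket_add_left: "\<lbrakk>x \<in> carrier L; y \<in> carrier L; z \<in> carrier L\<rbrakk> \<Longrightarrow>
    (x \<oplus> y) \<otimes> z = x \<otimes> z \<oplus> y \<otimes> z"
  using bracket_linear_left[of z] by (auto simp: linear_maps_iff)

lemma bracket_smult_right: "\<lbrakk>x \<in> carrier L; y \<in> carrier L\<rbrakk> \<Longrightarrow> x \<otimes> (c \<odot> y) = c \<odot> (x \<otimes> y)"
  using bracket_linear_right[of x] by (auto simp: linear_maps_iff)

lemma bracket_smult_left: "\<lbrakk>x \<in> carrier L; y \<in> carrier L\<rbrakk> \<Longrightarrow> (c \<odot> x) \<otimes> y = c \<odot> (x \<otimes> y)"
  using bracket_linear_left[of y] by (auto simp: linear_maps_iff)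

lemma bracket_zero_right [simp]: "x \<in> carrier L \<Longrightarrow> x \<otimes> \<zero> = \<zero>"
  using bracket_smult_right[of x \<zero> 0] by simp

lemma bracket_zero_left [simp]: "x \<in> carrier L \<Longrightarrow> \<zero> \<otimes> x = \<zero>"
  using bracket_smult_left[of \<zero> x 0] by simp

lemma bracket_anticommute:
  assumes x: "x \<in> carrier L" and y: "y \<in> carrier L"
  shows "x \<otimes> y = \<ominus> (y \<otimes> x)"
proof -
  have "\<zero> = (x \<oplus> y) \<otimes> (x \<oplus> y)" using x y by (intro bracket_alternating[symmetric]) simp
  also have "\<dots> = x \<otimes> y \<oplus> y \<otimes> x"
    using x y bracket_alternating[OF x] bracket_alternating[OF y]
    by (simp add: bracket_add_left bracket_add_right a_comm)
  finally show ?thesis using x y by (metis add.inv_equality bracket_closed)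
qed

lemma bracket_uminus_right: "\<lbrakk>x \<in> carrier L; y \<in> carrier L\<rbrakk> \<Longrightarrow> x \<otimes> (\<ominus> y) = \<ominus> (x \<otimes> y)"
  using bracket_smult_right[of x y "-1"] by (simp add: smult_m1)

lemma bracket_uminus_left: "\<lbrakk>x \<in> carrier L; y \<in> carrier L\<rbrakk> \<Longrightarrow> (\<ominus> x) \<otimes> y = \<ominus> (x \<otimes> y)"
  using bracket_smult_left[of x y "-1"] by (simp add: smult_m1)

lemma bracket_derivation:
  assumes "x \<in> carrier L" "y \<in> carrier L" "z \<in> carrier L"
  shows "x \<otimes> (y \<otimes> z) = (x \<otimes> y) \<otimes> z \<oplus> y \<otimes> (x \<otimes> z)"
proof -
  have 1: "y \<otimes> (z \<otimes> x) = \<ominus> (y \<otimes> (x \<otimes> z))"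
    using assms bracket_anticommute[of z x] by (simp add: bracket_uminus_right)
  have 2: "z \<otimes> (x \<otimes> y) = \<ominus> ((x \<otimes> y) \<otimes> z)"
    using assms by (simp add: bracket_anticommute[of z "x \<otimes> y"])
  have "x \<otimes> (y \<otimes> z) \<oplus> (\<ominus> (y \<otimes> (x \<otimes> z)) \<oplus> \<ominus> ((x \<otimes> y) \<otimes> z)) = \<zero>"
    using jacobi[OF assms] 1 2 by simp
  moreover have "\<ominus> (y \<otimes> (x \<otimes> z)) \<oplus> \<ominus> ((x \<otimes> y) \<otimes> z) = \<ominus> ((x \<otimes> y) \<otimes> z \<oplus> y \<otimes> (x \<otimes> z))"
    using assms by (simp add: minus_add a_comm)
  ultimately show ?thesis using assms
    by (metis a_closed add.inv_closed add.inv_equality bracket_closed minus_minus)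
qed

lemma bracket_finsum_right:
  "\<lbrakk>x \<in> carrier L; f \<in> A \<rightarrow> carrier L\<rbrakk> \<Longrightarrow> x \<otimes> (\<Oplus>i\<in>A. f i) = (\<Oplus>i\<in>A. x \<otimes> f i)"
  by (induct A rule: infinite_finite_induct) (auto simp: bracket_add_right Pi_def)

lemma bracket_finsum_left:
  "\<lbrakk>x \<in> carrier L; f \<in> A \<rightarrow> carrier L\<rbrakk> \<Longrightarrow> (\<Oplus>i\<in>A. f i) \<otimes> x = (\<Oplus>i\<in>A. f i \<otimes> x)"
  by (induct A rule: infinite_finite_induct) (auto simp: bracket_add_left Pi_def)

lemma bracket_swap_in: "\<lbrakk>subspace S; x \<in> carrier L; y \<in> carrier L; x \<otimes> y \<in> S\<rbrakk> \<Longrightarrow> y \<otimes> x \<in> S"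
  using bracket_anticommute[of y x] subspace_uminus by auto

lemma lie_subalgebraI: "\<lbrakk>subspace S; \<And>x y. \<lbrakk>x \<in> S; y \<in> S\<rbrakk> \<Longrightarrow> x \<otimes> y \<in> S\<rbrakk> \<Longrightarrow> lie_subalgebra L S"
  by (simp add: lie_subalgebra_def)

lemma lie_generated_subset_carrier: "X \<subseteq> carrier L \<Longrightarrow> lie_generated L X \<subseteq> carrier L"
  using subspace_carrier unfolding lie_generated_def lie_subalgebra_def by auto

lemma lie_generated_superset: "X \<subseteq> lie_generated L X"
  unfolding lie_generated_def by auto

lemma lie_generated_minimal: "\<lbrakk>lie_subalgebra L S; X \<subseteq> S\<rbrakk> \<Longrightarrow> lie_generated L X \<subseteq> S"
  unfolding lie_generated_def by auto

lemma lie_generated_subalgebra: "X \<subseteq> carrier L \<Longrightarrow> lie_subalgebra L (lie_generated L X)"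
proof (rule lie_subalgebraI)
  assume X: "X \<subseteq> carrier L"
  show "subspace (lie_generated L X)"
    by (rule subspaceI)
      (use lie_generated_subset_carrier[OF X] in \<open>auto simp: lie_generated_def lie_subalgebra_def intro: subspaceD\<close>)
qed (auto simp: lie_generated_def lie_subalgebra_def)

lemma lie_generated_induct [consumes 2, case_names gen zero add smult bracket]:
  assumes "x \<in> lie_generated L X" "X \<subseteq> carrier L"
    and "\<And>x. x \<in> X \<Longrightarrow> P x" "P \<zero>"
    and "\<And>x y. \<lbrakk>x \<in> carrier L; y \<in> carrier L; P x; P y\<rbrakk> \<Longrightarrow> P (x \<oplus> y)"
    and "\<And>c x. \<lbrakk>x \<in> carrier L; P x\<rbrakk> \<Longrightarrow> P (c \<odot> x)"
    and "\<And>x y. \<lbrakk>x \<in> carrier L; y \<in> carrier L; P x; P y\<rbrakk> \<Longrightarrow> P (x \<otimes> y)"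
  shows "P x"
proof -
  have "lie_subalgebra L {x \<in> carrier L. P x}"
    by (intro lie_subalgebraI subspaceI) (use assms in auto)
  from lie_generated_minimal[OF this, of X] assms show ?thesis by auto
qed

text \<open>By the Jacobi identity the elements whose adjoint action preserves \<open>S\<close> form
  a subalgebra, so invariance has to be checked for generators only.\<close>

lemma lie_generated_normalizes:
  assumes "subspace S" "X \<subseteq> carrier L" "\<And>x s. \<lbrakk>x \<in> X; s \<in> S\<rbrakk> \<Longrightarrow> x \<otimes> s \<in> S"
    and "y \<in> lie_generated L X" "s \<in> S"
  shows "y \<otimes> s \<in> S"
proof -
  note S = subspaceD[OF assms(1)]
  have "\<forall>s\<in>S. y \<otimes> s \<in> S"
    using assms(4) assms(2)
  proof (induct rule: lie_generated_induct)
    case (bracket x y)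
    show ?case
    proof
      fix s assume s: "s \<in> S"
      have "(x \<otimes> y) \<otimes> s = x \<otimes> (y \<otimes> s) \<ominus> y \<otimes> (x \<otimes> s)"
        using bracket_derivation[of x y s] bracket s S(1)
        by (simp add: a_minus_def a_assoc r_neg)
      then show "(x \<otimes> y) \<otimes> s \<in> S"
        using bracket s by (simp add: subspace_minus[OF assms(1)])
    qed
  qed (use assms(3) in \<open>auto simp: S bracket_add_left bracket_smult_left\<close>)
  with assms(5) show ?thesis by auto
qed

end

section \<open>Subalgebras generated by a local part\<close>

context complex_space
begin

definition homogeneous_sums :: "('i \<Rightarrow> 'a set) \<Rightarrow> 'a set"
  where "homogeneous_sums W = {x. \<exists>F v. finite F \<and> (\<forall>i\<in>F. v i \<in> W i) \<and> x = (\<Oplus>i\<in>F. v i)}"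

lemma finsum_superset:
  assumes "finite G" "F \<subseteq> G" "\<And>i. v i \<in> carrier L" "\<And>i. i \<notin> F \<Longrightarrow> v i = \<zero>"
  shows "(\<Oplus>i\<in>F. v i) = (\<Oplus>i\<in>G. v i)"
  using assms by (intro add.finprod_mono_neutral_cong_left) auto

lemma homogeneous_sumsE:
  assumes "x \<in> homogeneous_sums W" "\<And>i. subspace (W i)"
  obtains F v where "finite F" "\<And>i. v i \<in> W i" "\<And>i. i \<notin> F \<Longrightarrow> v i = \<zero>" "x = (\<Oplus>i\<in>F. v i)"
proof -
  obtain F v where F: "finite F" "\<forall>i\<in>F. v i \<in> W i" "x = (\<Oplus>i\<in>F. v i)"
    using assms(1) by (auto simp: homogeneous_sums_def)
  \<comment> \<open>Extension by zero: a family that is homogeneous at every index can be summed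
    over any larger index set, so two decompositions can be compared on the union of their
    supports.\<close>
  let ?v = "\<lambda>i. if i \<in> F then v i else \<zero>"
  show ?thesis
  proof (rule that[of F ?v])
    show "x = (\<Oplus>i\<in>F. ?v i)"
      unfolding F(3) using F(2) subspaceD(1)[OF assms(2)] by (intro finsum_cong') auto
  qed (use F assms(2) in \<open>auto simp: subspaceD\<close>)
qed

lemma homogeneous_sumsI:
  assumes "finite F" "\<And>i. i \<in> F \<Longrightarrow> v i \<in> W i"
  shows "(\<Oplus>i\<in>F. v i) \<in> homogeneous_sums W"
  using assms by (auto simp: homogeneous_sums_def)

lemma homogeneous_sums_incl: "\<lbrakk>x \<in> W i; subspace (W i)\<rbrakk> \<Longrightarrow> x \<in> homogeneous_sums W"
  using homogeneous_sumsI[of "{i}" "\<lambda>_. x" W] by (simp add: subspaceD)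

lemma homogeneous_sums_minimal:
  "\<lbrakk>\<And>i. W i \<subseteq> S; subspace S\<rbrakk> \<Longrightarrow> homogeneous_sums W \<subseteq> S"
  unfolding homogeneous_sums_def by (auto intro!: subspace_finsum)

lemma homogeneous_sums_mono: "(\<And>i. W i \<subseteq> W' i) \<Longrightarrow> homogeneous_sums W \<subseteq> homogeneous_sums W'"
  unfolding homogeneous_sums_def by blast

lemma homogeneous_sums_subspace:
  assumes W: "\<And>i. subspace (W i)"
  shows "subspace (homogeneous_sums W)"
proof (rule subspaceI)
  note WD = subspaceD[OF W]
  show "homogeneous_sums W \<subseteq> carrier L"
    by (rule homogeneous_sums_minimal) (auto simp: WD subspace_carrier)
  show "\<zero> \<in> homogeneous_sums W" using homogeneous_sumsI[of "{}" _ W] by simp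
next
  note WD = subspaceD[OF W]
  fix x y assume "x \<in> homogeneous_sums W" "y \<in> homogeneous_sums W"
  then obtain F v G w where
    F: "finite F" "\<And>i. v i \<in> W i" "\<And>i. i \<notin> F \<Longrightarrow> v i = \<zero>" "x = (\<Oplus>i\<in>F. v i)" and
    G: "finite G" "\<And>i. w i \<in> W i" "\<And>i. i \<notin> G \<Longrightarrow> w i = \<zero>" "y = (\<Oplus>i\<in>G. w i)"
    using W by (metis homogeneous_sumsE)
  have "x = (\<Oplus>i\<in>F \<union> G. v i)"
    unfolding F(4) by (rule finsum_superset) (use F(1-3) G(1) WD(1) in auto)
  moreover have "y = (\<Oplus>i\<in>F \<union> G. w i)"
    unfolding G(4) by (rule finsum_superset) (use G(1-3) F(1) WD(1) in auto)
  ultimately have "x \<oplus> y = (\<Oplus>i\<in>F \<union> G. v i \<oplus> w i)"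
    using F(2) G(2) WD(1) by (subst finsum_addf) auto
  then show "x \<oplus> y \<in> homogeneous_sums W"
    using homogeneous_sumsI[of "F \<union> G" "\<lambda>i. v i \<oplus> w i" W] F G WD by auto
next
  note WD = subspaceD[OF W]
  fix c x assume "x \<in> homogeneous_sums W"
  then obtain F v where
    F: "finite F" "\<And>i. v i \<in> W i" "\<And>i. i \<notin> F \<Longrightarrow> v i = \<zero>" "x = (\<Oplus>i\<in>F. v i)"
    using W by (metis homogeneous_sumsE)
  have "c \<odot> x = (\<Oplus>i\<in>F. c \<odot> v i)"
    unfolding F(4) using F(2) WD(1) by (intro finsum_smult) auto
  then show "c \<odot> x \<in> homogeneous_sums W"
    using homogeneous_sumsI[of F "\<lambda>i. c \<odot> v i" W] F WD by auto
qed

end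

lemma (in lie_algebra) homogeneous_sums_bracket:
  assumes W: "\<And>i. subspace (W i)" and S: "subspace S" and y: "y \<in> carrier L"
    and *: "\<And>i x. x \<in> W i \<Longrightarrow> y \<otimes> x \<in> S" and x: "x \<in> homogeneous_sums W"
  shows "y \<otimes> x \<in> S"
proof -
  obtain F v where F: "finite F" "\<And>i. v i \<in> W i" "x = (\<Oplus>i\<in>F. v i)"
    using W x by (metis homogeneous_sumsE)
  have "y \<otimes> x = (\<Oplus>i\<in>F. y \<otimes> v i)"
    unfolding F(3) using y F(2) subspaceD(1)[OF W] by (intro bracket_finsum_right) auto
  then show ?thesis using * F(2) by (auto intro!: subspace_finsum[OF S])
qed


text \<open>\<open>H\<close>, \<open>E\<close>, \<open>F\<close> are candidates for the degrees 0,
  1, -1 in an algebra that carries no grading yet. The conditions are symmetric under the exchange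
  of \<open>E\<close> and \<open>F\<close> (\<open>swap\<close>), so only one side is worked
  out.\<close>

locale local_triple = lie_algebra L for L :: "(complex, 'a) module" (structure) +
  fixes H E F :: "'a set"
  assumes H_subspace: "subspace H" and E_subspace: "subspace E" and F_subspace: "subspace F"
    and HH: "\<lbrakk>h \<in> H; h' \<in> H\<rbrakk> \<Longrightarrow> h \<otimes> h' \<in> H"
    and HE: "\<lbrakk>h \<in> H; e \<in> E\<rbrakk> \<Longrightarrow> h \<otimes> e \<in> E"
    and HF: "\<lbrakk>h \<in> H; f \<in> F\<rbrakk> \<Longrightarrow> h \<otimes> f \<in> F"
    and EF: "\<lbrakk>e \<in> E; f \<in> F\<rbrakk> \<Longrightarrow> e \<otimes> f \<in> H"
begin

lemmas HD = subspaceD[OF H_subspace] and ED = subspaceD[OF E_subspace] and FD = subspaceD[OF F_subspace]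

lemma FE: "\<lbrakk>f \<in> F; e \<in> E\<rbrakk> \<Longrightarrow> f \<otimes> e \<in> H"
  using EF bracket_swap_in[OF H_subspace] ED(1) FD(1) by blast

lemma EH: "\<lbrakk>e \<in> E; h \<in> H\<rbrakk> \<Longrightarrow> e \<otimes> h \<in> E"
  using HE bracket_swap_in[OF E_subspace] ED(1) HD(1) by blast

lemma swap: "local_triple L H F E"
  by (intro local_triple.intro local_triple_axioms.intro lie_algebra_axioms)
    (auto simp: H_subspace E_subspace F_subspace HH HE HF FE)

text \<open>Off by one: \<open>iterated k\<close> is the candidate for degree k + 1, spanned by
  nested brackets [e_1, [e_2, ...]] of k + 1 elements of \<open>E\<close>.\<close>

primrec iterated :: "nat \<Rightarrow> 'a set"
  where "iterated 0 = E"
  | "iterated (Suc k) = span {e \<otimes> x | e x. e \<in> E \<and> x \<in> iterated k}"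

lemma iterated_subspace: "subspace (iterated k)"
proof (induct k)
  case (Suc k)
  then show ?case using ED(1) subspaceD(1) by (auto intro!: subspace_span)
qed (simp add: E_subspace)

lemmas iterated_carrier = subspaceD(1)[OF iterated_subspace]

lemma gen_carrier: "{e \<otimes> x | e x. e \<in> E \<and> x \<in> iterated k} \<subseteq> carrier L"
  using iterated_carrier ED(1) by auto

lemma E_iterated: "\<lbrakk>e \<in> E; x \<in> iterated k\<rbrakk> \<Longrightarrow> e \<otimes> x \<in> iterated (Suc k)"
  using span_superset[OF gen_carrier] by auto

lemma iterated_SucI:
  assumes "x \<in> iterated (Suc k)" "y \<in> carrier L" "subspace S"
    and "\<And>e x. \<lbrakk>e \<in> E; x \<in> iterated k\<rbrakk> \<Longrightarrow> y \<otimes> (e \<otimes> x) \<in> S"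
  shows "y \<otimes> x \<in> S"
proof (rule span_induct_sub[of x _ "\<lambda>x. y \<otimes> x \<in> S"])
  show "x \<in> span {e \<otimes> x | e x. e \<in> E \<and> x \<in> iterated k}" using assms(1) by simp
  show "subspace {z \<in> carrier L. y \<otimes> z \<in> S}"
    by (rule subspaceI) (use assms(2) subspaceD[OF assms(3)] in
      \<open>auto simp: bracket_add_right bracket_smult_right\<close>)
qed (use gen_carrier assms(4) in auto)

lemma H_iterated: "\<lbrakk>h \<in> H; x \<in> iterated k\<rbrakk> \<Longrightarrow> h \<otimes> x \<in> iterated k"
proof (induct k arbitrary: x)
  case (Suc k)
  show ?case
  proof (rule iterated_SucI[OF Suc(3) HD(1)[OF Suc(2)] iterated_subspace])
    fix e x assume e: "e \<in> E" and x: "x \<in> iterated k"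
    have "h \<otimes> (e \<otimes> x) = (h \<otimes> e) \<otimes> x \<oplus> e \<otimes> (h \<otimes> x)"
      using Suc(2) e x HD(1) ED(1) iterated_carrier by (intro bracket_derivation) auto
    then show "h \<otimes> (e \<otimes> x) \<in> iterated (Suc k)"
      using Suc(1,2) e x HE E_iterated subspaceD(3)[OF iterated_subspace] by metis
  qed
qed (auto simp: HE)

lemma F_iterated: "\<lbrakk>f \<in> F; x \<in> iterated (Suc k)\<rbrakk> \<Longrightarrow> f \<otimes> x \<in> iterated k"
proof (induct k arbitrary: x)
  \<comment> \<open>Here both terms of the Leibniz rule pass through \<open>H\<close> and return to
    \<open>E\<close>; later steps stay inside the iterated spaces, so this one is separate.\<close>
  case 0
  show ?case
  proof (rule iterated_SucI[OF 0(2) FD(1)[OF 0(1)] iterated_subspace])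
    fix e x assume e: "e \<in> E" and x: "x \<in> iterated 0"
    have "f \<otimes> (e \<otimes> x) = (f \<otimes> e) \<otimes> x \<oplus> e \<otimes> (f \<otimes> x)"
      using 0 e x FD(1) ED(1) iterated_carrier by (intro bracket_derivation) auto
    then show "f \<otimes> (e \<otimes> x) \<in> iterated 0"
      using 0 e x FE HE EH ED(3) by auto
  qed
next
  case (Suc k)
  show ?case
  proof (rule iterated_SucI[OF Suc(3) FD(1)[OF Suc(2)] iterated_subspace])
    fix e x assume e: "e \<in> E" and x: "x \<in> iterated (Suc k)"
    have "f \<otimes> (e \<otimes> x) = (f \<otimes> e) \<otimes> x \<oplus> e \<otimes> (f \<otimes> x)"
      using Suc(2) e FD(1) ED(1) iterated_carrier[OF x] by (intro bracket_derivation) auto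
    then show "f \<otimes> (e \<otimes> x) \<in> iterated (Suc k)"
      using Suc(1,2) e x FE H_iterated E_iterated subspaceD(3)[OF iterated_subspace] by metis
  qed
qed

lemma iterated_generated: "lie_subalgebra L S \<Longrightarrow> E \<subseteq> S \<Longrightarrow> iterated k \<subseteq> S"
proof (induct k)
  case (Suc k)
  then have "{e \<otimes> x | e x. e \<in> E \<and> x \<in> iterated k} \<subseteq> S" "subspace S"
    by (auto simp: lie_subalgebra_def)
  then show ?case using span_minimal by simp
qed simp

end

context local_triple
begin

interpretation neg: local_triple L H F E by (rule swap)

text \<open>The subtraction of 1 undoes the shift of \<open>iterated\<close>; negative degrees come
  from the swapped triple.\<close>

definition iterated_component :: "int \<Rightarrow> 'a set"
  where "iterated_component k =
    (if k = 0 then H else if 0 < k then iterated (nat k - 1) else neg.iterated (nat (- k) - 1))"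

lemma component_simps:
  "iterated_component 0 = H" "iterated_component (int (Suc k)) = iterated k"
  "iterated_component (- int (Suc k)) = neg.iterated k"
  "iterated_component 1 = E" "iterated_component (- 1) = F"
  by (auto simp: iterated_component_def nat_add_distrib)

lemma int_three_cases:
  obtains "k = (0::int)" | m where "k = int (Suc m)" | m where "k = - int (Suc m)"
proof (cases k rule: int_cases3)
  case (pos n)
  then show ?thesis using that(2)[of "n - 1"] by simp
next
  case (neg n)
  then show ?thesis using that(3)[of "n - 1"] by simp
qed (use that in simp)

lemma component_subspace: "subspace (iterated_component k)"
  by (cases k rule: int_three_cases)
    (simp_all only: component_simps H_subspace iterated_subspace neg.iterated_subspace)

lemma component_E: "\<lbrakk>e \<in> E; x \<in> iterated_component k\<rbrakk> \<Longrightarrow> e \<otimes> x \<in> iterated_component (k + 1)"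
proof (cases k rule: int_three_cases)
  case (2 m)
  then have "k + 1 = int (Suc (Suc m))" by simp
  then show "\<lbrakk>e \<in> E; x \<in> iterated_component k\<rbrakk> \<Longrightarrow> ?thesis"
    using 2 E_iterated by (simp only: component_simps)
next
  \<comment> \<open>For the swapped triple \<open>E\<close> plays the role of \<open>F\<close>, so
    ad e climbs the negative side by \<open>neg.F_iterated\<close>; only from degree -1 does it land
    in \<open>H\<close>.\<close>
  case (3 m)
  show "\<lbrakk>e \<in> E; x \<in> iterated_component k\<rbrakk> \<Longrightarrow> ?thesis"
  proof (cases m)
    case 0
    then show "\<lbrakk>e \<in> E; x \<in> iterated_component k\<rbrakk> \<Longrightarrow> ?thesis"
      using 3 EF by (simp add: component_simps)
  next
    case (Suc l)
    then have "k + 1 = - int (Suc l)" using 3 by simp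
    then show "\<lbrakk>e \<in> E; x \<in> iterated_component k\<rbrakk> \<Longrightarrow> ?thesis"
      using 3 Suc neg.F_iterated by (simp only: component_simps)
  qed
qed (simp add: component_simps EH)

lemma component_F: "\<lbrakk>f \<in> F; x \<in> iterated_component k\<rbrakk> \<Longrightarrow> f \<otimes> x \<in> iterated_component (k - 1)"
proof (cases k rule: int_three_cases)
  case (3 m)
  then have "k - 1 = - int (Suc (Suc m))" by simp
  then show "\<lbrakk>f \<in> F; x \<in> iterated_component k\<rbrakk> \<Longrightarrow> ?thesis"
    using 3 neg.E_iterated by (simp only: component_simps)
next
  case (2 m)
  show "\<lbrakk>f \<in> F; x \<in> iterated_component k\<rbrakk> \<Longrightarrow> ?thesis"
  proof (cases m)
    case 0
    then show "\<lbrakk>f \<in> F; x \<in> iterated_component k\<rbrakk> \<Longrightarrow> ?thesis"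
      using 2 FE by (simp add: component_simps)
  next
    case (Suc l)
    then have "k - 1 = int (Suc l)" using 2 by simp
    then show "\<lbrakk>f \<in> F; x \<in> iterated_component k\<rbrakk> \<Longrightarrow> ?thesis"
      using 2 Suc F_iterated by (simp only: component_simps)
  qed
qed (simp add: component_simps neg.EH)

lemma component_H: "\<lbrakk>h \<in> H; x \<in> iterated_component k\<rbrakk> \<Longrightarrow> h \<otimes> x \<in> iterated_component k"
  by (cases k rule: int_three_cases)
    (auto simp only: component_simps HH H_iterated neg.H_iterated)

lemma component_generated: "lie_subalgebra L S \<Longrightarrow> F \<union> H \<union> E \<subseteq> S \<Longrightarrow> iterated_component k \<subseteq> S"
  using iterated_generated neg.iterated_generated
  by (cases k rule: int_three_cases) (simp_all only: component_simps; blast)+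

text \<open>The sum of the iterated components is invariant under the three generating spaces, hence
  under all that they generate (\<open>lie_generated_normalizes\<close>), and it is contained in
  what they generate. This makes it closed under brackets.\<close>

lemma generated_eq: "lie_generated L (F \<union> H \<union> E) = homogeneous_sums iterated_component"
proof -
  let ?X = "F \<union> H \<union> E" and ?S = "homogeneous_sums iterated_component"
  have X: "?X \<subseteq> carrier L" using HD(5) ED(5) FD(5) by auto
  have S: "subspace ?S" by (rule homogeneous_sums_subspace) (rule component_subspace)
  have sub: "?S \<subseteq> lie_generated L ?X"
    using lie_generated_subalgebra[OF X] lie_generated_superset[of ?X]
    by (intro homogeneous_sums_minimal component_generated) (auto simp: lie_subalgebra_def)
  have incl: "x \<in> iterated_component k \<Longrightarrow> x \<in> ?S" for x k
    by (rule homogeneous_sums_incl) (auto simp: component_subspace)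
  have "x \<otimes> s \<in> ?S" if "x \<in> ?X" "s \<in> ?S" for x s
    by (rule homogeneous_sums_bracket[OF component_subspace S _ _ that(2)])
      (use that X in \<open>auto intro: incl component_E component_F component_H\<close>)
  then have "y \<otimes> s \<in> ?S" if "y \<in> lie_generated L ?X" "s \<in> ?S" for y s
    using lie_generated_normalizes[OF S X] that by blast
  then have "lie_subalgebra L ?S" using S sub by (intro lie_subalgebraI) auto
  moreover have "?X \<subseteq> ?S"
    using incl[of _ 0] incl[of _ 1] incl[of _ "-1"] by (auto simp: component_simps)
  ultimately show ?thesis using lie_generated_minimal sub by blast
qed

end

text \<open>Records what holds at once for eigenspaces of an adjoint action and for products of
  graded algebras. Exhaustion is supplied later by \<open>generated_by_triple\<close>.\<close>

locale lie_gradation = lie_algebra L for L :: "(complex, 'a) module" (structure) +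
  fixes V :: "int \<Rightarrow> 'a set"
  assumes V_subspace: "subspace (V i)"
    and V_independent: "\<lbrakk>finite F; \<And>i. i \<in> F \<Longrightarrow> v i \<in> V i; (\<Oplus>i\<in>F. v i) = \<zero>; i \<in> F\<rbrakk> \<Longrightarrow> v i = \<zero>"
    and V_bracket: "\<lbrakk>x \<in> V i; y \<in> V j\<rbrakk> \<Longrightarrow> x \<otimes> y \<in> V (i + j)"
begin

lemmas VD = subspaceD[OF V_subspace]

text \<open>Subtracting the total from the j-th term gives a homogeneous family with sum zero, to
  which independence applies.\<close>

lemma component_unique:
  assumes F: "finite F" "\<And>i. v i \<in> V i" "\<And>i. i \<notin> F \<Longrightarrow> v i = \<zero>" and j: "(\<Oplus>i\<in>F. v i) \<in> V j"
  shows "(\<Oplus>i\<in>F. v i) = v j" and "i \<noteq> j \<Longrightarrow> v i = \<zero>"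
proof -
  let ?x = "\<Oplus>i\<in>F. v i"
  let ?G = "insert j F" and ?w = "v(j := v j \<ominus> ?x)"
  have vc: "v i \<in> carrier L" for i using F(2) VD(1) by blast
  have xc: "?x \<in> carrier L" using j VD(1) by blast
  have w: "?w i \<in> V i" for i
    using F(2) j subspace_minus[OF V_subspace] by simp
  have "(\<Oplus>i\<in>F. v i) = (\<Oplus>i\<in>?G. v i)"
    using F vc by (intro finsum_superset) auto
  also have "\<dots> = (\<Oplus>i\<in>insert j (F - {j}). v i)" by (intro finsum_cong') (auto simp: vc)
  also have "\<dots> = v j \<oplus> (\<Oplus>i\<in>F - {j}. v i)"
    using F(1) vc by (intro finsum_insert) auto
  finally have x: "?x = v j \<oplus> (\<Oplus>i\<in>F - {j}. v i)" .
  have "(\<Oplus>i\<in>?G. ?w i) = (\<Oplus>i\<in>insert j (F - {j}). ?w i)"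
    using vc xc by (intro finsum_cong') auto
  also have "\<dots> = ?w j \<oplus> (\<Oplus>i\<in>F - {j}. ?w i)"
    using F(1) vc xc by (intro finsum_insert) auto
  also have "(\<Oplus>i\<in>F - {j}. ?w i) = (\<Oplus>i\<in>F - {j}. v i)"
    using vc by (intro finsum_cong') auto
  finally have "(\<Oplus>i\<in>?G. ?w i) = (v j \<oplus> (\<Oplus>i\<in>F - {j}. v i)) \<ominus> ?x"
    using vc xc by (simp add: a_minus_def a_ac)
  then have 0: "(\<Oplus>i\<in>?G. ?w i) = \<zero>" using x xc by (simp add: a_minus_def r_neg)
  have z: "?w i = \<zero>" if "i \<in> ?G" for i
    using V_independent[of ?G ?w i] F(1) w 0 that by blast
  from z[of j] show "?x = v j" using vc xc by simp
  show "v i = \<zero>" if "i \<noteq> j" using z[of i] F(3)[of i] that by auto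
qed

lemma component_in:
  assumes "x \<in> homogeneous_sums W" "\<And>i. subspace (W i)" "\<And>i. W i \<subseteq> V i" "x \<in> V j"
  shows "x \<in> W j"
proof -
  obtain F v where "finite F" "\<And>i. v i \<in> W i" "\<And>i. i \<notin> F \<Longrightarrow> v i = \<zero>" "x = (\<Oplus>i\<in>F. v i)"
    using assms(1,2) by (metis homogeneous_sumsE)
  with component_unique(1)[of F v j] assms(3,4) show ?thesis by (metis subsetD)
qed

lemma flip: "lie_gradation L (\<lambda>k. V (- k))"
proof (intro lie_gradation.intro lie_gradation_axioms.intro lie_algebra_axioms)
  fix F v and i :: int
  assume F: "finite F" "\<And>i. i \<in> F \<Longrightarrow> v i \<in> V (- i)" "(\<Oplus>i\<in>F. v i) = \<zero>" "i \<in> F"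
  have "(\<Oplus>i\<in>F. v i) = (\<Oplus>i\<in>uminus ` F. v (- i))"
    using VD(1)[OF F(2)] by (subst finsum_reindex) (auto simp: o_def)
  then have "v (- (- i)) = \<zero>"
    using F by (intro V_independent[of "uminus ` F" "\<lambda>i. v (- i)"]) auto
  then show "v i = \<zero>" by simp
next
  fix x y and i j :: int
  assume "x \<in> V (- i)" "y \<in> V (- j)"
  then show "x \<otimes> y \<in> V (- (i + j))" using V_bracket[of x "-i" y "-j"] by simp
qed (rule V_subspace)

text \<open>The k-th iterated component lies in \<open>V k\<close>, so by uniqueness of
  decompositions it is all of \<open>M \<inter> V k\<close>. Applied to the graph of a local
  isomorphism, to \<open>kac_tilde\<close> and to the derived algebra, this gives both the
  decomposition and the local part.\<close>

lemma generated_by_triple: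
  assumes "local_triple L H E F" "H \<subseteq> V 0" "E \<subseteq> V 1" "F \<subseteq> V (-1)"
  defines "M \<equiv> lie_generated L (F \<union> H \<union> E)"
  shows "M \<inter> V 0 = H" "M \<inter> V 1 = E" "M \<inter> V (-1) = F" "M = homogeneous_sums (\<lambda>k. M \<inter> V k)"
proof -
  interpret T: local_triple L H E F by fact
  let ?N = T.iterated_component
  interpret T': local_triple L H F E by (rule T.swap)
  have M: "M = homogeneous_sums ?N" unfolding M_def by (rule T.generated_eq)
  \<comment> \<open>The degree d of the generating space is a parameter, so that d = 1 and d = -1
    cover both halves.\<close>
  have pos: "local_triple.iterated L E k \<subseteq> V (d * int (Suc k))"
    if S: "local_triple L H E F" "E \<subseteq> V d" for E F d k
  proof -
    interpret S: local_triple L H E F by fact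
    show ?thesis
    proof (induct k)
      case (Suc k)
      have "{e \<otimes> x | e x. e \<in> E \<and> x \<in> S.iterated k} \<subseteq> V (d + d * int (Suc k))"
        using Suc S(2) V_bracket by fastforce
      then show ?case using span_minimal[OF _ V_subspace] by (simp add: algebra_simps)
    qed (use S(2) in simp)
  qed
  have NV: "?N k \<subseteq> V k" for k
    using pos[OF T.local_triple_axioms, of 1] pos[OF T'.local_triple_axioms, of "-1"] assms(2-4)
    by (cases k rule: T.int_three_cases) (simp_all only: T.component_simps; simp)+
  have in_N: "x \<in> M \<Longrightarrow> x \<in> V k \<Longrightarrow> x \<in> ?N k" for x k
    unfolding M by (rule component_in) (auto simp: T.component_subspace dest: subsetD[OF NV])
  have NM: "?N k \<subseteq> M" for k
    unfolding M using homogeneous_sums_incl[of _ ?N k, OF _ T.component_subspace] by blast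
  show "M \<inter> V 0 = H" "M \<inter> V 1 = E" "M \<inter> V (-1) = F"
    using in_N[of _ 0] in_N[of _ 1] in_N[of _ "-1"] NM[of 0] NM[of 1] NM[of "-1"] assms(2-4)
    by (auto simp: T.component_simps)
  have "subspace M" unfolding M by (rule homogeneous_sums_subspace) (rule T.component_subspace)
  then have "homogeneous_sums (\<lambda>k. M \<inter> V k) \<subseteq> M"
    by (intro homogeneous_sums_minimal) auto
  moreover have "homogeneous_sums ?N \<subseteq> homogeneous_sums (\<lambda>k. M \<inter> V k)"
    using NV NM by (intro homogeneous_sums_mono) auto
  ultimately show "M = homogeneous_sums (\<lambda>k. M \<inter> V k)" using M by auto
qed

end

sublocale graded_lie_algebra \<subseteq> lie_gradation
  by (intro lie_gradation.intro lie_gradation_axioms.intro lie_algebra_axioms)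
    (rule component_subspace components_independent bracket_degree; assumption)+

section \<open>Transitive gradings are minimal\<close>

lemma lie_algebraI:
  fixes L (structure)
  assumes "complex_space L"
    and "\<And>x y. \<lbrakk>x \<in> carrier L; y \<in> carrier L\<rbrakk> \<Longrightarrow> x \<otimes> y \<in> carrier L"
    and "\<And>x y z. \<lbrakk>x \<in> carrier L; y \<in> carrier L; z \<in> carrier L\<rbrakk> \<Longrightarrow> x \<otimes> (y \<oplus> z) = x \<otimes> y \<oplus> x \<otimes> z"
    and "\<And>x y z. \<lbrakk>x \<in> carrier L; y \<in> carrier L; z \<in> carrier L\<rbrakk> \<Longrightarrow> (x \<oplus> y) \<otimes> z = x \<otimes> z \<oplus> y \<otimes> z"
    and "\<And>c x y. \<lbrakk>x \<in> carrier L; y \<in> carrier L\<rbrakk> \<Longrightarrow> x \<otimes> (c \<odot> y) = c \<odot> (x \<otimes> y)"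
    and "\<And>c x y. \<lbrakk>x \<in> carrier L; y \<in> carrier L\<rbrakk> \<Longrightarrow> (c \<odot> x) \<otimes> y = c \<odot> (x \<otimes> y)"
    and "\<And>x. x \<in> carrier L \<Longrightarrow> x \<otimes> x = \<zero>"
    and "\<And>x y z. \<lbrakk>x \<in> carrier L; y \<in> carrier L; z \<in> carrier L\<rbrakk> \<Longrightarrow>
      x \<otimes> (y \<otimes> z) \<oplus> (y \<otimes> (z \<otimes> x) \<oplus> z \<otimes> (x \<otimes> y)) = \<zero>"
  shows "lie_algebra L"
  using assms
  by (intro lie_algebra.intro lie_algebra_axioms.intro)
    (auto simp: complex_space_def bilinear_map_def linear_maps_iff)

definition lie_product :: "(complex, 'a) module \<Rightarrow> (complex, 'b) module \<Rightarrow> (complex, 'a \<times> 'b) module"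
  where "lie_product L M =
    \<lparr>carrier = carrier L \<times> carrier M,
     mult = (\<lambda>p q. (fst p \<otimes>\<^bsub>L\<^esub> fst q, snd p \<otimes>\<^bsub>M\<^esub> snd q)), one = undefined,
     zero = (\<zero>\<^bsub>L\<^esub>, \<zero>\<^bsub>M\<^esub>), add = (\<lambda>p q. (fst p \<oplus>\<^bsub>L\<^esub> fst q, snd p \<oplus>\<^bsub>M\<^esub> snd q)),
     smult = (\<lambda>c p. (c \<odot>\<^bsub>L\<^esub> fst p, c \<odot>\<^bsub>M\<^esub> snd p))\<rparr>"

lemma lie_product_simps [simp]:
  "carrier (lie_product L M) = carrier L \<times> carrier M"
  "p \<otimes>\<^bsub>lie_product L M\<^esub> q = (fst p \<otimes>\<^bsub>L\<^esub> fst q, snd p \<otimes>\<^bsub>M\<^esub> snd q)"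
  "\<zero>\<^bsub>lie_product L M\<^esub> = (\<zero>\<^bsub>L\<^esub>, \<zero>\<^bsub>M\<^esub>)"
  "p \<oplus>\<^bsub>lie_product L M\<^esub> q = (fst p \<oplus>\<^bsub>L\<^esub> fst q, snd p \<oplus>\<^bsub>M\<^esub> snd q)"
  "c \<odot>\<^bsub>lie_product L M\<^esub> p = (c \<odot>\<^bsub>L\<^esub> fst p, c \<odot>\<^bsub>M\<^esub> snd p)"
  by (simp_all add: lie_product_def)

lemma lie_product_lie_algebra:
  assumes "lie_algebra L" "lie_algebra M"
  shows "lie_algebra (lie_product L M)"
proof -
  interpret L: lie_algebra L by fact
  interpret M: lie_algebra M by fact
  show ?thesis
  proof (rule lie_algebraI)
    show "complex_space (lie_product L M)"
      by (rule complex_spaceI)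
        (auto simp: L.a_ac M.a_ac L.smult_m1 M.smult_m1 L.r_neg M.r_neg
          L.smult_add_left M.smult_add_left L.smult_add_right M.smult_add_right
          L.smult_smult M.smult_smult)
  qed (auto simp: L.bracket_add_right M.bracket_add_right L.bracket_add_left M.bracket_add_left
      L.bracket_smult_right M.bracket_smult_right L.bracket_smult_left M.bracket_smult_left
      L.bracket_alternating M.bracket_alternating L.jacobi M.jacobi)
qed

lemma lie_product_finsum:
  assumes "lie_algebra L" "lie_algebra M" "finite A" "f \<in> A \<rightarrow> carrier L \<times> carrier M"
  shows "finsum (lie_product L M) f A = (\<Oplus>\<^bsub>L\<^esub>i\<in>A. fst (f i), \<Oplus>\<^bsub>M\<^esub>i\<in>A. snd (f i))"
proof -
  interpret L: lie_algebra L by fact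
  interpret M: lie_algebra M by fact
  interpret P: lie_algebra "lie_product L M" by (rule lie_product_lie_algebra) fact+
  show ?thesis
    using assms(3,4)
  proof (induct A)
    case (insert x F)
    then have "fst (f i) \<in> carrier L" "snd (f i) \<in> carrier M" if "i \<in> insert x F" for i
      using that by (auto simp: Pi_def mem_Times_iff)
    with insert show ?case by (subst P.finsum_insert) (auto simp: Pi_def mem_Times_iff)
  qed simp
qed

lemma lie_product_subspace:
  assumes "lie_algebra L" "lie_algebra M"
    "VectorSpace.subspace complex_ring S L" "VectorSpace.subspace complex_ring T M"
  shows "VectorSpace.subspace complex_ring (S \<times> T) (lie_product L M)"
proof -
  interpret L: lie_algebra L by fact
  interpret M: lie_algebra M by fact
  interpret P: lie_algebra "lie_product L M" by (rule lie_product_lie_algebra) fact+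
  show ?thesis
    by (rule P.subspaceI) (use L.subspaceD[OF assms(3)] M.subspaceD[OF assms(4)] in auto)
qed

lemma lie_product_gradation:
  assumes "lie_gradation L V" "lie_gradation M W"
  shows "lie_gradation (lie_product L M) (\<lambda>k. V k \<times> W k)"
proof -
  interpret L: lie_gradation L V by fact
  interpret M: lie_gradation M W by fact
  note la = L.lie_algebra_axioms M.lie_algebra_axioms
  show ?thesis
  proof (intro lie_gradation.intro lie_gradation_axioms.intro lie_product_lie_algebra[OF la])
    show "VectorSpace.subspace complex_ring (V i \<times> W i) (lie_product L M)" for i
      by (rule lie_product_subspace[OF la L.V_subspace M.V_subspace])
  next
    fix F v and i :: int
    assume F: "finite F" "\<And>i. i \<in> F \<Longrightarrow> v i \<in> V i \<times> W i"
      and 0: "(\<Oplus>\<^bsub>lie_product L M\<^esub>i\<in>F. v i) = \<zero>\<^bsub>lie_product L M\<^esub>" and i: "i \<in> F"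
    have m: "fst (v i) \<in> V i" "snd (v i) \<in> W i" if "i \<in> F" for i
      using F(2)[OF that] by (auto simp: mem_Times_iff)
    have "v \<in> F \<rightarrow> carrier L \<times> carrier M"
      using L.VD(1)[OF m(1)] M.VD(1)[OF m(2)] by (auto simp: mem_Times_iff)
    from 0[unfolded lie_product_finsum[OF la F(1) this]]
    have "fst (v i) = \<zero>\<^bsub>L\<^esub>" "snd (v i) = \<zero>\<^bsub>M\<^esub>"
      using L.V_independent[OF F(1) m(1), of i] M.V_independent[OF F(1) m(2), of i] i by auto
    then show "v i = \<zero>\<^bsub>lie_product L M\<^esub>" by (simp add: prod_eq_iff)
  qed (auto simp: L.V_bracket M.V_bracket)
qed

text \<open>Degrees -1, 0, 1 are exempt: there a local isomorphism leaves nothing to decide. In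
  particular a center in degree 0 is allowed.\<close>

definition transitive_grading :: "(complex, 'a) module \<Rightarrow> (int \<Rightarrow> 'a set) \<Rightarrow> bool"
  where "transitive_grading L V \<longleftrightarrow>
    (\<forall>k\<ge>2. \<forall>x\<in>V k. (\<forall>y\<in>V (-1). y \<otimes>\<^bsub>L\<^esub> x = \<zero>\<^bsub>L\<^esub>) \<longrightarrow> x = \<zero>\<^bsub>L\<^esub>) \<and>
    (\<forall>k\<ge>2. \<forall>x\<in>V (- k). (\<forall>y\<in>V 1. y \<otimes>\<^bsub>L\<^esub> x = \<zero>\<^bsub>L\<^esub>) \<longrightarrow> x = \<zero>\<^bsub>L\<^esub>)"

lemma local_isoD:
  assumes "local_iso L' V' L V \<psi>" "i \<in> {-1, 0, 1}"
  shows "x \<in> V' i \<Longrightarrow> \<psi> x \<in> V i" "\<psi> ` V' i = V i" "inj_on \<psi> (V' i)"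
    and "\<lbrakk>x \<in> V' i; y \<in> V' i\<rbrakk> \<Longrightarrow> \<psi> (x \<oplus>\<^bsub>L'\<^esub> y) = \<psi> x \<oplus>\<^bsub>L\<^esub> \<psi> y"
    and "x \<in> V' i \<Longrightarrow> \<psi> (c \<odot>\<^bsub>L'\<^esub> x) = c \<odot>\<^bsub>L\<^esub> \<psi> x"
    and "\<lbrakk>j \<in> {-1, 0, 1}; i + j \<in> {-1, 0, 1}; x \<in> V' i; y \<in> V' j\<rbrakk> \<Longrightarrow>
      \<psi> (x \<otimes>\<^bsub>L'\<^esub> y) = \<psi> x \<otimes>\<^bsub>L\<^esub> \<psi> y"
proof -
  have "\<psi> \<in> linear_maps (L'\<lparr>carrier := V' i\<rparr>) (L\<lparr>carrier := V i\<rparr>)" "bij_betw \<psi> (V' i) (V i)"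
    using assms unfolding local_iso_def by blast+
  then show "x \<in> V' i \<Longrightarrow> \<psi> x \<in> V i" "\<psi> ` V' i = V i" "inj_on \<psi> (V' i)"
    "\<lbrakk>x \<in> V' i; y \<in> V' i\<rbrakk> \<Longrightarrow> \<psi> (x \<oplus>\<^bsub>L'\<^esub> y) = \<psi> x \<oplus>\<^bsub>L\<^esub> \<psi> y"
    "x \<in> V' i \<Longrightarrow> \<psi> (c \<odot>\<^bsub>L'\<^esub> x) = c \<odot>\<^bsub>L\<^esub> \<psi> x"
    by (auto simp: linear_maps_iff bij_betw_def)
  show "\<lbrakk>j \<in> {-1, 0, 1}; i + j \<in> {-1, 0, 1}; x \<in> V' i; y \<in> V' j\<rbrakk> \<Longrightarrow>
      \<psi> (x \<otimes>\<^bsub>L'\<^esub> y) = \<psi> x \<otimes>\<^bsub>L\<^esub> \<psi> y"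
    using assms unfolding local_iso_def by blast
qed

text \<open>An isomorphism of local parts extends because the subalgebra of the product generated by its
  graph is again a graph: a pair \<open>(0, b)\<close> of degree \<open>k \<ge> 2\<close> in it is moved to degree \<open>k - 1\<close> by
  the elements of degree \<open>-1\<close>, so \<open>b = 0\<close> by induction and transitivity.\<close>

lemma transitive_grading_minimal:
  fixes L :: "(complex, 'a) module"
  assumes "graded_lie_algebra L V" and tr: "transitive_grading L V"
  shows "minimal_graded_lie_algebra L V"
  unfolding minimal_graded_lie_algebra_def
proof (intro conjI allI impI)
  show "graded_lie_algebra L V" by fact
next
  fix L' :: "(complex, 'a) module" and V' \<psi>
  assume "graded_lie_algebra L' V' \<and> local_iso L' V' L V \<psi>"
  then have L': "graded_lie_algebra L' V'" and \<psi>: "local_iso L' V' L V \<psi>" by auto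
  interpret L: graded_lie_algebra L V by fact
  interpret L': graded_lie_algebra L' V' by fact
  note la = L'.lie_algebra_axioms L.lie_algebra_axioms
  let ?P = "lie_product L' L"
  interpret P: lie_gradation ?P "\<lambda>k. V' k \<times> V k"
    by (rule lie_product_gradation) (rule L'.lie_gradation_axioms L.lie_gradation_axioms)+
  define gr where "gr i = {(x, \<psi> x) | x. x \<in> V' i}" for i
  note D = local_isoD[OF \<psi>]
  have \<psi>0: "\<psi> \<zero>\<^bsub>L'\<^esub> = \<zero>\<^bsub>L\<^esub>"
    using D(5)[of 0 "\<zero>\<^bsub>L'\<^esub>" 0] D(1)[of 0 "\<zero>\<^bsub>L'\<^esub>"] L'.VD(2)[of 0] L.VD(1)[of _ 0] by simp
  have grV: "gr i \<subseteq> V' i \<times> V i" if "i \<in> {-1, 0, 1}" for i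
    unfolding gr_def using D(1)[OF that] by auto
  have grsub: "P.subspace (gr i)" if i: "i \<in> {-1, 0, 1}" for i
  proof (rule P.subspaceI)
    show "gr i \<subseteq> carrier ?P" using grV[OF i] L'.VD(1) L.VD(1) by fastforce
    show "\<zero>\<^bsub>?P\<^esub> \<in> gr i" unfolding gr_def using \<psi>0 L'.VD(2) by force
  qed (use D(4,5)[OF i] L'.VD(3,4) in \<open>auto simp: gr_def\<close>)
  have grbr: "p \<otimes>\<^bsub>?P\<^esub> q \<in> gr (i + j)"
    if "i \<in> {-1, 0, 1}" "j \<in> {-1, 0, 1}" "i + j \<in> {-1, 0, 1}" "p \<in> gr i" "q \<in> gr j" for i j p q
    using D(6)[OF that(1-3)] that(4,5) L'.V_bracket unfolding gr_def by fastforce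
  \<comment> \<open>Compatibility of \<psi> with the brackets that stay in degrees -1, 0, 1 is
    exactly what makes its graph a local triple in the product.\<close>
  have T: "local_triple ?P (gr 0) (gr 1) (gr (-1))"
    by (intro local_triple.intro local_triple_axioms.intro P.lie_algebra_axioms)
      (use grsub grbr[of 0 0] grbr[of 0 1] grbr[of 0 "-1"] grbr[of 1 "-1"] in auto)
  let ?X = "gr (-1) \<union> gr 0 \<union> gr 1"
  define M where "M = lie_generated ?P ?X"
  note gen = P.generated_by_triple[OF T grV grV grV, simplified, folded M_def]
  have Xc: "?X \<subseteq> carrier ?P" using grsub P.subspaceD(5) by auto
  have Msub: "lie_subalgebra ?P M" unfolding M_def by (rule P.lie_generated_subalgebra[OF Xc])
  then have Mv: "P.subspace M" by (simp add: lie_subalgebra_def)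
  note MD = P.subspaceD[OF Mv]
  have Mbr: "p \<otimes>\<^bsub>?P\<^esub> q \<in> M" if "p \<in> M" "q \<in> M" for p q
    using Msub that unfolding lie_subalgebra_def by blast
  have XM: "?X \<subseteq> M" unfolding M_def by (rule P.lie_generated_superset)
  \<comment> \<open>In these degrees \<open>M\<close> is no larger than the graph, which contains
    (0, b) only for b = 0.\<close>
  have loc: "b = \<zero>\<^bsub>L\<^esub>" if "(\<zero>\<^bsub>L'\<^esub>, b) \<in> M" "b \<in> V k" "k \<in> {-1, 0, 1}" for b k
  proof -
    have "(\<zero>\<^bsub>L'\<^esub>, b) \<in> gr k"
      using that gen(1-3) L'.VD(2) by auto
    then show ?thesis using \<psi>0 by (auto simp: gr_def)
  qed
  have step: "(\<zero>\<^bsub>L'\<^esub>, y \<otimes>\<^bsub>L\<^esub> b) \<in> M"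
    if "(\<zero>\<^bsub>L'\<^esub>, b) \<in> M" "i \<in> {-1, 0, 1}" "y \<in> V i" for b y i
  proof -
    from that D(2)[OF that(2)] obtain y' where y': "y' \<in> V' i" "y = \<psi> y'" by blast
    then have "(y', y) \<in> M" using XM that(2) by (auto simp: gr_def)
    from Mbr[OF this that(1)] show ?thesis using L'.VD(1)[OF y'(1)] by simp
  qed
  have pos: "b = \<zero>\<^bsub>L\<^esub>" if "(\<zero>\<^bsub>L'\<^esub>, b) \<in> M" "b \<in> V (int (Suc m))" for b m
    using that
  proof (induct m arbitrary: b)
    case 0
    then show ?case using loc[of b 1] by simp
  next
    case (Suc m)
    have "y \<otimes>\<^bsub>L\<^esub> b = \<zero>\<^bsub>L\<^esub>" if y: "y \<in> V (-1)" for y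
      using Suc(1)[OF step[OF Suc(2) _ y]] L.V_bracket[OF y Suc(3)] by simp
    moreover have "(2::int) \<le> int (Suc (Suc m))" by simp
    ultimately show ?case
      using tr Suc(3) unfolding transitive_grading_def by blast
  qed
  have neg: "b = \<zero>\<^bsub>L\<^esub>" if "(\<zero>\<^bsub>L'\<^esub>, b) \<in> M" "b \<in> V (- int (Suc m))" for b m
    using that
  proof (induct m arbitrary: b)
    case 0
    then show ?case using loc[of b "-1"] by simp
  next
    case (Suc m)
    have "y \<otimes>\<^bsub>L\<^esub> b = \<zero>\<^bsub>L\<^esub>" if y: "y \<in> V 1" for y
      using Suc(1)[OF step[OF Suc(2) _ y]] L.V_bracket[OF y Suc(3)] by simp
    moreover have "(2::int) \<le> int (Suc (Suc m))" by simp
    ultimately show ?case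
      using tr Suc(3) unfolding transitive_grading_def by blast
  qed
  have hom: "b = \<zero>\<^bsub>L\<^esub>" if "(\<zero>\<^bsub>L'\<^esub>, b) \<in> M" "b \<in> V k" for b k
  proof (cases k rule: int_cases3)
    case (pos n)
    then show ?thesis using \<open>\<And>b m. _ \<Longrightarrow> b \<in> V (int (Suc m)) \<Longrightarrow> _\<close>[of b "n - 1"] that by simp
  next
    case (neg n)
    then show ?thesis using \<open>\<And>b m. _ \<Longrightarrow> b \<in> V (- int (Suc m)) \<Longrightarrow> _\<close>[of b "n - 1"] that by simp
  qed (use loc[of b 0] that in simp)
  \<comment> \<open>The components of (0, y) lie in \<open>M\<close>, and their first coordinates
    vanish because the grading of \<open>L'\<close> is independent; so \<open>hom\<close> applies to
    each of them.\<close>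
  have zero: "y = \<zero>\<^bsub>L\<^esub>" if "(\<zero>\<^bsub>L'\<^esub>, y) \<in> M" for y
  proof -
    have sub: "P.subspace (M \<inter> (V' k \<times> V k))" for k
      by (rule P.subspace_Int[OF Mv P.V_subspace])
    have "(\<zero>\<^bsub>L'\<^esub>, y) \<in> P.homogeneous_sums (\<lambda>k. M \<inter> (V' k \<times> V k))"
      using that gen(4) by simp
    then obtain F v where F: "finite F" "\<And>k. v k \<in> M \<inter> (V' k \<times> V k)"
      "\<And>k. k \<notin> F \<Longrightarrow> v k = \<zero>\<^bsub>?P\<^esub>" "(\<zero>\<^bsub>L'\<^esub>, y) = (\<Oplus>\<^bsub>?P\<^esub>k\<in>F. v k)"
      by (rule P.homogeneous_sumsE[OF _ sub]) (rule that; assumption)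
    have m: "fst (v k) \<in> V' k" "snd (v k) \<in> V k" for k
      using F(2)[of k] by (auto simp: mem_Times_iff)
    have "v \<in> F \<rightarrow> carrier L' \<times> carrier L"
      using L.VD(1)[OF m(2)] L'.VD(1)[OF m(1)] by (auto simp: mem_Times_iff)
    from F(4)[unfolded lie_product_finsum[OF la F(1) this]]
    have s: "\<zero>\<^bsub>L'\<^esub> = (\<Oplus>\<^bsub>L'\<^esub>k\<in>F. fst (v k))" "y = (\<Oplus>\<^bsub>L\<^esub>k\<in>F. snd (v k))" by auto
    have fst0: "fst (v k) = \<zero>\<^bsub>L'\<^esub>" if "k \<in> F" for k
      by (rule L'.V_independent[OF F(1) m(1) s(1)[symmetric] that])
    have "snd (v k) = \<zero>\<^bsub>L\<^esub>" if "k \<in> F" for k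
      using hom[of "snd (v k)" k] F(2)[of k] fst0[OF that] by (cases "v k") auto
    then have "y = (\<Oplus>\<^bsub>L\<^esub>k\<in>F. \<zero>\<^bsub>L\<^esub>)"
      unfolding s(2) by (intro L.finsum_cong') auto
    then show ?thesis by simp
  qed
  have fn: "y = y'" if "(x, y) \<in> M" "(x, y') \<in> M" for x y y'
  proof -
    have c: "x \<in> carrier L'" "y \<in> carrier L" "y' \<in> carrier L"
      using MD(1)[OF that(1)] MD(1)[OF that(2)] by auto
    have "(x, y) \<oplus>\<^bsub>?P\<^esub> (-1) \<odot>\<^bsub>?P\<^esub> (x, y') \<in> M" by (intro MD(3,4) that)
    then have "(\<zero>\<^bsub>L'\<^esub>, y \<ominus>\<^bsub>L\<^esub> y') \<in> M"
      using c by (simp add: L.smult_m1 L'.smult_m1 L'.r_neg a_minus_def)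
    from zero[OF this] c show ?thesis by simp
  qed
  \<comment> \<open>Both projections of \<open>M\<close> are subalgebras that contain the local
    part, hence everything: the relation \<open>M\<close> is total and onto.\<close>
  have sub1: "lie_subalgebra L' (fst ` M)"
  proof (intro L'.lie_subalgebraI L'.subspaceI)
    show "fst ` M \<subseteq> carrier L'" "\<zero>\<^bsub>L'\<^esub> \<in> fst ` M" using MD(1,2) by force+
  qed (use MD(3,4) Mbr in \<open>(clarsimp simp: image_iff Bex_def, metis fst_conv)+\<close>)
  have sub2: "lie_subalgebra L (snd ` M)"
  proof (intro L.lie_subalgebraI L.subspaceI)
    show "snd ` M \<subseteq> carrier L" "\<zero>\<^bsub>L\<^esub> \<in> snd ` M" using MD(1,2) by force+
  qed (use MD(3,4) Mbr in \<open>(clarsimp simp: image_iff Bex_def, metis snd_conv)+\<close>)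
  have gm: "(x, \<psi> x) \<in> M" if "x \<in> V' i" "i \<in> {-1, 0, 1}" for x i
    using XM that unfolding gr_def by auto
  have "x \<in> fst ` M" if "x \<in> V' i" "i \<in> {-1, 0, 1}" for x i
    using gm[OF that] by force
  then have "V' (-1) \<union> V' 0 \<union> V' 1 \<subseteq> fst ` M" by auto
  from L'.lie_generated_minimal[OF sub1 this]
  have tot: "\<exists>y. (x, y) \<in> M" if "x \<in> carrier L'" for x
    using L'.generated_by_local_part that by force
  have "y \<in> snd ` M" if "y \<in> V i" "i \<in> {-1, 0, 1}" for y i
    using gm[OF _ that(2)] D(2)[OF that(2)] that(1) by force
  then have "V (-1) \<union> V 0 \<union> V 1 \<subseteq> snd ` M" by auto
  from L.lie_generated_minimal[OF sub2 this]
  have onto: "\<exists>x. (x, y) \<in> M" if "y \<in> carrier L" for y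
    using L.generated_by_local_part that by force
  define \<Psi> where "\<Psi> x = (THE y. (x, y) \<in> M)" for x
  have \<Psi>M: "(x, \<Psi> x) \<in> M" if "x \<in> carrier L'" for x
    unfolding \<Psi>_def using tot[OF that] fn by (metis theI)
  have \<Psi>eq: "\<Psi> x = y" if "(x, y) \<in> M" for x y
    unfolding \<Psi>_def using fn that by blast
  have \<Psi>c: "\<Psi> x \<in> carrier L" if "x \<in> carrier L'" for x
    using MD(1)[OF \<Psi>M[OF that]] by simp
  have "\<Psi> \<in> lie_hom L' L"
    unfolding lie_hom_def linear_maps_iff
    using \<Psi>c \<Psi>eq MD(3)[OF \<Psi>M \<Psi>M] MD(4)[OF \<Psi>M] Mbr[OF \<Psi>M \<Psi>M] by simp
  moreover have "\<Psi> ` carrier L' = carrier L"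
  proof
    show "\<Psi> ` carrier L' \<subseteq> carrier L" using \<Psi>c by auto
    show "carrier L \<subseteq> \<Psi> ` carrier L'"
    proof
      fix y assume "y \<in> carrier L"
      then obtain x where x: "(x, y) \<in> M" using onto by auto
      then show "y \<in> \<Psi> ` carrier L'" using \<Psi>eq[OF x] MD(1)[OF x] by auto
    qed
  qed
  moreover have "\<forall>i\<in>{-1, 0, 1}. \<forall>x\<in>V' i. \<Psi> x = \<psi> x"
    using XM \<Psi>eq unfolding gr_def by auto
  ultimately show "\<exists>\<Psi>\<in>lie_hom L' L. \<Psi> ` carrier L' = carrier L \<and> (\<forall>i\<in>{-1, 0, 1}. \<forall>x\<in>V' i. \<Psi> x = \<psi> x)"
    by blast
qed

section \<open>Isomorphisms and quotients\<close>

lemma lie_homD: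
  assumes "f \<in> lie_hom L M"
  shows "x \<in> carrier L \<Longrightarrow> f x \<in> carrier M"
    and "\<lbrakk>x \<in> carrier L; y \<in> carrier L\<rbrakk> \<Longrightarrow> f (x \<oplus>\<^bsub>L\<^esub> y) = f x \<oplus>\<^bsub>M\<^esub> f y"
    and "x \<in> carrier L \<Longrightarrow> f (c \<odot>\<^bsub>L\<^esub> x) = c \<odot>\<^bsub>M\<^esub> f x"
    and "\<lbrakk>x \<in> carrier L; y \<in> carrier L\<rbrakk> \<Longrightarrow> f (x \<otimes>\<^bsub>L\<^esub> y) = f x \<otimes>\<^bsub>M\<^esub> f y"
  using assms by (auto simp: lie_hom_def linear_maps_iff)

lemma lie_homI:
  assumes "\<And>x. x \<in> carrier L \<Longrightarrow> f x \<in> carrier M"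
    and "\<And>x y. \<lbrakk>x \<in> carrier L; y \<in> carrier L\<rbrakk> \<Longrightarrow> f (x \<oplus>\<^bsub>L\<^esub> y) = f x \<oplus>\<^bsub>M\<^esub> f y"
    and "\<And>c x. x \<in> carrier L \<Longrightarrow> f (c \<odot>\<^bsub>L\<^esub> x) = c \<odot>\<^bsub>M\<^esub> f x"
    and "\<And>x y. \<lbrakk>x \<in> carrier L; y \<in> carrier L\<rbrakk> \<Longrightarrow> f (x \<otimes>\<^bsub>L\<^esub> y) = f x \<otimes>\<^bsub>M\<^esub> f y"
  shows "f \<in> lie_hom L M"
  using assms by (auto simp: lie_hom_def linear_maps_iff)

lemma linear_map_zero:
  assumes "complex_space L" "complex_space M" "f \<in> linear_maps L M"
  shows "f \<zero>\<^bsub>L\<^esub> = \<zero>\<^bsub>M\<^esub>"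
proof -
  interpret L: complex_space L by fact
  interpret M: complex_space M by fact
  have "f (0 \<odot>\<^bsub>L\<^esub> \<zero>\<^bsub>L\<^esub>) = 0 \<odot>\<^bsub>M\<^esub> f \<zero>\<^bsub>L\<^esub>" "f \<zero>\<^bsub>L\<^esub> \<in> carrier M"
    using assms(3) L.zero_closed unfolding linear_maps_iff by blast+
  then show ?thesis by simp
qed

lemma linear_map_finsum:
  assumes "complex_space L" "complex_space M" "f \<in> linear_maps L M" "v \<in> A \<rightarrow> carrier L"
  shows "f (\<Oplus>\<^bsub>L\<^esub>i\<in>A. v i) = (\<Oplus>\<^bsub>M\<^esub>i\<in>A. f (v i))"
proof -
  interpret L: complex_space L by fact
  interpret M: complex_space M by fact
  have f: "f x \<in> carrier M" if "x \<in> carrier L" for x using assms(3) that by (auto simp: linear_maps_iff)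
  have f2: "f (x \<oplus>\<^bsub>L\<^esub> y) = f x \<oplus>\<^bsub>M\<^esub> f y" if "x \<in> carrier L" "y \<in> carrier L" for x y
    using assms(3) that by (auto simp: linear_maps_iff)
  show ?thesis
    using assms(4) by (induct A rule: infinite_finite_induct)
      (auto simp: linear_map_zero[OF assms(1-3)] f f2 Pi_def)
qed

lemma lie_hom_linear: "f \<in> lie_hom L M \<Longrightarrow> f \<in> linear_maps L M"
  by (simp add: lie_hom_def)

lemma lie_hom_comp: "\<lbrakk>f \<in> lie_hom L M; g \<in> lie_hom M N\<rbrakk> \<Longrightarrow> (\<lambda>x. g (f x)) \<in> lie_hom L N"
  by (rule lie_homI) (auto simp: lie_homD)

lemma lie_hom_eq_on_generated:
  assumes "lie_algebra L" "lie_algebra M" "f \<in> lie_hom L M" "g \<in> lie_hom L M"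
    and "X \<subseteq> carrier L" "lie_generated L X = carrier L" "\<And>x. x \<in> X \<Longrightarrow> f x = g x" "x \<in> carrier L"
  shows "f x = g x"
proof -
  interpret L: lie_algebra L by fact
  interpret M: lie_algebra M by fact
  have "x \<in> lie_generated L X" using assms by simp
  then show ?thesis
    using assms(5)
    by (induct rule: L.lie_generated_induct)
      (simp_all add: assms(7) lie_homD[OF assms(3)] lie_homD[OF assms(4)]
        linear_map_zero[OF L.complex_space_axioms M.complex_space_axioms lie_hom_linear] assms(3,4))
qed

lemma lie_hom_vimage_subalgebra:
  assumes "lie_algebra L" "lie_algebra M" "f \<in> lie_hom L M" "lie_subalgebra M S"
  shows "lie_subalgebra L {x \<in> carrier L. f x \<in> S}"
proof -
  interpret L: lie_algebra L by fact
  interpret M: lie_algebra M by fact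
  have S: "M.subspace S" "\<And>x y. \<lbrakk>x \<in> S; y \<in> S\<rbrakk> \<Longrightarrow> x \<otimes>\<^bsub>M\<^esub> y \<in> S"
    using assms(4) by (auto simp: lie_subalgebra_def)
  show ?thesis
    by (intro L.lie_subalgebraI L.subspaceI)
      (auto simp: lie_homD[OF assms(3)] S(2) M.subspaceD[OF S(1)]
        linear_map_zero[OF L.complex_space_axioms M.complex_space_axioms lie_hom_linear[OF assms(3)]])
qed

lemma lie_isomorphic_refl: "L \<simeq>\<^sub>L L"
proof -
  have "(\<lambda>x. x) \<in> lie_iso L L" by (auto simp: lie_iso_def lie_hom_def linear_maps_iff bij_betw_def)
  then show ?thesis by (auto simp: lie_isomorphic_def)
qed

lemma (in lie_gradation) component_disjoint:
  assumes "x \<in> V i" "x \<in> V j" "i \<noteq> j"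
  shows "x = \<zero>"
proof -
  let ?v = "\<lambda>k. if k = i then x else \<ominus> x"
  have x: "x \<in> carrier L" using VD(1) assms by blast
  have "(\<Oplus>k\<in>{i, j}. ?v k) = x \<oplus> \<ominus> x"
    using assms(3) x by (subst finsum_insert) auto
  then have 0: "(\<Oplus>k\<in>{i, j}. ?v k) = \<zero>" using x r_neg by simp
  have "?v i = \<zero>"
    by (rule V_independent[OF _ _ 0]) (use assms subspace_uminus[OF V_subspace] in auto)
  then show ?thesis by simp
qed

lemma local_iso_inverse:
  assumes "graded_lie_algebra L V" "graded_lie_algebra L' V'" "local_iso L V L' V' \<psi>"
  obtains \<phi> where "local_iso L' V' L V \<phi>" "\<And>i x. \<lbrakk>i \<in> {-1, 0, 1}; x \<in> V i\<rbrakk> \<Longrightarrow> \<phi> (\<psi> x) = x"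
    "\<And>i y. \<lbrakk>i \<in> {-1, 0, 1}; y \<in> V' i\<rbrakk> \<Longrightarrow> \<psi> (\<phi> y) = y"
proof -
  interpret L: graded_lie_algebra L V by fact
  interpret L': graded_lie_algebra L' V' by fact
  note D = local_isoD[OF assms(3)]
  \<comment> \<open>A single function has to invert \<psi> on three components. They meet only in
    zero, where the three inverses agree (\<open>iz\<close>), so the order of the cases is
    immaterial.\<close>
  define \<phi> where "\<phi> y = (if y \<in> V' 0 then inv_into (V 0) \<psi> y else if y \<in> V' 1
    then inv_into (V 1) \<psi> y else inv_into (V (-1)) \<psi> y)" for y
  have z: "\<psi> \<zero>\<^bsub>L\<^esub> = \<zero>\<^bsub>L'\<^esub>"
    using D(5)[of 0 "\<zero>\<^bsub>L\<^esub>" 0] D(1)[of 0 "\<zero>\<^bsub>L\<^esub>"] L.VD(2)[of 0] L'.VD(1)[of _ 0] by simp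
  have iz: "inv_into (V i) \<psi> \<zero>\<^bsub>L'\<^esub> = \<zero>\<^bsub>L\<^esub>" if "i \<in> {-1, 0, 1}" for i
    using inv_into_f_f[OF D(3)[OF that] L.VD(2)] z by simp
  have \<phi>: "\<phi> y = inv_into (V i) \<psi> y" if i: "i \<in> {-1, 0, 1}" and y: "y \<in> V' i" for i y
  proof (cases "y = \<zero>\<^bsub>L'\<^esub>")
    case True
    then show ?thesis using iz[OF i] iz[of 0] iz[of 1] iz[of "-1"] by (simp add: \<phi>_def)
  next
    case False
    have "\<not> y \<in> V' j" if "j \<noteq> i" for j using L'.component_disjoint[OF _ y that] False by auto
    then show ?thesis using i y by (auto simp: \<phi>_def)
  qed
  have m: "\<phi> y \<in> V i" "\<psi> (\<phi> y) = y" if i: "i \<in> {-1, 0, 1}" and y: "y \<in> V' i" for i y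
    using \<phi>[OF i y] y D(2)[OF i] by (auto simp: inv_into_into f_inv_into_f)
  have m': "\<phi> (\<psi> x) = x" if i: "i \<in> {-1, 0, 1}" and x: "x \<in> V i" for i x
    using \<phi>[OF i D(1)[OF i x]] inv_into_f_f[OF D(3)[OF i] x] by simp
  have bij: "bij_betw \<phi> (V' i) (V i)" if i: "i \<in> {-1, 0, 1}" for i
    by (rule bij_betw_byWitness[where f' = \<psi>]) (use m[OF i] m'[OF i] D(1)[OF i] in auto)
  have "local_iso L' V' L V \<phi>"
    unfolding local_iso_def
  proof (intro conjI ballI impI)
    fix i :: int assume i: "i \<in> {-1, 0, 1}"
    show "bij_betw \<phi> (V' i) (V i)" by (rule bij[OF i])
    have "\<phi> (x \<oplus>\<^bsub>L'\<^esub> y) = \<phi> x \<oplus>\<^bsub>L\<^esub> \<phi> y" if "x \<in> V' i" "y \<in> V' i" for x y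
      using m'[OF i, of "\<phi> x \<oplus>\<^bsub>L\<^esub> \<phi> y"] D(4)[OF i, of "\<phi> x" "\<phi> y"] m[OF i] that L.VD(3) by auto
    moreover have "\<phi> (c \<odot>\<^bsub>L'\<^esub> x) = c \<odot>\<^bsub>L\<^esub> \<phi> x" if "x \<in> V' i" for x c
      using m'[OF i, of "c \<odot>\<^bsub>L\<^esub> \<phi> x"] D(5)[OF i, of "\<phi> x" c] m[OF i] that L.VD(4) by auto
    ultimately show "\<phi> \<in> linear_maps (L'\<lparr>carrier := V' i\<rparr>) (L\<lparr>carrier := V i\<rparr>)"
      using m[OF i] by (auto simp: linear_maps_iff)
  next
    fix i j :: int and x y
    assume ij: "i \<in> {-1, 0, 1}" "j \<in> {-1, 0, 1}" "i + j \<in> {-1, 0, 1}" "x \<in> V' i" "y \<in> V' j"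
    show "\<phi> (x \<otimes>\<^bsub>L'\<^esub> y) = \<phi> x \<otimes>\<^bsub>L\<^esub> \<phi> y"
      using m'[OF ij(3), of "\<phi> x \<otimes>\<^bsub>L\<^esub> \<phi> y"] D(6)[OF ij(1-3), of "\<phi> x" "\<phi> y"]
        m[OF ij(1,4)] m[OF ij(2,5)] L.V_bracket by auto
  qed
  then show ?thesis using m m' that by blast
qed

text \<open>Minimality of \<open>L'\<close> extends \<psi> and minimality of \<open>L\<close>
  extends its inverse; their composite fixes the generators, so the first extension is injective.
  Both algebras live on one type, since \<open>minimal_graded_lie_algebra\<close> speaks of
  competitors on the type of the algebra.\<close>

lemma minimal_graded_unique:
  fixes L L' :: "(complex, 'a) module"
  assumes "minimal_graded_lie_algebra L V" "minimal_graded_lie_algebra L' V'"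
    and "local_iso L V L' V' \<psi>"
  shows "L \<simeq>\<^sub>L L'"
proof -
  have g: "graded_lie_algebra L V" "graded_lie_algebra L' V'"
    using assms(1,2) by (auto simp: minimal_graded_lie_algebra_def)
  interpret L: graded_lie_algebra L V by fact
  interpret L': graded_lie_algebra L' V' by fact
  obtain \<phi> where \<phi>: "local_iso L' V' L V \<phi>" "\<And>i x. \<lbrakk>i \<in> {-1, 0, 1}; x \<in> V i\<rbrakk> \<Longrightarrow> \<phi> (\<psi> x) = x"
    "\<And>i y. \<lbrakk>i \<in> {-1, 0, 1}; y \<in> V' i\<rbrakk> \<Longrightarrow> \<psi> (\<phi> y) = y"
    by (rule local_iso_inverse[OF g assms(3)]) (rule that)
  obtain f where f: "f \<in> lie_hom L L'" "f ` carrier L = carrier L'"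
    "\<forall>i\<in>{-1, 0, 1}. \<forall>x\<in>V i. f x = \<psi> x"
    using assms(2,3) g(1) unfolding minimal_graded_lie_algebra_def by blast
  obtain h where h: "h \<in> lie_hom L' L" "\<forall>i\<in>{-1, 0, 1}. \<forall>x\<in>V' i. h x = \<phi> x"
    using assms(1) \<phi>(1) g(2) unfolding minimal_graded_lie_algebra_def by blast
  have "h (f x) = x" if x: "x \<in> carrier L" for x
  proof (rule lie_hom_eq_on_generated[OF L.lie_algebra_axioms L.lie_algebra_axioms
        lie_hom_comp[OF f(1) h(1)] _ _ L.generated_by_local_part _ x])
    show "(\<lambda>x. x) \<in> lie_hom L L" by (auto simp: lie_hom_def linear_maps_iff)
    show "V (-1) \<union> V 0 \<union> V 1 \<subseteq> carrier L" using L.VD(1) by blast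
    have "h (f y) = y" if "i \<in> {-1, 0, 1}" "y \<in> V i" for i y
      using f(3) h(2) \<phi>(2)[OF that] local_isoD(1)[OF assms(3) that] that by metis
    then show "h (f y) = y" if "y \<in> V (-1) \<union> V 0 \<union> V 1" for y
      using that by auto
  qed
  then have "inj_on f (carrier L)" by (metis inj_onI)
  then have "f \<in> lie_iso L L'" using f by (simp add: lie_iso_def bij_betw_def)
  then show ?thesis by (auto simp: lie_isomorphic_def)
qed

text \<open>Identities pass to the image of a surjective map that respects the operations; in this
  way a quotient inherits all axioms from its projection.\<close>

lemma lie_algebra_image:
  assumes "lie_algebra L" "\<pi> ` carrier L = carrier Q" "\<pi> \<zero>\<^bsub>L\<^esub> = \<zero>\<^bsub>Q\<^esub>" "\<pi> \<in> lie_hom L Q"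
  shows "lie_algebra Q"
proof -
  interpret L: lie_algebra L by fact
  have ex: "\<exists>x\<in>carrier L. y = \<pi> x" if "y \<in> carrier Q" for y using assms(2) that by auto
  note pc = lie_homD(1)[OF assms(4)] and p = assms(3)[symmetric]
    lie_homD(2)[OF assms(4), symmetric] lie_homD(3)[OF assms(4), symmetric]
    lie_homD(4)[OF assms(4), symmetric]
  note ps = pc p L.a_assoc L.smult_m1 L.r_neg L.smult_smult
  show ?thesis
  proof (rule lie_algebraI)
    show "complex_space Q"
    proof (rule complex_spaceI)
      show "\<zero>\<^bsub>Q\<^esub> \<in> carrier Q" using pc[of "\<zero>\<^bsub>L\<^esub>"] assms(3) by simp
      show "x \<oplus>\<^bsub>Q\<^esub> y = y \<oplus>\<^bsub>Q\<^esub> x" if "x \<in> carrier Q" "y \<in> carrier Q" for x y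
        using ex[OF that(1)] ex[OF that(2)] by (auto simp: p L.a_comm)
    qed (auto dest!: ex simp: ps L.smult_add_left L.smult_add_right)
  qed (auto dest!: ex simp: ps L.bracket_add_left L.bracket_add_right L.bracket_smult_left
      L.bracket_smult_right L.bracket_alternating L.jacobi)
qed

context lie_algebra
begin

lemma lie_idealD:
  assumes "lie_ideal L J"
  shows "subspace J" "\<lbrakk>x \<in> carrier L; y \<in> J\<rbrakk> \<Longrightarrow> x \<otimes> y \<in> J" "\<lbrakk>x \<in> carrier L; y \<in> J\<rbrakk> \<Longrightarrow> y \<otimes> x \<in> J"
proof -
  show J: "subspace J" and r: "\<lbrakk>x \<in> carrier L; y \<in> J\<rbrakk> \<Longrightarrow> x \<otimes> y \<in> J"
    using assms by (auto simp: lie_ideal_def)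
  then show "\<lbrakk>x \<in> carrier L; y \<in> J\<rbrakk> \<Longrightarrow> y \<otimes> x \<in> J"
    using bracket_swap_in[OF J] subspaceD(1)[OF J] by blast
qed

lemma coset_mem_iff:
  assumes "subspace J" "x \<in> carrier L"
  shows "y \<in> J +> x \<longleftrightarrow> y \<in> carrier L \<and> y \<ominus> x \<in> J"
proof
  assume "y \<in> J +> x"
  then obtain j where j: "j \<in> J" "y = j \<oplus> x" by (auto simp: a_r_coset_def' )
  moreover have "j \<in> carrier L" using j subspaceD(1)[OF assms(1)] by blast
  ultimately show "y \<in> carrier L \<and> y \<ominus> x \<in> J"
    using assms(2) by (simp add: a_minus_def a_assoc r_neg)
next
  assume y: "y \<in> carrier L \<and> y \<ominus> x \<in> J"
  then have "y = (y \<ominus> x) \<oplus> x" using assms(2) by (simp add: a_minus_def a_assoc l_neg)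
  then show "y \<in> J +> x" using y by (auto simp: a_r_coset_def')
qed

lemma coset_eq_iff:
  assumes J: "subspace J" and "x \<in> carrier L" "y \<in> carrier L"
  shows "J +> x = J +> y \<longleftrightarrow> x \<ominus> y \<in> J"
proof
  assume "J +> x = J +> y"
  moreover have "x \<in> J +> x" using assms by (simp add: coset_mem_iff a_minus_def r_neg subspaceD)
  ultimately show "x \<ominus> y \<in> J" using assms by (simp add: coset_mem_iff)
next
  assume d: "x \<ominus> y \<in> J"
  have d': "y \<ominus> x \<in> J"
    using subspace_uminus[OF J d] assms by (simp add: a_minus_def minus_add a_comm)
  have "z \<ominus> y = (z \<ominus> x) \<oplus> (x \<ominus> y)" "z \<ominus> x = (z \<ominus> y) \<oplus> (y \<ominus> x)" if "z \<in> carrier L" for z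
    using that assms by (simp_all add: a_minus_def a_assoc r_neg1)
  then have "z \<ominus> x \<in> J \<longleftrightarrow> z \<ominus> y \<in> J" if "z \<in> carrier L" for z
    using d d' subspaceD(3)[OF J] that by metis
  then show "J +> x = J +> y"
    using assms by (auto simp: coset_mem_iff)
qed

lemma coset_self: "\<lbrakk>subspace J; x \<in> carrier L\<rbrakk> \<Longrightarrow> x \<in> J +> x"
  by (simp add: coset_mem_iff a_minus_def r_neg subspaceD)

context
  fixes J
  assumes J: "lie_ideal L J"
begin

interpretation abelian_subgroup J L
proof -
  have "subgroup J (add_monoid L)"
    using subspaceD[OF lie_idealD(1)[OF J]] subspace_uminus[OF lie_idealD(1)[OF J]]
    by (unfold_locales) (auto simp: a_inv_def[symmetric])
  then show "abelian_subgroup J L"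
    by (intro abelian_subgroupI3 additive_subgroup.intro abelian_group_axioms)
qed

lemma quotient_carrier: "carrier (lie_quotient L J) = (\<lambda>x. J +> x) ` carrier L"
  by (auto simp: lie_quotient_def A_RCOSETS_def')

lemma quotient_zero: "\<zero>\<^bsub>lie_quotient L J\<^esub> = J +> \<zero>"
proof -
  have "J +> \<zero> = J" using subspaceD[OF lie_idealD(1)[OF J]]
    by (auto simp: coset_mem_iff[OF lie_idealD(1)[OF J]] a_minus_def)
  then show ?thesis by (simp add: lie_quotient_def)
qed

lemma quotient_hom: "(\<lambda>x. J +> x) \<in> lie_hom L (lie_quotient L J)"
proof (rule lie_homI)
  note Js = lie_idealD(1)[OF J]
  fix x assume x: "x \<in> carrier L"
  then show "J +> x \<in> carrier (lie_quotient L J)" by (simp add: quotient_carrier)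
  fix c
  \<comment> \<open>The scalar multiple is a union over representatives; as the resulting coset does
    not depend on the representative, the union collapses.\<close>
  have e: "J +> c \<odot> y = J +> c \<odot> x" if "y \<in> J +> x" for y
  proof -
    have y: "y \<in> carrier L" "y \<ominus> x \<in> J" using that x by (auto simp: coset_mem_iff Js)
    have "c \<odot> y \<ominus> c \<odot> x = c \<odot> (y \<ominus> x)"
      using x y by (simp add: a_minus_def smult_add_right smult_smult smult_m1[symmetric])
    then show ?thesis using x y subspaceD(4)[OF Js y(2)] by (simp add: coset_eq_iff Js)
  qed
  have "(\<Union>y\<in>J +> x. J +> c \<odot> y) = (\<Union>y\<in>J +> x. J +> c \<odot> x)" by (rule SUP_cong[OF HOL.refl e])
  also have "\<dots> = J +> c \<odot> x" using coset_self[OF Js x] by auto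
  finally show "J +> c \<odot> x = c \<odot>\<^bsub>lie_quotient L J\<^esub> (J +> x)"
    by (simp add: lie_quotient_def)
next
  note Js = lie_idealD(1)[OF J]
  fix x y assume x: "x \<in> carrier L" and y: "y \<in> carrier L"
  show "J +> x \<oplus> y = (J +> x) \<oplus>\<^bsub>lie_quotient L J\<^esub> (J +> y)"
    using x y by (simp add: lie_quotient_def a_rcos_sum)
  have e: "J +> a \<otimes> b = J +> x \<otimes> y" if "a \<in> J +> x" "b \<in> J +> y" for a b
  proof -
    have ab: "a \<in> carrier L" "a \<ominus> x \<in> J" "b \<in> carrier L" "b \<ominus> y \<in> J"
      using that x y by (auto simp: coset_mem_iff Js)
    have "a \<otimes> b \<ominus> x \<otimes> y = (a \<ominus> x) \<otimes> b \<oplus> x \<otimes> (b \<ominus> y)"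
      using x y ab by (simp add: a_minus_def bracket_add_left bracket_add_right bracket_uminus_left
          bracket_uminus_right a_assoc r_neg2 r_neg1)
    then show ?thesis
      using x y ab subspaceD(3)[OF Js] lie_idealD(2,3)[OF J] by (simp add: coset_eq_iff Js)
  qed
  have "(\<Union>a\<in>J +> x. \<Union>b\<in>J +> y. J +> a \<otimes> b) = (\<Union>a\<in>J +> x. \<Union>b\<in>J +> y. J +> x \<otimes> y)"
    by (intro SUP_cong HOL.refl e)
  also have "\<dots> = J +> x \<otimes> y" using coset_self[OF Js x] coset_self[OF Js y] by auto
  finally show "J +> x \<otimes> y = (J +> x) \<otimes>\<^bsub>lie_quotient L J\<^esub> (J +> y)"
    by (simp add: lie_quotient_def rcoset_mult_def)
qed

lemma quotient_lie_algebra: "lie_algebra (lie_quotient L J)"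
  by (rule lie_algebra_image[OF lie_algebra_axioms _ _ quotient_hom])
    (auto simp: quotient_carrier quotient_zero)

lemma quotient_eq_zero_iff: "x \<in> carrier L \<Longrightarrow> J +> x = \<zero>\<^bsub>lie_quotient L J\<^esub> \<longleftrightarrow> x \<in> J"
  using smult_m1[of \<zero>] by (simp add: quotient_zero coset_eq_iff lie_idealD(1)[OF J] a_minus_def)

end

lemma center_ideal: "lie_ideal L (lie_center L)"
  unfolding lie_ideal_def
proof (intro conjI ballI)
  show "subspace (lie_center L)"
    by (rule subspaceI) (auto simp: lie_center_def bracket_add_left bracket_smult_left)
  fix x z assume x: "x \<in> carrier L" and z: "z \<in> lie_center L"
  have zz: "z \<in> carrier L" "\<And>y. y \<in> carrier L \<Longrightarrow> z \<otimes> y = \<zero>" using z by (auto simp: lie_center_def)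
  have "x \<otimes> z = \<zero>" using bracket_anticommute[OF x zz(1)] zz(2)[OF x] by simp
  then show "x \<otimes> z \<in> lie_center L" by (auto simp: lie_center_def)
qed

end

lemma lie_iso_quotient:
  assumes "lie_algebra L" "lie_algebra M" "f \<in> lie_iso L M" "lie_ideal L J" "lie_ideal M (f ` J)"
  shows "lie_quotient L J \<simeq>\<^sub>L lie_quotient M (f ` J)"
proof -
  interpret L: lie_algebra L by fact
  interpret M: lie_algebra M by fact
  have f: "f \<in> lie_hom L M" "inj_on f (carrier L)" "f ` carrier L = carrier M"
    using assms(3) by (auto simp: lie_iso_def bij_betw_def)
  note fD = lie_homD[OF f(1)]
  have Jc: "J \<subseteq> carrier L" using L.subspaceD(5)[OF L.lie_idealD(1)[OF assms(4)]] .
  have im: "f ` (J +>\<^bsub>L\<^esub> x) = (f ` J) +>\<^bsub>M\<^esub> f x" if "x \<in> carrier L" for x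
  proof -
    have "f ` (J +>\<^bsub>L\<^esub> x) = (\<Union>j\<in>J. {f (j \<oplus>\<^bsub>L\<^esub> x)})" by (auto simp: a_r_coset_def')
    also have "\<dots> = (\<Union>j\<in>J. {f j \<oplus>\<^bsub>M\<^esub> f x})"
      using Jc that fD(2) by (intro SUP_cong) auto
    also have "\<dots> = (f ` J) +>\<^bsub>M\<^esub> f x" by (auto simp: a_r_coset_def')
    finally show ?thesis .
  qed
  note qL = L.quotient_hom[OF assms(4)] and qM = M.quotient_hom[OF assms(5)]
  have "image f \<in> lie_hom (lie_quotient L J) (lie_quotient M (f ` J))"
    by (rule lie_homI;
      clarsimp simp only: L.quotient_carrier[OF assms(4)] M.quotient_carrier[OF assms(5)];
      simp add: im fD lie_homD(2-4)[OF qL, symmetric] lie_homD(2-4)[OF qM, symmetric])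
  moreover have "inj_on (image f) (carrier (lie_quotient L J))"
  proof (rule inj_on_subset[OF inj_on_image_Pow[OF f(2)]])
    show "carrier (lie_quotient L J) \<subseteq> Pow (carrier L)"
      by (auto simp: L.quotient_carrier[OF assms(4)] L.coset_mem_iff[OF L.lie_idealD(1)[OF assms(4)]])
  qed
  moreover have "image f ` carrier (lie_quotient L J) = carrier (lie_quotient M (f ` J))"
    unfolding L.quotient_carrier[OF assms(4)] M.quotient_carrier[OF assms(5)] f(3)[symmetric]
    by (auto simp: image_image im)
  ultimately have "image f \<in> lie_iso (lie_quotient L J) (lie_quotient M (f ` J))"
    by (simp add: lie_iso_def bij_betw_def)
  then show ?thesis by (auto simp: lie_isomorphic_def)
qed

lemma lie_iso_center:
  assumes "lie_algebra L" "lie_algebra M" "f \<in> lie_iso L M"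
  shows "f ` lie_center L = lie_center M"
proof -
  interpret L: lie_algebra L by fact
  interpret M: lie_algebra M by fact
  have f: "f \<in> lie_hom L M" "inj_on f (carrier L)" "f ` carrier L = carrier M"
    using assms(3) by (auto simp: lie_iso_def bij_betw_def)
  note fD = lie_homD[OF f(1)]
  have f0: "f \<zero>\<^bsub>L\<^esub> = \<zero>\<^bsub>M\<^esub>"
    by (rule linear_map_zero[OF L.complex_space_axioms M.complex_space_axioms lie_hom_linear[OF f(1)]])
  have cc: "z \<in> lie_center L \<longleftrightarrow> f z \<in> lie_center M" if z: "z \<in> carrier L" for z
  proof -
    have "f z \<in> lie_center M \<longleftrightarrow> (\<forall>x\<in>carrier L. f (z \<otimes>\<^bsub>L\<^esub> x) = f \<zero>\<^bsub>L\<^esub>)"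
      using z by (auto simp: lie_center_def f(3)[symmetric] fD f0)
    also have "\<dots> \<longleftrightarrow> z \<in> lie_center L"
      using z inj_on_eq_iff[OF f(2)] by (auto simp: lie_center_def)
    finally show ?thesis by simp
  qed
  show ?thesis
  proof
    show "f ` lie_center L \<subseteq> lie_center M" using cc by (auto simp: lie_center_def[of L])
    show "lie_center M \<subseteq> f ` lie_center L"
    proof
      fix y assume y: "y \<in> lie_center M"
      then have "y \<in> f ` carrier L" using f(3) by (simp add: lie_center_def)
      then show "y \<in> f ` lie_center L" using cc y by blast
    qed
  qed
qed

lemma quotient_by_zero:
  assumes "lie_algebra L"
  shows "L \<simeq>\<^sub>L lie_quotient L {\<zero>\<^bsub>L\<^esub>}"
proof -
  interpret L: lie_algebra L by fact
  have J: "lie_ideal L {\<zero>\<^bsub>L\<^esub>}" by (auto simp: lie_ideal_def L.subspace_zero)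
  have "(\<lambda>x. {\<zero>\<^bsub>L\<^esub>} +>\<^bsub>L\<^esub> x) \<in> lie_iso L (lie_quotient L {\<zero>\<^bsub>L\<^esub>})"
    using L.quotient_hom[OF J]
    by (auto simp: lie_iso_def bij_betw_def L.quotient_carrier[OF J] inj_on_def
        L.coset_eq_iff[OF L.subspace_zero])
  then show ?thesis by (auto simp: lie_isomorphic_def)
qed

text \<open>\<open>hom\<close> says that \<open>J\<close> is homogeneous; this is what keeps the
  images of the components independent.\<close>

lemma (in graded_lie_algebra) quotient_graded:
  assumes J: "lie_ideal L J"
    and hom: "\<And>F v i. \<lbrakk>finite F; \<And>i. v i \<in> V i; (\<Oplus>i\<in>F. v i) \<in> J; i \<in> F\<rbrakk> \<Longrightarrow> v i \<in> J"
  shows "graded_lie_algebra (lie_quotient L J) (\<lambda>k. (\<lambda>x. J +> x) ` V k)"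
proof -
  let ?Q = "lie_quotient L J" and ?\<pi> = "\<lambda>x. J +> x"
  interpret Q: lie_algebra ?Q by (rule quotient_lie_algebra[OF J])
  note qh = quotient_hom[OF J]
  note qD = lie_homD[OF qh] and q0 = quotient_zero[OF J] and qc = quotient_carrier[OF J]
  note qsum = linear_map_finsum[OF complex_space_axioms Q.complex_space_axioms lie_hom_linear[OF qh]]
  show ?thesis
  proof (intro graded_lie_algebra.intro graded_lie_algebra_axioms.intro Q.lie_algebra_axioms)
    fix i
    show "Q.subspace (?\<pi> ` V i)"
    proof (rule Q.subspaceI)
      show "?\<pi> ` V i \<subseteq> carrier ?Q" using qD(1) VD(1) by auto
      show "\<zero>\<^bsub>?Q\<^esub> \<in> ?\<pi> ` V i" using VD(2) q0 by auto
    qed (use VD in \<open>auto simp: qD(2,3)[symmetric]\<close>)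
  next
    fix X assume "X \<in> carrier ?Q"
    then obtain x where x: "x \<in> carrier L" "X = J +> x" by (auto simp: qc)
    from components_span[OF x(1)] obtain F v where
      F: "finite F" "\<forall>i\<in>F. v i \<in> V i" "x = (\<Oplus>i\<in>F. v i)" by blast
    have "v \<in> F \<rightarrow> carrier L" using F(2) VD(1) by blast
    then have "X = (\<Oplus>\<^bsub>?Q\<^esub>i\<in>F. ?\<pi> (v i))" unfolding x(2) F(3) by (rule qsum)
    then show "\<exists>F v. finite F \<and> (\<forall>i\<in>F. v i \<in> ?\<pi> ` V i) \<and> X = (\<Oplus>\<^bsub>?Q\<^esub>i\<in>F. v i)"
      using F by (intro exI[of _ F] exI[of _ "\<lambda>i. ?\<pi> (v i)"]) auto
  next
    fix F X and i :: int
    assume F: "finite F" "\<And>i. i \<in> F \<Longrightarrow> X i \<in> ?\<pi> ` V i" "(\<Oplus>\<^bsub>?Q\<^esub>i\<in>F. X i) = \<zero>\<^bsub>?Q\<^esub>" "i \<in> F"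
    \<comment> \<open>Representatives are chosen in the right components, and zero elsewhere, since
      \<open>hom\<close> asks for a family that is homogeneous at every index.\<close>
    define v where "v i = (if i \<in> F then SOME x. x \<in> V i \<and> X i = J +> x else \<zero>)" for i
    have v: "v i \<in> V i" "X i = J +> v i" if "i \<in> F" for i
      using someI_ex[of "\<lambda>x. x \<in> V i \<and> X i = J +> x"] F(2)[OF that] that by (auto simp: v_def)
    have v': "v i \<in> V i" for i using v(1)[of i] VD(2) by (cases "i \<in> F") (auto simp: v_def)
    have vc: "v i \<in> carrier L" for i using v' VD(1) by blast
    have "?\<pi> (\<Oplus>i\<in>F. v i) = (\<Oplus>\<^bsub>?Q\<^esub>i\<in>F. ?\<pi> (v i))" using vc by (intro qsum) auto
    also have "\<dots> = (\<Oplus>\<^bsub>?Q\<^esub>i\<in>F. X i)"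
      using v qD(1) vc by (intro Q.finsum_cong') auto
    finally have "(\<Oplus>i\<in>F. v i) \<in> J"
      using F(3) vc by (subst quotient_eq_zero_iff[OF J, symmetric]) auto
    from hom[OF F(1) v' this F(4)] have "v i \<in> J" .
    then show "X i = \<zero>\<^bsub>?Q\<^esub>" using v(2)[OF F(4)] quotient_eq_zero_iff[OF J vc] by simp
  next
    fix X Y and i j :: int
    assume "X \<in> ?\<pi> ` V i" "Y \<in> ?\<pi> ` V j"
    then show "X \<otimes>\<^bsub>?Q\<^esub> Y \<in> ?\<pi> ` V (i + j)"
      using V_bracket VD(1) by (auto simp: qD(4)[symmetric])
  next
    let ?Y = "?\<pi> ` V (- 1) \<union> ?\<pi> ` V 0 \<union> ?\<pi> ` V 1"
    have Yc: "?Y \<subseteq> carrier ?Q" using VD(1) qD(1) by auto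
    have "lie_subalgebra L {x \<in> carrier L. ?\<pi> x \<in> lie_generated ?Q ?Y}"
      by (rule lie_hom_vimage_subalgebra[OF lie_algebra_axioms Q.lie_algebra_axioms qh
            Q.lie_generated_subalgebra[OF Yc]])
    moreover have "V (- 1) \<union> V 0 \<union> V 1 \<subseteq> {x \<in> carrier L. ?\<pi> x \<in> lie_generated ?Q ?Y}"
      using Q.lie_generated_superset[of ?Y] VD(1) by auto
    ultimately have "lie_generated L (V (- 1) \<union> V 0 \<union> V 1)
        \<subseteq> {x \<in> carrier L. ?\<pi> x \<in> lie_generated ?Q ?Y}"
      by (rule lie_generated_minimal)
    then have "?\<pi> x \<in> lie_generated ?Q ?Y" if "x \<in> carrier L" for x
      using generated_by_local_part that by auto
    then show "lie_generated ?Q ?Y = carrier ?Q"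
      using Q.lie_generated_subset_carrier[OF Yc] by (auto simp: qc)
  qed
qed

section \<open>Lie algebras given by generators and relations\<close>

context
  fixes X :: "'x set" and R :: "('x lie_term \<times> 'x lie_term) set"
begin

lemma lie_class_eq_iff: "lie_class X R s = lie_class X R t \<longleftrightarrow> lie_eq X R s t"
  unfolding lie_class_def set_eq_iff by (auto intro: lie_eq.intros)

lemma lie_class_self: "t \<in> lie_class X R t"
  by (simp add: lie_class_def lie_eq.refl)

lemma presented_simps:
  "carrier (presented_lie_algebra X R) = range (lie_class X R)"
  "\<zero>\<^bsub>presented_lie_algebra X R\<^esub> = lie_class X R Zero"
  "lie_class X R s \<oplus>\<^bsub>presented_lie_algebra X R\<^esub> lie_class X R t = lie_class X R (Add s t)"
  "lie_class X R s \<otimes>\<^bsub>presented_lie_algebra X R\<^esub> lie_class X R t = lie_class X R (Bracket s t)"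
  "c \<odot>\<^bsub>presented_lie_algebra X R\<^esub> lie_class X R t = lie_class X R (Scale c t)"
proof -
  have m: "lie_eq X R t s" if "s \<in> lie_class X R t" for s t using that by (simp add: lie_class_def)
  have u2: "(\<Union>a\<in>lie_class X R s. \<Union>b\<in>lie_class X R t. lie_class X R (f a b)) = lie_class X R (f s t)"
    if "\<And>a b. \<lbrakk>lie_eq X R s a; lie_eq X R t b\<rbrakk> \<Longrightarrow> lie_eq X R (f s t) (f a b)" for f s t
  proof -
    have "(\<Union>a\<in>lie_class X R s. \<Union>b\<in>lie_class X R t. lie_class X R (f a b))
        = (\<Union>a\<in>lie_class X R s. \<Union>b\<in>lie_class X R t. lie_class X R (f s t))"
      by (intro SUP_cong HOL.refl) (simp add: lie_class_eq_iff lie_eq.sym m that)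
    then show ?thesis using lie_class_self[of s] lie_class_self[of t] by auto
  qed
  have u1: "(\<Union>a\<in>lie_class X R s. lie_class X R (f a)) = lie_class X R (f s)"
    if "\<And>a. lie_eq X R s a \<Longrightarrow> lie_eq X R (f s) (f a)" for f s
  proof -
    have "(\<Union>a\<in>lie_class X R s. lie_class X R (f a)) = (\<Union>a\<in>lie_class X R s. lie_class X R (f s))"
      by (intro SUP_cong HOL.refl) (simp add: lie_class_eq_iff lie_eq.sym m that)
    then show ?thesis using lie_class_self[of s] by auto
  qed
  show "carrier (presented_lie_algebra X R) = range (lie_class X R)"
    "\<zero>\<^bsub>presented_lie_algebra X R\<^esub> = lie_class X R Zero"
    by (simp_all add: presented_lie_algebra_def)
  show "lie_class X R s \<oplus>\<^bsub>presented_lie_algebra X R\<^esub> lie_class X R t = lie_class X R (Add s t)"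
    using u2[of s t Add] by (simp add: presented_lie_algebra_def lie_eq.Add_cong)
  show "lie_class X R s \<otimes>\<^bsub>presented_lie_algebra X R\<^esub> lie_class X R t = lie_class X R (Bracket s t)"
    using u2[of s t Bracket] by (simp add: presented_lie_algebra_def lie_eq.Bracket_cong)
  show "c \<odot>\<^bsub>presented_lie_algebra X R\<^esub> lie_class X R t = lie_class X R (Scale c t)"
    using u1[of t "Scale c"] by (simp add: presented_lie_algebra_def lie_eq.Scale_cong)
qed

lemma presented_lie_algebra: "lie_algebra (presented_lie_algebra X R)"
proof (rule lie_algebraI)
  show "complex_space (presented_lie_algebra X R)"
  proof (rule complex_spaceI)
    fix x c d assume "x \<in> carrier (presented_lie_algebra X R)"
    then obtain t where "x = lie_class X R t" by (auto simp: presented_simps)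
    then show "(c + d) \<odot>\<^bsub>presented_lie_algebra X R\<^esub> x = c \<odot>\<^bsub>presented_lie_algebra X R\<^esub> x
        \<oplus>\<^bsub>presented_lie_algebra X R\<^esub> d \<odot>\<^bsub>presented_lie_algebra X R\<^esub> x"
      by (simp add: presented_simps lie_class_eq_iff lie_eq.Scale_plus)
  qed (unfold presented_simps(1), ((elim rangeE)?; simp only: presented_simps lie_class_eq_iff rangeI
      lie_eq.Add_assoc lie_eq.Add_commute lie_eq.Add_Zero lie_eq.Add_inverse lie_eq.Scale_Add
      lie_eq.Scale_Scale lie_eq.Scale_one)+)
qed (unfold presented_simps(1), ((elim rangeE)?; simp only: presented_simps lie_class_eq_iff rangeI
      lie_eq.Bracket_Add_left lie_eq.Bracket_Add_right lie_eq.Bracket_Scale_left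
      lie_eq.Bracket_Scale_right lie_eq.Bracket_self lie_eq.Jacobi)+)

lemma presented_generated:
  "lie_generated (presented_lie_algebra X R) ((\<lambda>x. lie_class X R (Gen x)) ` X)
    = carrier (presented_lie_algebra X R)" (is "?G = _")
proof -
  let ?Y = "(\<lambda>x. lie_class X R (Gen x)) ` X"
  interpret lie_algebra "presented_lie_algebra X R" by (rule presented_lie_algebra)
  have Y: "?Y \<subseteq> carrier (presented_lie_algebra X R)" by (auto simp: presented_simps)
  have s: "subspace ?G" and b: "\<And>x y. \<lbrakk>x \<in> ?G; y \<in> ?G\<rbrakk> \<Longrightarrow> x \<otimes>\<^bsub>presented_lie_algebra X R\<^esub> y \<in> ?G"
    using lie_generated_subalgebra[OF Y] by (auto simp: lie_subalgebra_def)
  have "lie_class X R t \<in> ?G" for t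
  proof (induct t)
    case (Gen x)
    show ?case
    proof (cases "x \<in> X")
      case True
      then show ?thesis using lie_generated_superset[of ?Y] by auto
    next
      case False
      then have "lie_class X R (Gen x) = \<zero>\<^bsub>presented_lie_algebra X R\<^esub>"
        by (simp add: presented_simps lie_class_eq_iff lie_eq.no_generator)
      then show ?thesis using subspaceD(2)[OF s] by simp
    qed
  next
    case Zero
    then show ?case using subspaceD(2)[OF s] by (simp add: presented_simps)
  next
    case (Add t1 t2)
    then show ?case using subspaceD(3)[OF s Add] by (simp add: presented_simps)
  next
    case (Scale c t)
    then show ?case using subspaceD(4)[OF s Scale] by (simp add: presented_simps)
  next
    case (Bracket t1 t2)
    then show ?case using b[OF Bracket] by (simp add: presented_simps)
  qed
  then show ?thesis using lie_generated_subset_carrier[OF Y] by (auto simp: presented_simps)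
qed

end

text \<open>Terms are interpreted as operators on a space of functions, with the commutator as
  bracket. Operators are plain functions; their linearity is the separate predicate
  \<open>linear_operator\<close>.\<close>

primrec lie_eval :: "('x \<Rightarrow> ('w \<Rightarrow> complex) \<Rightarrow> 'w \<Rightarrow> complex) \<Rightarrow> 'x lie_term \<Rightarrow>
    ('w \<Rightarrow> complex) \<Rightarrow> 'w \<Rightarrow> complex"
  where
    "lie_eval g (Gen x) = g x"
  | "lie_eval g Zero = (\<lambda>\<phi> w. 0)"
  | "lie_eval g (Add s t) = (\<lambda>\<phi> w. lie_eval g s \<phi> w + lie_eval g t \<phi> w)"
  | "lie_eval g (Scale c t) = (\<lambda>\<phi> w. c * lie_eval g t \<phi> w)"
  | "lie_eval g (Bracket s t) = (\<lambda>\<phi> w. lie_eval g s (lie_eval g t \<phi>) w - lie_eval g t (lie_eval g s \<phi>) w)"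

definition linear_operator :: "(('w \<Rightarrow> complex) \<Rightarrow> 'w \<Rightarrow> complex) \<Rightarrow> bool"
  where "linear_operator T \<longleftrightarrow> (\<forall>\<phi> \<phi>'. T (\<lambda>w. \<phi> w + \<phi>' w) = (\<lambda>w. T \<phi> w + T \<phi>' w)) \<and>
    (\<forall>c \<phi>. T (\<lambda>w. c * \<phi> w) = (\<lambda>w. c * T \<phi> w))"

lemma linear_operatorD:
  assumes "linear_operator T"
  shows "T (\<lambda>w. \<phi> w + \<phi>' w) = (\<lambda>w. T \<phi> w + T \<phi>' w)" "T (\<lambda>w. c * \<phi> w) = (\<lambda>w. c * T \<phi> w)"
    "T (\<lambda>w. \<phi> w - \<phi>' w) = (\<lambda>w. T \<phi> w - T \<phi>' w)" "T (\<lambda>w. 0) = (\<lambda>w. 0)"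
proof -
  show 1: "T (\<lambda>w. \<phi> w + \<phi>' w) = (\<lambda>w. T \<phi> w + T \<phi>' w)" "T (\<lambda>w. c * \<phi> w) = (\<lambda>w. c * T \<phi> w)"
    for \<phi> \<phi>' c using assms by (auto simp: linear_operator_def)
  show "T (\<lambda>w. \<phi> w - \<phi>' w) = (\<lambda>w. T \<phi> w - T \<phi>' w)"
    using 1(1)[of \<phi> "\<lambda>w. -1 * \<phi>' w"] 1(2)[of "-1" \<phi>'] by simp
  show "T (\<lambda>w. 0) = (\<lambda>w. 0)" using 1(2)[of 0] by simp
qed

lemma lie_eval_linear:
  assumes "\<And>x. linear_operator (g x)"
  shows "linear_operator (lie_eval g t)"
proof (induct t)
  case (Bracket s t)
  note D = linear_operatorD[OF Bracket(1)] linear_operatorD[OF Bracket(2)]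
  show ?case unfolding linear_operator_def by (auto simp: D algebra_simps fun_eq_iff)
next
  case (Add s t)
  note D = linear_operatorD[OF Add(1)] linear_operatorD[OF Add(2)]
  show ?case unfolding linear_operator_def by (auto simp: D algebra_simps fun_eq_iff)
next
  case (Scale c t)
  note D = linear_operatorD[OF Scale]
  show ?case unfolding linear_operator_def by (auto simp: D algebra_simps fun_eq_iff)
qed (use assms in \<open>auto simp: linear_operator_def\<close>)

text \<open>Soundness of the equational calculus. It is the means of telling two classes of a
  presented algebra apart: a model that separates them.\<close>

lemma lie_eval_cong:
  assumes g: "\<And>x. linear_operator (g x)"
    and X: "\<And>x. x \<notin> X \<Longrightarrow> g x = (\<lambda>\<phi> w. 0)"
    and R: "\<And>s t. (s, t) \<in> R \<Longrightarrow> lie_eval g s = lie_eval g t"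
  shows "lie_eq X R s t \<Longrightarrow> lie_eval g s = lie_eval g t"
proof (induct rule: lie_eq.induct)
  note D = linear_operatorD[OF lie_eval_linear[where g = g, OF g]]
  case (Jacobi s t u)
  show ?case by (auto simp: fun_eq_iff D)
next
  case (Bracket_cong s s' t t')
  then show ?case by simp
qed (auto simp: R X fun_eq_iff algebra_simps linear_operatorD[OF lie_eval_linear[where g = g, OF g]])


section \<open>The universal algebra of a Cartan datum\<close>

text \<open>On functions on words: \<open>f\<^sub>i\<close> prepends the letter \<open>i\<close> (in the basis dual to evaluation at
  words), and \<open>\<hh>\<close> acts on the word \<open>u\<close> by the weight \<open>\<lambda> - \<Sum>\<^sub>k \<alpha>\<^sub>u\<^sub>k\<close>. The recursion for \<open>e\<^sub>j\<close> is
  forced by \<open>[e\<^sub>j, f\<^sub>i] = \<delta>\<^sub>i\<^sub>j \<alpha>\<^sub>j\<^sup>\<or>\<close>.\<close>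

context
  fixes \<alpha> :: "nat \<Rightarrow> 'h \<Rightarrow> complex" and \<alpha>\<^sub>c :: "nat \<Rightarrow> 'h" and \<mu> :: "'h \<Rightarrow> complex"
begin

definition word_weight :: "nat list \<Rightarrow> 'h \<Rightarrow> complex"
  where "word_weight u h = \<mu> h - (\<Sum>i\<leftarrow>u. \<alpha> i h)"

definition word_f :: "nat \<Rightarrow> (nat list \<Rightarrow> complex) \<Rightarrow> nat list \<Rightarrow> complex"
  where "word_f i \<phi> u = (case u of [] \<Rightarrow> 0 | k # w \<Rightarrow> if k = i then \<phi> w else 0)"

definition word_h :: "'h \<Rightarrow> (nat list \<Rightarrow> complex) \<Rightarrow> nat list \<Rightarrow> complex"
  where "word_h h \<phi> u = word_weight u h * \<phi> u"

fun word_e :: "nat \<Rightarrow> (nat list \<Rightarrow> complex) \<Rightarrow> nat list \<Rightarrow> complex"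
  where
    "word_e j \<phi> [] = \<mu> (\<alpha>\<^sub>c j) * \<phi> [j]"
  | "word_e j \<phi> (k # u) = word_weight (k # u) (\<alpha>\<^sub>c j) * \<phi> (j # k # u) + word_e j (\<lambda>w. \<phi> (k # w)) u"

lemma word_e_linear: "word_e j (\<lambda>w. \<phi> w + \<phi>' w) u = word_e j \<phi> u + word_e j \<phi>' u"
  "word_e j (\<lambda>w. c * \<phi> w) u = c * word_e j \<phi> u" "word_e j (\<lambda>w. 0) u = 0"
  by (induct u arbitrary: \<phi> \<phi>') (auto simp: algebra_simps)

lemma word_e_f: "word_e j (word_f i \<phi>) u - word_f i (word_e j \<phi>) u = (if i = j then word_h (\<alpha>\<^sub>c j) \<phi> u else 0)"
proof (cases u)
  case Nil
  then show ?thesis by (auto simp: word_f_def word_h_def word_weight_def)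
next
  case (Cons k w)
  have "(\<lambda>w. word_f i \<phi> (k # w)) = (if k = i then \<phi> else (\<lambda>w. 0))"
    by (auto simp: word_f_def)
  then show ?thesis using Cons by (auto simp: word_f_def word_h_def word_e_linear)
qed

lemma word_h_e: "word_h h (word_e j \<phi>) u - word_e j (word_h h \<phi>) u = \<alpha> j h * word_e j \<phi> u"
proof (induct u arbitrary: \<phi>)
  case Nil
  then show ?case by (simp add: word_h_def word_weight_def algebra_simps)
next
  case (Cons k u)
  let ?\<phi> = "\<lambda>w. \<phi> (k # w)"
  \<comment> \<open>Prefixing the letter k lowers the weight by \<open>\<alpha> k\<close>; this is
    the correction term that the induction has to carry.\<close>
  have "(\<lambda>w. word_h h \<phi> (k # w)) = (\<lambda>w. word_h h ?\<phi> w + (- \<alpha> k h) * ?\<phi> w)"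
    by (simp add: word_h_def word_weight_def algebra_simps)
  then have "word_e j (\<lambda>w. word_h h \<phi> (k # w)) u = word_e j (word_h h ?\<phi>) u + (- \<alpha> k h) * word_e j ?\<phi> u"
    by (simp only: word_e_linear)
  also have "word_e j (word_h h ?\<phi>) u = word_h h (word_e j ?\<phi>) u - \<alpha> j h * word_e j ?\<phi> u"
    using Cons[of ?\<phi>] by (simp add: algebra_simps)
  finally show ?case by (simp add: word_h_def word_weight_def algebra_simps)
qed

lemma word_h_f: "word_h h (word_f i \<phi>) u - word_f i (word_h h \<phi>) u = - \<alpha> i h * word_f i \<phi> u"
  by (cases u) (auto simp: word_h_def word_f_def word_weight_def algebra_simps)

end

section \<open>Eigenspace gradings\<close>

text \<open>Vandermonde elimination: applying ad \<rho> - j removes the j-th term and multiplies the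
  others by i - j, which is nonzero. With \<open>J\<close> zero this is the independence of
  eigenspaces; with an ideal \<open>J\<close> it is the homogeneity of that ideal.\<close>

lemma (in lie_algebra) eigenvector_components_in:
  assumes \<rho>: "\<rho> \<in> carrier L" and J: "subspace J" "\<And>x. x \<in> J \<Longrightarrow> \<rho> \<otimes> x \<in> J"
    and "finite F" "\<And>i. i \<in> F \<Longrightarrow> v i \<in> carrier L"
    "\<And>i. i \<in> F \<Longrightarrow> \<rho> \<otimes> v i = of_int i \<odot> v i" "(\<Oplus>i\<in>F. v i) \<in> J" "i \<in> F"
  shows "v i \<in> J"
proof -
  have "\<forall>i\<in>F. v i \<in> J"
    using assms(4-7)
  proof (induct F arbitrary: v)
    case (insert j F)
    have vc: "v i \<in> carrier L" if "i \<in> insert j F" for i using insert(4) that by blast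
    let ?x = "\<Oplus>i\<in>insert j F. v i" and ?w = "\<lambda>i. of_int (i - j) \<odot> v i"
    have x: "?x = v j \<oplus> (\<Oplus>i\<in>F. v i)" using insert(1,2) vc by (intro finsum_insert) auto
    have s: "(\<Oplus>i\<in>F. v i) \<in> carrier L" using vc by (intro finsum_closed) auto
    have "(\<Oplus>i\<in>F. ?w i) = (\<Oplus>i\<in>F. \<rho> \<otimes> v i \<oplus> of_int (- j) \<odot> v i)"
      using insert(5) vc \<rho> by (intro finsum_cong') (auto simp: smult_add_left[symmetric])
    also have "\<dots> = (\<Oplus>i\<in>F. \<rho> \<otimes> v i) \<oplus> (\<Oplus>i\<in>F. of_int (- j) \<odot> v i)"
      using \<rho> vc by (intro finsum_addf) auto
    also have "\<dots> = \<rho> \<otimes> (\<Oplus>i\<in>F. v i) \<oplus> of_int (- j) \<odot> (\<Oplus>i\<in>F. v i)"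
      using \<rho> vc by (subst bracket_finsum_right, simp, force, subst finsum_smult) auto
    also have "\<dots> = \<rho> \<otimes> ?x \<oplus> of_int (- j) \<odot> ?x"
    proof -
      have "\<rho> \<otimes> ?x \<oplus> of_int (- j) \<odot> ?x = (of_int j \<odot> v j \<oplus> of_int (- j) \<odot> v j)
          \<oplus> (\<rho> \<otimes> (\<Oplus>i\<in>F. v i) \<oplus> of_int (- j) \<odot> (\<Oplus>i\<in>F. v i))"
        unfolding x using \<rho> vc s insert(5)[of j]
        by (simp add: bracket_add_right smult_add_right a_ac)
      also have "of_int j \<odot> v j \<oplus> of_int (- j) \<odot> v j = \<zero>"
        using vc by (simp add: smult_add_left[symmetric])
      finally show ?thesis using \<rho> s by simp
    qed
    also have "\<dots> \<in> J" using insert(6) J subspaceD[OF J(1)] by blast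
    finally have "(\<Oplus>i\<in>F. ?w i) \<in> J" .
    moreover have "\<rho> \<otimes> ?w i = of_int i \<odot> ?w i" if "i \<in> F" for i
      using that \<rho> vc insert(5)[of i] by (simp add: bracket_smult_right smult_smult mult.commute)
    ultimately have wJ: "\<forall>i\<in>F. ?w i \<in> J" using insert(3)[of ?w] vc by auto
    have F: "v i \<in> J" if "i \<in> F" for i
    proof -
      have "(1 / of_int (i - j)) \<odot> ?w i \<in> J" using wJ that subspaceD(4)[OF J(1)] by blast
      moreover have "i \<noteq> j" using that insert(2) by auto
      then have "(1 / of_int (i - j)) \<odot> ?w i = v i" using that vc by (simp add: smult_smult)
      ultimately show ?thesis by simp
    qed
    have "v j = ?x \<ominus> (\<Oplus>i\<in>F. v i)"
      unfolding x using s vc by (simp add: a_minus_def a_assoc r_neg)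
    then have "v j \<in> J"
      using subspace_minus[OF J(1) insert(6) subspace_finsum[OF J(1) F]] by simp
    then show ?case using F by blast
  qed simp
  then show ?thesis using assms(8) by blast
qed

lemma (in lie_algebra) eigenspace_gradation:
  assumes \<rho>: "\<rho> \<in> carrier L"
  shows "lie_gradation L (\<lambda>k. {x \<in> carrier L. \<rho> \<otimes> x = of_int k \<odot> x})"
proof (intro lie_gradation.intro lie_gradation_axioms.intro lie_algebra_axioms)
  fix i
  show "subspace {x \<in> carrier L. \<rho> \<otimes> x = of_int i \<odot> x}"
    by (rule subspaceI) (use \<rho> in \<open>auto simp: bracket_add_right smult_add_right bracket_smult_right
      smult_smult mult.commute\<close>)
next
  fix F v i
  assume "finite F" "\<And>i. i \<in> F \<Longrightarrow> v i \<in> {x \<in> carrier L. \<rho> \<otimes> x = of_int i \<odot> x}"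
    "(\<Oplus>i\<in>F. v i) = \<zero>" "i \<in> F"
  then show "v i = \<zero>"
    using eigenvector_components_in[OF \<rho> subspace_zero, of F v i] \<rho> by auto
next
  fix x i y j
  assume "x \<in> {x \<in> carrier L. \<rho> \<otimes> x = of_int i \<odot> x}" "y \<in> {x \<in> carrier L. \<rho> \<otimes> x = of_int j \<odot> x}"
  then show "x \<otimes> y \<in> {x \<in> carrier L. \<rho> \<otimes> x = of_int (i + j) \<odot> x}"
    using \<rho> by (auto simp: bracket_derivation[of \<rho> x y] bracket_smult_left bracket_smult_right
      smult_add_left)
qed

context graded_lie_algebra
begin

lemma local_part_carrier: "V (-1) \<union> V 0 \<union> V 1 \<subseteq> carrier L"
  using VD(1) by blast

lemma carrier_homogeneous: "carrier L = homogeneous_sums V"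
proof
  show "carrier L \<subseteq> homogeneous_sums V"
    using components_span unfolding homogeneous_sums_def by blast
  show "homogeneous_sums V \<subseteq> carrier L"
    by (rule subspaceD(5)[OF homogeneous_sums_subspace]) (rule V_subspace)
qed

lemma flip_graded: "graded_lie_algebra L (\<lambda>k. V (- k))"
proof (intro graded_lie_algebra.intro graded_lie_algebra_axioms.intro lie_algebra_axioms)
  interpret f: lie_gradation L "\<lambda>k. V (- k)" by (rule flip)
  show "v i = \<zero>" if "finite F" "\<And>i. i \<in> F \<Longrightarrow> v i \<in> V (- i)" "(\<Oplus>i\<in>F. v i) = \<zero>" "i \<in> F" for F v i
    using f.V_independent[OF that] .
  show "x \<otimes> y \<in> V (- (i + j))" if "x \<in> V (- i)" "y \<in> V (- j)" for x y i j
    using f.V_bracket[OF that] .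
  show "lie_generated L (V (- (- 1)) \<union> V (- 0) \<union> V (- 1)) = carrier L"
    using generated_by_local_part by (simp add: Un_ac)
  show "\<exists>F v. finite F \<and> (\<forall>i\<in>F. v i \<in> V (- i)) \<and> x = (\<Oplus>i\<in>F. v i)" if x: "x \<in> carrier L" for x
  proof -
    obtain F v where F: "finite F" "\<forall>i\<in>F. v i \<in> V i" "x = (\<Oplus>i\<in>F. v i)"
      using components_span[OF x] by blast
    have "v i \<in> carrier L" if "i \<in> F" for i using F(2) VD(1) that by blast
    then have "(\<Oplus>i\<in>uminus ` F. v (- i)) = x"
      unfolding F(3) by (subst finsum_reindex) (auto intro!: finsum_cong')
    then show ?thesis using F(1,2)
      by (intro exI[of _ "uminus ` F"] exI[of _ "\<lambda>i. v (- i)"]) auto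
  qed
qed (rule V_subspace)

lemma subspace_ad_local_ideal:
  assumes "subspace I" "\<And>x s. \<lbrakk>x \<in> V (-1) \<union> V 0 \<union> V 1; s \<in> I\<rbrakk> \<Longrightarrow> x \<otimes> s \<in> I"
  shows "lie_ideal L I"
  using lie_generated_normalizes[OF assms(1) local_part_carrier assms(2)] assms(1)
  unfolding generated_by_local_part by (auto simp: lie_ideal_def)

text \<open>The elements of degree at least 2 that are moved to 0 in degree 1 by iterated brackets with
  degree -1 form an ideal.\<close>

lemma maximal_ideal_transitive:
  assumes J: "lie_ideal L J" "J \<inter> V 0 = {\<zero>}"
    and max: "\<And>I. \<lbrakk>lie_ideal L I; I \<inter> V 0 = {\<zero>}\<rbrakk> \<Longrightarrow> I \<subseteq> J"
    and loc: "\<And>x. \<lbrakk>x \<in> V 1; \<And>f. f \<in> V (-1) \<Longrightarrow> f \<otimes> x = \<zero>\<rbrakk> \<Longrightarrow> x = \<zero>"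
    and k: "2 \<le> k" and x: "x \<in> V k" "\<And>f. f \<in> V (-1) \<Longrightarrow> f \<otimes> x \<in> J"
  shows "x \<in> J"
proof -
  \<comment> \<open>Off by one: \<open>T m\<close> sits in degree m + 1. It starts with zero in
    degree 1, where by \<open>loc\<close> nothing else commutes with degree -1.\<close>
  define T where "T = rec_nat {\<zero>} (\<lambda>m S. {y \<in> V (int (Suc (Suc m))). \<forall>f\<in>V (-1). f \<otimes> y \<in> S})"
  have T0: "T 0 = {\<zero>}" and TS: "T (Suc m) = {y \<in> V (int (Suc (Suc m))). \<forall>f\<in>V (-1). f \<otimes> y \<in> T m}" for m
    by (simp_all add: T_def)
  have TV: "T m \<subseteq> V (int (Suc m))" for m
    by (cases m) (use VD(2)[of 1] in \<open>auto simp: T0 TS\<close>)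
  have Tc: "y \<in> carrier L" if "y \<in> T m" for y m using TV VD(1) that by blast
  have Tsub: "subspace (T m)" for m
  proof (induct m)
    case (Suc m)
    note D = subspaceD[OF Suc]
    show ?case
      by (rule subspaceI) (use VD D in \<open>auto simp: TS bracket_add_right bracket_smult_right\<close>)
  qed (simp add: T0 subspace_zero)
  \<comment> \<open>Lowering an element of \<open>J\<close> to degree 0 by brackets with degree -1
    gives zero, because \<open>J\<close> avoids degree 0; so the components of \<open>J\<close> in
    positive degrees are part of \<open>T\<close>.\<close>
  have JT: "y \<in> T m" if "y \<in> J" "y \<in> V (int (Suc m))" for y m
    using that
  proof (induct m arbitrary: y)
    case 0
    have "f \<otimes> y = \<zero>" if f: "f \<in> V (-1)" for f
      using V_bracket[OF f 0(2)] lie_idealD(2)[OF J(1) VD(1)[OF f] 0(1)] J(2) by auto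
    then show ?case using loc[of y] 0 by (simp add: T0)
  next
    case (Suc m)
    have "f \<otimes> y \<in> T m" if f: "f \<in> V (-1)" for f
      using V_bracket[OF f Suc(3)] lie_idealD(2)[OF J(1) VD(1)[OF f] Suc(2)] by (intro Suc(1)) auto
    then show ?case using Suc(3) by (simp add: TS)
  qed
  have HT: "h \<otimes> y \<in> T m" if "h \<in> V 0" "y \<in> T m" for h y m
    using that(2)
  proof (induct m arbitrary: y)
    case 0
    then show ?case using VD(1)[OF that(1)] by (simp add: T0)
  next
    case (Suc m)
    have y: "y \<in> V (int (Suc (Suc m)))" "\<And>f. f \<in> V (-1) \<Longrightarrow> f \<otimes> y \<in> T m"
      using Suc(2) by (auto simp: TS)
    have "f \<otimes> (h \<otimes> y) \<in> T m" if f: "f \<in> V (-1)" for f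
    proof -
      have "f \<otimes> h \<in> V (-1)" using V_bracket[OF f \<open>h \<in> V 0\<close>] by simp
      then show ?thesis
        using bracket_derivation[of f h y] f \<open>h \<in> V 0\<close> y VD(1) Suc(1)[OF y(2)[OF f]]
          subspaceD(3)[OF Tsub] by metis
    qed
    then show ?case using V_bracket[OF that(1) y(1)] by (simp add: TS)
  qed
  \<comment> \<open>The Leibniz rule reduces this to [f, e], which has degree 0 (\<open>HT\<close>),
    and to the induction hypothesis for [f, y].\<close>
  have ET: "e \<otimes> y \<in> T (Suc m)" if "e \<in> V 1" "y \<in> T m" for e y m
    using that(2)
  proof (induct m arbitrary: y)
    case 0
    then show ?case using VD(1)[OF that(1)] subspaceD(2)[OF Tsub] by (simp add: T0)
  next
    case (Suc m)
    have y: "y \<in> V (int (Suc (Suc m)))" "\<And>f. f \<in> V (-1) \<Longrightarrow> f \<otimes> y \<in> T m"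
      using Suc(2) by (auto simp: TS)
    have "f \<otimes> (e \<otimes> y) \<in> T (Suc m)" if f: "f \<in> V (-1)" for f
    proof -
      have "f \<otimes> e \<in> V 0" using V_bracket[OF f \<open>e \<in> V 1\<close>] by simp
      then show ?thesis
        using bracket_derivation[of f e y] f \<open>e \<in> V 1\<close> y VD(1) Suc(1)[OF y(2)[OF f]]
          subspaceD(3)[OF Tsub] HT Suc(2) by metis
    qed
    then show ?case using V_bracket[OF that(1) y(1)] by (simp add: TS[of "Suc m"])
  qed
  have FT: "f \<otimes> y \<in> (if m = 0 then {\<zero>} else T (m - 1))" if "f \<in> V (-1)" "y \<in> T m" for f y m
    using that VD(1)[OF that(1)] by (cases m) (auto simp: T0 TS)
  define W where "W k = (if 1 \<le> k then T (nat k - 1) else {\<zero>})" for k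
  have Wsub: "subspace (W k)" for k by (simp add: W_def Tsub subspace_zero)
  have WV: "W k \<subseteq> V k" for k
    using TV[of "nat k - 1"] VD(2) by (auto simp: W_def)
  let ?I = "homogeneous_sums W"
  have Isub: "subspace ?I" by (rule homogeneous_sums_subspace) (rule Wsub)
  have incl: "y \<in> ?I" if "y \<in> T m" for y m
  proof (rule homogeneous_sums_incl[where W = W and i = "int (Suc m)", OF _ Wsub])
    show "y \<in> W (int (Suc m))" using that by (simp add: W_def nat_add_distrib)
  qed
  have "z \<otimes> y \<in> ?I" if z: "z \<in> V (-1) \<union> V 0 \<union> V 1" and y: "y \<in> W k" for z y k
  proof (cases "1 \<le> k")
    case True
    then have y: "y \<in> T (nat k - 1)" using y by (simp add: W_def)
    from z consider "z \<in> V (-1)" | "z \<in> V 0" | "z \<in> V 1" by blast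
    then show ?thesis
    proof cases
      case 1
      from FT[OF this y] show ?thesis using incl subspaceD(2)[OF Isub] by (auto split: if_splits)
    next
      case 2
      from incl[OF HT[OF this y]] show ?thesis .
    next
      case 3
      from incl[OF ET[OF this y]] show ?thesis .
    qed
  next
    case False
    then show ?thesis using y z local_part_carrier subspaceD(2)[OF Isub] by (auto simp: W_def)
  qed
  then have "z \<otimes> s \<in> ?I" if "z \<in> V (-1) \<union> V 0 \<union> V 1" "s \<in> ?I" for z s
    using homogeneous_sums_bracket[OF Wsub Isub _ _ that(2), of z] that(1) local_part_carrier by blast
  then have ideal: "lie_ideal L ?I" by (rule subspace_ad_local_ideal[OF Isub])
  have W0: "W 0 = {\<zero>}" by (simp add: W_def)
  have "?I \<inter> V 0 = {\<zero>}"
  proof (intro equalityI subsetI)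
    fix y assume "y \<in> ?I \<inter> V 0"
    then have "y \<in> W 0" using component_in[of y W 0] Wsub WV by blast
    then show "y \<in> {\<zero>}" using W0 by simp
  qed (use subspaceD(2)[OF Isub] VD(2)[of 0] in simp)
  from max[OF ideal this] have IJ: "?I \<subseteq> J" .
  obtain m where m: "k = int (Suc (Suc m))"
    using k by (intro that[of "nat k - 2"]) auto
  \<comment> \<open>By \<open>JT\<close>, degree -1 moves x into \<open>T m\<close>, which puts x
    itself one level higher.\<close>
  have "x \<in> ?I"
  proof (rule incl)
    have "f \<otimes> x \<in> T m" if f: "f \<in> V (-1)" for f
      using JT[OF x(2)[OF f]] V_bracket[OF f x(1)] m by simp
    then show "x \<in> T (Suc m)" using x(1) m by (simp add: TS)
  qed
  with IJ show ?thesis by (rule subsetD)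
qed

end

section \<open>Bases as families\<close>

context complex_space
begin

text \<open>A basis as an indexed family: coordinates then become matrix entries.
  \<open>indexed_basis_iff\<close> connects it with the bases as sets behind
  \<open>indexed_basis\<close>.\<close>

definition family_basis :: "nat \<Rightarrow> (nat \<Rightarrow> 'a) \<Rightarrow> 'a set \<Rightarrow> bool"
  where "family_basis n b S \<longleftrightarrow> (\<forall>i<n. b i \<in> carrier L) \<and>
    S = {\<Oplus>i\<in>{..<n}. c i \<odot> b i | c. True} \<and>
    (\<forall>c. (\<Oplus>i\<in>{..<n}. c i \<odot> b i) = \<zero> \<longrightarrow> (\<forall>i<n. c i = 0))"

lemma lincomb_add:
  fixes b :: "nat \<Rightarrow> 'a"
  assumes "\<And>i. i < n \<Longrightarrow> b i \<in> carrier L"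
  shows "(\<Oplus>i\<in>{..<n}. c i \<odot> b i) \<oplus> (\<Oplus>i\<in>{..<n}. d i \<odot> b i) = (\<Oplus>i\<in>{..<n}. (c i + d i) \<odot> b i)"
proof -
  have "(\<Oplus>i\<in>{..<n}. (c i + d i) \<odot> b i) = (\<Oplus>i\<in>{..<n}. c i \<odot> b i \<oplus> d i \<odot> b i)"
    using assms by (intro finsum_cong') (auto simp: smult_add_left)
  then show ?thesis using assms by (simp add: finsum_addf Pi_def)
qed

lemma lincomb_smult':
  fixes b :: "nat \<Rightarrow> 'a"
  assumes "\<And>i. i < n \<Longrightarrow> b i \<in> carrier L"
  shows "a \<odot> (\<Oplus>i\<in>{..<n}. c i \<odot> b i) = (\<Oplus>i\<in>{..<n}. (a * c i) \<odot> b i)"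
proof -
  have "a \<odot> (\<Oplus>i\<in>{..<n}. c i \<odot> b i) = (\<Oplus>i\<in>{..<n}. a \<odot> (c i \<odot> b i))"
    using assms by (intro finsum_smult) auto
  also have "\<dots> = (\<Oplus>i\<in>{..<n}. (a * c i) \<odot> b i)"
    using assms by (intro finsum_cong') (auto simp: smult_smult)
  finally show ?thesis .
qed

lemma lincomb_closed':
  "(\<And>i. i < (n::nat) \<Longrightarrow> b i \<in> carrier L) \<Longrightarrow> (\<Oplus>i\<in>{..<n}. c i \<odot> b i) \<in> carrier L"
  by (intro finsum_closed) auto

lemma lincomb_zero':
  "(\<And>i. i < (n::nat) \<Longrightarrow> b i \<in> carrier L) \<Longrightarrow> (\<And>i. i < n \<Longrightarrow> c i = 0) \<Longrightarrow> (\<Oplus>i\<in>{..<n}. c i \<odot> b i) = \<zero>"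
  by (rule add.finprod_one_eqI) auto

lemma lincomb_unit:
  fixes b :: "nat \<Rightarrow> 'a"
  assumes "\<And>i. i < n \<Longrightarrow> b i \<in> carrier L" "j < n"
  shows "(\<Oplus>i\<in>{..<n}. (if i = j then a else 0) \<odot> b i) = a \<odot> b j"
proof -
  have "(\<Oplus>i\<in>{..<n}. (if i = j then a else 0) \<odot> b i) = (\<Oplus>i\<in>{..<n}. if j = i then a \<odot> b i else \<zero>)"
    using assms by (intro finsum_cong') auto
  also have "\<dots> = a \<odot> b j" using assms by (intro finsum_singleton) auto
  finally show ?thesis .
qed

lemma lincombs_subspace:
  fixes b :: "nat \<Rightarrow> 'a"
  assumes "\<And>i. i < n \<Longrightarrow> b i \<in> carrier L"
  shows "subspace {\<Oplus>i\<in>{..<n}. c i \<odot> b i | c. True}"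
proof (rule subspaceI)
  show "\<zero> \<in> {\<Oplus>i\<in>{..<n}. c i \<odot> b i | c. True}"
    using lincomb_zero'[where n = n and b = b and c = "\<lambda>_. 0", OF assms]
    by (auto intro!: exI[of _ "\<lambda>_. 0"])
next
  fix x y assume "x \<in> {\<Oplus>i\<in>{..<n}. c i \<odot> b i | c. True}" "y \<in> {\<Oplus>i\<in>{..<n}. c i \<odot> b i | c. True}"
  then obtain c d where "x = (\<Oplus>i\<in>{..<n}. c i \<odot> b i)" "y = (\<Oplus>i\<in>{..<n}. d i \<odot> b i)" by auto
  then have "x \<oplus> y = (\<Oplus>i\<in>{..<n}. (c i + d i) \<odot> b i)" using lincomb_add[OF assms] by simp
  then show "x \<oplus> y \<in> {\<Oplus>i\<in>{..<n}. c i \<odot> b i | c. True}"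
    by (auto intro!: exI[of _ "\<lambda>i. c i + d i"])
next
  fix a x assume "x \<in> {\<Oplus>i\<in>{..<n}. c i \<odot> b i | c. True}"
  then obtain c where "x = (\<Oplus>i\<in>{..<n}. c i \<odot> b i)" by auto
  then have "a \<odot> x = (\<Oplus>i\<in>{..<n}. (a * c i) \<odot> b i)" using lincomb_smult'[OF assms] by simp
  then show "a \<odot> x \<in> {\<Oplus>i\<in>{..<n}. c i \<odot> b i | c. True}"
    by (auto intro!: exI[of _ "\<lambda>i. a * c i"])
qed (use assms in \<open>auto intro: lincomb_closed'\<close>)

lemma lincombs_minimal:
  fixes b :: "nat \<Rightarrow> 'a"
  assumes "\<And>i. i < n \<Longrightarrow> b i \<in> S" "subspace S"
  shows "{\<Oplus>i\<in>{..<n}. c i \<odot> b i | c. True} \<subseteq> S"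
  using assms subspaceD(4)[OF assms(2)] by (auto intro!: subspace_finsum)

lemma lincombs_incl:
  fixes b :: "nat \<Rightarrow> 'a"
  assumes "\<And>i. i < n \<Longrightarrow> b i \<in> carrier L" "j < n"
  shows "b j \<in> {\<Oplus>i\<in>{..<n}. c i \<odot> b i | c. True}"
proof -
  have "b j = (\<Oplus>i\<in>{..<n}. (if i = j then 1 else 0) \<odot> b i)"
    using lincomb_unit[where b = b and a = 1, OF assms] assms by simp
  then show ?thesis
    unfolding mem_Collect_eq by (intro exI[of _ "\<lambda>i. if i = j then 1 else 0"] conjI TrueI)
qed

lemma family_basisD:
  assumes "family_basis n b S"
  shows "i < n \<Longrightarrow> b i \<in> carrier L" "i < n \<Longrightarrow> b i \<in> S" "subspace S"
    "x \<in> S \<Longrightarrow> \<exists>c. x = (\<Oplus>i\<in>{..<n}. c i \<odot> b i)" "(\<Oplus>i\<in>{..<n}. c i \<odot> b i) \<in> S"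
    "\<lbrakk>(\<Oplus>i\<in>{..<n}. c i \<odot> b i) = \<zero>; i < n\<rbrakk> \<Longrightarrow> c i = 0"
proof -
  show b: "i < n \<Longrightarrow> b i \<in> carrier L" for i using assms by (simp add: family_basis_def)
  have S: "S = {\<Oplus>i\<in>{..<n}. c i \<odot> b i | c. True}" using assms by (simp add: family_basis_def)
  show "i < n \<Longrightarrow> b i \<in> S" unfolding S by (rule lincombs_incl[OF b])
  show "subspace S" unfolding S by (rule lincombs_subspace[OF b])
  show "x \<in> S \<Longrightarrow> \<exists>c. x = (\<Oplus>i\<in>{..<n}. c i \<odot> b i)" "(\<Oplus>i\<in>{..<n}. c i \<odot> b i) \<in> S"
    unfolding S by auto
  show "\<lbrakk>(\<Oplus>i\<in>{..<n}. c i \<odot> b i) = \<zero>; i < n\<rbrakk> \<Longrightarrow> c i = 0"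
    using assms by (simp add: family_basis_def)
qed

lemma family_basis_unique:
  assumes "family_basis n b S" "(\<Oplus>i\<in>{..<n}. c i \<odot> b i) = (\<Oplus>i\<in>{..<n}. d i \<odot> b i)" "i < n"
  shows "c i = d i"
proof -
  note B = family_basisD[OF assms(1)]
  have "(\<Oplus>i\<in>{..<n}. (c i + (-1) * d i) \<odot> b i)
      = (\<Oplus>i\<in>{..<n}. c i \<odot> b i) \<oplus> (\<Oplus>i\<in>{..<n}. (-1 * d i) \<odot> b i)"
    by (rule lincomb_add[symmetric]) (rule B(1))
  also have "(\<Oplus>i\<in>{..<n}. (-1 * d i) \<odot> b i) = (-1) \<odot> (\<Oplus>i\<in>{..<n}. d i \<odot> b i)"
    by (rule lincomb_smult'[symmetric]) (rule B(1))
  also have "(\<Oplus>i\<in>{..<n}. c i \<odot> b i) \<oplus> \<dots> = \<zero>"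
    using assms(2) lincomb_closed'[of n b d] B(1) by (simp add: smult_m1 r_neg)
  finally have "c i + (-1) * d i = 0" by (rule B(6)[where c = "\<lambda>i. c i + (-1) * d i"]) fact
  then show ?thesis by simp
qed

lemma indexed_basis_iff:
  assumes S: "subspace S" and b: "\<And>i. i < n \<Longrightarrow> b i \<in> S"
  shows "indexed_basis L S n b \<longleftrightarrow> family_basis n b S"
proof -
  interpret S: complex_space "L\<lparr>carrier := S\<rparr>" by (rule restrict_complex_space[OF S])
  let ?B = "b ` {..<n}"
  have bc: "b i \<in> carrier L" if "i < n" for i using b[OF that] subspaceD(1)[OF S] by blast
  have Bc: "?B \<subseteq> carrier (L\<lparr>carrier := S\<rparr>)" using b by auto
  have lc: "S.lincomb a ?B = (\<Oplus>i\<in>{..<n}. a (b i) \<odot> b i)" if "inj_on b {..<n}" for a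
  proof -
    have "S.lincomb a ?B = (\<Oplus>v\<in>?B. a v \<odot> v)"
      unfolding S.lincomb_def using b subspaceD(4)[OF S]
      by (subst finsum_restrict_carrier[OF S, symmetric]) auto
    also have "\<dots> = (\<Oplus>i\<in>{..<n}. a (b i) \<odot> b i)"
      using that bc by (subst finsum_reindex) auto
    finally show ?thesis .
  qed
  show ?thesis
  proof
    assume i: "indexed_basis L S n b"
    then have inj: "inj_on b {..<n}" and bs: "S.basis ?B" by (auto simp: indexed_basis_def)
    have "S = S.span ?B" using bs by (simp add: S.basis_def)
    also have "\<dots> = {S.lincomb a ?B | a. True}" using S.finite_span[OF _ Bc] by auto
    finally have S1: "S = {S.lincomb a ?B | a. True}" .
    have "S = {\<Oplus>i\<in>{..<n}. c i \<odot> b i | c. True}"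
    proof
      show "S \<subseteq> {\<Oplus>i\<in>{..<n}. c i \<odot> b i | c. True}" by (subst S1) (auto simp: lc[OF inj])
      show "{\<Oplus>i\<in>{..<n}. c i \<odot> b i | c. True} \<subseteq> S" by (rule lincombs_minimal[OF b S])
    qed
    moreover have "\<forall>i<n. c i = 0" if c: "(\<Oplus>i\<in>{..<n}. c i \<odot> b i) = \<zero>" for c
    proof (intro allI impI)
      fix i assume i: "i < n"
      let ?a = "\<lambda>v. c (inv_into {..<n} b v)"
      have "S.lincomb ?a ?B = (\<Oplus>i\<in>{..<n}. c i \<odot> b i)"
        unfolding lc[OF inj] using bc by (intro finsum_cong') (auto simp: inv_into_f_f[OF inj])
      then have "S.lincomb ?a ?B = \<zero>\<^bsub>L\<lparr>carrier := S\<rparr>\<^esub>" using c by simp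
      moreover have "S.lin_indpt ?B" using bs by (simp add: S.basis_def)
      ultimately have "?a (b i) = 0"
        using S.not_lindepD[of ?B ?B ?a] i by auto
      then show "c i = 0" using i by (simp add: inv_into_f_f[OF inj])
    qed
    ultimately show "family_basis n b S" using bc by (auto simp: family_basis_def)
  next
    assume fb: "family_basis n b S"
    note B = family_basisD[OF fb]
    have inj: "inj_on b {..<n}"
    proof (rule inj_onI, rule ccontr)
      fix i j assume ij: "i \<in> {..<n}" "j \<in> {..<n}" "b i = b j" "i \<noteq> j"
      have "(\<Oplus>k\<in>{..<n}. (if k = i then 1 else 0) \<odot> b k) = (\<Oplus>k\<in>{..<n}. (if k = j then 1 else 0) \<odot> b k)"
        using ij lincomb_unit[where b = b and a = 1 and n = n, OF bc] by simp
      from family_basis_unique[OF fb this, of i] ij show False by auto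
    qed
    have "S.span ?B = {S.lincomb a ?B | a. True}" using S.finite_span[OF _ Bc] by auto
    also have "\<dots> = {\<Oplus>i\<in>{..<n}. c i \<odot> b i | c. True}"
    proof (intro equalityI subsetI)
      fix x assume "x \<in> {\<Oplus>i\<in>{..<n}. c i \<odot> b i | c. True}"
      then obtain c where x: "x = (\<Oplus>i\<in>{..<n}. c i \<odot> b i)" by auto
      have "x = S.lincomb (\<lambda>v. c (inv_into {..<n} b v)) ?B"
        unfolding lc[OF inj] x using bc by (intro finsum_cong') (auto simp: inv_into_f_f[OF inj])
      then show "x \<in> {S.lincomb a ?B | a. True}" by blast
    qed (auto simp: lc[OF inj])
    also have "\<dots> = S" using fb by (simp add: family_basis_def)
    finally have gen: "S.span ?B = S" .
    have "S.lin_indpt ?B"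
    proof (rule S.finite_lin_indpt2)
      fix a assume "S.lincomb a ?B = \<zero>\<^bsub>L\<lparr>carrier := S\<rparr>\<^esub>"
      then have "(\<Oplus>i\<in>{..<n}. a (b i) \<odot> b i) = \<zero>" using lc[OF inj] by simp
      from B(6)[OF this] show "\<forall>v\<in>?B. a v = \<zero>\<^bsub>complex_ring\<^esub>" by auto
    qed (use Bc in auto)
    then have "S.basis ?B" using gen Bc by (simp add: S.basis_def)
    then show "indexed_basis L S n b" using inj by (simp add: indexed_basis_def)
  qed
qed

end

lemma linear_lincomb:
  assumes "complex_space L" "complex_space M" "f \<in> linear_maps L M" "\<And>i. i < n \<Longrightarrow> b i \<in> carrier L"
  shows "f (\<Oplus>\<^bsub>L\<^esub>i\<in>{..<n}. c i \<odot>\<^bsub>L\<^esub> b i) = (\<Oplus>\<^bsub>M\<^esub>i\<in>{..<n}. c i \<odot>\<^bsub>M\<^esub> f (b i))"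
proof -
  interpret L: complex_space L by fact
  interpret M: complex_space M by fact
  have "f (\<Oplus>\<^bsub>L\<^esub>i\<in>{..<n}. c i \<odot>\<^bsub>L\<^esub> b i) = (\<Oplus>\<^bsub>M\<^esub>i\<in>{..<n}. f (c i \<odot>\<^bsub>L\<^esub> b i))"
    using assms(4) by (intro linear_map_finsum[OF assms(1-3)]) auto
  also have "\<dots> = (\<Oplus>\<^bsub>M\<^esub>i\<in>{..<n}. c i \<odot>\<^bsub>M\<^esub> f (b i))"
    using assms(3,4) by (intro M.finsum_cong') (auto simp: linear_maps_iff)
  finally show ?thesis .
qed

section \<open>Chevalley generators\<close>

context lie_algebra
begin

lemma comb_bracket_diagonal:
  fixes b :: "nat \<Rightarrow> 'a"
  assumes "\<And>i. i < n \<Longrightarrow> b i \<in> carrier L" "y \<in> carrier L" "j < n" "z \<in> carrier L"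
    and "\<And>i. i < n \<Longrightarrow> b i \<otimes> y = (if i = j then z else \<zero>)"
  shows "(\<Oplus>i\<in>{..<n}. c i \<odot> b i) \<otimes> y = c j \<odot> z"
proof -
  have "(\<Oplus>i\<in>{..<n}. c i \<odot> b i) \<otimes> y = (\<Oplus>i\<in>{..<n}. (c i \<odot> b i) \<otimes> y)"
    using assms by (intro bracket_finsum_left) auto
  also have "\<dots> = (\<Oplus>i\<in>{..<n}. if j = i then c i \<odot> z else \<zero>)"
    using assms by (intro finsum_cong') (auto simp: bracket_smult_left)
  also have "\<dots> = c j \<odot> z" using assms by (intro finsum_singleton) auto
  finally show ?thesis .
qed

lemma ad_vimage_subspace:
  assumes "subspace S" "y \<in> carrier L"
  shows "subspace {x \<in> carrier L. y \<otimes> x \<in> S}" "subspace {x \<in> carrier L. x \<otimes> y \<in> S}"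
  using assms subspaceD[OF assms(1)] by (auto intro!: subspaceI
      simp: bracket_add_left bracket_add_right bracket_smult_left bracket_smult_right)

end

text \<open>The space \<open>H\<close> is an external model of degree 0. Thus one interface with the
  same roots and coroots serves the presented algebra, its quotient g(C) and the derived algebra,
  for which \<open>H\<close> shrinks to the span of the coroots.\<close>

locale chevalley_graded = graded_lie_algebra L V + H: complex_space H
  for L :: "(complex, 'a) module" (structure) and V :: "int \<Rightarrow> 'a set"
    and H :: "(complex, 'h) module" +
  fixes n :: nat and \<alpha> :: "nat \<Rightarrow> 'h \<Rightarrow> complex" and \<alpha>\<^sub>c :: "nat \<Rightarrow> 'h"
    and hh :: "'h \<Rightarrow> 'a" and ee ff :: "nat \<Rightarrow> 'a"
  assumes hh_linear: "hh \<in> linear_maps H L" and hh_bij: "bij_betw hh (carrier H) (V 0)"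
    and e_basis: "family_basis n ee (V 1)" and f_basis: "family_basis n ff (V (-1))"
    and coroot: "i < n \<Longrightarrow> \<alpha>\<^sub>c i \<in> carrier H"
    and hh_hh: "\<lbrakk>h \<in> carrier H; h' \<in> carrier H\<rbrakk> \<Longrightarrow> hh h \<otimes> hh h' = \<zero>"
    and hh_e: "\<lbrakk>h \<in> carrier H; i < n\<rbrakk> \<Longrightarrow> hh h \<otimes> ee i = \<alpha> i h \<odot> ee i"
    and hh_f: "\<lbrakk>h \<in> carrier H; i < n\<rbrakk> \<Longrightarrow> hh h \<otimes> ff i = (- \<alpha> i h) \<odot> ff i"
    and e_f: "\<lbrakk>i < n; j < n\<rbrakk> \<Longrightarrow> ee i \<otimes> ff j = (if i = j then hh (\<alpha>\<^sub>c i) else \<zero>)"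
begin

lemmas eD = family_basisD[OF e_basis] and fD = family_basisD[OF f_basis]

lemma hhD: "h \<in> carrier H \<Longrightarrow> hh h \<in> V 0" "h \<in> carrier H \<Longrightarrow> hh h \<in> carrier L"
  "\<lbrakk>h \<in> carrier H; h' \<in> carrier H\<rbrakk> \<Longrightarrow> hh (h \<oplus>\<^bsub>H\<^esub> h') = hh h \<oplus> hh h'"
  "h \<in> carrier H \<Longrightarrow> hh (c \<odot>\<^bsub>H\<^esub> h) = c \<odot> hh h" "hh \<zero>\<^bsub>H\<^esub> = \<zero>"
  "x \<in> V 0 \<Longrightarrow> \<exists>h\<in>carrier H. x = hh h"
  "\<lbrakk>h \<in> carrier H; h' \<in> carrier H; hh h = hh h'\<rbrakk> \<Longrightarrow> h = h'"
  using hh_bij hh_linear linear_map_zero[OF H.complex_space_axioms complex_space_axioms hh_linear]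
  by (auto simp: linear_maps_iff bij_betw_def inj_on_def)

lemma hh_eq_zero: "\<lbrakk>h \<in> carrier H; hh h = \<zero>\<rbrakk> \<Longrightarrow> h = \<zero>\<^bsub>H\<^esub>"
  using hhD(7)[of h "\<zero>\<^bsub>H\<^esub>"] hhD(5) by simp

lemma e_comb_f:
  assumes "j < n"
  shows "(\<Oplus>i\<in>{..<n}. c i \<odot> ee i) \<otimes> ff j = c j \<odot> hh (\<alpha>\<^sub>c j)"
  by (rule comb_bracket_diagonal) (use eD(1) fD(1) assms hhD(2) coroot e_f in auto)

text \<open>With e and f exchanged, the relation for [e, f] is reversed, which changes the sign of
  the coroots, and the weights of the f's are the negated roots. Statements on positive degrees thus
  carry over to negative ones.\<close>

lemma flip_chevalley:
  "chevalley_graded L (\<lambda>k. V (- k)) H n (\<lambda>i h. - \<alpha> i h) (\<lambda>i. \<ominus>\<^bsub>H\<^esub> \<alpha>\<^sub>c i) hh ff ee"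
proof (intro chevalley_graded.intro chevalley_graded_axioms.intro flip_graded H.complex_space_axioms)
  fix i j assume ij: "i < n" "j < n"
  have "hh (\<ominus>\<^bsub>H\<^esub> \<alpha>\<^sub>c i) = \<ominus> hh (\<alpha>\<^sub>c i)"
    using hhD(4)[OF coroot[OF ij(1)], of "-1"] hhD(2)[OF coroot[OF ij(1)]] coroot[OF ij(1)]
    by (simp add: smult_m1 H.smult_m1)
  then show "ff i \<otimes> ee j = (if i = j then hh (\<ominus>\<^bsub>H\<^esub> \<alpha>\<^sub>c i) else \<zero>)"
    using bracket_anticommute[OF fD(1)[OF ij(1)] eD(1)[OF ij(2)]] e_f[OF ij(2,1)] ij
      smult_m1[of \<zero>] by auto
qed (use hh_linear hh_bij e_basis f_basis coroot hh_hh hh_e hh_f in auto)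

text \<open>The bracket with \<open>ff j\<close> reads off the j-th coordinate, multiplied by a
  nonzero coroot.\<close>

lemma local_transitive:
  assumes "\<And>i. i < n \<Longrightarrow> \<alpha>\<^sub>c i \<noteq> \<zero>\<^bsub>H\<^esub>" "x \<in> V 1" "\<And>f. f \<in> V (-1) \<Longrightarrow> f \<otimes> x = \<zero>"
  shows "x = \<zero>"
proof -
  obtain c where x: "x = (\<Oplus>i\<in>{..<n}. c i \<odot> ee i)" using eD(4)[OF assms(2)] by blast
  have xc: "x \<in> carrier L" using VD(1) assms(2) by blast
  have "c j = 0" if j: "j < n" for j
  proof -
    have "x \<otimes> ff j = \<zero>"
      using bracket_anticommute[OF xc fD(1)[OF j]] assms(3)[OF fD(2)[OF j]] smult_m1[of \<zero>] by simp
    then have "c j \<odot> hh (\<alpha>\<^sub>c j) = \<zero>" using e_comb_f[OF j] x by simp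
    then show ?thesis
      using smult_eq_zero[of "c j" "hh (\<alpha>\<^sub>c j)"] hhD(2)[OF coroot[OF j]] hh_eq_zero[OF coroot[OF j]]
        assms(1)[OF j] by blast
  qed
  then show ?thesis unfolding x by (intro lincomb_zero') (auto simp: eD(1))
qed

end

lemma (in complex_space) family_basis_image:
  assumes "family_basis n b S" "complex_space M" "f \<in> linear_maps L M"
    and inj: "\<And>x. \<lbrakk>x \<in> S; f x = \<zero>\<^bsub>M\<^esub>\<rbrakk> \<Longrightarrow> x = \<zero>"
  shows "complex_space.family_basis M n (\<lambda>i. f (b i)) (f ` S)"
proof -
  interpret M: complex_space M by fact
  note B = family_basisD[OF assms(1)]
  have lc: "f (\<Oplus>i\<in>{..<n}. c i \<odot> b i) = (\<Oplus>\<^bsub>M\<^esub>i\<in>{..<n}. c i \<odot>\<^bsub>M\<^esub> f (b i))" for c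
    by (rule linear_lincomb[OF complex_space_axioms assms(2,3) B(1)])
  have "f ` S = {\<Oplus>\<^bsub>M\<^esub>i\<in>{..<n}. c i \<odot>\<^bsub>M\<^esub> f (b i) | c. True}"
    using assms(1) unfolding family_basis_def by (auto simp: lc image_iff) (metis lc)
  moreover have "\<forall>i<n. c i = 0" if "(\<Oplus>\<^bsub>M\<^esub>i\<in>{..<n}. c i \<odot>\<^bsub>M\<^esub> f (b i)) = \<zero>\<^bsub>M\<^esub>" for c
    using inj[OF B(5)] B(6) that lc by metis
  ultimately show ?thesis
    using assms(3) B(1) by (auto simp: M.family_basis_def linear_maps_iff)
qed

context chevalley_graded
begin

text \<open>An element of \<open>J\<close> in degree 1 is moved by degree -1 into the degree 0 part
  of \<open>J\<close>, that is to zero, so it vanishes by \<open>local_transitive\<close>; likewise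
  in degree -1. Hence the whole local part survives in the quotient.\<close>

lemma quotient_chevalley:
  assumes J: "lie_ideal L J"
    and hom: "\<And>F v i. \<lbrakk>finite F; \<And>i. v i \<in> V i; (\<Oplus>i\<in>F. v i) \<in> J; i \<in> F\<rbrakk> \<Longrightarrow> v i \<in> J"
    and J0: "J \<inter> V 0 = {\<zero>}" and c: "\<And>i. i < n \<Longrightarrow> \<alpha>\<^sub>c i \<noteq> \<zero>\<^bsub>H\<^esub>"
  shows "chevalley_graded (lie_quotient L J) (\<lambda>k. (\<lambda>x. J +> x) ` V k) H n \<alpha> \<alpha>\<^sub>c
    (\<lambda>h. J +> hh h) (\<lambda>i. J +> ee i) (\<lambda>i. J +> ff i)"
proof -
  let ?Q = "lie_quotient L J" and ?\<pi> = "\<lambda>x. J +> x"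
  interpret Q: graded_lie_algebra ?Q "\<lambda>k. ?\<pi> ` V k" by (rule quotient_graded[OF J]) (rule hom)
  note qh = quotient_hom[OF J]
  note qD = lie_homD[OF qh] and q0 = quotient_zero[OF J]
  interpret fl: chevalley_graded L "\<lambda>k. V (- k)" H n "\<lambda>i h. - \<alpha> i h" "\<lambda>i. \<ominus>\<^bsub>H\<^esub> \<alpha>\<^sub>c i" hh ff ee
    by (rule flip_chevalley)
  have c': "\<ominus>\<^bsub>H\<^esub> \<alpha>\<^sub>c i \<noteq> \<zero>\<^bsub>H\<^esub>" if "i < n" for i
    using c[OF that] coroot[OF that] by (metis H.minus_nonzero)
  have JV: "f \<otimes> x = \<zero>" if "x \<in> J" "f \<in> V i" "x \<in> V (- i)" for f x i
    using lie_idealD(2)[OF J, of f x] VD(1)[OF that(2)] V_bracket[OF that(2,3)] that J0 by auto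
  have i0: "x = \<zero>" if "x \<in> V 0" "?\<pi> x = \<zero>\<^bsub>?Q\<^esub>" for x
    using that quotient_eq_zero_iff[OF J] VD(1) J0 by blast
  have i1: "x = \<zero>" if "x \<in> V 1" "?\<pi> x = \<zero>\<^bsub>?Q\<^esub>" for x
  proof (rule local_transitive[OF c that(1)])
    have "x \<in> J" using that quotient_eq_zero_iff[OF J] VD(1) by blast
    then show "f \<otimes> x = \<zero>" if "f \<in> V (-1)" for f using JV[of x f "-1"] that \<open>x \<in> V 1\<close> by simp
  qed
  have i2: "x = \<zero>" if "x \<in> V (-1)" "?\<pi> x = \<zero>\<^bsub>?Q\<^esub>" for x
  proof (rule fl.local_transitive[OF c'])
    have "x \<in> J" using that quotient_eq_zero_iff[OF J] VD(1) by blast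
    then show "f \<otimes> x = \<zero>" if "f \<in> V (- (-1))" for f using JV[of x f 1] that \<open>x \<in> V (-1)\<close> by simp
  qed (use that in auto)
  note lin = lie_hom_linear[OF qh]
  show ?thesis
  proof (intro chevalley_graded.intro chevalley_graded_axioms.intro Q.graded_lie_algebra_axioms
      H.complex_space_axioms)
    show "(\<lambda>h. ?\<pi> (hh h)) \<in> linear_maps H ?Q"
      using hhD qD by (auto simp: linear_maps_iff)
    have "inj_on ?\<pi> (V 0)"
    proof (rule inj_onI)
      fix x y assume xy: "x \<in> V 0" "y \<in> V 0" "?\<pi> x = ?\<pi> y"
      then have "x \<ominus> y \<in> J" using coset_eq_iff[OF lie_idealD(1)[OF J]] VD(1) by blast
      then have "x \<ominus> y = \<zero>" using subspace_minus[OF V_subspace xy(1,2)] J0 by blast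
      then show "x = y" using xy VD(1) minus_other_side by blast
    qed
    then have "bij_betw ?\<pi> (V 0) (?\<pi> ` V 0)" by (simp add: bij_betw_def)
    from bij_betw_trans[OF hh_bij this] show "bij_betw (\<lambda>h. ?\<pi> (hh h)) (carrier H) (?\<pi> ` V 0)"
      by (simp add: o_def)
    show "Q.family_basis n (\<lambda>i. ?\<pi> (ee i)) (?\<pi> ` V 1)"
      by (rule family_basis_image[OF e_basis Q.complex_space_axioms lin i1])
    show "Q.family_basis n (\<lambda>i. ?\<pi> (ff i)) (?\<pi> ` V (-1))"
      by (rule family_basis_image[OF f_basis Q.complex_space_axioms lin i2])
  qed (use coroot hhD(2) eD(1) fD(1) in \<open>auto simp: qD(3,4)[symmetric] hh_hh hh_e hh_f e_f q0\<close>)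
qed

end

section \<open>The greatest ideal avoiding degree 0, and the algebra g(C)\<close>

lemma (in lie_algebra) lie_ideal_sum:
  assumes "lie_ideal L I" "lie_ideal L J"
  shows "lie_ideal L {a \<oplus> b | a b. a \<in> I \<and> b \<in> J}"
proof -
  note I = lie_idealD[OF assms(1)] and J = lie_idealD[OF assms(2)]
  note ID = subspaceD[OF I(1)] and JD = subspaceD[OF J(1)]
  show ?thesis
    unfolding lie_ideal_def
  proof (intro conjI subspaceI ballI)
    fix x y assume "x \<in> {a \<oplus> b | a b. a \<in> I \<and> b \<in> J}" "y \<in> {a \<oplus> b | a b. a \<in> I \<and> b \<in> J}"
    then obtain a b c d where *: "x = a \<oplus> b" "y = c \<oplus> d" "a \<in> I" "c \<in> I" "b \<in> J" "d \<in> J" by blast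
    then have "x \<oplus> y = (a \<oplus> c) \<oplus> (b \<oplus> d)" using ID(1) JD(1) by (simp add: a_ac)
    then show "x \<oplus> y \<in> {a \<oplus> b | a b. a \<in> I \<and> b \<in> J}" using * ID(3) JD(3) by blast
  next
    fix c x assume "x \<in> {a \<oplus> b | a b. a \<in> I \<and> b \<in> J}"
    then obtain a b where *: "x = a \<oplus> b" "a \<in> I" "b \<in> J" by blast
    then have "c \<odot> x = c \<odot> a \<oplus> c \<odot> b" using ID(1) JD(1) by (simp add: smult_add_right)
    then show "c \<odot> x \<in> {a \<oplus> b | a b. a \<in> I \<and> b \<in> J}" using * ID(4) JD(4) by blast
  next
    fix y x assume "x \<in> {a \<oplus> b | a b. a \<in> I \<and> b \<in> J}" and y: "y \<in> carrier L"
    then obtain a b where *: "x = a \<oplus> b" "a \<in> I" "b \<in> J" by blast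
    then have "y \<otimes> x = y \<otimes> a \<oplus> y \<otimes> b" using ID(1) JD(1) y by (simp add: bracket_add_right)
    then show "y \<otimes> x \<in> {a \<oplus> b | a b. a \<in> I \<and> b \<in> J}" using * I(2)[OF y] J(2)[OF y] by blast
  next
    have "\<zero> = \<zero> \<oplus> \<zero>" by simp
    then show "\<zero> \<in> {a \<oplus> b | a b. a \<in> I \<and> b \<in> J}" using ID(2) JD(2) by blast
  qed (use ID(1) JD(1) in auto)
qed

text \<open>The union of the ideals that avoid degree 0 is closed under addition because the sum of
  two of them avoids degree 0 as well: the degree 0 component of a + b is the sum of those of a and
  b, which lie in the respective ideals by homogeneity and are therefore zero.\<close>

lemma (in graded_lie_algebra) ex_greatest_ideal:
  assumes hom: "\<And>I F v i. \<lbrakk>lie_ideal L I; finite F; \<And>i. v i \<in> V i; (\<Oplus>i\<in>F. v i) \<in> I; i \<in> F\<rbrakk> \<Longrightarrow> v i \<in> I"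
  defines "J \<equiv> \<Union>{I. lie_ideal L I \<and> I \<inter> V 0 = {\<zero>}}"
  shows "lie_ideal L J" "J \<inter> V 0 = {\<zero>}"
proof -
  let ?P = "\<lambda>I. lie_ideal L I \<and> I \<inter> V 0 = {\<zero>}"
  have zero: "?P {\<zero>}" using VD(2) subspace_zero by (auto simp: lie_ideal_def)
  have sum: "?P {a \<oplus> b | a b. a \<in> I \<and> b \<in> I'}" if "?P I" "?P I'" for I I'
  proof
    show id: "lie_ideal L {a \<oplus> b | a b. a \<in> I \<and> b \<in> I'}" using that lie_ideal_sum by blast
    have "a \<oplus> b = \<zero>" if ab: "a \<in> I" "b \<in> I'" "a \<oplus> b \<in> V 0" for a b
    proof -
      have I: "I \<inter> V 0 = {\<zero>}" "lie_ideal L I" "I' \<inter> V 0 = {\<zero>}" "lie_ideal L I'"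
        using \<open>?P I\<close> \<open>?P I'\<close> by auto
      have c: "a \<in> carrier L" "b \<in> carrier L"
        using ab subspaceD(1)[OF lie_idealD(1)[OF I(2)]] subspaceD(1)[OF lie_idealD(1)[OF I(4)]] by auto
      have comp: "\<exists>F v. finite F \<and> (\<forall>i. v i \<in> V i) \<and> (\<forall>i. i \<notin> F \<longrightarrow> v i = \<zero>) \<and> x = (\<Oplus>i\<in>F. v i)"
        if "x \<in> carrier L" for x
        using homogeneous_sumsE[of x V] V_subspace that carrier_homogeneous by metis
      obtain F v where F: "finite F" "\<And>i. v i \<in> V i" "\<And>i. i \<notin> F \<Longrightarrow> v i = \<zero>" "a = (\<Oplus>i\<in>F. v i)"
        using comp[OF c(1)] by blast
      obtain G w where G: "finite G" "\<And>i. w i \<in> V i" "\<And>i. i \<notin> G \<Longrightarrow> w i = \<zero>" "b = (\<Oplus>i\<in>G. w i)"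
        using comp[OF c(2)] by blast
      have vw: "v i \<in> carrier L" "w i \<in> carrier L" for i using F(2) G(2) VD(1) by blast+
      have v0: "v 0 = \<zero>"
      proof (cases "0 \<in> F")
        case True
        then have "v 0 \<in> I" using hom[OF I(2) F(1,2)] ab(1) F(4) by blast
        then show ?thesis using I(1) F(2) by blast
      qed (use F(3) in blast)
      have w0: "w 0 = \<zero>"
      proof (cases "0 \<in> G")
        case True
        then have "w 0 \<in> I'" using hom[OF I(4) G(1,2)] ab(2) G(4) by blast
        then show ?thesis using I(3) G(2) by blast
      qed (use G(3) in blast)
      have a: "a = (\<Oplus>i\<in>F \<union> G. v i)"
        unfolding F(4) by (rule finsum_superset) (use F(1,3) G(1) vw in auto)
      have b: "b = (\<Oplus>i\<in>F \<union> G. w i)"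
        unfolding G(4) by (rule finsum_superset) (use G(1,3) F(1) vw in auto)
      have s: "a \<oplus> b = (\<Oplus>i\<in>F \<union> G. v i \<oplus> w i)"
        unfolding a b by (rule finsum_addf[symmetric]) (use vw in auto)
      have "(\<Oplus>i\<in>F \<union> G. v i \<oplus> w i) = v 0 \<oplus> w 0"
      proof (rule component_unique(1)[where v = "\<lambda>i. v i \<oplus> w i"])
        show "v i \<oplus> w i \<in> V i" for i using F(2) G(2) VD(3) by blast
        show "v i \<oplus> w i = \<zero>" if "i \<notin> F \<union> G" for i using F(3) G(3) that by simp
      qed (use F(1) G(1) s ab(3) in auto)
      then show ?thesis using s v0 w0 by simp
    qed
    then show "{a \<oplus> b | a b. a \<in> I \<and> b \<in> I'} \<inter> V 0 = {\<zero>}"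
      using subspaceD(2)[OF lie_idealD(1)[OF id]] VD(2) by blast
  qed
  have J_sub: "I \<subseteq> J" if "?P I" for I using that unfolding J_def by blast
  have J_mem: "\<exists>I. ?P I \<and> x \<in> I" if "x \<in> J" for x using that unfolding J_def by blast
  show "J \<inter> V 0 = {\<zero>}" using J_sub[OF zero] J_mem VD(2)[of 0] by blast
  show "lie_ideal L J"
    unfolding lie_ideal_def
  proof (intro conjI subspaceI ballI)
    show "J \<subseteq> carrier L"
    proof
      fix x assume "x \<in> J"
      then obtain I where "lie_ideal L I" "x \<in> I" using J_mem by blast
      then show "x \<in> carrier L" by (rule subspaceD(1)[OF lie_idealD(1)])
    qed
    show "\<zero> \<in> J" using J_sub[OF zero] by blast
    fix x y assume xy: "x \<in> J" "y \<in> J"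
    obtain I where I: "?P I" "x \<in> I" using J_mem[OF xy(1)] by blast
    obtain I' where I': "?P I'" "y \<in> I'" using J_mem[OF xy(2)] by blast
    have "x \<oplus> y \<in> {a \<oplus> b | a b. a \<in> I \<and> b \<in> I'}" using I(2) I'(2) by blast
    then show "x \<oplus> y \<in> J" using J_sub[OF sum[OF I(1) I'(1)]] by blast
  next
    fix c x assume "x \<in> J"
    then obtain I where I: "?P I" "x \<in> I" using J_mem by blast
    then have "c \<odot> x \<in> I" using subspaceD(4)[OF lie_idealD(1)] by simp
    then show "c \<odot> x \<in> J" using J_sub[OF I(1)] by blast
  next
    fix y x assume y: "y \<in> carrier L" and "x \<in> J"
    then obtain I where I: "?P I" "x \<in> I" using J_mem by blast
    then have "y \<otimes> x \<in> I" using lie_idealD(2) y by blast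
    then show "y \<otimes> x \<in> J" using J_sub[OF I(1)] by blast
  qed
qed

text \<open>\<open>separated\<close> supplies enough weights to embed \<open>H\<close> into the
  presented algebra, and \<open>rho\<close> gives the element whose adjoint action is the principal
  grading.\<close>

locale cartan_datum = H: complex_space H for H :: "(complex, 'h) module" +
  fixes n :: nat and \<alpha> :: "nat \<Rightarrow> 'h \<Rightarrow> complex" and \<alpha>\<^sub>c :: "nat \<Rightarrow> 'h" and \<rho> :: 'h
  assumes separated: "\<lbrakk>h \<in> carrier H; h \<noteq> \<zero>\<^bsub>H\<^esub>\<rbrakk> \<Longrightarrow> \<exists>\<mu>\<in>linear_maps H complex_line. \<mu> h \<noteq> 0"
    and root_linear: "i < n \<Longrightarrow> \<alpha> i \<in> linear_maps H complex_line"
    and coroot_carrier: "i < n \<Longrightarrow> \<alpha>\<^sub>c i \<in> carrier H" and coroot_nonzero: "i < n \<Longrightarrow> \<alpha>\<^sub>c i \<noteq> \<zero>\<^bsub>H\<^esub>"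
    and rho: "\<rho> \<in> carrier H" "i < n \<Longrightarrow> \<alpha> i \<rho> = 1"
begin

abbreviation cls :: "'h kac_generator lie_term \<Rightarrow> 'h kac_generator lie_term set"
  where "cls \<equiv> lie_class (kac_generators n H) (kac_relations n H \<alpha> \<alpha>\<^sub>c)"

abbreviation T :: "(complex, 'h kac_generator lie_term set) module"
  where "T \<equiv> kac_tilde n H \<alpha> \<alpha>\<^sub>c"

definition ht :: "'h \<Rightarrow> 'h kac_generator lie_term set" where "ht h = cls (Gen (Gen_h h))"
definition et :: "nat \<Rightarrow> 'h kac_generator lie_term set" where "et i = cls (Gen (Gen_e i))"
definition ft :: "nat \<Rightarrow> 'h kac_generator lie_term set" where "ft i = cls (Gen (Gen_f i))"

lemmas T_simps = presented_simps[of "kac_generators n H" "kac_relations n H \<alpha> \<alpha>\<^sub>c", folded kac_tilde_def]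

sublocale T: lie_algebra T
  unfolding kac_tilde_def by (rule presented_lie_algebra)

lemma gen_carrier [simp]: "ht h \<in> carrier T" "et i \<in> carrier T" "ft i \<in> carrier T"
  by (auto simp: ht_def et_def ft_def T_simps)

lemma T_rels:
  "\<lbrakk>i < n; j < n\<rbrakk> \<Longrightarrow> et i \<otimes>\<^bsub>T\<^esub> ft j = (if i = j then ht (\<alpha>\<^sub>c i) else \<zero>\<^bsub>T\<^esub>)"
  "\<lbrakk>h \<in> carrier H; h' \<in> carrier H\<rbrakk> \<Longrightarrow> ht h \<otimes>\<^bsub>T\<^esub> ht h' = \<zero>\<^bsub>T\<^esub>"
  "\<lbrakk>h \<in> carrier H; i < n\<rbrakk> \<Longrightarrow> ht h \<otimes>\<^bsub>T\<^esub> et i = \<alpha> i h \<odot>\<^bsub>T\<^esub> et i"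
  "\<lbrakk>h \<in> carrier H; i < n\<rbrakk> \<Longrightarrow> ht h \<otimes>\<^bsub>T\<^esub> ft i = (- \<alpha> i h) \<odot>\<^bsub>T\<^esub> ft i"
  "\<lbrakk>h \<in> carrier H; h' \<in> carrier H\<rbrakk> \<Longrightarrow> ht (h \<oplus>\<^bsub>H\<^esub> h') = ht h \<oplus>\<^bsub>T\<^esub> ht h'"
  "h \<in> carrier H \<Longrightarrow> ht (c \<odot>\<^bsub>H\<^esub> h) = c \<odot>\<^bsub>T\<^esub> ht h"
proof -
  assume ij: "i < n" "j < n"
  show "et i \<otimes>\<^bsub>T\<^esub> ft j = (if i = j then ht (\<alpha>\<^sub>c i) else \<zero>\<^bsub>T\<^esub>)"
    using lie_eq.relation[OF kac_relations.intros(1)[OF ij, where \<hh> = H and \<alpha> = \<alpha> and \<alpha>\<^sub>c = \<alpha>\<^sub>c], of "kac_generators n H"]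
    by (auto simp: ht_def et_def ft_def T_simps lie_class_eq_iff split: if_splits)
qed (auto simp: ht_def et_def ft_def T_simps lie_class_eq_iff intro!: lie_eq.relation kac_relations.intros)

lemma ht_linear: "ht \<in> linear_maps H T"
  using T_rels(5,6) by (simp add: linear_maps_iff)

text \<open>A nonzero h has some weight \<mu> with \<mu> h nonzero. In the representation on words
  with highest weight \<mu>, h multiplies the value at the empty word by this number, so its class
  is not zero.\<close>

lemma ht_zero_iff: "h \<in> carrier H \<Longrightarrow> ht h = \<zero>\<^bsub>T\<^esub> \<longleftrightarrow> h = \<zero>\<^bsub>H\<^esub>"
proof
  assume h: "h \<in> carrier H" and 0: "ht h = \<zero>\<^bsub>T\<^esub>"
  show "h = \<zero>\<^bsub>H\<^esub>"
  proof (rule ccontr)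
    assume "h \<noteq> \<zero>\<^bsub>H\<^esub>"
    then obtain \<mu> where \<mu>: "\<mu> \<in> linear_maps H complex_line" "\<mu> h \<noteq> 0" using separated h by blast
    \<comment> \<open>Words may contain every natural number as a letter, so the roots are extended
      by zero to keep all weights linear.\<close>
    define \<alpha>' where "\<alpha>' i h = (if i < n then \<alpha> i h else 0)" for i h
    define g where "g x = (case x of Gen_e i \<Rightarrow> if i < n then word_e \<alpha>' \<alpha>\<^sub>c \<mu> i else (\<lambda>\<phi> w. 0)
      | Gen_f i \<Rightarrow> if i < n then word_f i else (\<lambda>\<phi> w. 0)
      | Gen_h h \<Rightarrow> if h \<in> carrier H then word_h \<alpha>' \<mu> h else (\<lambda>\<phi> w. 0))" for x
    have a: "\<alpha>' i (h \<oplus>\<^bsub>H\<^esub> h') = \<alpha>' i h + \<alpha>' i h'" "\<alpha>' i (c \<odot>\<^bsub>H\<^esub> h) = c * \<alpha>' i h"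
      "\<mu> (h \<oplus>\<^bsub>H\<^esub> h') = \<mu> h + \<mu> h'" "\<mu> (c \<odot>\<^bsub>H\<^esub> h) = c * \<mu> h"
      if "h \<in> carrier H" "h' \<in> carrier H" for i h h' c
      using root_linear[of i] \<mu>(1) that by (auto simp: \<alpha>'_def linear_maps_iff)
    have w: "word_weight \<alpha>' \<mu> u (h \<oplus>\<^bsub>H\<^esub> h') = word_weight \<alpha>' \<mu> u h + word_weight \<alpha>' \<mu> u h'"
      "word_weight \<alpha>' \<mu> u (c \<odot>\<^bsub>H\<^esub> h) = c * word_weight \<alpha>' \<mu> u h"
      if "h \<in> carrier H" "h' \<in> carrier H" for u h h' c
      using that by (induct u) (auto simp: word_weight_def a algebra_simps)
    have lin: "linear_operator (g x)" for x
      by (cases x) (auto simp: g_def linear_operator_def fun_eq_iff word_e_linear word_f_def word_h_def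
          algebra_simps split: list.split)
    have X: "g x = (\<lambda>\<phi> w. 0)" if "x \<notin> kac_generators n H" for x
      using that by (cases x) (auto simp: g_def kac_generators_def)
    have R: "lie_eval g s = lie_eval g t" if "(s, t) \<in> kac_relations n H \<alpha> \<alpha>\<^sub>c" for s t
      using that
    proof cases
      case (1 i j)
      then show ?thesis
        using word_e_f[of \<alpha>' \<alpha>\<^sub>c \<mu> i j] coroot_carrier by (auto simp: g_def fun_eq_iff)
    next
      case (2 h h')
      then show ?thesis by (auto simp: g_def fun_eq_iff word_h_def)
    next
      case (3 h i)
      then show ?thesis
        using word_h_e[of \<alpha>' \<mu> h \<alpha>\<^sub>c i] by (auto simp: g_def fun_eq_iff \<alpha>'_def)
    next
      case (4 h i)
      then show ?thesis
        using word_h_f[of \<alpha>' \<mu> h i] by (auto simp: g_def fun_eq_iff \<alpha>'_def)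
    next
      case (5 h h')
      then show ?thesis by (auto simp: g_def fun_eq_iff word_h_def w algebra_simps)
    next
      case (6 h c)
      then show ?thesis by (auto simp: g_def fun_eq_iff word_h_def w algebra_simps)
    qed
    have "lie_eq (kac_generators n H) (kac_relations n H \<alpha> \<alpha>\<^sub>c) (Gen (Gen_h h)) Zero"
      using 0 by (simp add: ht_def T_simps lie_class_eq_iff)
    from lie_eval_cong[OF lin X R this]
    have "word_h \<alpha>' \<mu> h (\<lambda>_. 1) [] = 0" using h by (simp add: g_def fun_eq_iff)
    then show False using \<mu>(2) by (simp add: word_h_def word_weight_def)
  qed
qed (use linear_map_zero[OF H.complex_space_axioms T.complex_space_axioms ht_linear] in simp)

text \<open>The degree is not read off from terms but defined as an eigenvalue of ad \<rho>:
  well-definedness on classes is then free, and every ideal is homogeneous.\<close>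

definition VT :: "int \<Rightarrow> 'h kac_generator lie_term set set"
  where "VT k = {x \<in> carrier T. ht \<rho> \<otimes>\<^bsub>T\<^esub> x = of_int k \<odot>\<^bsub>T\<^esub> x}"

lemma T_chevalley: "chevalley_graded T VT H n \<alpha> \<alpha>\<^sub>c ht et ft"
proof -
  interpret G: lie_gradation T VT
    unfolding VT_def by (rule T.eigenspace_gradation) simp
  let ?H = "ht ` carrier H"
  define E where "E = {\<Oplus>\<^bsub>T\<^esub>i\<in>{..<n}. c i \<odot>\<^bsub>T\<^esub> et i | c. True}"
  define F where "F = {\<Oplus>\<^bsub>T\<^esub>i\<in>{..<n}. c i \<odot>\<^bsub>T\<^esub> ft i | c. True}"
  have Es: "T.subspace E" and Fs: "T.subspace F" unfolding E_def F_def by (rule T.lincombs_subspace; simp)+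
  have E_min: "E \<subseteq> S" if "\<And>i. i < n \<Longrightarrow> et i \<in> S" "T.subspace S" for S
    unfolding E_def by (rule T.lincombs_minimal[OF that])
  have F_min: "F \<subseteq> S" if "\<And>i. i < n \<Longrightarrow> ft i \<in> S" "T.subspace S" for S
    unfolding F_def by (rule T.lincombs_minimal[OF that])
  have Hs: "T.subspace ?H"
  proof (rule T.subspaceI)
    show "\<zero>\<^bsub>T\<^esub> \<in> ?H" using ht_zero_iff[of "\<zero>\<^bsub>H\<^esub>"] by force
  qed (auto simp: T_rels(5,6)[symmetric])
  have eE: "et i \<in> E" if "i < n" for i unfolding E_def by (rule T.lincombs_incl[OF _ that]) simp
  have fF: "ft i \<in> F" if "i < n" for i unfolding F_def by (rule T.lincombs_incl[OF _ that]) simp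
  have HE: "ht h \<otimes>\<^bsub>T\<^esub> x \<in> E" if h: "h \<in> carrier H" and x: "x \<in> E" for h x
  proof -
    have "E \<subseteq> {x \<in> carrier T. ht h \<otimes>\<^bsub>T\<^esub> x \<in> E}"
      by (rule E_min[OF _ T.ad_vimage_subspace(1)[OF Es]])
        (use h T.subspaceD(4)[OF Es eE] in \<open>simp_all add: T_rels\<close>)
    then show ?thesis using x by blast
  qed
  have HF: "ht h \<otimes>\<^bsub>T\<^esub> x \<in> F" if h: "h \<in> carrier H" and x: "x \<in> F" for h x
  proof -
    have "F \<subseteq> {x \<in> carrier T. ht h \<otimes>\<^bsub>T\<^esub> x \<in> F}"
      by (rule F_min[OF _ T.ad_vimage_subspace(1)[OF Fs]])
        (use h T.subspaceD(4)[OF Fs fF] in \<open>simp_all add: T_rels\<close>)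
    then show ?thesis using x by blast
  qed
  have Ef: "x \<otimes>\<^bsub>T\<^esub> ft j \<in> ?H" if "j < n" "x \<in> E" for x j
  proof -
    have "E \<subseteq> {x \<in> carrier T. x \<otimes>\<^bsub>T\<^esub> ft j \<in> ?H}"
      by (rule E_min[OF _ T.ad_vimage_subspace(2)[OF Hs]])
        (use that(1) coroot_carrier T.subspaceD(2)[OF Hs] in \<open>simp_all add: T_rels\<close>)
    then show ?thesis using that(2) by blast
  qed
  have EF: "x \<otimes>\<^bsub>T\<^esub> y \<in> ?H" if "x \<in> E" "y \<in> F" for x y
  proof -
    have xc: "x \<in> carrier T" using T.subspaceD(1)[OF Es that(1)] .
    have "F \<subseteq> {y \<in> carrier T. x \<otimes>\<^bsub>T\<^esub> y \<in> ?H}"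
      by (rule F_min[OF _ T.ad_vimage_subspace(1)[OF Hs xc]])
        (use Ef[OF _ that(1)] in simp)
    then show ?thesis using that(2) by blast
  qed
  have tri: "local_triple T ?H E F"
    by (rule local_triple.intro[OF T.lie_algebra_axioms], rule local_triple_axioms.intro)
      (use Hs Es Fs EF HE HF T.subspaceD(2)[OF Hs] in \<open>auto simp: T_rels(2)\<close>)
  have H0: "?H \<subseteq> VT 0" using rho by (auto simp: VT_def T_rels(2))
  have E1: "E \<subseteq> VT 1"
    by (rule E_min[OF _ G.V_subspace]) (simp add: VT_def T_rels rho)
  have F1: "F \<subseteq> VT (-1)"
    by (rule F_min[OF _ G.V_subspace]) (simp add: VT_def T_rels rho)
  let ?X = "F \<union> ?H \<union> E"
  have Xc: "?X \<subseteq> carrier T" using T.subspaceD(5) Hs Es Fs by blast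
  have "(\<lambda>x. cls (Gen x)) ` kac_generators n H \<subseteq> ?X"
    using eE fF by (auto simp: kac_generators_def et_def ft_def ht_def)
  then have "lie_generated T ((\<lambda>x. cls (Gen x)) ` kac_generators n H) \<subseteq> lie_generated T ?X"
    by (intro T.lie_generated_minimal T.lie_generated_subalgebra[OF Xc]
        subset_trans[OF _ T.lie_generated_superset[of ?X]])
  then have gen: "lie_generated T ?X = carrier T"
    using presented_generated[of "kac_generators n H" "kac_relations n H \<alpha> \<alpha>\<^sub>c", folded kac_tilde_def]
      T.lie_generated_subset_carrier[OF Xc] by blast
  have VT_carrier: "carrier T \<inter> VT k = VT k" for k by (auto simp: VT_def)
  \<comment> \<open>As the triple generates everything, the eigenspaces exhaust the algebra, and
    degrees 0, 1, -1 are no larger than \<open>?H\<close>, \<open>E\<close>,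
    \<open>F\<close>.\<close>
  note tr = G.generated_by_triple[OF tri H0 E1 F1, unfolded gen]
  have V: "VT 0 = ?H" "VT 1 = E" "VT (-1) = F"
    using tr(1-3) unfolding VT_carrier by auto
  have graded: "graded_lie_algebra T VT"
  proof (intro graded_lie_algebra.intro graded_lie_algebra_axioms.intro T.lie_algebra_axioms)
    show "lie_generated T (VT (- 1) \<union> VT 0 \<union> VT 1) = carrier T" unfolding V by (rule gen)
    fix x assume "x \<in> carrier T"
    then have "x \<in> T.homogeneous_sums VT" using tr(4) unfolding VT_carrier by blast
    then show "\<exists>F v. finite F \<and> (\<forall>i\<in>F. v i \<in> VT i) \<and> x = (\<Oplus>\<^bsub>T\<^esub>i\<in>F. v i)"
      unfolding T.homogeneous_sums_def by blast
  qed (rule G.V_subspace, rule G.V_independent, auto intro: G.V_bracket)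
  have hn: "ht (\<alpha>\<^sub>c j) \<noteq> \<zero>\<^bsub>T\<^esub>" if "j < n" for j
    using ht_zero_iff[OF coroot_carrier[OF that]] coroot_nonzero[OF that] by simp
  have eb: "T.family_basis n et E"
    unfolding T.family_basis_def E_def
  proof (intro conjI allI impI)
    fix c j assume c: "(\<Oplus>\<^bsub>T\<^esub>i\<in>{..<n}. c i \<odot>\<^bsub>T\<^esub> et i) = \<zero>\<^bsub>T\<^esub>" and j: "j < n"
    have "(\<Oplus>\<^bsub>T\<^esub>i\<in>{..<n}. c i \<odot>\<^bsub>T\<^esub> et i) \<otimes>\<^bsub>T\<^esub> ft j = c j \<odot>\<^bsub>T\<^esub> ht (\<alpha>\<^sub>c j)"
      by (rule T.comb_bracket_diagonal) (use j in \<open>auto simp: T_rels\<close>)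
    then have "c j \<odot>\<^bsub>T\<^esub> ht (\<alpha>\<^sub>c j) = \<zero>\<^bsub>T\<^esub>" using c by simp
    then show "c j = 0" using T.smult_eq_zero[of "c j" "ht (\<alpha>\<^sub>c j)"] hn[OF j] by auto
  qed simp_all
  have fe: "ft i \<otimes>\<^bsub>T\<^esub> et j = (if i = j then \<ominus>\<^bsub>T\<^esub> ht (\<alpha>\<^sub>c j) else \<zero>\<^bsub>T\<^esub>)" if "i < n" "j < n" for i j
    using T.bracket_anticommute[of "ft i" "et j"] T_rels(1)[OF that(2,1)] T.smult_m1[of "\<zero>\<^bsub>T\<^esub>"] by auto
  have fb: "T.family_basis n ft F"
    unfolding T.family_basis_def F_def
  proof (intro conjI allI impI)
    fix c j assume c: "(\<Oplus>\<^bsub>T\<^esub>i\<in>{..<n}. c i \<odot>\<^bsub>T\<^esub> ft i) = \<zero>\<^bsub>T\<^esub>" and j: "j < n"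
    have "(\<Oplus>\<^bsub>T\<^esub>i\<in>{..<n}. c i \<odot>\<^bsub>T\<^esub> ft i) \<otimes>\<^bsub>T\<^esub> et j = c j \<odot>\<^bsub>T\<^esub> \<ominus>\<^bsub>T\<^esub> ht (\<alpha>\<^sub>c j)"
      by (rule T.comb_bracket_diagonal) (use j in \<open>auto simp: fe\<close>)
    then have "c j \<odot>\<^bsub>T\<^esub> \<ominus>\<^bsub>T\<^esub> ht (\<alpha>\<^sub>c j) = \<zero>\<^bsub>T\<^esub>" using c by simp
    then show "c j = 0"
      using T.smult_eq_zero[of "c j" "\<ominus>\<^bsub>T\<^esub> ht (\<alpha>\<^sub>c j)"] T.minus_nonzero[OF _ hn[OF j]] by auto
  qed simp_all
  have "inj_on ht (carrier H)"
  proof (rule inj_onI)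
    fix h h' assume h: "h \<in> carrier H" "h' \<in> carrier H" "ht h = ht h'"
    have "ht (h \<oplus>\<^bsub>H\<^esub> (-1) \<odot>\<^bsub>H\<^esub> h') = ht h \<oplus>\<^bsub>T\<^esub> (-1) \<odot>\<^bsub>T\<^esub> ht h'"
      using h by (subst T_rels(5), simp, simp, subst T_rels(6)) auto
    also have "\<dots> = \<zero>\<^bsub>T\<^esub>" using h(3) by (simp add: T.smult_m1 T.r_neg)
    finally have "h \<oplus>\<^bsub>H\<^esub> (-1) \<odot>\<^bsub>H\<^esub> h' = \<zero>\<^bsub>H\<^esub>" using ht_zero_iff h by simp
    then show "h = h'" using h H.minus_other_side[of h h'] by (simp add: H.smult_m1 a_minus_def)
  qed
  then show ?thesis
    by (intro chevalley_graded.intro chevalley_graded_axioms.intro graded H.complex_space_axioms)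
      (auto simp: V eb fb ht_linear bij_betw_def coroot_carrier T_rels)
qed

sublocale TG: chevalley_graded T VT H n \<alpha> \<alpha>\<^sub>c ht et ft by (rule T_chevalley)

definition JT :: "'h kac_generator lie_term set set"
  where "JT = \<Union>{I. lie_ideal T I \<and> I \<inter> VT 0 = {\<zero>\<^bsub>T\<^esub>}}"

lemma T_ideal_homogeneous:
  assumes "lie_ideal T I" "finite F" "\<And>i. v i \<in> VT i" "(\<Oplus>\<^bsub>T\<^esub>i\<in>F. v i) \<in> I" "i \<in> F"
  shows "v i \<in> I"
  by (rule T.eigenvector_components_in[OF gen_carrier(1)[of \<rho>] T.lie_idealD(1)[OF assms(1)]
      T.lie_idealD(2)[OF assms(1)] assms(2)])
    (use assms(3-5) in \<open>auto simp: VT_def\<close>)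

lemma JT: "lie_ideal T JT" "JT \<inter> VT 0 = {\<zero>\<^bsub>T\<^esub>}"
  unfolding JT_def by (rule TG.ex_greatest_ideal; rule T_ideal_homogeneous; assumption)+

lemma JT_greatest: "\<lbrakk>lie_ideal T I; I \<inter> VT 0 = {\<zero>\<^bsub>T\<^esub>}\<rbrakk> \<Longrightarrow> I \<subseteq> JT"
  unfolding JT_def by blast

text \<open>The \<open>GREATEST\<close> in the definition can be evaluated because \<open>JT\<close>
  is known to be the greatest ideal of this kind, and degree 0 to be the image of the Cartan
  space.\<close>

lemma kac_algebra_eq: "kac_algebra n H \<alpha> \<alpha>\<^sub>c = lie_quotient T JT"
proof -
  have "kac_tilde_cartan n H \<alpha> \<alpha>\<^sub>c = VT 0"
    using TG.hh_bij by (simp add: kac_tilde_cartan_def ht_def bij_betw_def)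
  moreover have "(GREATEST J. lie_ideal T J \<and> J \<inter> VT 0 = {\<zero>\<^bsub>T\<^esub>}) = JT"
    by (rule Greatest_equality) (use JT JT_greatest in auto)
  ultimately show ?thesis by (simp add: kac_algebra_def)
qed

definition VK :: "int \<Rightarrow> 'h kac_generator lie_term set set set"
  where "VK k = (\<lambda>x. JT +>\<^bsub>T\<^esub> x) ` VT k"

definition hk :: "'h \<Rightarrow> 'h kac_generator lie_term set set" where "hk h = JT +>\<^bsub>T\<^esub> ht h"
definition ek :: "nat \<Rightarrow> 'h kac_generator lie_term set set" where "ek i = JT +>\<^bsub>T\<^esub> et i"
definition fk :: "nat \<Rightarrow> 'h kac_generator lie_term set set" where "fk i = JT +>\<^bsub>T\<^esub> ft i"

lemma kac_chevalley: "chevalley_graded (kac_algebra n H \<alpha> \<alpha>\<^sub>c) VK H n \<alpha> \<alpha>\<^sub>c hk ek fk"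
  unfolding kac_algebra_eq VK_def hk_def ek_def fk_def
  by (rule TG.quotient_chevalley[OF JT(1) _ JT(2)])
    (rule T_ideal_homogeneous[OF JT(1)] coroot_nonzero; assumption)+

text \<open>Lifted to the presented algebra: if degree -1 moves x, of degree at least 2, into
  \<open>JT\<close>, then x itself belongs to \<open>JT\<close> by maximality
  (\<open>maximal_ideal_transitive\<close>).\<close>

lemma kac_transitive: "transitive_grading (kac_algebra n H \<alpha> \<alpha>\<^sub>c) VK"
proof -
  interpret fl: chevalley_graded T "\<lambda>k. VT (- k)" H n "\<lambda>i h. - \<alpha> i h" "\<lambda>i. \<ominus>\<^bsub>H\<^esub> \<alpha>\<^sub>c i" ht ft et
    by (rule TG.flip_chevalley)
  note qh = lie_homD[OF T.quotient_hom[OF JT(1)]] and q0 = T.quotient_eq_zero_iff[OF JT(1)]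
  have key: "x \<in> JT" if k: "2 \<le> k" "x \<in> VT k" "\<forall>y\<in>VK (-1). y \<otimes>\<^bsub>lie_quotient T JT\<^esub> (JT +>\<^bsub>T\<^esub> x) = \<zero>\<^bsub>lie_quotient T JT\<^esub>" for k x
  proof (rule TG.maximal_ideal_transitive[OF JT JT_greatest _ k(1,2)])
    fix f assume f: "f \<in> VT (-1)"
    have c: "f \<in> carrier T" "x \<in> carrier T" using TG.VD(1) f k(2) by blast+
    have "(JT +>\<^bsub>T\<^esub> f) \<otimes>\<^bsub>lie_quotient T JT\<^esub> (JT +>\<^bsub>T\<^esub> x) = \<zero>\<^bsub>lie_quotient T JT\<^esub>"
      using k(3) f by (simp add: VK_def)
    then show "f \<otimes>\<^bsub>T\<^esub> x \<in> JT" using qh(4)[OF c] q0[of "f \<otimes>\<^bsub>T\<^esub> x"] c by simp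
  next
    show "x = \<zero>\<^bsub>T\<^esub>" if "x \<in> VT 1" "\<And>f. f \<in> VT (-1) \<Longrightarrow> f \<otimes>\<^bsub>T\<^esub> x = \<zero>\<^bsub>T\<^esub>" for x
      by (rule TG.local_transitive[OF coroot_nonzero that])
  qed
  have key': "x \<in> JT" if k: "2 \<le> k" "x \<in> VT (- k)" "\<forall>y\<in>VK 1. y \<otimes>\<^bsub>lie_quotient T JT\<^esub> (JT +>\<^bsub>T\<^esub> x) = \<zero>\<^bsub>lie_quotient T JT\<^esub>" for k x
  proof (rule fl.maximal_ideal_transitive[OF JT(1) _ _ _ k(1,2)])
    show "JT \<inter> VT (- 0) = {\<zero>\<^bsub>T\<^esub>}" using JT(2) by simp
    show "I \<subseteq> JT" if "lie_ideal T I" "I \<inter> VT (- 0) = {\<zero>\<^bsub>T\<^esub>}" for I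
      using JT_greatest that by simp
    show "x = \<zero>\<^bsub>T\<^esub>" if "x \<in> VT (- 1)" "\<And>f. f \<in> VT (- (- 1)) \<Longrightarrow> f \<otimes>\<^bsub>T\<^esub> x = \<zero>\<^bsub>T\<^esub>" for x
    proof (rule fl.local_transitive[OF _ that])
      show "\<ominus>\<^bsub>H\<^esub> \<alpha>\<^sub>c i \<noteq> \<zero>\<^bsub>H\<^esub>" if "i < n" for i
        by (rule H.minus_nonzero[OF coroot_carrier[OF that] coroot_nonzero[OF that]])
    qed
    fix f assume f: "f \<in> VT (- (- 1))"
    have c: "f \<in> carrier T" "x \<in> carrier T" using TG.VD(1) f k(2) by blast+
    have "(JT +>\<^bsub>T\<^esub> f) \<otimes>\<^bsub>lie_quotient T JT\<^esub> (JT +>\<^bsub>T\<^esub> x) = \<zero>\<^bsub>lie_quotient T JT\<^esub>"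
      using k(3) f by (simp add: VK_def)
    then show "f \<otimes>\<^bsub>T\<^esub> x \<in> JT" using qh(4)[OF c] q0[of "f \<otimes>\<^bsub>T\<^esub> x"] c by simp
  qed
  show ?thesis
    unfolding transitive_grading_def kac_algebra_eq
  proof (intro conjI allI impI ballI)
    fix k X assume k: "2 \<le> k" "X \<in> VK k" "\<forall>y\<in>VK (-1). y \<otimes>\<^bsub>lie_quotient T JT\<^esub> X = \<zero>\<^bsub>lie_quotient T JT\<^esub>"
    then obtain x where x: "x \<in> VT k" "X = JT +>\<^bsub>T\<^esub> x" by (auto simp: VK_def)
    then show "X = \<zero>\<^bsub>lie_quotient T JT\<^esub>"
      using key[of k x] k q0[of x] TG.VD(1)[OF x(1)] by simp
  next
    fix k X assume k: "2 \<le> k" "X \<in> VK (- k)" "\<forall>y\<in>VK 1. y \<otimes>\<^bsub>lie_quotient T JT\<^esub> X = \<zero>\<^bsub>lie_quotient T JT\<^esub>"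
    then obtain x where x: "x \<in> VT (- k)" "X = JT +>\<^bsub>T\<^esub> x" by (auto simp: VK_def)
    then show "X = \<zero>\<^bsub>lie_quotient T JT\<^esub>"
      using key'[of k x] k q0[of x] TG.VD(1)[OF x(1)] by simp
  qed
qed

end

section \<open>The derived algebra\<close>

context lie_algebra
begin

lemma subalgebra_lie_algebra:
  assumes "lie_subalgebra L M"
  shows "lie_algebra (L\<lparr>carrier := M\<rparr>)"
proof -
  have M: "subspace M" "\<And>x y. \<lbrakk>x \<in> M; y \<in> M\<rbrakk> \<Longrightarrow> x \<otimes> y \<in> M"
    using assms by (auto simp: lie_subalgebra_def)
  note MD = subspaceD(1)[OF M(1)]
  show ?thesis
    by (rule lie_algebraI[OF restrict_complex_space[OF M(1)]])
      (auto simp: M(2) MD bracket_add_left bracket_add_right bracket_smult_left bracket_smult_right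
        bracket_alternating jacobi)
qed

lemma restrict_subspace_iff:
  assumes "subspace M" "S \<subseteq> M"
  shows "VectorSpace.subspace complex_ring S (L\<lparr>carrier := M\<rparr>) \<longleftrightarrow> subspace S"
proof -
  interpret M: complex_space "L\<lparr>carrier := M\<rparr>" by (rule restrict_complex_space[OF assms(1)])
  show ?thesis using assms subspaceD(5)[OF assms(1)] by (auto simp: subspace_iff M.subspace_iff)
qed

lemma restrict_generated:
  assumes M: "lie_subalgebra L M" and X: "X \<subseteq> M" "lie_generated L X = M"
  shows "lie_generated (L\<lparr>carrier := M\<rparr>) X = M"
proof -
  have sM: "subspace M" using M by (simp add: lie_subalgebra_def)
  interpret M: lie_algebra "L\<lparr>carrier := M\<rparr>" by (rule subalgebra_lie_algebra[OF M])
  have "M \<subseteq> S" if S: "lie_subalgebra (L\<lparr>carrier := M\<rparr>) S" "X \<subseteq> S" for S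
  proof -
    have SM: "S \<subseteq> M" using S(1) M.subspaceD(5) by (auto simp: lie_subalgebra_def)
    then have "lie_subalgebra L S"
      using S(1) restrict_subspace_iff[OF sM SM] by (simp add: lie_subalgebra_def)
    from lie_generated_minimal[OF this S(2)] show ?thesis using X(2) by simp
  qed
  then show ?thesis using M.lie_generated_subset_carrier[of X] X(1) unfolding lie_generated_def by auto
qed

end

lemma transitive_grading_restrict:
  assumes "transitive_grading L V" "V (-1) \<subseteq> M" "V 1 \<subseteq> M"
  shows "transitive_grading (L\<lparr>carrier := M\<rparr>) (\<lambda>k. M \<inter> V k)"
proof -
  have e: "M \<inter> V (-1) = V (-1)" "M \<inter> V 1 = V 1" using assms by auto
  show ?thesis
    using assms(1) unfolding transitive_grading_def e by auto
qed

context chevalley_graded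
begin

definition coroot_span :: "'h set"
  where "coroot_span = {\<Oplus>\<^bsub>H\<^esub>i\<in>{..<n}. c i \<odot>\<^bsub>H\<^esub> \<alpha>\<^sub>c i | c. True}"

lemma coroot_span_subspace: "H.subspace coroot_span"
  unfolding coroot_span_def by (rule H.lincombs_subspace) (rule coroot)

lemma coroot_in_span: "j < n \<Longrightarrow> \<alpha>\<^sub>c j \<in> coroot_span"
  unfolding coroot_span_def by (rule H.lincombs_incl[where b = \<alpha>\<^sub>c and n = n, OF coroot])

text \<open>[L, L] is identified with the subalgebra \<open>N\<close> generated by degrees 1, -1 and
  the coroots. It contains \<open>N\<close> because ad \<rho> reproduces each e and f up to sign;
  conversely \<open>N\<close> is an ideal, and the quotient by it is abelian because degree 0
  is.\<close>

lemma derived_chevalley: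
  assumes \<rho>: "\<rho> \<in> carrier H" "\<And>i. i < n \<Longrightarrow> \<alpha> i \<rho> = 1"
  defines "M \<equiv> carrier (derived_algebra L)"
  shows "chevalley_graded (derived_algebra L) (\<lambda>k. M \<inter> V k) (H\<lparr>carrier := coroot_span\<rparr>) n \<alpha> \<alpha>\<^sub>c hh ee ff"
    "V 1 \<subseteq> M" "V (-1) \<subseteq> M"
proof -
  define S0 where "S0 = hh ` coroot_span"
  have hc: "h \<in> carrier H" if "h \<in> coroot_span" for h
    using H.subspaceD(1)[OF coroot_span_subspace that] .
  note hs = H.subspaceD[OF coroot_span_subspace]
  have S0s: "subspace S0"
  proof (rule subspaceI)
    show "\<zero> \<in> S0" using hhD(5) hs(2) unfolding S0_def by force
  qed (use hc hs(3,4) hhD(2) in \<open>auto simp: S0_def hhD(3,4)[OF hc, symmetric] hhD(3)[OF hc hc, symmetric]\<close>)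
  have S0V: "S0 \<subseteq> V 0" using hc hhD(1) by (auto simp: S0_def)
  have abel: "x \<otimes> y = \<zero>" if "x \<in> V 0" "y \<in> V 0" for x y
    using hhD(6)[OF that(1)] hhD(6)[OF that(2)] hh_hh by auto
  have cS: "hh (\<alpha>\<^sub>c j) \<in> S0" if "j < n" for j
    unfolding S0_def using coroot_in_span[OF that] by blast
  have V1: "V 1 = {\<Oplus>i\<in>{..<n}. c i \<odot> ee i | c. True}" and Vm1: "V (-1) = {\<Oplus>i\<in>{..<n}. c i \<odot> ff i | c. True}"
    using e_basis f_basis by (auto simp: family_basis_def)
  have V1_min: "V 1 \<subseteq> S" if "\<And>i. i < n \<Longrightarrow> ee i \<in> S" "subspace S" for S
    unfolding V1 by (rule lincombs_minimal[OF that])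
  have Vm1_min: "V (-1) \<subseteq> S" if "\<And>i. i < n \<Longrightarrow> ff i \<in> S" "subspace S" for S
    unfolding Vm1 by (rule lincombs_minimal[OF that])
  have S0_min: "S0 \<subseteq> S" if "\<And>i. i < n \<Longrightarrow> hh (\<alpha>\<^sub>c i) \<in> S" "subspace S" for S
  proof -
    have "hh h \<in> S" if h: "h \<in> coroot_span" for h
    proof -
      obtain c where "h = (\<Oplus>\<^bsub>H\<^esub>i\<in>{..<n}. c i \<odot>\<^bsub>H\<^esub> \<alpha>\<^sub>c i)"
        using h by (auto simp: coroot_span_def)
      then have "hh h = (\<Oplus>i\<in>{..<n}. c i \<odot> hh (\<alpha>\<^sub>c i))"
        using linear_lincomb[OF H.complex_space_axioms complex_space_axioms hh_linear,
            where b = \<alpha>\<^sub>c and n = n, OF coroot] by simp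
      then show ?thesis
        using subspaceD(4)[OF \<open>subspace S\<close>] \<open>\<And>i. i < n \<Longrightarrow> hh (\<alpha>\<^sub>c i) \<in> S\<close>
        by (auto intro!: subspace_finsum[OF \<open>subspace S\<close>])
    qed
    then show ?thesis by (auto simp: S0_def)
  qed
  have Ef: "x \<otimes> ff j \<in> S0" if "j < n" "x \<in> V 1" for x j
  proof -
    have "V 1 \<subseteq> {x \<in> carrier L. x \<otimes> ff j \<in> S0}"
      by (rule V1_min[OF _ ad_vimage_subspace(2)[OF S0s]])
        (use that(1) cS subspaceD(2)[OF S0s] eD(1) fD(1) in \<open>simp_all add: e_f\<close>)
    then show ?thesis using that(2) by blast
  qed
  have EF: "x \<otimes> y \<in> S0" if "x \<in> V 1" "y \<in> V (-1)" for x y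
  proof -
    have xc: "x \<in> carrier L" using VD(1)[OF that(1)] .
    have "V (-1) \<subseteq> {y \<in> carrier L. x \<otimes> y \<in> S0}"
      by (rule Vm1_min[OF _ ad_vimage_subspace(1)[OF S0s xc]]) (use Ef[OF _ that(1)] fD(1) in simp)
    then show ?thesis using that(2) by blast
  qed
  have tri: "local_triple L S0 (V 1) (V (-1))"
    by (rule local_triple.intro[OF lie_algebra_axioms], rule local_triple_axioms.intro)
      (use S0s V_subspace EF S0V abel subspaceD(2)[OF S0s] V_bracket[of _ 0 _ 1] V_bracket[of _ 0 _ "-1"]
        in \<open>auto simp: subset_iff\<close>)
  let ?X = "V (-1) \<union> S0 \<union> V 1"
  define N where "N = lie_generated L ?X"
  note tr = generated_by_triple[OF tri S0V subset_refl subset_refl, folded N_def]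
  have Xc: "?X \<subseteq> carrier L" using S0V local_part_carrier by blast
  have Na: "lie_subalgebra L N" unfolding N_def by (rule lie_generated_subalgebra[OF Xc])
  then have Ns: "subspace N" and Nb: "\<And>x y. \<lbrakk>x \<in> N; y \<in> N\<rbrakk> \<Longrightarrow> x \<otimes> y \<in> N"
    by (auto simp: lie_subalgebra_def)
  note ND = subspaceD[OF Ns]
  have XN: "?X \<subseteq> N" unfolding N_def by (rule lie_generated_superset)
  let ?G = "{x \<otimes> y | x y. x \<in> carrier L \<and> y \<in> carrier L}"
  have Gc: "?G \<subseteq> carrier L" by auto
  have Meq: "M = span ?G" by (simp add: M_def derived_algebra_def)
  have Ms: "subspace M" unfolding Meq by (rule subspace_span[OF Gc])
  note MD = subspaceD[OF Ms]
  have MG: "x \<otimes> y \<in> M" if "x \<in> carrier L" "y \<in> carrier L" for x y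
    unfolding Meq using span_superset[OF Gc] that by blast
  have NM: "N \<subseteq> M"
    unfolding N_def
  proof (rule lie_generated_minimal)
    show "lie_subalgebra L M" using Ms MG MD(1) by (intro lie_subalgebraI) auto
    have "ee i \<in> M" "ff i \<in> M" "hh (\<alpha>\<^sub>c i) \<in> M" if "i < n" for i
    proof -
      have "ee i = hh \<rho> \<otimes> ee i" using hh_e[OF \<rho>(1) that] \<rho>(2)[OF that] eD(1)[OF that] by simp
      then show "ee i \<in> M" using MG[OF hhD(2)[OF \<rho>(1)] eD(1)[OF that]] by simp
      have "ff i = (-1) \<odot> (hh \<rho> \<otimes> ff i)"
        using hh_f[OF \<rho>(1) that] \<rho>(2)[OF that] fD(1)[OF that] by (simp add: smult_smult)
      then show "ff i \<in> M" using MD(4)[OF MG[OF hhD(2)[OF \<rho>(1)] fD(1)[OF that]], of "-1"] by simp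
      have "hh (\<alpha>\<^sub>c i) = ee i \<otimes> ff i" using e_f[OF that that] by simp
      then show "hh (\<alpha>\<^sub>c i) \<in> M" using MG[OF eD(1)[OF that] fD(1)[OF that]] by simp
    qed
    then show "?X \<subseteq> M" using V1_min[OF _ Ms] Vm1_min[OF _ Ms] S0_min[OF _ Ms] by blast
  qed
  have VN: "z \<otimes> s \<in> N" if z: "z \<in> V 0" and s: "s \<in> N" for z s
  proof -
    have zc: "z \<in> carrier L" using VD(1)[OF z] .
    \<comment> \<open>Membership in \<open>N\<close> is carried along because the bracket case needs
      it for both factors.\<close>
    have "s \<in> N \<and> z \<otimes> s \<in> N"
      using s[unfolded N_def] Xc
    proof (induct rule: lie_generated_induct)
      case (gen x)
      then have "z \<otimes> x \<in> ?X \<union> {\<zero>}"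
        using V_bracket[OF z, of x 1] V_bracket[OF z, of x "-1"] abel[OF z] S0V by auto
      then have "z \<otimes> x \<in> N" using XN ND(2) by (auto simp: subset_iff)
      then show ?case using XN gen by (auto simp: subset_iff)
    next
      case (bracket x y)
      have "z \<otimes> (x \<otimes> y) = (z \<otimes> x) \<otimes> y \<oplus> x \<otimes> (z \<otimes> y)"
        using zc bracket(1,2) by (rule bracket_derivation)
      then show ?case using bracket Nb ND(3) by simp
    qed (use zc ND in \<open>auto simp: bracket_add_right bracket_smult_right\<close>)
    then show ?thesis by simp
  qed
  have Nid: "lie_ideal L N"
  proof (rule subspace_ad_local_ideal[OF Ns])
    fix x s assume "x \<in> V (-1) \<union> V 0 \<union> V 1" "s \<in> N"
    then show "x \<otimes> s \<in> N" using VN Nb XN by blast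
  qed
  note Ni = lie_idealD(2,3)[OF Nid]
  \<comment> \<open>Here y ranges over the whole algebra: on generators the bracket is in
    \<open>N\<close> since degree 0 commutes, and the ideal property of \<open>N\<close> propagates
    this.\<close>
  have HN: "h \<otimes> y \<in> N" if h: "h \<in> V 0" and y: "y \<in> carrier L" for h y
  proof -
    have hc: "h \<in> carrier L" using VD(1)[OF h] .
    have "y \<in> lie_generated L (V (-1) \<union> V 0 \<union> V 1)" using generated_by_local_part y by simp
    then show ?thesis
      using local_part_carrier
    proof (induct rule: lie_generated_induct)
      case (gen x)
      then show ?case using VN[OF h] XN abel[OF h] ND(2) by auto
    next
      case (bracket x y)
      have "h \<otimes> (x \<otimes> y) = (h \<otimes> x) \<otimes> y \<oplus> x \<otimes> (h \<otimes> y)"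
        using hc bracket(1,2) by (rule bracket_derivation)
      then show ?case using bracket Ni ND(3) by simp
    qed (use hc ND in \<open>auto simp: bracket_add_right bracket_smult_right\<close>)
  qed
  have LN: "x \<otimes> y \<in> N" if x: "x \<in> carrier L" and y: "y \<in> carrier L" for x y
  proof -
    have "x \<in> lie_generated L (V (-1) \<union> V 0 \<union> V 1)" using generated_by_local_part x by simp
    then have "\<forall>y\<in>carrier L. x \<otimes> y \<in> N"
      using local_part_carrier
    proof (induct rule: lie_generated_induct)
      case (gen x)
      then show ?case using HN Ni(2) XN by blast
    next
      case (bracket x z)
      show ?case
      proof
        fix y assume y: "y \<in> carrier L"
        have "(x \<otimes> z) \<otimes> y = x \<otimes> (z \<otimes> y) \<ominus> z \<otimes> (x \<otimes> y)"
          using bracket_derivation[of x z y] bracket(1,2) y by (simp add: a_minus_def a_assoc r_neg)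
        then show "(x \<otimes> z) \<otimes> y \<in> N"
          using bracket y subspace_minus[OF Ns] by simp
      qed
    qed (use ND in \<open>auto simp: bracket_add_left bracket_smult_left\<close>)
    then show ?thesis using y by blast
  qed
  have MN: "M = N"
  proof
    show "M \<subseteq> N" unfolding Meq by (rule span_minimal[OF _ Ns]) (use LN in auto)
  qed (rule NM)
  show VM: "V 1 \<subseteq> M" "V (-1) \<subseteq> M" using XN MN by auto
  have dL: "derived_algebra L = L\<lparr>carrier := M\<rparr>" by (simp add: M_def derived_algebra_def)
  interpret D: lie_algebra "L\<lparr>carrier := M\<rparr>"
    using subalgebra_lie_algebra[OF Na] MN by simp
  have comp: "M \<inter> V 0 = S0" "M \<inter> V 1 = V 1" "M \<inter> V (-1) = V (-1)"
    using tr(1-3) MN by auto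
  have g: "graded_lie_algebra (L\<lparr>carrier := M\<rparr>) (\<lambda>k. M \<inter> V k)"
  proof (intro graded_lie_algebra.intro graded_lie_algebra_axioms.intro D.lie_algebra_axioms)
    show "D.subspace (M \<inter> V i)" for i
      using restrict_subspace_iff[OF Ms, of "M \<inter> V i"] subspace_Int[OF Ms V_subspace] by auto
    show "lie_generated (L\<lparr>carrier := M\<rparr>) (M \<inter> V (- 1) \<union> M \<inter> V 0 \<union> M \<inter> V 1) = carrier (L\<lparr>carrier := M\<rparr>)"
      unfolding comp using restrict_generated[OF Na XN] MN N_def by simp
    fix x assume "x \<in> carrier (L\<lparr>carrier := M\<rparr>)"
    then have "x \<in> homogeneous_sums (\<lambda>k. M \<inter> V k)" using tr(4) MN by simp
    then obtain F v where F: "finite F" "\<forall>i\<in>F. v i \<in> M \<inter> V i" "x = (\<Oplus>i\<in>F. v i)"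
      unfolding homogeneous_sums_def by blast
    then have "x = (\<Oplus>\<^bsub>L\<lparr>carrier := M\<rparr>\<^esub>i\<in>F. v i)"
      using finsum_restrict_carrier[OF Ms F(1), of v] by auto
    then show "\<exists>F v. finite F \<and> (\<forall>i\<in>F. v i \<in> M \<inter> V i) \<and> x = (\<Oplus>\<^bsub>L\<lparr>carrier := M\<rparr>\<^esub>i\<in>F. v i)"
      using F by blast
  next
    fix F v and i :: int
    assume F: "finite F" "\<And>i. i \<in> F \<Longrightarrow> v i \<in> M \<inter> V i"
      "(\<Oplus>\<^bsub>L\<lparr>carrier := M\<rparr>\<^esub>i\<in>F. v i) = \<zero>\<^bsub>L\<lparr>carrier := M\<rparr>\<^esub>" "i \<in> F"
    then have "(\<Oplus>i\<in>F. v i) = \<zero>" using finsum_restrict_carrier[OF Ms F(1), of v] by simp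
    then show "v i = \<zero>\<^bsub>L\<lparr>carrier := M\<rparr>\<^esub>" using V_independent[of F v i] F by simp
  next
    fix x i y j assume "x \<in> M \<inter> V i" "y \<in> M \<inter> V j"
    then show "x \<otimes>\<^bsub>L\<lparr>carrier := M\<rparr>\<^esub> y \<in> M \<inter> V (i + j)" using V_bracket MG MD(1) by simp
  qed
  have fb: "D.family_basis n b S" if "family_basis n b S" "S \<subseteq> M" for b S
  proof -
    note B = family_basisD[OF that(1)]
    have "(\<Oplus>\<^bsub>L\<lparr>carrier := M\<rparr>\<^esub>i\<in>{..<n}. c i \<odot> b i) = (\<Oplus>i\<in>{..<n}. c i \<odot> b i)" for c
      using B(2) that(2) MD(4) by (intro finsum_restrict_carrier[OF Ms]) auto
    then show ?thesis using that B(2) unfolding D.family_basis_def family_basis_def by auto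
  qed
  show "chevalley_graded (derived_algebra L) (\<lambda>k. M \<inter> V k) (H\<lparr>carrier := coroot_span\<rparr>) n \<alpha> \<alpha>\<^sub>c hh ee ff"
    unfolding dL
  proof (intro chevalley_graded.intro chevalley_graded_axioms.intro g
      H.restrict_complex_space[OF coroot_span_subspace])
    show "hh \<in> linear_maps (H\<lparr>carrier := coroot_span\<rparr>) (L\<lparr>carrier := M\<rparr>)"
      using hc hhD(3,4) comp(1) by (auto simp: linear_maps_iff S0_def)
    show "bij_betw hh (carrier (H\<lparr>carrier := coroot_span\<rparr>)) (M \<inter> V 0)"
      unfolding comp using hc hhD(7) by (auto simp: S0_def bij_betw_def inj_on_def)
    show "D.family_basis n ee (M \<inter> V 1)" "D.family_basis n ff (M \<inter> V (-1))"
      unfolding comp using fb e_basis f_basis VM by auto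
    show "\<alpha>\<^sub>c i \<in> carrier (H\<lparr>carrier := coroot_span\<rparr>)" if "i < n" for i
      using coroot_in_span[OF that] by simp
  qed (use hc hh_hh hh_e hh_f e_f in auto)
qed

end

section \<open>Uniqueness of G(C)\<close>

lemma (in complex_space) indexed_basis_family_basis:
  assumes "subspace S" "indexed_basis L S n b"
  shows "family_basis n b S"
proof -
  interpret S: complex_space "L\<lparr>carrier := S\<rparr>" by (rule restrict_complex_space[OF assms(1)])
  have "b i \<in> S" if "i < n" for i
    using assms(2) that by (auto simp: indexed_basis_def S.basis_def)
  then show ?thesis using indexed_basis_iff[OF assms(1)] assms(2) by blast
qed

lemma basis_change:
  assumes "complex_space L" "complex_space M"
    and b: "complex_space.family_basis L n b S" and d: "complex_space.family_basis M n d U"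
  obtains \<psi> where "\<psi> \<in> linear_maps (L\<lparr>carrier := S\<rparr>) (M\<lparr>carrier := U\<rparr>)" "bij_betw \<psi> S U"
    "\<And>i. i < n \<Longrightarrow> \<psi> (b i) = d i"
proof -
  interpret L: complex_space L by fact
  interpret M: complex_space M by fact
  note B = L.family_basisD[OF b] and D = M.family_basisD[OF d]
  define \<psi> where "\<psi> x = (\<Oplus>\<^bsub>M\<^esub>i\<in>{..<n}. (SOME c. x = (\<Oplus>\<^bsub>L\<^esub>i\<in>{..<n}. c i \<odot>\<^bsub>L\<^esub> b i)) i \<odot>\<^bsub>M\<^esub> d i)" for x
  have \<psi>: "\<psi> (\<Oplus>\<^bsub>L\<^esub>i\<in>{..<n}. c i \<odot>\<^bsub>L\<^esub> b i) = (\<Oplus>\<^bsub>M\<^esub>i\<in>{..<n}. c i \<odot>\<^bsub>M\<^esub> d i)" for c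
  proof -
    let ?P = "\<lambda>c'. (\<Oplus>\<^bsub>L\<^esub>i\<in>{..<n}. c i \<odot>\<^bsub>L\<^esub> b i) = (\<Oplus>\<^bsub>L\<^esub>i\<in>{..<n}. c' i \<odot>\<^bsub>L\<^esub> b i)"
    have "?P (SOME c'. ?P c')" by (rule someI[of ?P c]) simp
    from L.family_basis_unique[OF b this] show ?thesis
      unfolding \<psi>_def using D(1) by (intro M.finsum_cong') auto
  qed
  have mem: "\<psi> x \<in> U" if "x \<in> S" for x using B(4)[OF that] \<psi> D(5) by auto
  have add: "\<psi> (x \<oplus>\<^bsub>L\<^esub> y) = \<psi> x \<oplus>\<^bsub>M\<^esub> \<psi> y" if xy: "x \<in> S" "y \<in> S" for x y
  proof -
    obtain c c' where "x = (\<Oplus>\<^bsub>L\<^esub>i\<in>{..<n}. c i \<odot>\<^bsub>L\<^esub> b i)" "y = (\<Oplus>\<^bsub>L\<^esub>i\<in>{..<n}. c' i \<odot>\<^bsub>L\<^esub> b i)"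
      using B(4) xy by meson
    then show ?thesis
      using L.lincomb_add[of n b c c'] M.lincomb_add[of n d c c'] B(1) D(1) by (simp add: \<psi>)
  qed
  have smult: "\<psi> (a \<odot>\<^bsub>L\<^esub> x) = a \<odot>\<^bsub>M\<^esub> \<psi> x" if x: "x \<in> S" for a x
  proof -
    obtain c where "x = (\<Oplus>\<^bsub>L\<^esub>i\<in>{..<n}. c i \<odot>\<^bsub>L\<^esub> b i)" using B(4) x by meson
    then show ?thesis
      using L.lincomb_smult'[of n b a c] M.lincomb_smult'[of n d a c] B(1) D(1) by (simp add: \<psi>)
  qed
  have "inj_on \<psi> S"
  proof (rule inj_onI)
    fix x y assume xy: "x \<in> S" "y \<in> S" "\<psi> x = \<psi> y"
    obtain c c' where c: "x = (\<Oplus>\<^bsub>L\<^esub>i\<in>{..<n}. c i \<odot>\<^bsub>L\<^esub> b i)" "y = (\<Oplus>\<^bsub>L\<^esub>i\<in>{..<n}. c' i \<odot>\<^bsub>L\<^esub> b i)"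
      using B(4) xy by meson
    have "(\<Oplus>\<^bsub>M\<^esub>i\<in>{..<n}. c i \<odot>\<^bsub>M\<^esub> d i) = (\<Oplus>\<^bsub>M\<^esub>i\<in>{..<n}. c' i \<odot>\<^bsub>M\<^esub> d i)"
      using xy(3) unfolding c \<psi> .
    from M.family_basis_unique[OF d this] have "c i = c' i" if "i < n" for i using that .
    then show "x = y" unfolding c using B(1) by (intro L.finsum_cong') auto
  qed
  moreover have "\<psi> ` S = U"
  proof
    show "U \<subseteq> \<psi> ` S"
    proof
      fix y assume "y \<in> U"
      then obtain c where "y = (\<Oplus>\<^bsub>M\<^esub>i\<in>{..<n}. c i \<odot>\<^bsub>M\<^esub> d i)" using D(4) by meson
      then have "y = \<psi> (\<Oplus>\<^bsub>L\<^esub>i\<in>{..<n}. c i \<odot>\<^bsub>L\<^esub> b i)" using \<psi> by simp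
      then show "y \<in> \<psi> ` S" using B(5) by (rule image_eqI)
    qed
  qed (use mem in auto)
  ultimately have "bij_betw \<psi> S U" by (simp add: bij_betw_def)
  moreover have "\<psi> (b i) = d i" if i: "i < n" for i
    using \<psi>[of "\<lambda>j. if j = i then 1 else 0"] L.lincomb_unit[where b = b and n = n and a = 1, OF B(1) i]
      M.lincomb_unit[where b = d and n = n and a = 1, OF D(1) i] B(1)[OF i] D(1)[OF i] by simp
  moreover have "\<psi> \<in> linear_maps (L\<lparr>carrier := S\<rparr>) (M\<lparr>carrier := U\<rparr>)"
    using mem add smult by (auto simp: linear_maps_iff)
  ultimately show ?thesis using that by blast
qed

text \<open>A map of local parts is linear on each component separately; hence linearity is assumed
  on the spaces of the two arguments and of the bracket, and bilinearity extends the identity from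
  the two bases.\<close>

lemma bracket_hom_extend:
  assumes "lie_algebra L" "lie_algebra M"
    and b: "complex_space.family_basis L n b S" and d: "complex_space.family_basis L m d U"
    and \<psi>: "\<psi> \<in> linear_maps (L\<lparr>carrier := S\<rparr>) M" "\<psi> \<in> linear_maps (L\<lparr>carrier := U\<rparr>) M"
      "\<psi> \<in> linear_maps (L\<lparr>carrier := W\<rparr>) M"
    and br: "\<And>x y. \<lbrakk>x \<in> S; y \<in> U\<rbrakk> \<Longrightarrow> x \<otimes>\<^bsub>L\<^esub> y \<in> W" and W: "VectorSpace.subspace complex_ring W L"
    and base: "\<And>i j. \<lbrakk>i < n; j < m\<rbrakk> \<Longrightarrow> \<psi> (b i \<otimes>\<^bsub>L\<^esub> d j) = \<psi> (b i) \<otimes>\<^bsub>M\<^esub> \<psi> (d j)"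
    and x: "x \<in> S" and y: "y \<in> U"
  shows "\<psi> (x \<otimes>\<^bsub>L\<^esub> y) = \<psi> x \<otimes>\<^bsub>M\<^esub> \<psi> y"
proof -
  interpret L: lie_algebra L by fact
  interpret M: lie_algebra M by fact
  note B = L.family_basisD[OF b] and D = L.family_basisD[OF d]
  note SD = L.subspaceD[OF B(3)] and UD = L.subspaceD[OF D(3)]
  have zero: "\<psi> \<zero>\<^bsub>L\<^esub> = \<zero>\<^bsub>M\<^esub>"
    using linear_map_zero[OF L.restrict_complex_space[OF W] M.complex_space_axioms \<psi>(3)] by simp
  note lin = \<psi>[unfolded linear_maps_iff, simplified]
  have 1: "\<psi> (x \<otimes>\<^bsub>L\<^esub> d j) = \<psi> x \<otimes>\<^bsub>M\<^esub> \<psi> (d j)" if j: "j < m" and x: "x \<in> S" for x j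
  proof -
    have "S \<subseteq> {x \<in> S. \<psi> (x \<otimes>\<^bsub>L\<^esub> d j) = \<psi> x \<otimes>\<^bsub>M\<^esub> \<psi> (d j)}"
    proof -
      have "L.subspace {x \<in> S. \<psi> (x \<otimes>\<^bsub>L\<^esub> d j) = \<psi> x \<otimes>\<^bsub>M\<^esub> \<psi> (d j)}"
        by (rule L.subspaceI)
          (use j SD D(1,2) br lin zero in \<open>auto simp: L.bracket_add_left L.bracket_smult_left
            M.bracket_add_left M.bracket_smult_left Pi_iff\<close>)
      then have "{\<Oplus>\<^bsub>L\<^esub>i\<in>{..<n}. c i \<odot>\<^bsub>L\<^esub> b i | c. True} \<subseteq> {x \<in> S. \<psi> (x \<otimes>\<^bsub>L\<^esub> d j) = \<psi> x \<otimes>\<^bsub>M\<^esub> \<psi> (d j)}"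
        by (intro L.lincombs_minimal) (use B(2) base j in auto)
      then show ?thesis using b by (simp add: L.family_basis_def)
    qed
    then show ?thesis using x by blast
  qed
  have "U \<subseteq> {y \<in> U. \<psi> (x \<otimes>\<^bsub>L\<^esub> y) = \<psi> x \<otimes>\<^bsub>M\<^esub> \<psi> y}"
  proof -
    have "L.subspace {y \<in> U. \<psi> (x \<otimes>\<^bsub>L\<^esub> y) = \<psi> x \<otimes>\<^bsub>M\<^esub> \<psi> y}"
      by (rule L.subspaceI)
        (use x SD(1) UD br lin zero in \<open>auto simp: L.bracket_add_right L.bracket_smult_right
          M.bracket_add_right M.bracket_smult_right Pi_iff\<close>)
    then have "{\<Oplus>\<^bsub>L\<^esub>i\<in>{..<m}. c i \<odot>\<^bsub>L\<^esub> d i | c. True} \<subseteq> {y \<in> U. \<psi> (x \<otimes>\<^bsub>L\<^esub> y) = \<psi> x \<otimes>\<^bsub>M\<^esub> \<psi> y}"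
      by (intro L.lincombs_minimal) (use D(2) 1[OF _ x] in auto)
    then show ?thesis using d by (simp add: L.family_basis_def)
  qed
  then show ?thesis using y by blast
qed

text \<open>The bracket table on bases determines the local part, and minimality the rest. So
  \<open>contragredient\<close> may be replaced by any convenient representative on its
  type.\<close>

lemma is_contragredient_unique:
  fixes L L' :: "(complex, 'a) module"
  assumes "is_contragredient n C L" "is_contragredient n C L'"
  shows "L \<simeq>\<^sub>L L'"
proof -
  obtain V e f h where m: "minimal_graded_lie_algebra L V"
    and "indexed_basis L (V (-1)) n f" "indexed_basis L (V 0) n h" "indexed_basis L (V 1) n e"
    and R: "\<And>i j. \<lbrakk>i < n; j < n\<rbrakk> \<Longrightarrow> h i \<otimes>\<^bsub>L\<^esub> h j = \<zero>\<^bsub>L\<^esub>"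
      "\<And>i j. \<lbrakk>i < n; j < n\<rbrakk> \<Longrightarrow> e i \<otimes>\<^bsub>L\<^esub> f j = (if i = j then h i else \<zero>\<^bsub>L\<^esub>)"
      "\<And>i j. \<lbrakk>i < n; j < n\<rbrakk> \<Longrightarrow> h i \<otimes>\<^bsub>L\<^esub> e j = C $$ (i, j) \<odot>\<^bsub>L\<^esub> e j"
      "\<And>i j. \<lbrakk>i < n; j < n\<rbrakk> \<Longrightarrow> h i \<otimes>\<^bsub>L\<^esub> f j = (- C $$ (i, j)) \<odot>\<^bsub>L\<^esub> f j"
    using assms(1) unfolding is_contragredient_def by blast
  interpret L: graded_lie_algebra L V using m by (simp add: minimal_graded_lie_algebra_def)
  have b: "L.family_basis n f (V (-1))" "L.family_basis n h (V 0)" "L.family_basis n e (V 1)"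
    by (rule L.indexed_basis_family_basis[OF L.V_subspace]; fact)+
  obtain V' e' f' h' where m': "minimal_graded_lie_algebra L' V'"
    and "indexed_basis L' (V' (-1)) n f'" "indexed_basis L' (V' 0) n h'" "indexed_basis L' (V' 1) n e'"
    and R': "\<And>i j. \<lbrakk>i < n; j < n\<rbrakk> \<Longrightarrow> h' i \<otimes>\<^bsub>L'\<^esub> h' j = \<zero>\<^bsub>L'\<^esub>"
      "\<And>i j. \<lbrakk>i < n; j < n\<rbrakk> \<Longrightarrow> e' i \<otimes>\<^bsub>L'\<^esub> f' j = (if i = j then h' i else \<zero>\<^bsub>L'\<^esub>)"
      "\<And>i j. \<lbrakk>i < n; j < n\<rbrakk> \<Longrightarrow> h' i \<otimes>\<^bsub>L'\<^esub> e' j = C $$ (i, j) \<odot>\<^bsub>L'\<^esub> e' j"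
      "\<And>i j. \<lbrakk>i < n; j < n\<rbrakk> \<Longrightarrow> h' i \<otimes>\<^bsub>L'\<^esub> f' j = (- C $$ (i, j)) \<odot>\<^bsub>L'\<^esub> f' j"
    using assms(2) unfolding is_contragredient_def by blast
  interpret L': graded_lie_algebra L' V' using m' by (simp add: minimal_graded_lie_algebra_def)
  have b': "L'.family_basis n f' (V' (-1))" "L'.family_basis n h' (V' 0)" "L'.family_basis n e' (V' 1)"
    by (rule L'.indexed_basis_family_basis[OF L'.V_subspace]; fact)+
  note cs = L.complex_space_axioms L'.complex_space_axioms
  obtain \<phi>f where \<phi>f: "\<phi>f \<in> linear_maps (L\<lparr>carrier := V (-1)\<rparr>) (L'\<lparr>carrier := V' (-1)\<rparr>)"
    "bij_betw \<phi>f (V (-1)) (V' (-1))" "\<And>i. i < n \<Longrightarrow> \<phi>f (f i) = f' i"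
    by (rule basis_change[OF cs b(1) b'(1)]) (rule that; assumption)
  obtain \<phi>h where \<phi>h: "\<phi>h \<in> linear_maps (L\<lparr>carrier := V 0\<rparr>) (L'\<lparr>carrier := V' 0\<rparr>)"
    "bij_betw \<phi>h (V 0) (V' 0)" "\<And>i. i < n \<Longrightarrow> \<phi>h (h i) = h' i"
    by (rule basis_change[OF cs b(2) b'(2)]) (rule that; assumption)
  obtain \<phi>e where \<phi>e: "\<phi>e \<in> linear_maps (L\<lparr>carrier := V 1\<rparr>) (L'\<lparr>carrier := V' 1\<rparr>)"
    "bij_betw \<phi>e (V 1) (V' 1)" "\<And>i. i < n \<Longrightarrow> \<phi>e (e i) = e' i"
    by (rule basis_change[OF cs b(3) b'(3)]) (rule that; assumption)
  \<comment> \<open>The components meet only in zero, where the three linear maps agree, so \<psi>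
    restricts to the intended map on each.\<close>
  define \<psi> where "\<psi> x = (if x \<in> V 0 then \<phi>h x else if x \<in> V 1 then \<phi>e x else \<phi>f x)" for x
  have z: "\<phi> \<zero>\<^bsub>L\<^esub> = \<zero>\<^bsub>L'\<^esub>" if "\<phi> \<in> linear_maps (L\<lparr>carrier := V i\<rparr>) (L'\<lparr>carrier := V' i\<rparr>)" for \<phi> i
    using linear_map_zero[OF L.restrict_complex_space[OF L.V_subspace]
        L'.restrict_complex_space[OF L'.V_subspace] that] by simp
  have disj: "x = \<zero>\<^bsub>L\<^esub>" if "x \<in> V i" "x \<in> V j" "i \<noteq> j" for x i j by (rule L.component_disjoint[OF that])
  have \<psi>h: "\<psi> x = \<phi>h x" if "x \<in> V 0" for x using that by (simp add: \<psi>_def)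
  have \<psi>e: "\<psi> x = \<phi>e x" if "x \<in> V 1" for x
    using that disj[of x 0 1] z[OF \<phi>h(1)] z[OF \<phi>e(1)] by (auto simp: \<psi>_def)
  have \<psi>f: "\<psi> x = \<phi>f x" if "x \<in> V (-1)" for x
    using that disj[of x 0 "-1"] disj[of x 1 "-1"] z[OF \<phi>h(1)] z[OF \<phi>e(1)] z[OF \<phi>f(1)] by (auto simp: \<psi>_def)
  have lin: "\<psi> \<in> linear_maps (L\<lparr>carrier := V i\<rparr>) (L'\<lparr>carrier := V' i\<rparr>) \<and> bij_betw \<psi> (V i) (V' i)"
    if i: "i \<in> {-1, 0, 1}" for i
  proof -
    have c: "\<psi> \<in> linear_maps (L\<lparr>carrier := V i\<rparr>) (L'\<lparr>carrier := V' i\<rparr>) \<and> bij_betw \<psi> (V i) (V' i)"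
      if "\<phi> \<in> linear_maps (L\<lparr>carrier := V i\<rparr>) (L'\<lparr>carrier := V' i\<rparr>)" "bij_betw \<phi> (V i) (V' i)"
        "\<And>x. x \<in> V i \<Longrightarrow> \<psi> x = \<phi> x" for \<phi> i
      using that L.VD(3,4)[of _ i] bij_betw_cong[of "V i" \<psi> \<phi> "V' i"] by (auto simp: linear_maps_iff)
    from i show ?thesis using c[OF \<phi>f(1,2) \<psi>f] c[OF \<phi>h(1,2) \<psi>h] c[OF \<phi>e(1,2) \<psi>e] by auto
  qed
  have lin': "\<psi> \<in> linear_maps (L\<lparr>carrier := V i\<rparr>) L'" if "i \<in> {-1, 0, 1}" for i
    using lin[OF that] L'.VD(1)[of _ i] by (auto simp: linear_maps_iff)
  note B = L.family_basisD(2)[OF b(1)] L.family_basisD(2)[OF b(2)] L.family_basisD(2)[OF b(3)]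
  have base: "\<psi> (h i) = h' i" "\<psi> (e i) = e' i" "\<psi> (f i) = f' i" if "i < n" for i
    using \<psi>h[OF B(2)] \<psi>e[OF B(3)] \<psi>f[OF B(1)] \<phi>h(3) \<phi>e(3) \<phi>f(3) that by auto
  have sm: "\<psi> (c \<odot>\<^bsub>L\<^esub> x) = c \<odot>\<^bsub>L'\<^esub> \<psi> x" if "x \<in> V i" "i \<in> {-1, 0, 1}" for c x i
    using lin'[OF that(2)] that(1) by (auto simp: linear_maps_iff)
  have \<psi>0: "\<psi> \<zero>\<^bsub>L\<^esub> = \<zero>\<^bsub>L'\<^esub>" using \<psi>h[OF L.VD(2)] z[OF \<phi>h(1)] by simp
  note ext = bracket_hom_extend[OF L.lie_algebra_axioms L'.lie_algebra_axioms]
  have l: "\<psi> \<in> linear_maps (L\<lparr>carrier := V 0\<rparr>) L'" "\<psi> \<in> linear_maps (L\<lparr>carrier := V 1\<rparr>) L'"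
    "\<psi> \<in> linear_maps (L\<lparr>carrier := V (-1)\<rparr>) L'" by (rule lin'; simp)+
  have hh: "\<psi> (x \<otimes>\<^bsub>L\<^esub> y) = \<psi> x \<otimes>\<^bsub>L'\<^esub> \<psi> y" if "x \<in> V 0" "y \<in> V 0" for x y
    by (rule ext[OF b(2) b(2) l(1) l(1) l(1) _ L.V_subspace])
      (use that L.V_bracket[of _ 0 _ 0] in \<open>auto simp: base R R' \<psi>0\<close>)
  have he: "\<psi> (x \<otimes>\<^bsub>L\<^esub> y) = \<psi> x \<otimes>\<^bsub>L'\<^esub> \<psi> y" if "x \<in> V 0" "y \<in> V 1" for x y
    by (rule ext[OF b(2) b(3) l(1) l(2) l(2) _ L.V_subspace])
      (use that L.V_bracket[of _ 0 _ 1] in \<open>auto simp: base R R' sm[OF B(3)]\<close>)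
  have hf: "\<psi> (x \<otimes>\<^bsub>L\<^esub> y) = \<psi> x \<otimes>\<^bsub>L'\<^esub> \<psi> y" if "x \<in> V 0" "y \<in> V (-1)" for x y
    by (rule ext[OF b(2) b(1) l(1) l(3) l(3) _ L.V_subspace])
      (use that L.V_bracket[of _ 0 _ "-1"] in \<open>auto simp: base R R' sm[OF B(1)]\<close>)
  have ef: "\<psi> (x \<otimes>\<^bsub>L\<^esub> y) = \<psi> x \<otimes>\<^bsub>L'\<^esub> \<psi> y" if "x \<in> V 1" "y \<in> V (-1)" for x y
    by (rule ext[OF b(3) b(1) l(2) l(3) l(1) _ L.V_subspace])
      (use that L.V_bracket[of _ 1 _ "-1"] in \<open>auto simp: base R R' \<psi>0\<close>)
  have sym: "\<psi> (y \<otimes>\<^bsub>L\<^esub> x) = \<psi> y \<otimes>\<^bsub>L'\<^esub> \<psi> x"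
    if "\<psi> (x \<otimes>\<^bsub>L\<^esub> y) = \<psi> x \<otimes>\<^bsub>L'\<^esub> \<psi> y" "x \<in> V i" "y \<in> V j" "i \<in> {-1, 0, 1}" "j \<in> {-1, 0, 1}"
      "i + j \<in> {-1, 0, 1}" for x y i j
  proof -
    have c: "x \<in> carrier L" "y \<in> carrier L" "\<psi> x \<in> carrier L'" "\<psi> y \<in> carrier L'"
      using L.VD(1)[OF that(2)] L.VD(1)[OF that(3)] lin'[OF that(4)] lin'[OF that(5)] that(2,3)
      by (auto simp: linear_maps_iff)
    have "\<psi> (y \<otimes>\<^bsub>L\<^esub> x) = \<psi> ((-1) \<odot>\<^bsub>L\<^esub> (x \<otimes>\<^bsub>L\<^esub> y))"
      using c L.bracket_anticommute[of y x] by (simp add: L.smult_m1)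
    also have "\<dots> = (-1) \<odot>\<^bsub>L'\<^esub> (\<psi> x \<otimes>\<^bsub>L'\<^esub> \<psi> y)"
      using sm[OF L.V_bracket[OF that(2,3)] that(6)] that(1) by simp
    also have "\<dots> = \<psi> y \<otimes>\<^bsub>L'\<^esub> \<psi> x"
      using c L'.bracket_anticommute[of "\<psi> y" "\<psi> x"] by (simp add: L'.smult_m1)
    finally show ?thesis .
  qed
  have "local_iso L V L' V' \<psi>"
    unfolding local_iso_def
  proof (intro conjI ballI impI)
    fix i j :: int and x y
    assume ij: "i \<in> {-1, 0, 1}" "j \<in> {-1, 0, 1}" "i + j \<in> {-1, 0, 1}" and x: "x \<in> V i" and y: "y \<in> V j"
    from ij consider "i = 0" "j = 0" | "i = 0" "j = 1" | "i = 0" "j = -1" | "i = 1" "j = -1"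
      | "i = 1" "j = 0" | "i = -1" "j = 0" | "i = -1" "j = 1" by auto
    then show "\<psi> (x \<otimes>\<^bsub>L\<^esub> y) = \<psi> x \<otimes>\<^bsub>L'\<^esub> \<psi> y"
    proof cases
      case 5
      then show ?thesis using x y he[of y x] sym[of y x 0 1] by simp
    next
      case 6
      then show ?thesis using x y hf[of y x] sym[of y x 0 "-1"] by simp
    next
      case 7
      then show ?thesis using x y ef[of y x] sym[of y x 1 "-1"] by simp
    qed (use x y hh he hf ef in auto)
  qed (use lin in auto)
  then show ?thesis by (rule minimal_graded_unique[OF m m'])
qed

lemma (in chevalley_graded) is_contragredientI:
  assumes tr: "transitive_grading L V" and c: "H.family_basis n \<alpha>\<^sub>c (carrier H)"
    and C: "\<And>i j. \<lbrakk>i < n; j < n\<rbrakk> \<Longrightarrow> \<alpha> j (\<alpha>\<^sub>c i) = C $$ (i, j)"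
  shows "is_contragredient n C L"
proof -
  have "family_basis n (\<lambda>i. hh (\<alpha>\<^sub>c i)) (hh ` carrier H)"
    by (rule H.family_basis_image[OF c complex_space_axioms hh_linear hh_eq_zero])
  then have h: "family_basis n (\<lambda>i. hh (\<alpha>\<^sub>c i)) (V 0)" using hh_bij by (simp add: bij_betw_def)
  have "indexed_basis L (V (-1)) n ff" "indexed_basis L (V 0) n (\<lambda>i. hh (\<alpha>\<^sub>c i))" "indexed_basis L (V 1) n ee"
    by (subst indexed_basis_iff[OF V_subspace]; use family_basisD(2)[OF h] eD(2) fD(2) h e_basis f_basis in simp)+
  moreover have "\<forall>i<n. \<forall>j<n. hh (\<alpha>\<^sub>c i) \<otimes> hh (\<alpha>\<^sub>c j) = \<zero> \<and>
      ee i \<otimes> ff j = (if i = j then hh (\<alpha>\<^sub>c i) else \<zero>) \<and>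
      hh (\<alpha>\<^sub>c i) \<otimes> ee j = C $$ (i, j) \<odot> ee j \<and> hh (\<alpha>\<^sub>c i) \<otimes> ff j = (- C $$ (i, j)) \<odot> ff j"
    using coroot hh_hh hh_e hh_f e_f C by simp
  ultimately show ?thesis
    unfolding is_contragredient_def
    using transitive_grading_minimal[OF graded_lie_algebra_axioms tr] by blast
qed

section \<open>Recognizing PC Lie algebras\<close>

lemma cartan_space_simps [simp]:
  "carrier (cartan_space r) = carrier_vec r" "\<zero>\<^bsub>cartan_space r\<^esub> = 0\<^sub>v r"
  "a \<oplus>\<^bsub>cartan_space r\<^esub> b = a + b" "c \<odot>\<^bsub>cartan_space r\<^esub> a = c \<cdot>\<^sub>v a"
  "a \<otimes>\<^bsub>cartan_space r\<^esub> b = 0\<^sub>v r"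
  by (simp_all add: cartan_space_def module_vec_def)

lemma module_vec_complex_space: "complex_space (module_vec TYPE(complex) n)"
  by (rule complex_spaceI) (auto simp: module_vec_def add_smult_distrib_vec smult_add_distrib_vec
      smult_smult_assoc comm_add_vec[of _ n] assoc_add_vec[of _ n])

lemma sum_vec_add:
  "\<lbrakk>x \<in> carrier_vec n; y \<in> carrier_vec n\<rbrakk> \<Longrightarrow> (\<Sum>j<n. g j ((x + y) $ j)) = (\<Sum>j<n. g j (x $ j + y $ j))"
  by (intro sum.cong) auto

lemma sum_vec_smult: "x \<in> carrier_vec n \<Longrightarrow> (\<Sum>j<n. g j ((c \<cdot>\<^sub>v x) $ j)) = (\<Sum>j<n. g j (c * x $ j))"
  by (intro sum.cong) auto

lemma cartan_space_lie_algebra: "lie_algebra (cartan_space r)"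
proof (rule lie_algebraI)
  show "complex_space (cartan_space r)"
    by (rule complex_spaceI) (auto simp: add_smult_distrib_vec smult_add_distrib_vec
      smult_smult_assoc comm_add_vec[of _ r] assoc_add_vec[of _ r])
qed auto

lemma (in complex_space) basis_map_iso:
  assumes b: "family_basis n b S"
  shows "(\<lambda>v. \<Oplus>i\<in>{..<n}. v $ i \<odot> b i) \<in> linear_maps (module_vec TYPE(complex) n) (L\<lparr>carrier := S\<rparr>)"
    "bij_betw (\<lambda>v. \<Oplus>i\<in>{..<n}. v $ i \<odot> b i) (carrier_vec n) S"
proof -
  note B = family_basisD[OF b]
  let ?f = "\<lambda>v. \<Oplus>i\<in>{..<n}. v $ i \<odot> b i"
  have "?f (v + w) = ?f v \<oplus> ?f w" if "v \<in> carrier_vec n" "w \<in> carrier_vec n" for v w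
  proof -
    have "?f (v + w) = (\<Oplus>i\<in>{..<n}. (v $ i + w $ i) \<odot> b i)"
      using that B(1) by (intro finsum_cong') auto
    then show ?thesis using lincomb_add[of n b "\<lambda>i. v $ i" "\<lambda>i. w $ i"] B(1) by simp
  qed
  moreover have "?f (c \<cdot>\<^sub>v v) = c \<odot> ?f v" if "v \<in> carrier_vec n" for v c
  proof -
    have "?f (c \<cdot>\<^sub>v v) = (\<Oplus>i\<in>{..<n}. (c * v $ i) \<odot> b i)"
      using that B(1) by (intro finsum_cong') auto
    then show ?thesis using lincomb_smult'[of n b c "\<lambda>i. v $ i"] B(1) by simp
  qed
  ultimately show "?f \<in> linear_maps (module_vec TYPE(complex) n) (L\<lparr>carrier := S\<rparr>)"
    using B(5) by (simp add: linear_maps_iff module_vec_def)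
  have "inj_on ?f (carrier_vec n)"
  proof (rule inj_onI)
    fix v w :: "complex vec" assume vw: "v \<in> carrier_vec n" "w \<in> carrier_vec n" "?f v = ?f w"
    have "v $ i = w $ i" if "i < n" for i
      by (rule family_basis_unique[OF b vw(3) that])
    then show "v = w" using vw by (intro eq_vecI) auto
  qed
  moreover have "?f ` carrier_vec n = S"
  proof
    show "S \<subseteq> ?f ` carrier_vec n"
    proof
      fix x assume "x \<in> S"
      then obtain c where c: "x = (\<Oplus>i\<in>{..<n}. c i \<odot> b i)" using B(4) by meson
      have "x = ?f (vec n c)" unfolding c using B(1) by (intro finsum_cong') auto
      then show "x \<in> ?f ` carrier_vec n" by (rule image_eqI) simp
    qed
  qed (use B(5) in auto)
  ultimately show "bij_betw ?f (carrier_vec n) S" by (simp add: bij_betw_def)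
qed

lemma (in complex_space) lincomb_lincomb:
  fixes b :: "nat \<Rightarrow> 'a"
  assumes "\<And>k. k < r \<Longrightarrow> b k \<in> carrier L"
  shows "(\<Oplus>j\<in>{..<m::nat}. c j \<odot> (\<Oplus>k\<in>{..<r}. X k j \<odot> b k)) = (\<Oplus>k\<in>{..<r}. (\<Sum>j<m. c j * X k j) \<odot> b k)"
proof (induct m)
  case 0
  show ?case using lincomb_zero'[of r b "\<lambda>_. 0"] assms by simp
next
  case (Suc m)
  have "(\<Oplus>j\<in>{..<Suc m}. c j \<odot> (\<Oplus>k\<in>{..<r}. X k j \<odot> b k))
      = c m \<odot> (\<Oplus>k\<in>{..<r}. X k m \<odot> b k) \<oplus> (\<Oplus>j\<in>{..<m}. c j \<odot> (\<Oplus>k\<in>{..<r}. X k j \<odot> b k))"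
    unfolding lessThan_Suc using lincomb_closed'[OF assms] by (intro finsum_insert) auto
  also have "c m \<odot> (\<Oplus>k\<in>{..<r}. X k m \<odot> b k) = (\<Oplus>k\<in>{..<r}. (c m * X k m) \<odot> b k)"
    by (rule lincomb_smult') (rule assms)
  also have "(\<Oplus>k\<in>{..<r}. (c m * X k m) \<odot> b k) \<oplus> (\<Oplus>j\<in>{..<m}. c j \<odot> (\<Oplus>k\<in>{..<r}. X k j \<odot> b k))
      = (\<Oplus>k\<in>{..<r}. (c m * X k m + (\<Sum>j<m. c j * X k j)) \<odot> b k)"
    unfolding Suc by (rule lincomb_add) (rule assms)
  finally show ?case by (simp add: add.commute)
qed

lemma diagonal_mat_entry_nonzero:
  fixes \<Gamma> :: "complex mat"
  assumes \<Gamma>: "\<Gamma> \<in> carrier_mat n n" "diagonal_mat \<Gamma>" "invertible_mat \<Gamma>" and j: "j < n"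
  shows "\<Gamma> $$ (j, j) \<noteq> 0"
proof
  assume 0: "\<Gamma> $$ (j, j) = 0"
  obtain G where "\<Gamma> * G = 1\<^sub>m n" "G * \<Gamma> = 1\<^sub>m (dim_row G)"
    using \<Gamma> by (auto simp: invertible_mat_def inverts_mat_def)
  moreover then have "G \<in> carrier_mat n n"
    using \<Gamma>(1) by (metis carrier_matD(2) carrier_matI index_mult_mat(2,3) index_one_mat(2,3))
  ultimately have GG: "G \<in> carrier_mat n n" "\<Gamma> * G = 1\<^sub>m n" by auto
  have "(\<Gamma> * G) $$ (j, j) = (\<Sum>k<n. \<Gamma> $$ (j, k) * G $$ (k, j))"
    using \<Gamma>(1) GG(1) j by (simp add: scalar_prod_def atLeast0LessThan)
  also have "\<dots> = 0"
  proof (intro sum.neutral ballI)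
    fix k assume "k \<in> {..<n}"
    then show "\<Gamma> $$ (j, k) * G $$ (k, j) = 0"
      using 0 \<Gamma>(1,2) j by (cases "k = j") (auto simp: diagonal_mat_def)
  qed
  finally show False using j GG(2) by simp
qed

text \<open>In terms of the Gram matrix \<open>B\<close> of the form, \<open>A = (B\<^sup>-\<^sup>1)\<^sup>t\<close>, and the defining property of
  \<open>\<Phi>\<close> says that the coordinates \<open>X\<close> of the brackets \<open>[e\<^sub>i, f\<^sub>i]\<close> satisfy \<open>B X = D \<Gamma>\<close>.\<close>

context
  fixes r n :: nat and B D X \<Gamma> :: "complex mat"
  assumes pos: "0 < r" "0 < n"
    and D: "D \<in> carrier_mat r n" and X: "X \<in> carrier_mat r n"
    and \<Gamma>: "\<Gamma> \<in> carrier_mat n n" "diagonal_mat \<Gamma>" "invertible_mat \<Gamma>"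
    and B: "B \<in> carrier_mat r r" "invertible_mat B" and BX: "B * X = D * \<Gamma>"
begin

lemmas Gamma_nonzero = diagonal_mat_entry_nonzero[OF \<Gamma>]

lemma ex_pc_matrix:
  obtains A where "A \<in> carrier_mat r r" "invertible_mat A"
    "\<And>a b. pc_form A a b = a \<bullet> (B *\<^sub>v b)"
proof -
  obtain C where C: "B * C = 1\<^sub>m r" "C * B = 1\<^sub>m (dim_row C)"
    using B by (auto simp: invertible_mat_def inverts_mat_def)
  then have Cc: "C \<in> carrier_mat r r"
    using B(1) by (metis carrier_matD(2) carrier_matI index_mult_mat(2,3) index_one_mat(2,3))
  let ?A = "transpose_mat C" and ?I = "transpose_mat B"
  have CB: "C * B = 1\<^sub>m r" using C(2) Cc by simp
  have AI: "?A * ?I = 1\<^sub>m r" "?I * ?A = 1\<^sub>m r"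
    by (simp_all only: transpose_mult[OF B(1) Cc, symmetric] transpose_mult[OF Cc B(1), symmetric]
        C(1) CB transpose_one)
  have Ac: "?A \<in> carrier_mat r r" "?I \<in> carrier_mat r r" using Cc B(1) by auto
  have inv: "invertible_mat ?A"
    using AI Ac unfolding invertible_mat_def inverts_mat_def by (auto intro!: exI[of _ ?I])
  have U: "?A \<in> Units (ring_mat TYPE(complex) r ())"
    using AI Ac unfolding Units_def ring_mat_def by auto
  obtain I where I: "mat_inverse ?A = Some I" 
    using mat_inverse(1)[OF Ac(1), where b = "()"] U by (cases "mat_inverse ?A") auto
  have I': "?A * I = 1\<^sub>m r" "I \<in> carrier_mat r r" using mat_inverse(2)[OF Ac(1) I] by auto
  \<comment> \<open>\<open>mat_inverse\<close> returns some inverse; uniqueness of inverses makes it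
    the transpose of \<open>B\<close>.\<close>
  have "I = (?I * ?A) * I" using AI(2) I'(2) by simp
  also have "\<dots> = ?I * (?A * I)" using Ac I'(2) by (intro assoc_mult_mat) auto
  also have "\<dots> = ?I" using I'(1) Ac(2) by simp
  finally have "transpose_mat (the (mat_inverse ?A)) = B" using I by simp
  then have "pc_form ?A a b = a \<bullet> (B *\<^sub>v b)" for a b by (simp add: pc_form_def)
  then show ?thesis using that[OF Ac(1) inv] by blast
qed

definition gram_form :: "complex vec \<Rightarrow> complex vec \<Rightarrow> complex"
  where "gram_form a b = a \<bullet> (B *\<^sub>v b)"

definition root_value :: "nat \<Rightarrow> complex vec \<Rightarrow> complex"
  where "root_value j a = (\<Sum>i<r. a $ i * D $$ (i, j))"

text \<open>In coordinates this is the rule [e_i, f_j] = \<delta>_ij h_i, where column j of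
  \<open>X\<close> holds the coordinates of h_j.\<close>

definition pc_phi :: "complex vec \<Rightarrow> complex vec \<Rightarrow> complex vec"
  where "pc_phi v \<phi> = vec r (\<lambda>k. \<Sum>j<n. (v $ j * \<phi> $ j) * X $$ (k, j))"

lemma diagonal_action_eq:
  "diagonal_action D a x = vec n (\<lambda>j. root_value j a * x $ j)"
  "diagonal_action (- D) a x = vec n (\<lambda>j. - root_value j a * x $ j)"
  using D by (auto simp: diagonal_action_def root_value_def sum_negf)

text \<open>As \<Gamma> is diagonal, the (l, j) entry of \<open>B * X = D * \<Gamma>\<close> is the
  claim for basis vectors; the rest is an exchange of summations.\<close>

lemma gram_phi:
  assumes a: "a \<in> carrier_vec r"
  shows "gram_form a (pc_phi v \<phi>) = pc_pairing \<Gamma> (diagonal_action D a v) \<phi>"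
proof -
  have bx: "(\<Sum>k<r. B $$ (l, k) * X $$ (k, j)) = D $$ (l, j) * \<Gamma> $$ (j, j)" if "l < r" "j < n" for l j
  proof -
    have "(\<Sum>k<r. B $$ (l, k) * X $$ (k, j)) = (B * X) $$ (l, j)"
      using that B(1) X by (simp add: scalar_prod_def atLeast0LessThan)
    also have "\<dots> = (\<Sum>k<n. D $$ (l, k) * \<Gamma> $$ (k, j))"
      unfolding BX using that D \<Gamma>(1) by (simp add: scalar_prod_def atLeast0LessThan)
    also have "\<dots> = (\<Sum>k<n. if k = j then D $$ (l, j) * \<Gamma> $$ (j, j) else 0)"
      using \<Gamma>(1,2) that by (intro sum.cong) (auto simp: diagonal_mat_def)
    finally show ?thesis using that by simp
  qed
  have "gram_form a (pc_phi v \<phi>) = (\<Sum>l<r. a $ l * (\<Sum>k<r. B $$ (l, k) * (\<Sum>j<n. (v $ j * \<phi> $ j) * X $$ (k, j))))"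
    using a B(1) by (simp add: gram_form_def pc_phi_def scalar_prod_def atLeast0LessThan)
  also have "\<dots> = (\<Sum>l<r. a $ l * (\<Sum>j<n. (v $ j * \<phi> $ j) * (\<Sum>k<r. B $$ (l, k) * X $$ (k, j))))"
  proof -
    have "(\<Sum>k<r. B $$ (l, k) * (\<Sum>j<n. (v $ j * \<phi> $ j) * X $$ (k, j)))
        = (\<Sum>j<n. (v $ j * \<phi> $ j) * (\<Sum>k<r. B $$ (l, k) * X $$ (k, j)))" for l
      unfolding sum_distrib_left by (subst sum.swap) (simp add: mult_ac)
    then show ?thesis by (simp only:)
  qed
  also have "\<dots> = (\<Sum>l<r. \<Sum>j<n. a $ l * ((v $ j * \<phi> $ j) * (D $$ (l, j) * \<Gamma> $$ (j, j))))"
    by (simp add: bx sum_distrib_left)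
  also have "\<dots> = (\<Sum>j<n. \<Sum>l<r. a $ l * ((v $ j * \<phi> $ j) * (D $$ (l, j) * \<Gamma> $$ (j, j))))"
    by (rule sum.swap)
  also have "\<dots> = (\<Sum>j<n. root_value j a * v $ j * \<Gamma> $$ (j, j) * \<phi> $ j)"
    by (simp add: root_value_def sum_distrib_left mult_ac)
  finally show ?thesis using \<Gamma>(1) by (simp add: pc_pairing_def diagonal_action_eq)
qed

lemma pc_phi_map:
  "pentad_map (cartan_space r) (module_vec TYPE(complex) n) (module_vec TYPE(complex) n)
    (diagonal_action D) (pc_pairing \<Gamma>) gram_form pc_phi"
proof -
  have "pc_phi v (x + y) = pc_phi v x + pc_phi v y" "pc_phi (x + y) v = pc_phi x v + pc_phi y v"
    if "x \<in> carrier_vec n" "y \<in> carrier_vec n" for v x y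
    using sum_vec_add[OF that, of "\<lambda>j z. (v $ j * z) * X $$ (_, j)"]
      sum_vec_add[OF that, of "\<lambda>j z. (z * v $ j) * X $$ (_, j)"]
    by (intro eq_vecI; simp add: pc_phi_def distrib_left distrib_right sum.distrib)+
  moreover have "pc_phi v (c \<cdot>\<^sub>v x) = c \<cdot>\<^sub>v pc_phi v x" "pc_phi (c \<cdot>\<^sub>v x) v = c \<cdot>\<^sub>v pc_phi x v"
    if "x \<in> carrier_vec n" for c v x
    using sum_vec_smult[OF that, of "\<lambda>j z. (v $ j * z) * X $$ (_, j)" c]
      sum_vec_smult[OF that, of "\<lambda>j z. (z * v $ j) * X $$ (_, j)" c]
    by (intro eq_vecI; simp add: pc_phi_def sum_distrib_left mult_ac)+
  moreover have "pc_phi v x \<in> carrier_vec r" for v x by (simp add: pc_phi_def)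
  ultimately show ?thesis
    unfolding pentad_map_def bilinear_map_def linear_maps_iff by (simp add: gram_phi module_vec_simps)
qed

lemma root_value_linear:
  "\<lbrakk>a \<in> carrier_vec r; b \<in> carrier_vec r\<rbrakk> \<Longrightarrow> root_value j (a + b) = root_value j a + root_value j b"
  "a \<in> carrier_vec r \<Longrightarrow> root_value j (c \<cdot>\<^sub>v a) = c * root_value j a" "root_value j (0\<^sub>v r) = 0"
  using sum_vec_add[of a r b "\<lambda>i z. z * D $$ (i, j)"] sum_vec_smult[of a r "\<lambda>i z. z * D $$ (i, j)" c]
  by (simp_all add: root_value_def sum.distrib sum_distrib_left distrib_left distrib_right mult_ac)

lemma pc_standard_pentad:
  "standard_pentad (cartan_space r) (module_vec TYPE(complex) n) (module_vec TYPE(complex) n)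
    (diagonal_action D) (diagonal_action (- D)) (pc_pairing \<Gamma>) gram_form"
proof -
  let ?V = "module_vec TYPE(complex) n"
  have Vs: "vectorspace complex_ring ?V" using module_vec_complex_space by (simp add: complex_space_def)
  interpret V: vectorspace complex_ring ?V by (rule Vs)
  have Bv: "B *\<^sub>v b \<in> carrier_vec r" if "b \<in> carrier_vec r" for b using B(1) that by simp
  obtain C where C: "B * C = 1\<^sub>m r" "C * B = 1\<^sub>m (dim_row C)"
    using B by (auto simp: invertible_mat_def inverts_mat_def)
  then have Cc: "C \<in> carrier_mat r r"
    using B(1) by (metis carrier_matD(2) carrier_matI index_mult_mat(2,3) index_one_mat(2,3))
  \<comment> \<open>Against the columns of the inverse \<open>C\<close> of \<open>B\<close> the form
    reads off the coordinates of a. For the second argument, unit vectors give B b = 0, and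
    \<open>C\<close> cancels \<open>B\<close>.\<close>
  have nd1: "a = 0\<^sub>v r" if a: "a \<in> carrier_vec r" "\<forall>b\<in>carrier_vec r. gram_form a b = 0" for a
  proof (rule eq_vecI)
    fix j assume "j < dim_vec (0\<^sub>v r :: complex vec)"
    then have j: "j < r" by simp
    have "B *\<^sub>v (C *\<^sub>v unit_vec r j) = unit_vec r j"
      using assoc_mult_mat_vec[OF B(1) Cc, of "unit_vec r j"] C(1) by simp
    then have "gram_form a (C *\<^sub>v unit_vec r j) = a $ j"
      using a(1) j by (simp add: gram_form_def)
    then show "a $ j = 0\<^sub>v r $ j" using a(2) Cc j by simp
  qed (use a in simp)
  have nd2: "b = 0\<^sub>v r" if b: "b \<in> carrier_vec r" "\<forall>a\<in>carrier_vec r. gram_form a b = 0" for b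
  proof -
    have "B *\<^sub>v b = 0\<^sub>v r"
    proof (rule eq_vecI)
      fix j assume "j < dim_vec (0\<^sub>v r :: complex vec)"
      then have j: "j < r" by simp
      have "gram_form (unit_vec r j) b = (B *\<^sub>v b) $ j"
        using Bv[OF b(1)] j by (simp add: gram_form_def)
      then show "(B *\<^sub>v b) $ j = 0\<^sub>v r $ j" using b(2) j by simp
    qed (use B(1) in simp)
    moreover have "C *\<^sub>v (B *\<^sub>v b) = b"
      using assoc_mult_mat_vec[OF Cc B(1) b(1)] C(2) Cc b(1) by simp
    moreover have "C *\<^sub>v 0\<^sub>v r = 0\<^sub>v r" using Cc by (intro eq_vecI) auto
    ultimately show ?thesis by simp
  qed
  have unit: "pc_pairing \<Gamma> (unit_vec n j) y = \<Gamma> $$ (j, j) * y $ j" "pc_pairing \<Gamma> y (unit_vec n j) = \<Gamma> $$ (j, j) * y $ j"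
    if "j < n" for j y
  proof -
    have "pc_pairing \<Gamma> (unit_vec n j) y = (\<Sum>i<n. if i = j then \<Gamma> $$ (j, j) * y $ j else 0)"
      unfolding pc_pairing_def using \<Gamma>(1) by (intro sum.cong) (auto simp: unit_vec_def)
    then show "pc_pairing \<Gamma> (unit_vec n j) y = \<Gamma> $$ (j, j) * y $ j" using that by simp
    have "pc_pairing \<Gamma> y (unit_vec n j) = (\<Sum>i<n. if i = j then \<Gamma> $$ (j, j) * y $ j else 0)"
      unfolding pc_pairing_def using \<Gamma>(1) by (intro sum.cong) (auto simp: unit_vec_def)
    then show "pc_pairing \<Gamma> y (unit_vec n j) = \<Gamma> $$ (j, j) * y $ j" using that by simp
  qed
  have zero_minus: "x \<ominus>\<^bsub>?V\<^esub> x = 0\<^sub>v n" if "x \<in> carrier_vec n" for x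
    using V.M.r_neg[of x] that by (simp add: a_minus_def module_vec_def)
  \<comment> \<open>Both modules are diagonal, with s = 1 and s = -1. Over a commutative algebra a
    representation is a linear family of commuting operators.\<close>
  have rep: "lie_representation (cartan_space r) ?V \<rho>"
    if \<rho>: "\<And>a x. \<rho> a x = vec n (\<lambda>j. s * root_value j a * x $ j)" for \<rho> s
  proof -
    have "bilinear_map (cartan_space r) ?V ?V \<rho>"
      unfolding bilinear_map_def linear_maps_iff
      by (auto simp: \<rho> module_vec_def root_value_linear algebra_simps intro!: eq_vecI)
    moreover have "\<rho> a (\<rho> b v) = \<rho> b (\<rho> a v)" "\<rho> (0\<^sub>v r) v = 0\<^sub>v n" "\<rho> a v \<in> carrier_vec n" for a b v
      by (auto simp: \<rho> root_value_linear intro!: eq_vecI)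
    ultimately show ?thesis by (simp add: lie_representation_def zero_minus)
  qed
  show ?thesis
  proof (intro standard_pentad.intro standard_pentad_axioms.intro pentad.intro pentad_axioms.intro
      cartan_space_lie_algebra Vs)
    show "bilinear_map (cartan_space r) (cartan_space r) complex_line gram_form"
      unfolding bilinear_map_def linear_maps_iff gram_form_def
      using B(1) Bv by (auto simp: mult_add_distrib_mat_vec[of _ r r] mult_mat_vec[of _ r r]
        scalar_prod_add_distrib[of _ r] add_scalar_prod_distrib[of _ r])
    show "nondegenerate (cartan_space r) (cartan_space r) gram_form"
      unfolding nondegenerate_def using nd1 nd2 by simp
    show "gram_form (a \<otimes>\<^bsub>cartan_space r\<^esub> b) c = gram_form a (b \<otimes>\<^bsub>cartan_space r\<^esub> c)"
      if "a \<in> carrier (cartan_space r)" "b \<in> carrier (cartan_space r)" "c \<in> carrier (cartan_space r)" for a b c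
    proof -
      have "B *\<^sub>v 0\<^sub>v r = 0\<^sub>v r" using B(1) by (intro eq_vecI) auto
      then show ?thesis using that Bv by (simp add: gram_form_def)
    qed
    show "lie_representation (cartan_space r) ?V (diagonal_action D)"
      by (rule rep[of _ 1]) (simp add: diagonal_action_eq)
    show "lie_representation (cartan_space r) ?V (diagonal_action (- D))"
      by (rule rep[of _ "-1"]) (simp add: diagonal_action_eq)
    show "bilinear_map ?V ?V complex_line (pc_pairing \<Gamma>)"
    proof -
      have "pc_pairing \<Gamma> v (x + y) = pc_pairing \<Gamma> v x + pc_pairing \<Gamma> v y"
        "pc_pairing \<Gamma> (x + y) v = pc_pairing \<Gamma> x v + pc_pairing \<Gamma> y v"
        if "x \<in> carrier_vec n" "y \<in> carrier_vec n" for v x y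
        using \<Gamma>(1) sum_vec_add[OF that, of "\<lambda>j z. v $ j * \<Gamma> $$ (j, j) * z"]
          sum_vec_add[OF that, of "\<lambda>j z. z * \<Gamma> $$ (j, j) * v $ j"]
        by (simp_all add: pc_pairing_def sum.distrib distrib_left distrib_right)
      moreover have "pc_pairing \<Gamma> v (c \<cdot>\<^sub>v x) = c * pc_pairing \<Gamma> v x"
        "pc_pairing \<Gamma> (c \<cdot>\<^sub>v x) v = c * pc_pairing \<Gamma> x v" if "x \<in> carrier_vec n" for c v x
        using \<Gamma>(1) sum_vec_smult[OF that, of "\<lambda>j z. v $ j * \<Gamma> $$ (j, j) * z" c]
          sum_vec_smult[OF that, of "\<lambda>j z. z * \<Gamma> $$ (j, j) * v $ j" c]
        by (simp_all add: pc_pairing_def sum_distrib_left mult_ac)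
      ultimately show ?thesis
        unfolding bilinear_map_def linear_maps_iff by (simp add: module_vec_simps)
    qed
    show "nondegenerate ?V ?V (pc_pairing \<Gamma>)"
      unfolding nondegenerate_def
    proof (intro conjI ballI impI)
      fix x assume x: "x \<in> carrier ?V" "\<forall>y\<in>carrier ?V. pc_pairing \<Gamma> x y = 0"
      have "x $ j = 0" if "j < n" for j
        using x(2)[rule_format, of "unit_vec n j"] unit(2)[OF that] Gamma_nonzero[OF that]
        by (simp add: module_vec_simps)
      then show "x = \<zero>\<^bsub>?V\<^esub>" using x(1) by (auto simp: module_vec_def intro!: eq_vecI)
    next
      fix x assume x: "x \<in> carrier ?V" "\<forall>y\<in>carrier ?V. pc_pairing \<Gamma> y x = 0"
      have "x $ j = 0" if "j < n" for j
        using x(2)[rule_format, of "unit_vec n j"] unit(1)[OF that] Gamma_nonzero[OF that]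
        by (simp add: module_vec_simps)
      then show "x = \<zero>\<^bsub>?V\<^esub>" using x(1) by (auto simp: module_vec_def intro!: eq_vecI)
    qed
    show "pc_pairing \<Gamma> (diagonal_action D a v) \<phi> = - pc_pairing \<Gamma> v (diagonal_action (- D) a \<phi>)" for a v \<phi>
      using \<Gamma>(1) by (simp add: pc_pairing_def diagonal_action_eq sum_negf[symmetric] mult_ac)
    show "\<exists>\<Phi>. pentad_map (cartan_space r) ?V ?V (diagonal_action D) (pc_pairing \<Gamma>) gram_form \<Phi>"
      using pc_phi_map by blast
  qed
qed

text \<open>The pentad is read off from bases of the degrees 0, 1, -1 of a minimal algebra. The
  matrix \<open>A\<close> comes from \<open>ex_pc_matrix\<close>; the formula for
  \<open>pc_form A\<close> is part of the conclusion so that symmetry of the form can be checked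
  afterwards.\<close>

lemma pc_algebraI:
  fixes L :: "(complex, 'a) module"
  assumes min: "minimal_graded_lie_algebra L V"
    and b: "complex_space.family_basis L r \<epsilon> (V 0)" "complex_space.family_basis L n ee (V 1)"
      "complex_space.family_basis L n ff (V (-1))"
    and R0: "\<And>k l. \<lbrakk>k < r; l < r\<rbrakk> \<Longrightarrow> \<epsilon> k \<otimes>\<^bsub>L\<^esub> \<epsilon> l = \<zero>\<^bsub>L\<^esub>"
    and Re: "\<And>k j. \<lbrakk>k < r; j < n\<rbrakk> \<Longrightarrow> \<epsilon> k \<otimes>\<^bsub>L\<^esub> ee j = D $$ (k, j) \<odot>\<^bsub>L\<^esub> ee j"
    and Rf: "\<And>k j. \<lbrakk>k < r; j < n\<rbrakk> \<Longrightarrow> \<epsilon> k \<otimes>\<^bsub>L\<^esub> ff j = (- D $$ (k, j)) \<odot>\<^bsub>L\<^esub> ff j"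
    and Ref: "\<And>i j. \<lbrakk>i < n; j < n\<rbrakk> \<Longrightarrow> ee i \<otimes>\<^bsub>L\<^esub> ff j =
      (if i = j then \<Oplus>\<^bsub>L\<^esub>k\<in>{..<r}. X $$ (k, i) \<odot>\<^bsub>L\<^esub> \<epsilon> k else \<zero>\<^bsub>L\<^esub>)"
  shows "\<exists>A. pc_data r n A D \<Gamma> \<and> is_pc_algebra_of r n A D \<Gamma> L \<and> (\<forall>a b. pc_form A a b = a \<bullet> (B *\<^sub>v b))"
proof -
  interpret L: graded_lie_algebra L V using min by (simp add: minimal_graded_lie_algebra_def)
  obtain A where A: "A \<in> carrier_mat r r" "invertible_mat A" "\<And>a b. pc_form A a b = a \<bullet> (B *\<^sub>v b)"
    by (rule ex_pc_matrix) (rule that; assumption)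
  have form: "pc_form A = gram_form" using A(3) by (intro ext) (simp add: gram_form_def)
  let ?V = "module_vec TYPE(complex) n"
  define i0 where "i0 v = (\<Oplus>\<^bsub>L\<^esub>i\<in>{..<r}. v $ i \<odot>\<^bsub>L\<^esub> \<epsilon> i)" for v :: "complex vec"
  define i1 where "i1 v = (\<Oplus>\<^bsub>L\<^esub>i\<in>{..<n}. v $ i \<odot>\<^bsub>L\<^esub> ee i)" for v :: "complex vec"
  define j1 where "j1 v = (\<Oplus>\<^bsub>L\<^esub>i\<in>{..<n}. v $ i \<odot>\<^bsub>L\<^esub> ff i)" for v :: "complex vec"
  note b0 = L.family_basisD[OF b(1)] and b1 = L.family_basisD[OF b(2)] and b2 = L.family_basisD[OF b(3)]
  note m0 = L.basis_map_iso[OF b(1), folded i0_def] and m1 = L.basis_map_iso[OF b(2), folded i1_def]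
    and m2 = L.basis_map_iso[OF b(3), folded j1_def]
  have c0: "i0 v \<in> carrier L" "i1 v \<in> carrier L" "j1 v \<in> carrier L" for v
    unfolding i0_def i1_def j1_def using b0(1) b1(1) b2(1) by (auto intro!: L.lincomb_closed')
  \<comment> \<open>Stated for a general family \<open>g\<close> and sign s, to be used for e with s
    = 1 and for f with s = -1.\<close>
  have act: "i0 a \<otimes>\<^bsub>L\<^esub> g j = (s * root_value j a) \<odot>\<^bsub>L\<^esub> g j"
    if "\<And>k. k < r \<Longrightarrow> \<epsilon> k \<otimes>\<^bsub>L\<^esub> g j = (s * D $$ (k, j)) \<odot>\<^bsub>L\<^esub> g j" "g j \<in> carrier L" for a s j and g :: "nat \<Rightarrow> 'a"
  proof -
    have "i0 a \<otimes>\<^bsub>L\<^esub> g j = (\<Oplus>\<^bsub>L\<^esub>k\<in>{..<r}. (a $ k \<odot>\<^bsub>L\<^esub> \<epsilon> k) \<otimes>\<^bsub>L\<^esub> g j)"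
      unfolding i0_def using b0(1) that(2) by (intro L.bracket_finsum_left) auto
    also have "\<dots> = (\<Oplus>\<^bsub>L\<^esub>k\<in>{..<r}. (a $ k * (s * D $$ (k, j))) \<odot>\<^bsub>L\<^esub> g j)"
      using b0(1) that by (intro L.finsum_cong') (auto simp: L.bracket_smult_left L.smult_smult)
    also have "\<dots> = (\<Sum>k<r. a $ k * (s * D $$ (k, j))) \<odot>\<^bsub>L\<^esub> g j"
      using that(2) by (rule L.sum_smult[symmetric])
    also have "(\<Sum>k<r. a $ k * (s * D $$ (k, j))) = s * root_value j a"
      by (simp add: root_value_def sum_distrib_left mult_ac)
    finally show ?thesis .
  qed
  have act': "i0 a \<otimes>\<^bsub>L\<^esub> (\<Oplus>\<^bsub>L\<^esub>i\<in>{..<n}. v $ i \<odot>\<^bsub>L\<^esub> g i)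
      = (\<Oplus>\<^bsub>L\<^esub>i\<in>{..<n}. (vec n (\<lambda>j. s * root_value j a * v $ j)) $ i \<odot>\<^bsub>L\<^esub> g i)"
    if g: "\<And>k j. \<lbrakk>k < r; j < n\<rbrakk> \<Longrightarrow> \<epsilon> k \<otimes>\<^bsub>L\<^esub> g j = (s * D $$ (k, j)) \<odot>\<^bsub>L\<^esub> g j"
      "\<And>j. j < n \<Longrightarrow> g j \<in> carrier L" for a s v and g :: "nat \<Rightarrow> 'a"
  proof -
    have "i0 a \<otimes>\<^bsub>L\<^esub> (\<Oplus>\<^bsub>L\<^esub>i\<in>{..<n}. v $ i \<odot>\<^bsub>L\<^esub> g i) = (\<Oplus>\<^bsub>L\<^esub>i\<in>{..<n}. i0 a \<otimes>\<^bsub>L\<^esub> (v $ i \<odot>\<^bsub>L\<^esub> g i))"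
      using c0(1) g(2) by (intro L.bracket_finsum_right) auto
    also have "\<dots> = (\<Oplus>\<^bsub>L\<^esub>i\<in>{..<n}. (vec n (\<lambda>j. s * root_value j a * v $ j)) $ i \<odot>\<^bsub>L\<^esub> g i)"
      using c0(1) g act by (intro L.finsum_cong') (auto simp: L.bracket_smult_right L.smult_smult mult_ac)
    finally show ?thesis .
  qed
  have q1: "i0 a \<otimes>\<^bsub>L\<^esub> i1 v = i1 (diagonal_action D a v)" for a v
    unfolding i1_def diagonal_action_eq using act'[of ee 1 a v] Re b1(1) by simp
  have q2: "i0 a \<otimes>\<^bsub>L\<^esub> j1 v = j1 (diagonal_action (- D) a v)" for a v
    unfolding j1_def diagonal_action_eq using act'[of ff "-1" a v] Rf b2(1) by simp
  have q3: "i1 v \<otimes>\<^bsub>L\<^esub> j1 \<phi> = i0 (pc_phi v \<phi>)" for v \<phi>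
  proof -
    let ?h = "\<lambda>j. \<Oplus>\<^bsub>L\<^esub>k\<in>{..<r}. X $$ (k, j) \<odot>\<^bsub>L\<^esub> \<epsilon> k"
    have hc: "?h j \<in> carrier L" for j using b0(1) by (rule L.lincomb_closed')
    have s: "i1 v \<otimes>\<^bsub>L\<^esub> ff j = v $ j \<odot>\<^bsub>L\<^esub> ?h j" if "j < n" for j
      unfolding i1_def by (rule L.comb_bracket_diagonal) (use that b1(1) b2(1) hc Ref in auto)
    have "i1 v \<otimes>\<^bsub>L\<^esub> j1 \<phi> = (\<Oplus>\<^bsub>L\<^esub>j\<in>{..<n}. i1 v \<otimes>\<^bsub>L\<^esub> (\<phi> $ j \<odot>\<^bsub>L\<^esub> ff j))"
      unfolding j1_def using c0(2) b2(1) by (intro L.bracket_finsum_right) auto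
    also have "\<dots> = (\<Oplus>\<^bsub>L\<^esub>j\<in>{..<n}. (v $ j * \<phi> $ j) \<odot>\<^bsub>L\<^esub> ?h j)"
      using c0(2) b2(1) s hc by (intro L.finsum_cong') (auto simp: L.bracket_smult_right L.smult_smult mult_ac)
    also have "\<dots> = (\<Oplus>\<^bsub>L\<^esub>k\<in>{..<r}. (\<Sum>j<n. (v $ j * \<phi> $ j) * X $$ (k, j)) \<odot>\<^bsub>L\<^esub> \<epsilon> k)"
      using b0(1) by (rule L.lincomb_lincomb)
    also have "\<dots> = i0 (pc_phi v \<phi>)"
      unfolding i0_def using b0(1) by (intro L.finsum_cong') (auto simp: pc_phi_def)
    finally show ?thesis .
  qed
  have abel: "i0 a \<otimes>\<^bsub>L\<^esub> i0 b = \<zero>\<^bsub>L\<^esub>" for a b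
  proof -
    have 1: "i0 a \<otimes>\<^bsub>L\<^esub> \<epsilon> l = \<zero>\<^bsub>L\<^esub>" if "l < r" for l
    proof -
      have "i0 a \<otimes>\<^bsub>L\<^esub> \<epsilon> l = (\<Oplus>\<^bsub>L\<^esub>k\<in>{..<r}. (a $ k \<odot>\<^bsub>L\<^esub> \<epsilon> k) \<otimes>\<^bsub>L\<^esub> \<epsilon> l)"
        unfolding i0_def using b0(1) that by (intro L.bracket_finsum_left) auto
      also have "\<dots> = \<zero>\<^bsub>L\<^esub>"
        using b0(1) that by (intro L.add.finprod_one_eqI) (auto simp: L.bracket_smult_left R0)
      finally show ?thesis .
    qed
    have "i0 a \<otimes>\<^bsub>L\<^esub> i0 b = (\<Oplus>\<^bsub>L\<^esub>k\<in>{..<r}. i0 a \<otimes>\<^bsub>L\<^esub> (b $ k \<odot>\<^bsub>L\<^esub> \<epsilon> k))"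
      unfolding i0_def[of b] using b0(1) c0(1) by (intro L.bracket_finsum_right) auto
    also have "\<dots> = \<zero>\<^bsub>L\<^esub>"
      using b0(1) c0(1) by (intro L.add.finprod_one_eqI) (auto simp: L.bracket_smult_right 1)
    finally show ?thesis .
  qed
  have i00: "i0 (0\<^sub>v r) = \<zero>\<^bsub>L\<^esub>"
    unfolding i0_def by (rule L.lincomb_zero') (use b0(1) in auto)
  have i0: "i0 \<in> lie_iso (cartan_space r) (L\<lparr>carrier := V 0\<rparr>)"
    using m0 by (auto simp: lie_iso_def lie_hom_def linear_maps_iff module_vec_def abel i00)
  have "is_pc_algebra_of r n A D \<Gamma> L"
    unfolding is_pc_algebra_of_def is_pentad_lie_algebra_def form
  proof (intro conjI pc_standard_pentad exI)
    show "i1 \<in> linear_maps ?V (L\<lparr>carrier := V 1\<rparr>)" "bij_betw i1 (carrier ?V) (V 1)"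
      "j1 \<in> linear_maps ?V (L\<lparr>carrier := V (-1)\<rparr>)" "bij_betw j1 (carrier ?V) (V (-1))"
      using m1 m2 by (simp_all add: module_vec_def)
  qed (use min pc_phi_map i0 q1 q2 q3 in auto)
  moreover have "pc_data r n A D \<Gamma>"
    using pos A(1,2) D \<Gamma> by (simp add: pc_data_def)
  ultimately show ?thesis using A(3) by blast
qed

end

section \<open>Functionals, extension of bases, and the criterion for PC Lie algebras\<close>

lemma linear_functionalD:
  assumes "f \<in> linear_maps H complex_line"
  shows "\<lbrakk>x \<in> carrier H; y \<in> carrier H\<rbrakk> \<Longrightarrow> f (x \<oplus>\<^bsub>H\<^esub> y) = f x + f y"
    "x \<in> carrier H \<Longrightarrow> f (c \<odot>\<^bsub>H\<^esub> x) = c * f x"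
  using assms by (auto simp: linear_maps_iff)

context complex_space
begin

lemma functional_zero:
  assumes "f \<in> linear_maps L complex_line"
  shows "f \<zero> = 0"
  using linear_functionalD(2)[OF assms zero_closed, of 0] by simp

lemma functional_lincomb:
  fixes b :: "nat \<Rightarrow> 'a"
  assumes f: "f \<in> linear_maps L complex_line" and b: "\<And>i. i < n \<Longrightarrow> b i \<in> carrier L"
  shows "f (\<Oplus>i\<in>{..<n}. c i \<odot> b i) = (\<Sum>i<n. c i * f (b i))"
  using b
proof (induct n)
  case (Suc n)
  have "(\<Oplus>i\<in>{..<Suc n}. c i \<odot> b i) = c n \<odot> b n \<oplus> (\<Oplus>i\<in>{..<n}. c i \<odot> b i)"
    unfolding lessThan_Suc using Suc(2) by (intro finsum_insert) auto
  moreover have "(\<Oplus>i\<in>{..<n}. c i \<odot> b i) \<in> carrier L" using Suc(2) by (intro lincomb_closed') auto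
  ultimately show ?case
    using Suc linear_functionalD[OF f] by simp
qed (simp add: functional_zero[OF f])

text \<open>Biorthogonalization: \<open>p\<close> projects onto the common kernel of the first n
  functionals. If the next one vanished on the image of \<open>p\<close>, it would be a combination
  of the others; otherwise it provides a new vector, by which the old ones are corrected.\<close>

lemma dual_vectors:
  fixes \<alpha> :: "nat \<Rightarrow> 'a \<Rightarrow> complex"
  assumes "\<And>i. i < n \<Longrightarrow> \<alpha> i \<in> linear_maps L complex_line"
    and "\<forall>c. (\<forall>h\<in>carrier L. (\<Sum>i<n. c i * \<alpha> i h) = 0) \<longrightarrow> (\<forall>i<n. c i = 0)"
  shows "\<exists>u. (\<forall>i<n. u i \<in> carrier L) \<and> (\<forall>i<n. \<forall>j<n. \<alpha> j (u i) = (if i = j then 1 else 0))"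
  using assms
proof (induct n)
  case (Suc n)
  note lin = linear_functionalD[OF Suc(2)]
  have "\<forall>i<n. c i = 0" if c: "\<forall>h\<in>carrier L. (\<Sum>i<n. c i * \<alpha> i h) = 0" for c
  proof (intro allI impI)
    fix i assume i: "i < n"
    have "\<forall>h\<in>carrier L. (\<Sum>i<Suc n. (c(n := 0)) i * \<alpha> i h) = 0" using c by simp
    then have "(c(n := 0)) i = 0" using Suc(3) i by (meson less_SucI)
    then show "c i = 0" using i by simp
  qed
  then have "\<exists>u. (\<forall>i<n. u i \<in> carrier L) \<and> (\<forall>i<n. \<forall>j<n. \<alpha> j (u i) = (if i = j then 1 else 0))"
    using Suc(2) by (intro Suc(1)) auto
  then obtain u where u: "\<And>i. i < n \<Longrightarrow> u i \<in> carrier L"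
    "\<And>i j. \<lbrakk>i < n; j < n\<rbrakk> \<Longrightarrow> \<alpha> j (u i) = (if i = j then 1 else 0)"
    by blast
  define p where "p h = h \<oplus> (\<Oplus>i\<in>{..<n}. (- \<alpha> i h) \<odot> u i)" for h
  have pc: "p h \<in> carrier L" if "h \<in> carrier L" for h
    unfolding p_def using that lincomb_closed'[of n u] u(1) by auto
  have pj: "\<alpha> j (p h) = \<alpha> j h - (\<Sum>i<n. \<alpha> i h * \<alpha> j (u i))" if "h \<in> carrier L" "j < Suc n" for h j
    unfolding p_def using that lincomb_closed'[of n u] u(1) lin(1)[of j]
      functional_lincomb[of "\<alpha> j" n u] Suc(2)[of j] by (simp add: sum_negf)
  have p0: "\<alpha> j (p h) = 0" if "h \<in> carrier L" "j < n" for h j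
  proof -
    have "(\<Sum>i<n. \<alpha> i h * \<alpha> j (u i)) = (\<Sum>i<n. if i = j then \<alpha> j h else 0)"
      using u(2) that by (intro sum.cong) auto
    then show ?thesis using pj[of h j] that by simp
  qed
  have "\<exists>h\<in>carrier L. \<alpha> n (p h) \<noteq> 0"
  proof (rule ccontr)
    assume "\<not> ?thesis"
    then have z: "\<alpha> n h - (\<Sum>i<n. \<alpha> i h * \<alpha> n (u i)) = 0" if "h \<in> carrier L" for h
      using pj[of h n] that by auto
    define c where "c i = (if i = n then 1 else - \<alpha> n (u i))" for i
    have "(\<Sum>i<Suc n. c i * \<alpha> i h) = 0" if "h \<in> carrier L" for h
      using z[OF that] by (simp add: c_def sum_negf mult.commute)
    then have "c n = 0" using Suc(3) by blast
    then show False by (simp add: c_def)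
  qed
  then obtain h where h: "h \<in> carrier L" "\<alpha> n (p h) \<noteq> 0" by blast
  define w where "w = (1 / \<alpha> n (p h)) \<odot> p h"
  have w: "w \<in> carrier L" "\<alpha> n w = 1" "\<And>j. j < n \<Longrightarrow> \<alpha> j w = 0"
    unfolding w_def using pc[OF h(1)] h p0[OF h(1)] lin(2) by auto
  define u' where "u' i = (if i = n then w else u i \<oplus> (- \<alpha> n (u i)) \<odot> w)" for i
  have "u' i \<in> carrier L" if "i < Suc n" for i using that u(1) w(1) by (auto simp: u'_def)
  moreover have "\<alpha> j (u' i) = (if i = j then 1 else 0)" if "i < Suc n" "j < Suc n" for i j
    using that u w lin by (cases "i = n"; cases "j = n") (auto simp: u'_def)
  ultimately show ?case by blast
qed simp

lemma ex_coordinate_functional: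
  assumes b: "family_basis r b (carrier L)" and k: "k < r"
  shows "\<exists>\<mu>\<in>linear_maps L complex_line. \<forall>c. \<mu> (\<Oplus>i\<in>{..<r}. c i \<odot> b i) = c k"
proof
  note B = family_basisD[OF b]
  define \<mu> where "\<mu> h = (SOME c. h = (\<Oplus>i\<in>{..<r}. c i \<odot> b i)) k" for h
  have \<mu>: "\<mu> (\<Oplus>i\<in>{..<r}. c i \<odot> b i) = c k" for c
  proof -
    let ?P = "\<lambda>c'. (\<Oplus>i\<in>{..<r}. c i \<odot> b i) = (\<Oplus>i\<in>{..<r}. c' i \<odot> b i)"
    have "?P (SOME c'. ?P c')" by (rule someI[of ?P c]) simp
    from family_basis_unique[OF b this k] show ?thesis by (simp add: \<mu>_def)
  qed
  then show "\<forall>c. \<mu> (\<Oplus>i\<in>{..<r}. c i \<odot> b i) = c k" by blast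
  have "\<mu> (x \<oplus> y) = \<mu> x + \<mu> y" if xy: "x \<in> carrier L" "y \<in> carrier L" for x y
  proof -
    obtain c c' where "x = (\<Oplus>i\<in>{..<r}. c i \<odot> b i)" "y = (\<Oplus>i\<in>{..<r}. c' i \<odot> b i)"
      using B(4) xy by meson
    then show ?thesis using lincomb_add[of r b c c'] B(1) \<mu> by simp
  qed
  moreover have "\<mu> (a \<odot> x) = a * \<mu> x" if x: "x \<in> carrier L" for a x
  proof -
    obtain c where "x = (\<Oplus>i\<in>{..<r}. c i \<odot> b i)" using B(4) x by meson
    then show ?thesis using lincomb_smult'[of r b a c] B(1) \<mu> by simp
  qed
  ultimately show "\<mu> \<in> linear_maps L complex_line" by (auto simp: linear_maps_iff)
qed

lemma enumerate_basis:
  assumes "basis S" "finite S" "A \<subseteq> S" "inj_on a {..<n}" "A = a ` {..<n}"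
  shows "\<exists>r b. family_basis r b (carrier L) \<and> r = card S \<and> n \<le> r \<and> (\<forall>i<n. b i = a i) \<and> b ` {..<r} = S"
proof -
  have cA: "card A = n" using assms(4,5) by (simp add: card_image)
  obtain e where e: "bij_betw e {0..<card (S - A)} (S - A)"
    using ex_bij_betw_nat_finite[of "S - A"] assms(2) by auto
  define r where "r = card S"
  have r: "r = n + card (S - A)"
    using assms(2,3) cA card_mono[OF assms(2,3)] by (simp add: r_def card_Diff_subset finite_subset)
  define b where "b i = (if i < n then a i else e (i - n))" for i
  have img: "b ` {..<r} = S"
  proof -
    have "{..<r} = {..<n} \<union> (\<lambda>i. n + i) ` {0..<card (S - A)}"
      unfolding r by (auto simp: image_iff)
    then have "b ` {..<r} = b ` {..<n} \<union> b ` ((\<lambda>i. n + i) ` {0..<card (S - A)})" by (simp add: image_Un)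
    also have "b ` {..<n} = A" using assms(5) by (auto simp: b_def)
    also have "b ` ((\<lambda>i. n + i) ` {0..<card (S - A)}) = e ` {0..<card (S - A)}"
      unfolding image_image by (rule image_cong) (auto simp: b_def)
    also have "\<dots> = S - A" using e by (simp add: bij_betw_def)
    finally show ?thesis using assms(3) by auto
  qed
  have "card (b ` {..<r}) = card {..<r}" unfolding img by (simp add: r_def)
  then have inj: "inj_on b {..<r}" by (intro eq_card_imp_inj_on) auto
  have "L\<lparr>carrier := carrier L\<rparr> = L" by simp
  then have "indexed_basis L (carrier L) r b" using inj img assms(1) by (simp add: indexed_basis_def)
  from indexed_basis_family_basis[OF subspace_carrier this]
  show ?thesis using r img by (intro exI[of _ r] exI[of _ b]) (auto simp: r_def b_def)
qed

lemma independent_family_extend: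
  assumes fd: fin_dim and a: "\<And>i. i < n \<Longrightarrow> a i \<in> carrier L"
    and ind: "\<forall>c. (\<Oplus>i\<in>{..<n}. c i \<odot> a i) = \<zero> \<longrightarrow> (\<forall>i<n. c i = 0)"
  shows "\<exists>r b. family_basis r b (carrier L) \<and> r = dim \<and> n \<le> r \<and> (\<forall>i<n. b i = a i)"
proof -
  define S0 where "S0 = {\<Oplus>i\<in>{..<n}. c i \<odot> a i | c. True}"
  have S0: "subspace S0" unfolding S0_def by (rule lincombs_subspace) (rule a)
  have fb: "family_basis n a S0" using a ind by (auto simp: family_basis_def S0_def)
  have aS: "a i \<in> S0" if "i < n" for i by (rule family_basisD(2)[OF fb that])
  have ib: "indexed_basis L S0 n a" using indexed_basis_iff[where b = a and n = n, OF S0 aS] fb by blast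
  let ?A = "a ` {..<n}"
  have inj: "inj_on a {..<n}" using ib by (simp add: indexed_basis_def)
  have Ac: "?A \<subseteq> carrier L" using a by auto
  have li: "lin_indpt ?A"
  proof (rule finite_lin_indpt2[OF _ Ac])
    fix c assume "lincomb c ?A = \<zero>"
    moreover have "lincomb c ?A = (\<Oplus>i\<in>{..<n}. c (a i) \<odot> a i)"
      unfolding lincomb_def using inj a by (subst finsum_reindex) auto
    ultimately have "(\<Oplus>i\<in>{..<n}. c (a i) \<odot> a i) = \<zero>" by simp
    from ind[THEN spec[where x = "\<lambda>i. c (a i)"], THEN mp, OF this]
    show "\<forall>v\<in>?A. c v = \<zero>\<^bsub>complex_ring\<^esub>" by auto
  qed simp
  \<comment> \<open>A maximal independent set above the given family exists because
    \<open>dim\<close> bounds the cardinality; it is then maximal among all independent sets, hence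
    a basis.\<close>
  let ?P = "\<lambda>S. ?A \<subseteq> S \<and> S \<subseteq> carrier L \<and> lin_indpt S"
  have "finite S \<and> card S \<le> dim" if "?P S" for S using li_le_dim[OF fd] that by blast
  moreover have "?P ?A" using li Ac by blast
  ultimately have "\<exists>S. finite S \<and> maximal S ?P" by (rule maximal_exists)
  then obtain S where S: "finite S" "maximal S ?P" by blast
  then have PS: "?P S" and mx: "\<And>B. \<lbrakk>S \<subseteq> B; ?P B\<rbrakk> \<Longrightarrow> B = S" unfolding maximal_def by blast+
  have "maximal S (\<lambda>S. S \<subseteq> carrier L \<and> lin_indpt S)"
    unfolding maximal_def
  proof (intro conjI allI impI)
    fix B assume B: "S \<subseteq> B \<and> B \<subseteq> carrier L \<and> lin_indpt B"
    then have "?A \<subseteq> B" using PS by (metis subset_trans)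
    then show "B = S" using B mx by (metis (no_types, lifting))
  qed (use PS in simp_all)
  then have bs: "basis S" "?A \<subseteq> S" using max_li_is_basis PS by auto
  from enumerate_basis[OF bs(1) S(1) bs(2) inj HOL.refl] dim_basis[OF S(1) bs(1)]
  show ?thesis by auto
qed

end

lemma invertible_matI:
  fixes B :: "complex mat"
  assumes B: "B \<in> carrier_mat r r" and ker: "\<And>v. \<lbrakk>v \<in> carrier_vec r; B *\<^sub>v v = 0\<^sub>v r\<rbrakk> \<Longrightarrow> v = 0\<^sub>v r"
  shows "invertible_mat B"
proof -
  have "det B \<noteq> 0" using det_0_iff_vec_prod_zero[OF B] ker by blast
  from det_non_zero_imp_unit[OF B this, of "()"] obtain C where "C \<in> carrier_mat r r" "C * B = 1\<^sub>m r" "B * C = 1\<^sub>m r"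
    by (auto simp: Units_def ring_mat_def)
  then show ?thesis using B by (auto simp: invertible_mat_def inverts_mat_def)
qed

lemma (in chevalley_graded) chevalley_pc:
  assumes tr: "transitive_grading L V" and pos: "0 < r" "0 < n"
    and b: "H.family_basis r b (carrier H)" and D: "D \<in> carrier_mat r n" "\<And>k j. \<lbrakk>k < r; j < n\<rbrakk> \<Longrightarrow> D $$ (k, j) = \<alpha> j (b k)"
    and X: "X \<in> carrier_mat r n" "\<And>i. i < n \<Longrightarrow> \<alpha>\<^sub>c i = (\<Oplus>\<^bsub>H\<^esub>k\<in>{..<r}. X $$ (k, i) \<odot>\<^bsub>H\<^esub> b k)"
    and \<Gamma>: "\<Gamma> \<in> carrier_mat n n" "diagonal_mat \<Gamma>" "invertible_mat \<Gamma>"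
    and B: "B \<in> carrier_mat r r" "invertible_mat B" and BX: "B * X = D * \<Gamma>"
  shows "pc_lie_algebra L"
proof -
  note bD = H.family_basisD[OF b]
  have "family_basis r (\<lambda>k. hh (b k)) (hh ` carrier H)"
    by (rule H.family_basis_image[OF b complex_space_axioms hh_linear hh_eq_zero])
  then have h: "family_basis r (\<lambda>k. hh (b k)) (V 0)" using hh_bij by (simp add: bij_betw_def)
  have "\<exists>A. pc_data r n A D \<Gamma> \<and> is_pc_algebra_of r n A D \<Gamma> L \<and> (\<forall>a b. pc_form A a b = a \<bullet> (B *\<^sub>v b))"
  proof (rule pc_algebraI[OF pos D(1) X(1) \<Gamma> B BX transitive_grading_minimal[OF graded_lie_algebra_axioms tr] h e_basis f_basis])
    fix i j assume ij: "i < n" "j < n"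
    have "hh (\<alpha>\<^sub>c i) = (\<Oplus>k\<in>{..<r}. X $$ (k, i) \<odot> hh (b k))"
      unfolding X(2)[OF ij(1)] by (rule linear_lincomb[OF H.complex_space_axioms complex_space_axioms hh_linear bD(1)])
    then show "ee i \<otimes> ff j = (if i = j then \<Oplus>k\<in>{..<r}. X $$ (k, i) \<odot> hh (b k) else \<zero>)"
      using e_f[OF ij] by (cases "i = j") simp_all
  qed (use hh_hh hh_e hh_f bD(1) D(2) in auto)
  then show ?thesis unfolding pc_lie_algebra_def by blast
qed

lemma lincomb_vec_index:
  fixes w :: "nat \<Rightarrow> complex vec"
  assumes "k < r" "\<And>j. j < m \<Longrightarrow> w j \<in> carrier_vec r"
  shows "(\<Oplus>\<^bsub>module_vec TYPE(complex) r\<^esub>j\<in>{..<m}. c j \<odot>\<^bsub>module_vec TYPE(complex) r\<^esub> w j) $ k = (\<Sum>j<m. c j * w j $ k)"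
  using assms(2)
proof (induct m)
  case 0
  interpret M: complex_space "module_vec TYPE(complex) r" by (rule module_vec_complex_space)
  show ?case using assms(1) by (simp add: module_vec_simps)
next
  case (Suc m)
  let ?M = "module_vec TYPE(complex) r"
  interpret M: complex_space ?M by (rule module_vec_complex_space)
  have wc: "w j \<in> carrier ?M" if "j < Suc m" for j using Suc(2)[OF that] by (simp add: module_vec_simps)
  let ?s = "\<Oplus>\<^bsub>?M\<^esub>j\<in>{..<m}. c j \<odot>\<^bsub>?M\<^esub> w j"
  have "(\<Oplus>\<^bsub>?M\<^esub>j\<in>{..<Suc m}. c j \<odot>\<^bsub>?M\<^esub> w j) = c m \<odot>\<^bsub>?M\<^esub> w m \<oplus>\<^bsub>?M\<^esub> ?s"
    unfolding lessThan_Suc using wc by (intro M.finsum_insert) auto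
  also have "\<dots> = c m \<cdot>\<^sub>v w m + ?s" by (simp only: module_vec_simps)
  also have "(c m \<cdot>\<^sub>v w m + ?s) $ k = c m * w m $ k + ?s $ k"
  proof -
    have "?s \<in> carrier ?M" using wc by (intro M.lincomb_closed') auto
    then have "dim_vec ?s = r" by (simp only: module_vec_simps carrier_vecD)
    then show ?thesis using Suc(2)[of m] assms(1) by (subst index_add_vec) auto
  qed
  finally show ?case using Suc by simp
qed

text \<open>Common ground of the realizations of C and of the model on C^(2n) from which
  \<open>contragredient\<close> is obtained.\<close>

locale independent_datum = H: complex_space H for H :: "(complex, 'h) module" +
  fixes n :: nat and \<alpha> :: "nat \<Rightarrow> 'h \<Rightarrow> complex" and \<alpha>\<^sub>c :: "nat \<Rightarrow> 'h"
  assumes fin_dim: "H.fin_dim" and n_pos: "0 < n"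
    and root_linear: "i < n \<Longrightarrow> \<alpha> i \<in> linear_maps H complex_line"
    and root_independent: "\<forall>c. (\<forall>h\<in>carrier H. (\<Sum>i<n. c i * \<alpha> i h) = 0) \<longrightarrow> (\<forall>i<n. c i = 0)"
    and coroot_carrier: "i < n \<Longrightarrow> \<alpha>\<^sub>c i \<in> carrier H"
    and coroot_independent: "\<forall>c. (\<Oplus>\<^bsub>H\<^esub>i\<in>{..<n}. c i \<odot>\<^bsub>H\<^esub> \<alpha>\<^sub>c i) = \<zero>\<^bsub>H\<^esub> \<longrightarrow> (\<forall>i<n. c i = 0)"
begin

lemma ex_rho: "\<exists>\<rho>\<in>carrier H. \<forall>i<n. \<alpha> i \<rho> = 1"
proof -
  obtain u where u: "\<And>i. i < n \<Longrightarrow> u i \<in> carrier H"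
    "\<And>i j. \<lbrakk>i < n; j < n\<rbrakk> \<Longrightarrow> \<alpha> j (u i) = (if i = j then 1 else 0)"
    using H.dual_vectors[of n \<alpha>, OF root_linear root_independent] by blast
  let ?\<rho> = "\<Oplus>\<^bsub>H\<^esub>i\<in>{..<n}. 1 \<odot>\<^bsub>H\<^esub> u i"
  have "\<alpha> j ?\<rho> = 1" if j: "j < n" for j
  proof -
    have "\<alpha> j ?\<rho> = (\<Sum>i<n. 1 * \<alpha> j (u i))" by (rule H.functional_lincomb[OF root_linear[OF j] u(1)])
    also have "\<dots> = (\<Sum>i<n. if i = j then 1 else 0)" using u(2) j by (intro sum.cong) auto
    finally show ?thesis using j by simp
  qed
  moreover have "?\<rho> \<in> carrier H" using u(1) by (rule H.lincomb_closed')
  ultimately show ?thesis by blast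
qed

definition \<rho> :: 'h where "\<rho> = (SOME \<rho>. \<rho> \<in> carrier H \<and> (\<forall>i<n. \<alpha> i \<rho> = 1))"

lemma rho: "\<rho> \<in> carrier H" "i < n \<Longrightarrow> \<alpha> i \<rho> = 1"
  using someI_ex[of "\<lambda>\<rho>. \<rho> \<in> carrier H \<and> (\<forall>i<n. \<alpha> i \<rho> = 1)"] ex_rho unfolding \<rho>_def by blast+

lemma ex_basis: "\<exists>r b. H.family_basis r b (carrier H) \<and> n \<le> r \<and> (\<forall>i<n. b i = \<alpha>\<^sub>c i)"
  using H.independent_family_extend[OF fin_dim coroot_carrier coroot_independent] by blast

lemma coroot_nonzero: "i < n \<Longrightarrow> \<alpha>\<^sub>c i \<noteq> \<zero>\<^bsub>H\<^esub>"
proof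
  assume i: "i < n" and 0: "\<alpha>\<^sub>c i = \<zero>\<^bsub>H\<^esub>"
  have "(\<Oplus>\<^bsub>H\<^esub>k\<in>{..<n}. (if k = i then 1 else 0) \<odot>\<^bsub>H\<^esub> \<alpha>\<^sub>c k) = 1 \<odot>\<^bsub>H\<^esub> \<alpha>\<^sub>c i"
    by (rule H.lincomb_unit[OF _ i]) (rule coroot_carrier)
  then have "(\<Oplus>\<^bsub>H\<^esub>k\<in>{..<n}. (if k = i then 1 else 0) \<odot>\<^bsub>H\<^esub> \<alpha>\<^sub>c k) = \<zero>\<^bsub>H\<^esub>" using 0 by simp
  from coroot_independent[rule_format, OF this i] show False by simp
qed

sublocale cartan_datum H n \<alpha> \<alpha>\<^sub>c \<rho>
proof
  fix h assume h: "h \<in> carrier H" "h \<noteq> \<zero>\<^bsub>H\<^esub>"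
  obtain r b where b: "H.family_basis r b (carrier H)" using ex_basis by blast
  obtain c where c: "h = (\<Oplus>\<^bsub>H\<^esub>i\<in>{..<r}. c i \<odot>\<^bsub>H\<^esub> b i)" using H.family_basisD(4)[OF b h(1)] by blast
  have "\<exists>k<r. c k \<noteq> 0"
  proof (rule ccontr)
    assume "\<not> (\<exists>k<r. c k \<noteq> 0)"
    then have "h = \<zero>\<^bsub>H\<^esub>" unfolding c by (intro H.lincomb_zero' H.family_basisD(1)[OF b]) auto
    with h(2) show False by simp
  qed
  then obtain k where k: "k < r" "c k \<noteq> 0" by blast
  obtain \<mu> where "\<mu> \<in> linear_maps H complex_line" "\<mu> (\<Oplus>\<^bsub>H\<^esub>i\<in>{..<r}. c i \<odot>\<^bsub>H\<^esub> b i) = c k"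
    using H.ex_coordinate_functional[OF b k(1)] by blast
  then show "\<exists>\<mu>\<in>linear_maps H complex_line. \<mu> h \<noteq> 0"
    unfolding c using k(2) by (intro bexI[of _ \<mu>]) simp_all
qed (use root_linear coroot_carrier coroot_nonzero rho in auto)

text \<open>With \<Gamma> = 1 and \<open>X\<close> the first n columns of the identity,
  \<open>B * X = D * \<Gamma>\<close> prescribes only the first n columns of \<open>B\<close>. The
  remaining ones merely complete a basis, so the form is in general not symmetric.\<close>

lemma kac_algebra_pc: "pc_lie_algebra (kac_algebra n H \<alpha> \<alpha>\<^sub>c)"
proof -
  interpret K: chevalley_graded "kac_algebra n H \<alpha> \<alpha>\<^sub>c" VK H n \<alpha> \<alpha>\<^sub>c hk ek fk by (rule kac_chevalley)
  obtain r b where b: "H.family_basis r b (carrier H)" "n \<le> r" "\<And>i. i < n \<Longrightarrow> b i = \<alpha>\<^sub>c i"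
    using ex_basis by blast
  note bD = H.family_basisD[OF b(1)]
  let ?M = "module_vec TYPE(complex) r"
  interpret M: complex_space ?M by (rule module_vec_complex_space)
  interpret vs: vec_space "TYPE(complex)" r .
  define d where "d j = vec r (\<lambda>k. \<alpha> j (b k))" for j
  have dc: "d j \<in> carrier ?M" for j by (simp add: d_def module_vec_simps)
  \<comment> \<open>A relation among the columns \<open>d j\<close> is a relation among the roots on
    a basis of \<open>H\<close>, hence on all of \<open>H\<close>.\<close>
  have ind: "\<forall>i<n. c i = 0" if c: "(\<Oplus>\<^bsub>?M\<^esub>j\<in>{..<n}. c j \<odot>\<^bsub>?M\<^esub> d j) = \<zero>\<^bsub>?M\<^esub>" for c
  proof (rule root_independent[THEN spec, THEN mp], rule ballI)
    fix h assume "h \<in> carrier H"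
    then obtain x where x: "h = (\<Oplus>\<^bsub>H\<^esub>k\<in>{..<r}. x k \<odot>\<^bsub>H\<^esub> b k)" using bD(4) by blast
    have z: "(\<Sum>j<n. c j * \<alpha> j (b k)) = 0" if "k < r" for k
    proof -
      have "(\<Oplus>\<^bsub>?M\<^esub>j\<in>{..<n}. c j \<odot>\<^bsub>?M\<^esub> d j) $ k = (\<Sum>j<n. c j * d j $ k)"
        by (rule lincomb_vec_index[OF that]) (simp add: d_def)
      then show ?thesis using c that by (simp add: d_def module_vec_simps)
    qed
    have "(\<Sum>j<n. c j * \<alpha> j h) = (\<Sum>j<n. \<Sum>k<r. c j * (x k * \<alpha> j (b k)))"
      unfolding x using H.functional_lincomb[OF root_linear bD(1)]
      by (intro sum.cong) (auto simp: sum_distrib_left)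
    also have "\<dots> = (\<Sum>k<r. x k * (\<Sum>j<n. c j * \<alpha> j (b k)))"
      by (subst sum.swap) (simp add: sum_distrib_left mult_ac)
    also have "\<dots> = 0" using z by simp
    finally show "(\<Sum>j<n. c j * \<alpha> j h) = 0" .
  qed
  obtain r' w where w: "M.family_basis r' w (carrier ?M)" "r' = M.dim" "\<And>i. i < n \<Longrightarrow> w i = d i"
    using M.independent_family_extend[of n d, OF vs.fin_dim dc] ind by blast
  have r': "r' = r" using w(2) vs.dim_is_n by simp
  note wD = M.family_basisD[OF w(1)[unfolded r']]
  have wc: "w j \<in> carrier_vec r" if "j < r" for j using wD(1)[OF that] by (simp add: module_vec_simps)
  define B where "B = mat r r (\<lambda>(k, l). w l $ k)"
  have B: "invertible_mat B"
  proof (rule invertible_matI)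
    show "B \<in> carrier_mat r r" by (simp add: B_def)
    fix v assume v: "v \<in> carrier_vec r" "B *\<^sub>v v = 0\<^sub>v r"
    have "(\<Oplus>\<^bsub>?M\<^esub>j\<in>{..<r}. v $ j \<odot>\<^bsub>?M\<^esub> w j) = \<zero>\<^bsub>?M\<^esub>"
    proof -
      have dv: "(\<Oplus>\<^bsub>?M\<^esub>j\<in>{..<r}. v $ j \<odot>\<^bsub>?M\<^esub> w j) \<in> carrier_vec r"
        using M.lincomb_closed'[of r w "\<lambda>j. v $ j"] wD(1) by (simp add: module_vec_simps)
      have "(\<Oplus>\<^bsub>?M\<^esub>j\<in>{..<r}. v $ j \<odot>\<^bsub>?M\<^esub> w j) $ k = 0" if k: "k < r" for k
      proof -
        have "(\<Oplus>\<^bsub>?M\<^esub>j\<in>{..<r}. v $ j \<odot>\<^bsub>?M\<^esub> w j) $ k = (\<Sum>j<r. v $ j * w j $ k)"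
          by (rule lincomb_vec_index[OF k wc])
        also have "\<dots> = (B *\<^sub>v v) $ k"
          using k v(1) by (simp add: B_def scalar_prod_def atLeast0LessThan mult.commute)
        finally show ?thesis using v(2) k by simp
      qed
      then show ?thesis using dv by (intro eq_vecI) (auto simp: module_vec_simps)
    qed
    from wD(6)[OF this] show "v = 0\<^sub>v r" using v(1) by (intro eq_vecI) auto
  qed
  define D where "D = mat r n (\<lambda>(k, j). \<alpha> j (b k))"
  define X where "X = mat r n (\<lambda>(k, i). if k = i then (1::complex) else 0)"
  show ?thesis
  proof (rule K.chevalley_pc[OF kac_transitive, where r = r and b = b and D = D and X = X and B = B and \<Gamma> = "1\<^sub>m n"])
    show "0 < r" "0 < n" using n_pos b(2) by auto
    show "\<alpha>\<^sub>c i = (\<Oplus>\<^bsub>H\<^esub>k\<in>{..<r}. X $$ (k, i) \<odot>\<^bsub>H\<^esub> b k)" if i: "i < n" for i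
    proof -
      have "(\<Oplus>\<^bsub>H\<^esub>k\<in>{..<r}. X $$ (k, i) \<odot>\<^bsub>H\<^esub> b k) = (\<Oplus>\<^bsub>H\<^esub>k\<in>{..<r}. (if k = i then 1 else 0) \<odot>\<^bsub>H\<^esub> b k)"
        using i bD(1) by (intro H.finsum_cong') (auto simp: X_def)
      also have "\<dots> = 1 \<odot>\<^bsub>H\<^esub> b i" by (rule H.lincomb_unit) (use bD(1) i b(2) in auto)
      finally show ?thesis using b(3)[OF i] coroot_carrier[OF i] by simp
    qed
    show "B * X = D * 1\<^sub>m n"
    proof (rule eq_matI)
      fix k j assume kj: "k < dim_row (D * 1\<^sub>m n)" "j < dim_col (D * 1\<^sub>m n)"
      then have kj: "k < r" "j < n" by (auto simp: D_def)
      have "(B * X) $$ (k, j) = (\<Sum>l<r. w l $ k * (if l = j then 1 else 0))"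
        using kj by (simp add: B_def X_def scalar_prod_def atLeast0LessThan)
      also have "\<dots> = (\<Sum>l<r. if l = j then w j $ k else 0)" by (intro sum.cong) auto
      also have "\<dots> = \<alpha> j (b k)" using kj b(2) w(3)[OF kj(2)] by (simp add: d_def)
      finally show "(B * X) $$ (k, j) = (D * 1\<^sub>m n) $$ (k, j)" using kj by (simp add: D_def)
    qed (auto simp: B_def X_def D_def)
    show "diagonal_mat (1\<^sub>m n)" by (simp add: diagonal_mat_def)
    show "invertible_mat (1\<^sub>m n :: complex mat)" by (rule invertible_matI) auto
  qed (use b(1) B in \<open>auto simp: D_def X_def B_def\<close>)
qed

text \<open>Passing to the derived algebra cuts degree 0 down to the span of the coroots, which then
  form a basis of it as G(C) demands; transitivity is inherited because degrees 1 and -1 are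
  unchanged.\<close>

lemma kac_derived: "\<exists>V H'. chevalley_graded (derived_algebra (kac_algebra n H \<alpha> \<alpha>\<^sub>c)) V H' n \<alpha> \<alpha>\<^sub>c hk ek fk \<and>
    transitive_grading (derived_algebra (kac_algebra n H \<alpha> \<alpha>\<^sub>c)) V \<and>
    complex_space.family_basis H' n \<alpha>\<^sub>c (carrier H') \<and> (\<forall>i<n. \<alpha> i \<in> linear_maps H' complex_line)"
proof -
  interpret K: chevalley_graded "kac_algebra n H \<alpha> \<alpha>\<^sub>c" VK H n \<alpha> \<alpha>\<^sub>c hk ek fk by (rule kac_chevalley)
  let ?K = "kac_algebra n H \<alpha> \<alpha>\<^sub>c"
  note d = K.derived_chevalley[OF rho]
  let ?M = "carrier (derived_algebra ?K)"
  have dK: "derived_algebra ?K = ?K\<lparr>carrier := ?M\<rparr>" by (simp add: derived_algebra_def)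
  have t: "transitive_grading (derived_algebra ?K) (\<lambda>k. ?M \<inter> VK k)"
    by (subst dK) (rule transitive_grading_restrict[OF kac_transitive d(3,2)])
  let ?H = "H\<lparr>carrier := K.coroot_span\<rparr>"
  interpret H': complex_space ?H by (rule H.restrict_complex_space[OF K.coroot_span_subspace])
  have e: "(\<Oplus>\<^bsub>?H\<^esub>i\<in>{..<n}. c i \<odot>\<^bsub>?H\<^esub> \<alpha>\<^sub>c i) = (\<Oplus>\<^bsub>H\<^esub>i\<in>{..<n}. c i \<odot>\<^bsub>H\<^esub> \<alpha>\<^sub>c i)" for c
    using K.coroot_in_span H.subspaceD(4)[OF K.coroot_span_subspace]
    by (subst H.finsum_restrict_carrier[OF K.coroot_span_subspace]) auto
  have "H'.family_basis n \<alpha>\<^sub>c (carrier ?H)"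
    unfolding H'.family_basis_def e using K.coroot_in_span coroot_independent
    by (auto simp: K.coroot_span_def)
  moreover have "\<forall>i<n. \<alpha> i \<in> linear_maps ?H complex_line"
    using root_linear H.subspaceD(1)[OF K.coroot_span_subspace] by (simp add: linear_maps_iff)
  ultimately show ?thesis using d(1) t by blast
qed

end

section \<open>Centers and reduced algebras\<close>

context chevalley_graded
begin

text \<open>An element of degree 0 acts on e_j and f_j by plus and minus \<alpha>_j(h). Its
  centralizer is a subalgebra, so it is central as soon as it commutes with the local part.\<close>

lemma hh_central_iff:
  assumes h: "h \<in> carrier H"
  shows "hh h \<in> lie_center L \<longleftrightarrow> (\<forall>j<n. \<alpha> j h = 0)"
proof
  assume c: "hh h \<in> lie_center L"
  show "\<forall>j<n. \<alpha> j h = 0"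
  proof (intro allI impI)
    fix j assume j: "j < n"
    have "\<alpha> j h \<odot> ee j = \<zero>" using c hh_e[OF h j] eD(1)[OF j] by (simp add: lie_center_def)
    then have "(\<Oplus>i\<in>{..<n}. (if i = j then \<alpha> j h else 0) \<odot> ee i) = \<zero>"
      using lincomb_unit[where b = ee and n = n, OF eD(1) j] by simp
    from eD(6)[OF this j] show "\<alpha> j h = 0" by simp
  qed
next
  assume z: "\<forall>j<n. \<alpha> j h = 0"
  let ?S = "{x \<in> carrier L. hh h \<otimes> x \<in> {\<zero>}}"
  have hc: "hh h \<in> carrier L" by (rule hhD(2)[OF h])
  have S: "subspace ?S" by (rule ad_vimage_subspace(1)[OF subspace_zero hc])
  have "lie_subalgebra L ?S"
  proof (rule lie_subalgebraI[OF S])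
    fix x y assume "x \<in> ?S" "y \<in> ?S"
    then show "x \<otimes> y \<in> ?S" using hc by (simp add: bracket_derivation)
  qed
  moreover have "V (-1) \<union> V 0 \<union> V 1 \<subseteq> ?S"
  proof -
    have "V 1 \<subseteq> ?S"
      using lincombs_minimal[of n ee ?S, OF _ S] e_basis hh_e[OF h] z eD(1)
      by (simp add: family_basis_def)
    moreover have "V (-1) \<subseteq> ?S"
      using lincombs_minimal[of n ff ?S, OF _ S] f_basis hh_f[OF h] z fD(1)
      by (simp add: family_basis_def)
    moreover have "V 0 \<subseteq> ?S" using hhD(6) hh_hh[OF h] hhD(2) by fastforce
    ultimately show ?thesis by blast
  qed
  ultimately have "lie_generated L (V (-1) \<union> V 0 \<union> V 1) \<subseteq> ?S" by (rule lie_generated_minimal)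
  then show "hh h \<in> lie_center L" unfolding generated_by_local_part lie_center_def using hc by auto
qed

lemma homogeneous_central_zero:
  assumes tr: "transitive_grading L V" and c: "\<And>i. i < n \<Longrightarrow> \<alpha>\<^sub>c i \<noteq> \<zero>\<^bsub>H\<^esub>"
    and k: "k \<noteq> 0" and x: "x \<in> V k" and z: "\<And>y. y \<in> V (-1) \<union> V 1 \<Longrightarrow> y \<otimes> x = \<zero>"
  shows "x = \<zero>"
proof -
  interpret fl: chevalley_graded L "\<lambda>k. V (- k)" H n "\<lambda>i h. - \<alpha> i h" "\<lambda>i. \<ominus>\<^bsub>H\<^esub> \<alpha>\<^sub>c i" hh ff ee
    by (rule flip_chevalley)
  from k consider "k = 1" | "k = -1" | "2 \<le> k" | "2 \<le> - k" by linarith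
  then show ?thesis
  proof cases
    case 1
    show ?thesis by (rule local_transitive[OF c]) (use x z 1 in auto)
  next
    case 2
    show ?thesis
    proof (rule fl.local_transitive)
      show "\<ominus>\<^bsub>H\<^esub> \<alpha>\<^sub>c i \<noteq> \<zero>\<^bsub>H\<^esub>" if "i < n" for i
        by (rule H.minus_nonzero[OF coroot[OF that] c[OF that]])
    qed (use x z 2 in auto)
  next
    case 3
    then show ?thesis using tr x z unfolding transitive_grading_def by blast
  next
    case 4
    have "x \<in> V (- (- k))" using x by simp
    then show ?thesis using tr 4 z unfolding transitive_grading_def by blast
  qed
qed

text \<open>Each homogeneous component of a central element commutes with every homogeneous element;
  outside degree 0 it then vanishes by transitivity.\<close>

lemma center_degree_zero:
  assumes tr: "transitive_grading L V" and c: "\<And>i. i < n \<Longrightarrow> \<alpha>\<^sub>c i \<noteq> \<zero>\<^bsub>H\<^esub>"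
  shows "lie_center L \<subseteq> V 0"
proof
  fix z assume z: "z \<in> lie_center L"
  then have zc: "z \<in> carrier L" and z0: "\<And>y. y \<in> carrier L \<Longrightarrow> z \<otimes> y = \<zero>" by (auto simp: lie_center_def)
  have yz: "y \<otimes> z = \<zero>" if "y \<in> carrier L" for y
    using bracket_anticommute[OF that zc] z0[OF that] smult_m1[of \<zero>] by simp
  obtain F v where F: "finite F" "\<And>i. v i \<in> V i" "\<And>i. i \<notin> F \<Longrightarrow> v i = \<zero>" "z = (\<Oplus>i\<in>F. v i)"
    using zc unfolding carrier_homogeneous
    by (rule homogeneous_sumsE[OF _ V_subspace]) (rule that; assumption)
  have vc: "v i \<in> carrier L" for i using F(2) VD(1) by blast
  have comp: "y \<otimes> v i = \<zero>" if y: "y \<in> V j" and i: "i \<in> F" for y i j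
  proof -
    have yc: "y \<in> carrier L" by (rule VD(1)[OF y])
    \<comment> \<open>A shift by the degree j of y, so that the terms [y, v i] are indexed by their
      own degree and independence applies.\<close>
    let ?w = "\<lambda>k. y \<otimes> v (k - j)"
    have "(\<Oplus>k\<in>(\<lambda>i. i + j) ` F. ?w k) = (\<Oplus>i\<in>F. y \<otimes> v i)"
      using yc vc by (subst finsum_reindex) auto
    also have "\<dots> = y \<otimes> z" unfolding F(4) using yc vc by (intro bracket_finsum_right[symmetric]) auto
    finally have s: "(\<Oplus>k\<in>(\<lambda>i. i + j) ` F. ?w k) = \<zero>" using yz[OF yc] by simp
    have m: "?w k \<in> V k" for k using V_bracket[OF y F(2)[of "k - j"]] by simp
    have "?w (i + j) = \<zero>" by (rule V_independent[OF _ m s]) (use F(1) i in auto)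
    then show ?thesis by simp
  qed
  have "v i = \<zero>" if "i \<noteq> 0" for i
  proof (cases "i \<in> F")
    case True
    show ?thesis
      by (rule homogeneous_central_zero[OF tr c that F(2)]) (use comp[OF _ True] in auto)
  qed (use F(3) in simp)
  then have "z \<in> V 0"
    unfolding F(4) using F(2) VD(2) by (intro subspace_finsum[OF V_subspace]) metis
  then show "z \<in> V 0" .
qed

end

text \<open>The situation of G(C): the coroots are a basis of degree 0, whereas in g(C) they may
  span only a part of it.\<close>

locale chevalley_transitive = chevalley_graded L V H n \<alpha> \<alpha>\<^sub>c hh ee ff
  for L :: "(complex, 'a) module" (structure) and V H n \<alpha> \<alpha>\<^sub>c hh ee ff +
  fixes C :: "complex mat"
  assumes transitive: "transitive_grading L V" and n_pos: "0 < n"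
    and coroot_basis: "H.family_basis n \<alpha>\<^sub>c (carrier H)"
    and root_linear: "i < n \<Longrightarrow> \<alpha> i \<in> linear_maps H complex_line"
    and C: "C \<in> carrier_mat n n" "\<lbrakk>i < n; j < n\<rbrakk> \<Longrightarrow> \<alpha> j (\<alpha>\<^sub>c i) = C $$ (i, j)"
begin

lemmas cD = H.family_basisD[OF coroot_basis]

lemma coroot_nonzero: "i < n \<Longrightarrow> \<alpha>\<^sub>c i \<noteq> \<zero>\<^bsub>H\<^esub>"
proof
  assume i: "i < n" and 0: "\<alpha>\<^sub>c i = \<zero>\<^bsub>H\<^esub>"
  have "(\<Oplus>\<^bsub>H\<^esub>k\<in>{..<n}. (if k = i then 1 else 0) \<odot>\<^bsub>H\<^esub> \<alpha>\<^sub>c k) = 1 \<odot>\<^bsub>H\<^esub> \<alpha>\<^sub>c i"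
    by (rule H.lincomb_unit[OF _ i]) (rule coroot)
  then have "(\<Oplus>\<^bsub>H\<^esub>k\<in>{..<n}. (if k = i then 1 else 0) \<odot>\<^bsub>H\<^esub> \<alpha>\<^sub>c k) = \<zero>\<^bsub>H\<^esub>" using 0 by simp
  from cD(6)[OF this i] show False by simp
qed

lemma root_comb: "j < n \<Longrightarrow> \<alpha> j (\<Oplus>\<^bsub>H\<^esub>i\<in>{..<n}. c i \<odot>\<^bsub>H\<^esub> \<alpha>\<^sub>c i) = (\<Sum>i<n. c i * C $$ (i, j))"
  using H.functional_lincomb[OF root_linear, where b = \<alpha>\<^sub>c and n = n, OF _ coroot] C(2) by simp

lemmas center_V0 = center_degree_zero[OF transitive coroot_nonzero]

lemma center_trivial:
  assumes "invertible_mat C"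
  shows "lie_center L = {\<zero>}"
proof
  show "lie_center L \<subseteq> {\<zero>}"
  proof
    fix z assume z: "z \<in> lie_center L"
    then obtain h where h: "h \<in> carrier H" "z = hh h" using center_V0 hhD(6) by blast
    obtain c where c: "h = (\<Oplus>\<^bsub>H\<^esub>i\<in>{..<n}. c i \<odot>\<^bsub>H\<^esub> \<alpha>\<^sub>c i)" using cD(4)[OF h(1)] by blast
    have s: "(\<Sum>i<n. c i * C $$ (i, j)) = 0" if "j < n" for j
      using hh_central_iff[OF h(1)] z h(2) root_comb[OF that, of c] c that by simp
    obtain I where I: "C * I = 1\<^sub>m n" "I * C = 1\<^sub>m (dim_row I)"
      using assms C(1) by (auto simp: invertible_mat_def inverts_mat_def)
    then have Ic: "I \<in> carrier_mat n n"
      using C(1) by (metis carrier_matD(2) carrier_matI index_mult_mat(2,3) index_one_mat(2,3))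
    \<comment> \<open>\<open>s\<close> says that the row vector c satisfies c C = 0; it is
      multiplied by the inverse from the right.\<close>
    have "c k = 0" if k: "k < n" for k
    proof -
      have "c k = (\<Sum>i<n. c i * (C * I) $$ (i, k))"
        unfolding I(1) using k by (simp add: if_distrib[of "\<lambda>x. c _ * x"] cong: if_cong)
      also have "\<dots> = (\<Sum>i<n. \<Sum>j<n. c i * (C $$ (i, j) * I $$ (j, k)))"
        using C(1) Ic k by (simp add: scalar_prod_def atLeast0LessThan sum_distrib_left)
      also have "\<dots> = (\<Sum>j<n. (\<Sum>i<n. c i * C $$ (i, j)) * I $$ (j, k))"
        by (subst sum.swap) (simp add: sum_distrib_left sum_distrib_right mult_ac)
      also have "\<dots> = 0" using s by simp
      finally show ?thesis .
    qed
    then have "h = \<zero>\<^bsub>H\<^esub>" unfolding c by (intro H.lincomb_zero' coroot) auto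
    then show "z \<in> {\<zero>}" using h(2) hhD(5) by simp
  qed
  show "{\<zero>} \<subseteq> lie_center L" using subspaceD(2)[OF lie_idealD(1)[OF center_ideal]] by simp
qed

text \<open>In the basis of coroots \<open>X\<close> is the identity and \<open>D\<close> is
  \<open>C\<close>, so with \<Gamma> = 1 the condition \<open>B * X = D * \<Gamma>\<close> just says
  B = C.\<close>

lemma invertible_pc:
  assumes "invertible_mat C"
  shows "pc_lie_algebra L"
proof (rule chevalley_pc[OF transitive n_pos n_pos coroot_basis C(1) C(2)[symmetric],
      where X = "1\<^sub>m n" and \<Gamma> = "1\<^sub>m n" and B = C])
  show "\<alpha>\<^sub>c i = (\<Oplus>\<^bsub>H\<^esub>k\<in>{..<n}. 1\<^sub>m n $$ (k, i) \<odot>\<^bsub>H\<^esub> \<alpha>\<^sub>c k)" if i: "i < n" for i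
  proof -
    have "(\<Oplus>\<^bsub>H\<^esub>k\<in>{..<n}. 1\<^sub>m n $$ (k, i) \<odot>\<^bsub>H\<^esub> \<alpha>\<^sub>c k) = (\<Oplus>\<^bsub>H\<^esub>k\<in>{..<n}. (if k = i then 1 else 0) \<odot>\<^bsub>H\<^esub> \<alpha>\<^sub>c k)"
      using i coroot by (intro H.finsum_cong') auto
    also have "\<dots> = 1 \<odot>\<^bsub>H\<^esub> \<alpha>\<^sub>c i" by (rule H.lincomb_unit[OF _ i]) (rule coroot)
    finally show ?thesis using coroot[OF i] by simp
  qed
  show "diagonal_mat (1\<^sub>m n)" by (simp add: diagonal_mat_def)
  show "invertible_mat (1\<^sub>m n :: complex mat)" by (rule invertible_matI) auto
qed (use C(1) assms in auto)

abbreviation Q :: "(complex, 'a set) module"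
  where "Q \<equiv> lie_quotient L (lie_center L)"

abbreviation \<pi> :: "'a \<Rightarrow> 'a set"
  where "\<pi> x \<equiv> lie_center L +> x"

lemmas \<pi>D = lie_homD[OF quotient_hom[OF center_ideal]] and \<pi>0 = quotient_eq_zero_iff[OF center_ideal]
  and \<pi>_linear = lie_hom_linear[OF quotient_hom[OF center_ideal]]

lemma center_homogeneous:
  assumes "finite F" "\<And>i. v i \<in> V i" "(\<Oplus>i\<in>F. v i) \<in> lie_center L" "i \<in> F"
  shows "v i \<in> lie_center L"
proof -
  \<comment> \<open>Truncation to \<open>F\<close>, as \<open>component_unique\<close> wants a
    family that vanishes elsewhere.\<close>
  define w where "w i = (if i \<in> F then v i else \<zero>)" for i
  have vc: "v i \<in> carrier L" for i using assms(2) VD(1) by blast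
  have w: "w i \<in> V i" for i using assms(2) VD(2) by (simp add: w_def)
  have s: "(\<Oplus>i\<in>F. w i) = (\<Oplus>i\<in>F. v i)" using vc by (intro finsum_cong') (auto simp: w_def)
  then have "(\<Oplus>i\<in>F. w i) \<in> V 0" using assms(3) center_V0 by auto
  note u = component_unique[OF assms(1) w _ this]
  show ?thesis
  proof (cases "i = 0")
    case True
    have "(\<Oplus>i\<in>F. w i) = w 0" by (rule u(1)) (simp add: w_def)
    then show ?thesis using s assms(3,4) True by (simp add: w_def)
  next
    case False
    have "w i = \<zero>" by (rule u(2)) (simp_all add: w_def False)
    then show ?thesis using assms(4) subspaceD(2)[OF lie_idealD(1)[OF center_ideal]] by (simp add: w_def)
  qed
qed

sublocale Q: graded_lie_algebra Q "\<lambda>k. \<pi> ` V k"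
  by (rule quotient_graded[OF center_ideal]) (rule center_homogeneous)

lemma \<pi>_inj: "\<lbrakk>x \<in> V k; k \<noteq> 0; \<pi> x = \<zero>\<^bsub>Q\<^esub>\<rbrakk> \<Longrightarrow> x = \<zero>"
  using \<pi>0[of x] VD(1)[of x k] center_V0 component_disjoint[of x k 0] by blast

text \<open>For x of degree at least 2 the bracket with degree -1 has nonzero degree, where division
  by the center, which sits in degree 0, is injective. So the bracket already vanishes before the
  quotient is taken.\<close>

lemma Q_transitive: "transitive_grading Q (\<lambda>k. \<pi> ` V k)"
  unfolding transitive_grading_def
proof (intro conjI allI impI ballI)
  fix k X assume k: "2 \<le> k" and "X \<in> \<pi> ` V k" and z: "\<forall>y\<in>\<pi> ` V (-1). y \<otimes>\<^bsub>Q\<^esub> X = \<zero>\<^bsub>Q\<^esub>"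
  then obtain x where x: "x \<in> V k" "X = \<pi> x" by blast
  have "y \<otimes> x = \<zero>" if y: "y \<in> V (-1)" for y
  proof (rule \<pi>_inj)
    show "y \<otimes> x \<in> V (-1 + k)" by (rule V_bracket[OF y x(1)])
    show "\<pi> (y \<otimes> x) = \<zero>\<^bsub>Q\<^esub>" using z y x \<pi>D(4)[OF VD(1)[OF y] VD(1)[OF x(1)]] by auto
  qed (use k in simp)
  then have "x = \<zero>" using transitive k x(1) unfolding transitive_grading_def by blast
  then show "X = \<zero>\<^bsub>Q\<^esub>" using x(2) quotient_zero[OF center_ideal] by simp
next
  fix k X assume k: "2 \<le> k" and "X \<in> \<pi> ` V (- k)" and z: "\<forall>y\<in>\<pi> ` V 1. y \<otimes>\<^bsub>Q\<^esub> X = \<zero>\<^bsub>Q\<^esub>"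
  then obtain x where x: "x \<in> V (- k)" "X = \<pi> x" by blast
  have "y \<otimes> x = \<zero>" if y: "y \<in> V 1" for y
  proof (rule \<pi>_inj)
    show "y \<otimes> x \<in> V (1 + - k)" by (rule V_bracket[OF y x(1)])
    show "\<pi> (y \<otimes> x) = \<zero>\<^bsub>Q\<^esub>" using z y x \<pi>D(4)[OF VD(1)[OF y] VD(1)[OF x(1)]] by auto
  qed (use k in simp)
  then have "x = \<zero>" using transitive k x(1) unfolding transitive_grading_def by blast
  then show "X = \<zero>\<^bsub>Q\<^esub>" using x(2) quotient_zero[OF center_ideal] by simp
qed

lemma Q_e_basis: "Q.family_basis n (\<lambda>i. \<pi> (ee i)) (\<pi> ` V 1)"
  by (rule family_basis_image[OF e_basis Q.complex_space_axioms \<pi>_linear \<pi>_inj[of _ 1]]) simp_all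

lemma Q_f_basis: "Q.family_basis n (\<lambda>i. \<pi> (ff i)) (\<pi> ` V (-1))"
  by (rule family_basis_image[OF f_basis Q.complex_space_axioms \<pi>_linear \<pi>_inj[of _ "-1"]]) simp_all

lemma Q_minimal: "minimal_graded_lie_algebra Q (\<lambda>k. \<pi> ` V k)"
  by (rule transitive_grading_minimal[OF Q.graded_lie_algebra_axioms Q_transitive])

definition hq :: "nat \<Rightarrow> 'a set" where "hq i = \<pi> (hh (\<alpha>\<^sub>c i))"

lemma hq_carrier: "i < n \<Longrightarrow> hq i \<in> carrier Q"
  using \<pi>D(1) hhD(2) coroot by (simp add: hq_def)

lemma \<pi>_hh_linear: "(\<lambda>h. \<pi> (hh h)) \<in> linear_maps H Q"
  using \<pi>D hhD by (auto simp: linear_maps_iff)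

lemma \<pi>_hh_comb: "(\<Oplus>\<^bsub>Q\<^esub>i\<in>{..<n}. c i \<odot>\<^bsub>Q\<^esub> hq i) = \<pi> (hh (\<Oplus>\<^bsub>H\<^esub>i\<in>{..<n}. c i \<odot>\<^bsub>H\<^esub> \<alpha>\<^sub>c i))"
  unfolding hq_def
  using linear_lincomb[OF H.complex_space_axioms Q.complex_space_axioms \<pi>_hh_linear, where b = \<alpha>\<^sub>c and n = n, OF coroot]
  by simp

lemma hq_comb_zero_iff:
  "(\<Oplus>\<^bsub>Q\<^esub>i\<in>{..<n}. c i \<odot>\<^bsub>Q\<^esub> hq i) = \<zero>\<^bsub>Q\<^esub> \<longleftrightarrow> (\<forall>j<n. (\<Sum>i<n. c i * C $$ (i, j)) = 0)"
proof -
  have hc: "(\<Oplus>\<^bsub>H\<^esub>i\<in>{..<n}. c i \<odot>\<^bsub>H\<^esub> \<alpha>\<^sub>c i) \<in> carrier H" using coroot by (rule H.lincomb_closed')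
  show ?thesis
    unfolding \<pi>_hh_comb using \<pi>0[OF hhD(2)[OF hc]] hh_central_iff[OF hc] root_comb by simp
qed

lemma hq_span: "\<pi> ` V 0 = {\<Oplus>\<^bsub>Q\<^esub>i\<in>{..<n}. c i \<odot>\<^bsub>Q\<^esub> hq i | c. True}"
proof -
  have "\<pi> ` V 0 = (\<lambda>h. \<pi> (hh h)) ` carrier H"
    using hh_bij by (simp add: bij_betw_def image_image[symmetric])
  also have "\<dots> = {\<Oplus>\<^bsub>Q\<^esub>i\<in>{..<n}. c i \<odot>\<^bsub>Q\<^esub> hq i | c. True}"
    unfolding \<pi>_hh_comb using cD(4) H.lincomb_closed'[of n \<alpha>\<^sub>c] coroot by (auto simp: image_iff)
  finally show ?thesis .
qed

lemma Q_rels: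
  assumes "i < n" "j < n"
  shows "hq i \<otimes>\<^bsub>Q\<^esub> hq j = \<zero>\<^bsub>Q\<^esub>" "hq i \<otimes>\<^bsub>Q\<^esub> \<pi> (ee j) = C $$ (i, j) \<odot>\<^bsub>Q\<^esub> \<pi> (ee j)"
    "hq i \<otimes>\<^bsub>Q\<^esub> \<pi> (ff j) = (- C $$ (i, j)) \<odot>\<^bsub>Q\<^esub> \<pi> (ff j)"
    "\<pi> (ee i) \<otimes>\<^bsub>Q\<^esub> \<pi> (ff j) = (if i = j then hq i else \<zero>\<^bsub>Q\<^esub>)"
  using assms hhD(2) coroot eD(1) fD(1) quotient_zero[OF center_ideal]
  by (simp_all add: hq_def \<pi>D(3,4)[symmetric] hh_hh hh_e hh_f e_f C(2))

end

text \<open>The basis is a subfamily of the given family, recorded by its indices \<iota>. For the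
  coroots modulo the center, Gram matrix and root values can then be written with entries of
  \<open>C\<close>.\<close>

lemma (in complex_space) spanning_family_basis:
  fixes g :: "nat \<Rightarrow> 'a"
  assumes g: "\<And>i. i < n \<Longrightarrow> g i \<in> carrier L"
  defines "S \<equiv> {\<Oplus>i\<in>{..<n}. c i \<odot> g i | c. True}"
  shows "\<exists>r \<iota>. (\<forall>k<r. \<iota> k < n) \<and> family_basis r (\<lambda>k. g (\<iota> k)) S"
proof -
  have S: "subspace S" unfolding S_def by (rule lincombs_subspace) (rule g)
  interpret S: complex_space "L\<lparr>carrier := S\<rparr>" by (rule restrict_complex_space[OF S])
  have gS: "g i \<in> S" if "i < n" for i
    unfolding S_def by (rule lincombs_incl[where b = g and n = n, OF g that])
  let ?G = "g ` {..<n}"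
  have Gc: "?G \<subseteq> carrier (L\<lparr>carrier := S\<rparr>)" using gS by auto
  have ss: "S.subspace (S.span ?G)" by (rule S.subspace_span[OF Gc])
  have "S \<subseteq> S.span ?G"
  proof -
    note D = S.subspaceD[OF ss]
    have sub: "subspace (S.span ?G)"
    proof (rule subspaceI)
      show "S.span ?G \<subseteq> carrier L" using D(1) subspaceD(1)[OF S] by auto
    qed (use D in auto)
    have "g i \<in> S.span ?G" if "i < n" for i using S.span_superset[OF Gc] that by blast
    from lincombs_minimal[where b = g and n = n, OF this sub] show ?thesis unfolding S_def[symmetric] .
  qed
  then have gen: "S.span ?G = carrier (L\<lparr>carrier := S\<rparr>)" using S.subspaceD(1)[OF ss] by auto
  let ?P = "\<lambda>B. B \<subseteq> carrier (L\<lparr>carrier := S\<rparr>) \<and> S.span B = carrier (L\<lparr>carrier := S\<rparr>)"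
  have "\<exists>B. B \<subseteq> ?G \<and> minimal B ?P" by (rule minimal_exists) (use Gc gen in auto)
  then obtain B where B: "B \<subseteq> ?G" "minimal B ?P" by blast
  have bs: "S.basis B" by (rule S.min_gen_is_basis[OF B(2)])
  have fB: "finite B" using B(1) finite_subset by blast
  \<comment> \<open>No initial segment is prescribed, hence the instance of
    \<open>enumerate_basis\<close> for the empty family.\<close>
  have "\<exists>r b. S.family_basis r b (carrier (L\<lparr>carrier := S\<rparr>)) \<and> r = card B \<and> 0 \<le> r \<and>
      (\<forall>i<0. b i = undefined) \<and> b ` {..<r} = B"
    by (rule S.enumerate_basis[OF bs fB empty_subsetI]) simp_all
  then obtain r b where b: "S.family_basis r b (carrier (L\<lparr>carrier := S\<rparr>))" "b ` {..<r} = B"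
    by (elim exE conjE) (rule that)
  have ex: "\<exists>i. i < n \<and> b k = g i" if k: "k < r" for k
  proof -
    have "b k \<in> b ` {..<r}" using k by (intro imageI) simp
    then have "b k \<in> g ` {..<n}" unfolding b(2) using B(1) by (rule rev_subsetD)
    then show ?thesis by (elim imageE) (simp add: lessThan_iff exI)
  qed
  define \<iota> where "\<iota> k = (SOME i. i < n \<and> b k = g i)" for k
  have \<iota>: "\<iota> k < n" "b k = g (\<iota> k)" if "k < r" for k
    using someI_ex[OF ex[OF that]] unfolding \<iota>_def by simp_all
  have bS: "b k \<in> S" if "k < r" for k using \<iota> gS that by simp
  have e: "(\<Oplus>\<^bsub>L\<lparr>carrier := S\<rparr>\<^esub>k\<in>{..<r}. c k \<odot> b k) = (\<Oplus>k\<in>{..<r}. c k \<odot> g (\<iota> k))" for c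
  proof -
    have "(\<Oplus>\<^bsub>L\<lparr>carrier := S\<rparr>\<^esub>k\<in>{..<r}. c k \<odot> b k) = (\<Oplus>k\<in>{..<r}. c k \<odot> b k)"
      using bS subspaceD(4)[OF S] by (intro finsum_restrict_carrier[OF S]) auto
    also have "\<dots> = (\<Oplus>k\<in>{..<r}. c k \<odot> g (\<iota> k))" using \<iota> g by (intro finsum_cong') auto
    finally show ?thesis .
  qed
  have "family_basis r (\<lambda>k. g (\<iota> k)) S"
    using b(1) \<iota>(1) g unfolding S.family_basis_def family_basis_def by (simp add: e)
  then show ?thesis using \<iota>(1) by blast
qed

text \<open>On coroots the form is \<open>\<gamma> j * C $$ (i, j)\<close>, which equals \<gamma>_i
  \<gamma>_j S_ij. Its radical on the span of the coroots consists of the combinations on which all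
  roots vanish, that is of the center, so it is nondegenerate in the quotient.\<close>

lemma (in chevalley_transitive) quotient_symmetric_pc:
  assumes \<Gamma>: "\<Gamma> \<in> carrier_mat n n" "diagonal_mat \<Gamma>" "invertible_mat \<Gamma>"
    and S: "S \<in> carrier_mat n n" "transpose_mat S = S" "C = \<Gamma> * S" and C0: "C \<noteq> 0\<^sub>m n n"
  shows "symmetric_pc_lie_algebra Q"
proof -
  define \<gamma> where "\<gamma> i = \<Gamma> $$ (i, i)" for i
  have \<gamma>0: "\<gamma> i \<noteq> 0" if "i < n" for i
    unfolding \<gamma>_def by (rule diagonal_mat_entry_nonzero[OF \<Gamma> that])
  have Sym: "S $$ (i, j) = S $$ (j, i)" if "i < n" "j < n" for i j
    using S(1,2) that by (metis carrier_matD index_transpose_mat(1))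
  have CS: "C $$ (i, j) = \<gamma> i * S $$ (i, j)" if "i < n" "j < n" for i j
  proof -
    have "C $$ (i, j) = (\<Sum>k<n. \<Gamma> $$ (i, k) * S $$ (k, j))"
      unfolding S(3) using that \<Gamma>(1) S(1) by (simp add: scalar_prod_def atLeast0LessThan)
    also have "\<dots> = (\<Sum>k<n. if k = i then \<gamma> i * S $$ (i, j) else 0)"
      using \<Gamma>(1,2) that by (intro sum.cong) (auto simp: diagonal_mat_def \<gamma>_def)
    finally show ?thesis using that by simp
  qed
  have sym: "\<gamma> j * C $$ (i, j) = \<gamma> i * C $$ (j, i)" if "i < n" "j < n" for i j
    using CS[OF that] CS[OF that(2,1)] Sym[OF that] by simp
  obtain r \<iota> where \<iota>: "\<And>k. k < r \<Longrightarrow> \<iota> k < n" and "Q.family_basis r (\<lambda>k. hq (\<iota> k)) {\<Oplus>\<^bsub>Q\<^esub>i\<in>{..<n}. c i \<odot>\<^bsub>Q\<^esub> hq i | c. True}"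
    using Q.spanning_family_basis[of n hq, OF hq_carrier] by blast
  then have b: "Q.family_basis r (\<lambda>k. hq (\<iota> k)) (\<pi> ` V 0)" by (simp add: hq_span)
  note bD = Q.family_basisD[OF b]
  have hqV: "hq i \<in> \<pi> ` V 0" if "i < n" for i
    using hhD(1)[OF coroot[OF that]] by (simp add: hq_def)
  have "\<exists>x. hq i = (\<Oplus>\<^bsub>Q\<^esub>k\<in>{..<r}. x k \<odot>\<^bsub>Q\<^esub> hq (\<iota> k))" if "i < n" for i
    using bD(4)[OF hqV[OF that]] .
  then obtain x where x: "\<And>i. i < n \<Longrightarrow> hq i = (\<Oplus>\<^bsub>Q\<^esub>k\<in>{..<r}. x i k \<odot>\<^bsub>Q\<^esub> hq (\<iota> k))" by metis
  have e1: "\<pi> (ee j) \<in> carrier Q" if "j < n" for j using \<pi>D(1)[OF eD(1)[OF that]] .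
  have e_ne: "c = d" if "c \<odot>\<^bsub>Q\<^esub> \<pi> (ee j) = d \<odot>\<^bsub>Q\<^esub> \<pi> (ee j)" "j < n" for c d j
  proof -
    note E = Q.family_basisD(1)[OF Q_e_basis]
    have "(\<Oplus>\<^bsub>Q\<^esub>i\<in>{..<n}. (if i = j then c else 0) \<odot>\<^bsub>Q\<^esub> \<pi> (ee i))
        = (\<Oplus>\<^bsub>Q\<^esub>i\<in>{..<n}. (if i = j then d else 0) \<odot>\<^bsub>Q\<^esub> \<pi> (ee i))"
      using Q.lincomb_unit[where b = "\<lambda>i. \<pi> (ee i)" and n = n, OF E that(2)] that(1) by simp
    from Q.family_basis_unique[OF Q_e_basis this that(2)] show ?thesis by simp
  qed
  \<comment> \<open>Both sides of the expansion \<open>x\<close> are compared through their action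
    on e_j: the rows of \<open>C\<close> inherit the linear relations of the coroots in the
    quotient.\<close>
  have Cx: "C $$ (i, j) = (\<Sum>k<r. x i k * C $$ (\<iota> k, j))" if ij: "i < n" "j < n" for i j
  proof (rule e_ne[OF _ ij(2)])
    have "C $$ (i, j) \<odot>\<^bsub>Q\<^esub> \<pi> (ee j) = hq i \<otimes>\<^bsub>Q\<^esub> \<pi> (ee j)" using Q_rels(2)[OF ij] by simp
    also have "\<dots> = (\<Oplus>\<^bsub>Q\<^esub>k\<in>{..<r}. (x i k \<odot>\<^bsub>Q\<^esub> hq (\<iota> k)) \<otimes>\<^bsub>Q\<^esub> \<pi> (ee j))"
      unfolding x[OF ij(1)] using bD(1) e1[OF ij(2)] by (intro Q.bracket_finsum_left) auto
    also have "\<dots> = (\<Oplus>\<^bsub>Q\<^esub>k\<in>{..<r}. (x i k * C $$ (\<iota> k, j)) \<odot>\<^bsub>Q\<^esub> \<pi> (ee j))"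
      using bD(1) e1[OF ij(2)] ij \<iota> by (intro Q.finsum_cong') (auto simp: Q.bracket_smult_left Q_rels Q.smult_smult)
    also have "\<dots> = (\<Sum>k<r. x i k * C $$ (\<iota> k, j)) \<odot>\<^bsub>Q\<^esub> \<pi> (ee j)"
      using e1[OF ij(2)] by (rule Q.sum_smult[symmetric])
    finally show "C $$ (i, j) \<odot>\<^bsub>Q\<^esub> \<pi> (ee j) = (\<Sum>k<r. x i k * C $$ (\<iota> k, j)) \<odot>\<^bsub>Q\<^esub> \<pi> (ee j)" .
  qed
  \<comment> \<open>If degree 0 of the quotient were zero, \<open>Cx\<close> would express every
    entry of C by an empty sum.\<close>
  have r: "0 < r"
  proof (rule ccontr)
    assume "\<not> 0 < r"
    then have "C $$ (i, j) = 0" if "i < n" "j < n" for i j using Cx[OF that] by simp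
    then have "C = 0\<^sub>m n n" using C(1) by (intro eq_matI) auto
    with C0 show False by simp
  qed
  define B where "B = mat r r (\<lambda>(k, l). \<gamma> (\<iota> l) * C $$ (\<iota> k, \<iota> l))"
  define D where "D = mat r n (\<lambda>(k, j). C $$ (\<iota> k, j))"
  define X where "X = mat r n (\<lambda>(k, i). x i k)"
  have Bsym: "B $$ (k, l) = B $$ (l, k)" if "k < r" "l < r" for k l
    using that sym[OF \<iota> \<iota>, of k l] by (simp add: B_def)
  have BX: "B * X = D * \<Gamma>"
  proof (rule eq_matI)
    fix k i assume "k < dim_row (D * \<Gamma>)" "i < dim_col (D * \<Gamma>)"
    then have ki: "k < r" "i < n" using \<Gamma>(1) by (auto simp: D_def)
    have "(B * X) $$ (k, i) = (\<Sum>l<r. \<gamma> (\<iota> l) * C $$ (\<iota> k, \<iota> l) * x i l)"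
      using ki by (simp add: B_def X_def scalar_prod_def atLeast0LessThan)
    also have "\<dots> = (\<Sum>l<r. \<gamma> (\<iota> k) * (x i l * C $$ (\<iota> l, \<iota> k)))"
      using ki \<iota> sym by (intro sum.cong) auto
    also have "\<dots> = \<gamma> (\<iota> k) * C $$ (i, \<iota> k)"
      using Cx[OF ki(2) \<iota>[OF ki(1)]] by (simp add: sum_distrib_left)
    also have "\<dots> = C $$ (\<iota> k, i) * \<gamma> i" using sym[OF ki(2) \<iota>[OF ki(1)]] by simp
    also have "\<dots> = (\<Sum>j<n. if j = i then C $$ (\<iota> k, i) * \<gamma> i else 0)" using ki by simp
    also have "\<dots> = (\<Sum>j<n. C $$ (\<iota> k, j) * \<Gamma> $$ (j, i))"
      using \<Gamma>(1,2) ki by (intro sum.cong) (auto simp: diagonal_mat_def \<gamma>_def)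
    also have "\<dots> = (D * \<Gamma>) $$ (k, i)"
      using ki \<Gamma>(1) by (simp add: D_def scalar_prod_def atLeast0LessThan)
    finally show "(B * X) $$ (k, i) = (D * \<Gamma>) $$ (k, i)" .
  qed (use \<Gamma>(1) in \<open>auto simp: B_def X_def D_def\<close>)
  have Bi: "invertible_mat B"
  proof (rule invertible_matI)
    show "B \<in> carrier_mat r r" by (simp add: B_def)
    fix v assume v: "v \<in> carrier_vec r" "B *\<^sub>v v = 0\<^sub>v r"
    have Bv: "(\<Sum>l<r. \<gamma> (\<iota> l) * C $$ (\<iota> k, \<iota> l) * v $ l) = 0" if "k < r" for k
    proof -
      have "(B *\<^sub>v v) $ k = (\<Sum>l<r. \<gamma> (\<iota> l) * C $$ (\<iota> k, \<iota> l) * v $ l)"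
        using that v(1) by (simp add: B_def scalar_prod_def atLeast0LessThan)
      then show ?thesis using v(2) that by simp
    qed
    \<comment> \<open>Up to nonzero factors, B v = 0 says that the selected roots vanish on the
      combination of coroots with coefficients v; \<open>Cx\<close> and symmetry extend this to all
      roots.\<close>
    have alpha: "(\<Sum>l<r. v $ l * C $$ (\<iota> l, j)) = 0" if j: "j < n" for j
    proof -
      have "\<gamma> j * (\<Sum>l<r. v $ l * C $$ (\<iota> l, j)) = (\<Sum>l<r. v $ l * (\<gamma> (\<iota> l) * C $$ (j, \<iota> l)))"
        unfolding sum_distrib_left using j \<iota> sym by (intro sum.cong) (auto simp: mult.left_commute)
      also have "\<dots> = (\<Sum>l<r. \<Sum>k<r. x j k * (\<gamma> (\<iota> l) * C $$ (\<iota> k, \<iota> l) * v $ l))"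
        using Cx[OF j \<iota>] by (intro sum.cong) (auto simp: sum_distrib_left mult_ac)
      also have "\<dots> = (\<Sum>k<r. x j k * (\<Sum>l<r. \<gamma> (\<iota> l) * C $$ (\<iota> k, \<iota> l) * v $ l))"
        by (subst sum.swap) (simp add: sum_distrib_left)
      also have "\<dots> = 0" using Bv by simp
      finally show ?thesis using \<gamma>0[OF j] by simp
    qed
    let ?h = "\<Oplus>\<^bsub>H\<^esub>l\<in>{..<r}. v $ l \<odot>\<^bsub>H\<^esub> \<alpha>\<^sub>c (\<iota> l)"
    have ac: "\<alpha>\<^sub>c (\<iota> l) \<in> carrier H" if "l < r" for l using coroot \<iota> that by blast
    have hc: "?h \<in> carrier H" using ac by (rule H.lincomb_closed')
    have "\<alpha> j ?h = 0" if j: "j < n" for j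
    proof -
      have "\<alpha> j ?h = (\<Sum>l<r. v $ l * \<alpha> j (\<alpha>\<^sub>c (\<iota> l)))" by (rule H.functional_lincomb[OF root_linear[OF j] ac])
      also have "\<dots> = 0" using alpha[OF j] C(2)[OF \<iota> j] by simp
      finally show ?thesis .
    qed
    then have "\<pi> (hh ?h) = \<zero>\<^bsub>Q\<^esub>" using \<pi>0[OF hhD(2)[OF hc]] hh_central_iff[OF hc] by simp
    moreover have "\<pi> (hh ?h) = (\<Oplus>\<^bsub>Q\<^esub>l\<in>{..<r}. v $ l \<odot>\<^bsub>Q\<^esub> hq (\<iota> l))"
      unfolding hq_def by (rule linear_lincomb[OF H.complex_space_axioms Q.complex_space_axioms \<pi>_hh_linear ac])
    ultimately have "(\<Oplus>\<^bsub>Q\<^esub>l\<in>{..<r}. v $ l \<odot>\<^bsub>Q\<^esub> hq (\<iota> l)) = \<zero>\<^bsub>Q\<^esub>" by simp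
    from bD(6)[OF this] show "v = 0\<^sub>v r" using v(1) by (intro eq_vecI) auto
  qed
  have Bc: "B \<in> carrier_mat r r" "D \<in> carrier_mat r n" "X \<in> carrier_mat r n" by (simp_all add: B_def D_def X_def)
  have "\<exists>A. pc_data r n A D \<Gamma> \<and> is_pc_algebra_of r n A D \<Gamma> Q \<and> (\<forall>a b. pc_form A a b = a \<bullet> (B *\<^sub>v b))"
  proof (rule pc_algebraI[OF r n_pos Bc(2,3) \<Gamma> Bc(1) Bi BX Q_minimal b Q_e_basis Q_f_basis])
    fix i j assume ij: "i < n" "j < n"
    have "hq i = (\<Oplus>\<^bsub>Q\<^esub>k\<in>{..<r}. X $$ (k, i) \<odot>\<^bsub>Q\<^esub> hq (\<iota> k))"
      unfolding x[OF ij(1)] using ij bD(1) by (intro Q.finsum_cong') (auto simp: X_def)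
    then show "\<pi> (ee i) \<otimes>\<^bsub>Q\<^esub> \<pi> (ff j) = (if i = j then \<Oplus>\<^bsub>Q\<^esub>k\<in>{..<r}. X $$ (k, i) \<odot>\<^bsub>Q\<^esub> hq (\<iota> k) else \<zero>\<^bsub>Q\<^esub>)"
      using Q_rels(4)[OF ij] by (cases "i = j") simp_all
  qed (use Q_rels \<iota> in \<open>auto simp: D_def\<close>)
  then obtain A where A: "pc_data r n A D \<Gamma>" "is_pc_algebra_of r n A D \<Gamma> Q"
    "\<And>a b. pc_form A a b = a \<bullet> (B *\<^sub>v b)" by blast
  have "pc_form A a b = pc_form A b a" if "a \<in> carrier_vec r" "b \<in> carrier_vec r" for a b
  proof -
    have e: "c \<bullet> (B *\<^sub>v d) = (\<Sum>k<r. \<Sum>l<r. c $ k * (B $$ (k, l) * d $ l))" if "c \<in> carrier_vec r" "d \<in> carrier_vec r" for c d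
      using that Bc(1) by (simp add: scalar_prod_def atLeast0LessThan sum_distrib_left)
    have "(\<Sum>k<r. \<Sum>l<r. a $ k * (B $$ (k, l) * b $ l)) = (\<Sum>l<r. \<Sum>k<r. a $ k * (B $$ (k, l) * b $ l))"
      by (rule sum.swap)
    also have "\<dots> = (\<Sum>l<r. \<Sum>k<r. b $ l * (B $$ (l, k) * a $ k))"
      using Bsym by (intro sum.cong) (auto simp: mult_ac)
    finally show ?thesis using that by (simp add: A(3) e)
  qed
  then show ?thesis using A unfolding symmetric_pc_lie_algebra_def by blast
qed

section \<open>The zero matrix\<close>

lemma (in lie_algebra) commuting_generators_abelian:
  assumes X: "X \<subseteq> carrier L" "lie_generated L X = carrier L" "\<And>x y. \<lbrakk>x \<in> X; y \<in> X\<rbrakk> \<Longrightarrow> x \<otimes> y = \<zero>"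
    and x: "x \<in> carrier L" and y: "y \<in> carrier L"
  shows "x \<otimes> y = \<zero>"
proof -
  have cent: "z \<otimes> y = \<zero>" if z: "z \<in> carrier L" "\<And>y. y \<in> X \<Longrightarrow> z \<otimes> y = \<zero>" and y: "y \<in> carrier L" for z y
  proof -
    have "y \<in> lie_generated L X" using X(2) y by simp
    then show ?thesis
      using X(1)
    proof (induct rule: lie_generated_induct)
      case (bracket x y)
      then show ?case using bracket_derivation[of z x y] z(1) by simp
    qed (use z in \<open>auto simp: bracket_add_right bracket_smult_right\<close>)
  qed
  have "x \<otimes> z = \<zero>" if z: "z \<in> X" for z
  proof -
    have zc: "z \<in> carrier L" using X(1) z by blast
    have "z \<otimes> x = \<zero>" by (rule cent[OF zc X(3)[OF z] x])
    then show ?thesis using bracket_anticommute[OF x zc] smult_m1[of \<zero>] by simp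
  qed
  from cent[OF x this y] show ?thesis .
qed

lemma (in complex_space) lincomb_split:
  fixes b :: "nat \<Rightarrow> 'a"
  assumes "\<And>i. i < n + m \<Longrightarrow> b i \<in> carrier L"
  shows "(\<Oplus>i\<in>{..<n + m}. c i \<odot> b i) = (\<Oplus>i\<in>{..<n}. c i \<odot> b i) \<oplus> (\<Oplus>i\<in>{..<m}. c (n + i) \<odot> b (n + i))"
  using assms
proof (induct m)
  case 0
  then show ?case using lincomb_closed'[of n b c] by simp
next
  case (Suc m)
  have cl: "(\<Oplus>i\<in>{..<n}. c i \<odot> b i) \<in> carrier L" "(\<Oplus>i\<in>{..<m}. c (n + i) \<odot> b (n + i)) \<in> carrier L"
    using Suc(2) by (auto intro!: finsum_closed)
  have "(\<Oplus>i\<in>{..<n + Suc m}. c i \<odot> b i) = c (n + m) \<odot> b (n + m) \<oplus> (\<Oplus>i\<in>{..<n + m}. c i \<odot> b i)"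
    unfolding add_Suc_right lessThan_Suc using Suc(2) by (intro finsum_insert) auto
  also have "(\<Oplus>i\<in>{..<n + m}. c i \<odot> b i) = (\<Oplus>i\<in>{..<n}. c i \<odot> b i) \<oplus> (\<Oplus>i\<in>{..<m}. c (n + i) \<odot> b (n + i))"
    using Suc by simp
  also have "c (n + m) \<odot> b (n + m) \<oplus> \<dots> = (\<Oplus>i\<in>{..<n}. c i \<odot> b i) \<oplus>
      (c (n + m) \<odot> b (n + m) \<oplus> (\<Oplus>i\<in>{..<m}. c (n + i) \<odot> b (n + i)))"
    using cl Suc(2) by (simp add: a_lcomm)
  also have "c (n + m) \<odot> b (n + m) \<oplus> (\<Oplus>i\<in>{..<m}. c (n + i) \<odot> b (n + i))
      = (\<Oplus>i\<in>{..<Suc m}. c (n + i) \<odot> b (n + i))"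
    unfolding lessThan_Suc using Suc(2) by (intro finsum_insert[symmetric]) auto
  finally show ?case .
qed

lemma (in complex_space) family_basis_append:
  assumes e: "family_basis n e S" and f: "family_basis n f U" and disj: "S \<inter> U = {\<zero>}"
    and car: "\<And>x. x \<in> carrier L \<Longrightarrow> \<exists>a\<in>S. \<exists>b\<in>U. x = a \<oplus> b"
  shows "family_basis (n + n) (\<lambda>i. if i < n then e i else f (i - n)) (carrier L)"
proof -
  let ?b = "\<lambda>i. if i < n then e i else f (i - n)"
  note eD = family_basisD[OF e] and fD = family_basisD[OF f]
  have bc: "?b i \<in> carrier L" if "i < n + n" for i using eD(1) fD(1) that by auto
  have split: "(\<Oplus>i\<in>{..<n + n}. c i \<odot> ?b i) = (\<Oplus>i\<in>{..<n}. c i \<odot> e i) \<oplus> (\<Oplus>i\<in>{..<n}. c (n + i) \<odot> f i)" for c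
  proof -
    have "(\<Oplus>i\<in>{..<n}. c i \<odot> ?b i) = (\<Oplus>i\<in>{..<n}. c i \<odot> e i)" using eD(1) by (intro finsum_cong') auto
    moreover have "(\<Oplus>i\<in>{..<n}. c (n + i) \<odot> ?b (n + i)) = (\<Oplus>i\<in>{..<n}. c (n + i) \<odot> f i)"
      using fD(1) by (intro finsum_cong') auto
    ultimately show ?thesis using lincomb_split[of n n ?b c] bc by simp
  qed
  have "\<exists>c. x = (\<Oplus>i\<in>{..<n + n}. c i \<odot> ?b i)" if x: "x \<in> carrier L" for x
  proof -
    obtain a b where ab: "a \<in> S" "b \<in> U" "x = a \<oplus> b" using car[OF x] by blast
    obtain c where c: "a = (\<Oplus>i\<in>{..<n}. c i \<odot> e i)" using eD(4)[OF ab(1)] by blast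
    obtain d where d: "b = (\<Oplus>i\<in>{..<n}. d i \<odot> f i)" using fD(4)[OF ab(2)] by blast
    let ?c = "\<lambda>i. if i < n then c i else d (i - n)"
    have "(\<Oplus>i\<in>{..<n}. ?c i \<odot> e i) = a" unfolding c using eD(1) by (intro finsum_cong') auto
    moreover have "(\<Oplus>i\<in>{..<n}. ?c (n + i) \<odot> f i) = b" unfolding d using fD(1) by (intro finsum_cong') auto
    ultimately show ?thesis using split[of ?c] ab(3) by (intro exI[of _ ?c]) simp
  qed
  moreover have "c i = 0" if c: "(\<Oplus>i\<in>{..<n + n}. c i \<odot> ?b i) = \<zero>" and i: "i < n + n" for c i
  proof -
    let ?x = "\<Oplus>i\<in>{..<n}. c i \<odot> e i" and ?y = "\<Oplus>i\<in>{..<n}. c (n + i) \<odot> f i"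
    have x: "?x \<in> S" "?x \<in> carrier L" and y: "?y \<in> U" "?y \<in> carrier L"
      using eD(5) fD(5) subspaceD(1)[OF eD(3)] subspaceD(1)[OF fD(3)] by auto
    have "?x \<oplus> ?y = \<zero>" using split c by simp
    then have "?x = \<ominus> ?y" using x(2) y(2) by (metis minus_equality)
    then have "?x \<in> U" using subspace_uminus[OF fD(3) y(1)] by simp
    then have x0: "?x = \<zero>" using x(1) disj by blast
    then have y0: "?y = \<zero>" using \<open>?x \<oplus> ?y = \<zero>\<close> y(2) by simp
    show ?thesis
    proof (cases "i < n")
      case True
      then show ?thesis using eD(6)[OF x0] by simp
    next
      case False
      then show ?thesis using fD(6)[OF y0, of "i - n"] i by simp
    qed
  qed
  ultimately show ?thesis
    unfolding family_basis_def using bc lincomb_closed'[of "n + n" ?b] by blast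
qed

text \<open>In an abelian algebra any distribution of degrees over a basis is a grading. With
  degrees in {-1, 0, 1} the algebra is generated by its local part, and transitivity is trivial
  because the other components are zero.\<close>

locale abelian_graded_basis = lie_algebra L for L :: "(complex, 'a) module" (structure) +
  fixes N :: nat and b :: "nat \<Rightarrow> 'a" and deg :: "nat \<Rightarrow> int"
  assumes abelian: "\<lbrakk>x \<in> carrier L; y \<in> carrier L\<rbrakk> \<Longrightarrow> x \<otimes> y = \<zero>"
    and b: "family_basis N b (carrier L)" and deg: "i < N \<Longrightarrow> deg i \<in> {-1, 0, 1}"
begin

lemmas bD = family_basisD[OF b]

definition U :: "int \<Rightarrow> 'a set"
  where "U k = {\<Oplus>i\<in>{..<N}. c i \<odot> b i | c. \<forall>i<N. deg i \<noteq> k \<longrightarrow> c i = 0}"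

lemma UI: "(\<And>i. \<lbrakk>i < N; deg i \<noteq> k\<rbrakk> \<Longrightarrow> c i = 0) \<Longrightarrow> (\<Oplus>i\<in>{..<N}. c i \<odot> b i) \<in> U k"
  by (auto simp: U_def)

lemma UE:
  assumes "x \<in> U k"
  obtains c where "x = (\<Oplus>i\<in>{..<N}. c i \<odot> b i)" "\<And>i. \<lbrakk>i < N; deg i \<noteq> k\<rbrakk> \<Longrightarrow> c i = 0"
  using assms by (auto simp: U_def)

lemma U_subspace: "subspace (U k)"
proof (rule subspaceI)
  show "U k \<subseteq> carrier L" using lincomb_closed'[of N b] bD(1) by (auto elim!: UE)
  show "\<zero> \<in> U k" using UI[of k "\<lambda>_. 0"] lincomb_zero'[of N b "\<lambda>_. 0"] bD(1) by simp
next
  fix x y assume x: "x \<in> U k" and y: "y \<in> U k"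
  obtain c where c: "x = (\<Oplus>i\<in>{..<N}. c i \<odot> b i)" "\<And>i. \<lbrakk>i < N; deg i \<noteq> k\<rbrakk> \<Longrightarrow> c i = 0"
    using x by (rule UE) (rule that; assumption)
  obtain d where d: "y = (\<Oplus>i\<in>{..<N}. d i \<odot> b i)" "\<And>i. \<lbrakk>i < N; deg i \<noteq> k\<rbrakk> \<Longrightarrow> d i = 0"
    using y by (rule UE) (rule that; assumption)
  from c d show "x \<oplus> y \<in> U k" using UI[of k "\<lambda>i. c i + d i"] lincomb_add[of N b c d] bD(1) by simp
next
  fix a x assume "x \<in> U k"
  then obtain c where "x = (\<Oplus>i\<in>{..<N}. c i \<odot> b i)" "\<And>i. \<lbrakk>i < N; deg i \<noteq> k\<rbrakk> \<Longrightarrow> c i = 0"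
    by (rule UE) (rule that; assumption)
  then show "a \<odot> x \<in> U k" using UI[of k "\<lambda>i. a * c i"] lincomb_smult'[of N b a c] bD(1) by simp
qed

lemma basis_in_U: "i < N \<Longrightarrow> b i \<in> U (deg i)"
  using UI[of "deg i" "\<lambda>j. if j = i then 1 else 0"] lincomb_unit[where b = b and n = N and a = 1, OF bD(1)] bD(1)
  by force

lemma U_trivial: "k \<notin> {-1, 0, 1} \<Longrightarrow> U k = {\<zero>}"
proof -
  assume k: "k \<notin> {-1, 0, 1}"
  have "x = \<zero>" if x: "x \<in> U k" for x
  proof -
    obtain c where c: "x = (\<Oplus>i\<in>{..<N}. c i \<odot> b i)" "\<And>i. \<lbrakk>i < N; deg i \<noteq> k\<rbrakk> \<Longrightarrow> c i = 0"
      using x by (rule UE) (rule that; assumption)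
    have "c i = 0" if "i < N" for i using c(2)[OF that] deg[OF that] k by metis
    then show ?thesis unfolding c by (intro lincomb_zero' bD(1))
  qed
  then show "U k = {\<zero>}" using subspaceD(2)[OF U_subspace] by blast
qed

lemma carrier_minimal: "\<lbrakk>subspace S; \<And>k. U k \<subseteq> S\<rbrakk> \<Longrightarrow> carrier L \<subseteq> S"
proof -
  assume S: "subspace S" "\<And>k. U k \<subseteq> S"
  have "{\<Oplus>i\<in>{..<N}. c i \<odot> b i | c. True} \<subseteq> S"
    by (rule lincombs_minimal[OF _ S(1)]) (use basis_in_U S(2) in blast)
  then show "carrier L \<subseteq> S" using b by (simp add: family_basis_def)
qed

lemma U_graded: "graded_lie_algebra L U"
proof (intro graded_lie_algebra.intro graded_lie_algebra_axioms.intro lie_algebra_axioms U_subspace)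
  show "\<exists>F v. finite F \<and> (\<forall>i\<in>F. v i \<in> U i) \<and> x = (\<Oplus>i\<in>F. v i)" if x: "x \<in> carrier L" for x
  proof -
    have "carrier L \<subseteq> homogeneous_sums U"
      by (rule carrier_minimal[OF homogeneous_sums_subspace[OF U_subspace]])
        (use homogeneous_sums_incl[of _ U, OF _ U_subspace] in blast)
    then show ?thesis using x unfolding homogeneous_sums_def by blast
  qed
next
  fix F v and k :: int
  assume F: "finite F" "\<And>k. k \<in> F \<Longrightarrow> v k \<in> U k" "(\<Oplus>k\<in>F. v k) = \<zero>" "k \<in> F"
  have "\<exists>c. v k = (\<Oplus>i\<in>{..<N}. c i \<odot> b i) \<and> (\<forall>i<N. deg i \<noteq> k \<longrightarrow> c i = 0)" if "k \<in> F" for k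
    using F(2)[OF that] by (auto simp: U_def)
  then obtain c where c: "\<And>k. k \<in> F \<Longrightarrow> v k = (\<Oplus>i\<in>{..<N}. c k i \<odot> b i)"
    "\<And>k i. \<lbrakk>k \<in> F; i < N; deg i \<noteq> k\<rbrakk> \<Longrightarrow> c k i = 0" by metis
  have "(\<Oplus>k\<in>F. v k) = (\<Oplus>i\<in>{..<N}. (\<Sum>k\<in>F. c k i) \<odot> b i)"
    using F(1) c(1)
  proof (induct F)
    case empty
    then show ?case using lincomb_zero'[of N b "\<lambda>_. 0"] bD(1) by simp
  next
    case (insert k F)
    have vc: "v j \<in> carrier L" if "j \<in> insert k F" for j
      using insert(4)[OF that] lincomb_closed'[of N b "c j"] bD(1) by simp
    have "(\<Oplus>k\<in>insert k F. v k) = v k \<oplus> (\<Oplus>k\<in>F. v k)"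
      using insert(1,2) vc by (intro finsum_insert) auto
    then show ?case
      using insert lincomb_add[of N b "c k" "\<lambda>i. \<Sum>k\<in>F. c k i"] bD(1) by simp
  qed
  then have "(\<Oplus>i\<in>{..<N}. (\<Sum>k\<in>F. c k i) \<odot> b i) = \<zero>" using F(3) by simp
  from bD(6)[OF this] have s: "(\<Sum>k\<in>F. c k i) = 0" if "i < N" for i using that .
  have "c k i = 0" if i: "i < N" for i
  proof (cases "deg i = k")
    case True
    have "(\<Sum>j\<in>F. c j i) = (\<Sum>j\<in>F. if j = k then c k i else 0)"
      using c(2) i True by (intro sum.cong) auto
    then show ?thesis using s[OF i] F(1,4) by simp
  qed (use c(2) F(4) i in blast)
  then show "v k = \<zero>" unfolding c(1)[OF F(4)] by (intro lincomb_zero' bD(1))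
next
  fix x i y j assume "x \<in> U i" "y \<in> U j"
  then have "x \<otimes> y = \<zero>" using abelian subspaceD(1)[OF U_subspace] by blast
  then show "x \<otimes> y \<in> U (i + j)" using subspaceD(2)[OF U_subspace] by simp
next
  let ?X = "U (-1) \<union> U 0 \<union> U 1"
  have X: "?X \<subseteq> carrier L" using subspaceD(5)[OF U_subspace] by blast
  have s: "subspace (lie_generated L ?X)" using lie_generated_subalgebra[OF X] by (simp add: lie_subalgebra_def)
  have "U k \<subseteq> lie_generated L ?X" for k
    using lie_generated_superset[of ?X] U_trivial[of k] subspaceD(2)[OF s] by (cases "k \<in> {-1, 0, 1}") auto
  then have "carrier L \<subseteq> lie_generated L ?X" by (rule carrier_minimal[OF s])
  then show "lie_generated L ?X = carrier L" using lie_generated_subset_carrier[OF X] by blast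
qed

lemma U_minimal: "minimal_graded_lie_algebra L U"
proof (rule transitive_grading_minimal[OF U_graded])
  have "x = \<zero>" if "2 \<le> k" "x \<in> U k \<or> x \<in> U (- k)" for k x
    using that U_trivial[of k] U_trivial[of "- k"] by auto
  then show "transitive_grading L U" unfolding transitive_grading_def by blast
qed

lemma U_basis:
  assumes \<iota>: "bij_betw \<iota> {..<m} {i. i < N \<and> deg i = d}"
  shows "family_basis m (\<lambda>k. b (\<iota> k)) (U d)"
proof -
  let ?D = "{i. i < N \<and> deg i = d}"
  have im: "\<iota> ` {..<m} = ?D" and inj: "inj_on \<iota> {..<m}" using \<iota> by (auto simp: bij_betw_def)
  have \<iota>N: "\<iota> k < N" if "k < m" for k using im that by blast
  have A: "(\<Oplus>i\<in>{..<N}. c i \<odot> b i) = (\<Oplus>k\<in>{..<m}. c (\<iota> k) \<odot> b (\<iota> k))"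
    if "\<And>i. \<lbrakk>i < N; deg i \<noteq> d\<rbrakk> \<Longrightarrow> c i = 0" for c
  proof -
    have "(\<Oplus>i\<in>?D. c i \<odot> b i) = (\<Oplus>i\<in>{..<N}. c i \<odot> b i)"
      by (rule add.finprod_mono_neutral_cong_left) (use that bD(1) in auto)
    moreover have "(\<Oplus>i\<in>\<iota> ` {..<m}. c i \<odot> b i) = (\<Oplus>k\<in>{..<m}. c (\<iota> k) \<odot> b (\<iota> k))"
      using inj bD(1) \<iota>N by (subst finsum_reindex) auto
    ultimately show ?thesis unfolding im by simp
  qed
  have B: "(\<Oplus>k\<in>{..<m}. c k \<odot> b (\<iota> k)) = (\<Oplus>i\<in>{..<N}. (if deg i = d then c (inv_into {..<m} \<iota> i) else 0) \<odot> b i)" for c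
  proof -
    have "(\<Oplus>i\<in>{..<N}. (if deg i = d then c (inv_into {..<m} \<iota> i) else 0) \<odot> b i)
        = (\<Oplus>k\<in>{..<m}. (if deg (\<iota> k) = d then c (inv_into {..<m} \<iota> (\<iota> k)) else 0) \<odot> b (\<iota> k))"
      by (rule A) simp
    also have "\<dots> = (\<Oplus>k\<in>{..<m}. c k \<odot> b (\<iota> k))"
      using im bD(1) \<iota>N by (intro finsum_cong') (auto simp: inv_into_f_f[OF inj])
    finally show ?thesis by simp
  qed
  have "U d = {\<Oplus>k\<in>{..<m}. c k \<odot> b (\<iota> k) | c. True}"
  proof (intro equalityI subsetI)
    fix x assume "x \<in> U d"
    then obtain c where "x = (\<Oplus>i\<in>{..<N}. c i \<odot> b i)" "\<And>i. \<lbrakk>i < N; deg i \<noteq> d\<rbrakk> \<Longrightarrow> c i = 0"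
      by (rule UE) (rule that; assumption)
    then have "x = (\<Oplus>k\<in>{..<m}. c (\<iota> k) \<odot> b (\<iota> k))" using A by simp
    then show "x \<in> {\<Oplus>k\<in>{..<m}. c k \<odot> b (\<iota> k) | c. True}"
      unfolding mem_Collect_eq by (intro exI[of _ "\<lambda>k. c (\<iota> k)"] conjI TrueI)
  next
    fix x assume "x \<in> {\<Oplus>k\<in>{..<m}. c k \<odot> b (\<iota> k) | c. True}"
    then obtain c where "x = (\<Oplus>k\<in>{..<m}. c k \<odot> b (\<iota> k))" by blast
    then show "x \<in> U d" unfolding B by (simp add: UI)
  qed
  moreover have "c k = 0" if c: "(\<Oplus>k\<in>{..<m}. c k \<odot> b (\<iota> k)) = \<zero>" and k: "k < m" for c k
  proof -
    have "(if deg (\<iota> k) = d then c (inv_into {..<m} \<iota> (\<iota> k)) else 0) = 0"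
      by (rule bD(6)[OF c[unfolded B] \<iota>N[OF k]])
    moreover have "deg (\<iota> k) = d" using im k by blast
    ultimately show ?thesis using k by (simp add: inv_into_f_f[OF inj])
  qed
  ultimately show ?thesis unfolding family_basis_def using bD(1) \<iota>N by auto
qed

end

text \<open>The grading induced from \<open>G(0)\<close> on its reduced algebra has no component of degree 0, whereas a
  PC Lie algebra has one of dimension \<open>r > 0\<close>. The algebra being abelian, two basis vectors can be
  moved to degree 0, which leaves \<open>n - 1 > 0\<close> pairs.\<close>

lemma abelian_symmetric_pc:
  fixes L :: "(complex, 'a) module"
  assumes "lie_algebra L" and ab: "\<And>x y. \<lbrakk>x \<in> carrier L; y \<in> carrier L\<rbrakk> \<Longrightarrow> x \<otimes>\<^bsub>L\<^esub> y = \<zero>\<^bsub>L\<^esub>"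
    and n: "2 \<le> n" and b: "complex_space.family_basis L (n + n) b (carrier L)"
  shows "symmetric_pc_lie_algebra L"
proof -
  interpret L: lie_algebra L by fact
  \<comment> \<open>In the application the basis lists first the e's, then the f's: the last e and
    the last f, at positions n - 1 and 2n - 1, go to degree 0, while the others keep degrees 1 and
    -1.\<close>
  define deg :: "nat \<Rightarrow> int" where "deg i = (if i < n - 1 then 1 else if i = n - 1 \<or> i = n + n - 1 then 0 else -1)" for i
  interpret A: abelian_graded_basis L "n + n" b deg
    by unfold_locales (use ab b in \<open>auto simp: deg_def\<close>)
  define \<iota>0 where "\<iota>0 k = (if k = 0 then n - 1 else n + n - 1)" for k :: nat
  have "bij_betw \<iota>0 {..<2} {i. i < n + n \<and> deg i = 0}"
    unfolding bij_betw_def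
  proof
    show "inj_on \<iota>0 {..<2}" using n by (auto simp: inj_on_def \<iota>0_def)
    have "\<iota>0 ` {..<2} = {n - 1, n + n - 1}" by (auto simp: \<iota>0_def lessThan_Suc numeral_2_eq_2)
    also have "\<dots> = {i. i < n + n \<and> deg i = 0}" using n by (auto simp: deg_def split: if_splits)
    finally show "\<iota>0 ` {..<2} = {i. i < n + n \<and> deg i = 0}" .
  qed
  note b0 = A.U_basis[OF this]
  have "bij_betw (\<lambda>k. k) {..<n - 1} {i. i < n + n \<and> deg i = 1}"
    unfolding bij_betw_def by (auto simp: deg_def split: if_splits)
  note b1 = A.U_basis[OF this]
  have "bij_betw (\<lambda>k. n + k) {..<n - 1} {i. i < n + n \<and> deg i = -1}"
    unfolding bij_betw_def
  proof
    show "(\<lambda>k. n + k) ` {..<n - 1} = {i. i < n + n \<and> deg i = -1}"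
    proof (intro equalityI subsetI)
      fix i assume "i \<in> {i. i < n + n \<and> deg i = -1}"
      then show "i \<in> (\<lambda>k. n + k) ` {..<n - 1}"
        by (intro image_eqI[of _ _ "i - n"]) (auto simp: deg_def split: if_splits)
    qed (auto simp: deg_def)
  qed (auto simp: inj_on_def)
  note b2 = A.U_basis[OF this]
  \<comment> \<open>All brackets vanish, so D = 0 and X = 0, and any symmetric invertible
    \<open>B\<close> satisfies the matrix condition; the identity is taken.\<close>
  have "\<exists>A. pc_data 2 (n - 1) A (0\<^sub>m 2 (n - 1)) (1\<^sub>m (n - 1)) \<and>
      is_pc_algebra_of 2 (n - 1) A (0\<^sub>m 2 (n - 1)) (1\<^sub>m (n - 1)) L \<and>
      (\<forall>a b. pc_form A a b = a \<bullet> (1\<^sub>m 2 *\<^sub>v b))"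
  proof (rule pc_algebraI[where X = "0\<^sub>m 2 (n - 1)", OF _ _ _ _ _ _ _ _ _ _ A.U_minimal b0 b1 b2])
    show "invertible_mat (1\<^sub>m (n - 1) :: complex mat)" "invertible_mat (1\<^sub>m 2 :: complex mat)"
      using invertible_matI[of "1\<^sub>m (n - 1) :: complex mat" "n - 1"] invertible_matI[of "1\<^sub>m 2 :: complex mat" 2]
      by simp_all
    have bc: "b i \<in> carrier L" if "i < n + n" for i using A.bD(1)[OF that] .
    have \<iota>n: "\<iota>0 k < n + n" for k using n by (auto simp: \<iota>0_def)
    fix i j assume ij: "i < n - 1" "j < n - 1"
    have "(\<Oplus>\<^bsub>L\<^esub>k\<in>{..<2}. 0\<^sub>m 2 (n - 1) $$ (k, i) \<odot>\<^bsub>L\<^esub> b (\<iota>0 k)) = \<zero>\<^bsub>L\<^esub>"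
      by (rule L.lincomb_zero') (use bc \<iota>n ij in auto)
    moreover have "b i \<otimes>\<^bsub>L\<^esub> b (n + j) = \<zero>\<^bsub>L\<^esub>" using ab bc ij by simp
    ultimately show "b i \<otimes>\<^bsub>L\<^esub> b (n + j) =
        (if i = j then \<Oplus>\<^bsub>L\<^esub>k\<in>{..<2}. 0\<^sub>m 2 (n - 1) $$ (k, i) \<odot>\<^bsub>L\<^esub> b (\<iota>0 k) else \<zero>\<^bsub>L\<^esub>)"
      by (cases "i = j") simp_all
  next
    have bc: "b i \<in> carrier L" if "i < n + n" for i using A.bD(1)[OF that] .
    have \<iota>n: "\<iota>0 k < n + n" for k using n by (auto simp: \<iota>0_def)
    fix k j :: nat assume "k < 2" "j < n - 1"
    then show "b (\<iota>0 k) \<otimes>\<^bsub>L\<^esub> b j = 0\<^sub>m 2 (n - 1) $$ (k, j) \<odot>\<^bsub>L\<^esub> b j"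
      "b (\<iota>0 k) \<otimes>\<^bsub>L\<^esub> b (n + j) = - 0\<^sub>m 2 (n - 1) $$ (k, j) \<odot>\<^bsub>L\<^esub> b (n + j)"
      using bc \<iota>n ab by simp_all
  next
    have bc: "b i \<in> carrier L" if "i < n + n" for i using A.bD(1)[OF that] .
    have \<iota>n: "\<iota>0 k < n + n" for k using n by (auto simp: \<iota>0_def)
    show "b (\<iota>0 k) \<otimes>\<^bsub>L\<^esub> b (\<iota>0 l) = \<zero>\<^bsub>L\<^esub>" for k l using bc \<iota>n ab by simp
  qed (use n in \<open>auto simp: diagonal_mat_def\<close>)
  then obtain A where A: "pc_data 2 (n - 1) A (0\<^sub>m 2 (n - 1)) (1\<^sub>m (n - 1))"
      "is_pc_algebra_of 2 (n - 1) A (0\<^sub>m 2 (n - 1)) (1\<^sub>m (n - 1)) L"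
      "\<And>a b. pc_form A a b = a \<bullet> (1\<^sub>m 2 *\<^sub>v b)" by blast
  have "pc_form A x y = pc_form A y x" if "x \<in> carrier_vec 2" "y \<in> carrier_vec 2" for x y
    using that comm_scalar_prod[of x 2 y] by (simp add: A(3))
  then show ?thesis using A(1,2) unfolding symmetric_pc_lie_algebra_def by blast
qed

text \<open>For C = 0 all coroots are central, so degree 0 of the quotient vanishes. Then degrees 1
  and -1 commute with each other, and brackets within degree 1 or within degree -1 are killed by the
  opposite degree, hence zero by transitivity: the quotient is abelian, with the 2n images of the
  e's and f's as basis.\<close>

lemma (in chevalley_transitive) quotient_zero_pc:
  assumes C0: "C = 0\<^sub>m n n" and n: "2 \<le> n"
  shows "symmetric_pc_lie_algebra Q"
proof -
  let ?W = "\<lambda>k. \<pi> ` V k"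
  have W0: "?W 0 = {\<zero>\<^bsub>Q\<^esub>}"
  proof -
    have "(\<Oplus>\<^bsub>Q\<^esub>i\<in>{..<n}. c i \<odot>\<^bsub>Q\<^esub> hq i) = \<zero>\<^bsub>Q\<^esub>" for c
      using hq_comb_zero_iff[of c] by (simp add: C0)
    then show ?thesis unfolding hq_span by simp
  qed
  have WD: "x \<in> carrier Q" if "x \<in> ?W k" for x k using Q.VD(1)[OF that] .
  have pm: "y \<otimes>\<^bsub>Q\<^esub> x = \<zero>\<^bsub>Q\<^esub>" if "x \<in> ?W k" "y \<in> ?W (- k)" for x y k
    using Q.V_bracket[OF that(2,1)] W0 by auto
  have key: "x \<otimes>\<^bsub>Q\<^esub> y = \<zero>\<^bsub>Q\<^esub>" if "x \<in> ?W d" "y \<in> ?W d" "d \<in> {1, -1}" for x y d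
  proof -
    have xy: "x \<otimes>\<^bsub>Q\<^esub> y \<in> ?W (d + d)" by (rule Q.V_bracket[OF that(1,2)])
    have z: "f \<otimes>\<^bsub>Q\<^esub> (x \<otimes>\<^bsub>Q\<^esub> y) = \<zero>\<^bsub>Q\<^esub>" if f: "f \<in> ?W (- d)" for f
      using Q.bracket_derivation[OF WD[OF f] WD[OF \<open>x \<in> ?W d\<close>] WD[OF \<open>y \<in> ?W d\<close>]]
        pm[OF \<open>x \<in> ?W d\<close> f] pm[OF \<open>y \<in> ?W d\<close> f] WD[OF \<open>x \<in> ?W d\<close>] WD[OF \<open>y \<in> ?W d\<close>] by simp
    from that(3) consider "d = 1" | "d = -1" by blast
    then show ?thesis
    proof cases
      case 1
      have "x \<otimes>\<^bsub>Q\<^esub> y \<in> ?W 2" "\<forall>f\<in>?W (-1). f \<otimes>\<^bsub>Q\<^esub> (x \<otimes>\<^bsub>Q\<^esub> y) = \<zero>\<^bsub>Q\<^esub>" using xy z 1 by auto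
      moreover have "(2::int) \<le> 2" by simp
      ultimately show ?thesis using Q_transitive unfolding transitive_grading_def by blast
    next
      case 2
      have "x \<otimes>\<^bsub>Q\<^esub> y \<in> ?W (- 2)" "\<forall>f\<in>?W 1. f \<otimes>\<^bsub>Q\<^esub> (x \<otimes>\<^bsub>Q\<^esub> y) = \<zero>\<^bsub>Q\<^esub>" using xy z 2 by auto
      moreover have "(2::int) \<le> 2" by simp
      ultimately show ?thesis using Q_transitive unfolding transitive_grading_def by blast
    qed
  qed
  let ?X = "?W (-1) \<union> ?W 0 \<union> ?W 1"
  have comm: "x \<otimes>\<^bsub>Q\<^esub> y = \<zero>\<^bsub>Q\<^esub>" if "x \<in> ?X" "y \<in> ?X" for x y
  proof -
    have xc: "x \<in> carrier Q" and yc: "y \<in> carrier Q" using that Q.local_part_carrier by blast+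
    have x0: "x \<otimes>\<^bsub>Q\<^esub> y = \<zero>\<^bsub>Q\<^esub>" if "x \<in> ?W 0" using that yc unfolding W0 by simp
    have y0: "x \<otimes>\<^bsub>Q\<^esub> y = \<zero>\<^bsub>Q\<^esub>" if "y \<in> ?W 0" using that xc unfolding W0 by simp
    have op: "x \<otimes>\<^bsub>Q\<^esub> y = \<zero>\<^bsub>Q\<^esub>" if "x \<in> ?W 1" "y \<in> ?W (-1)"
      by (rule pm[OF that(2)]) (simp add: that(1))
    have po: "x \<otimes>\<^bsub>Q\<^esub> y = \<zero>\<^bsub>Q\<^esub>" if "x \<in> ?W (-1)" "y \<in> ?W 1"
      by (rule pm[OF that(2) that(1)])
    have pp: "x \<otimes>\<^bsub>Q\<^esub> y = \<zero>\<^bsub>Q\<^esub>" if "x \<in> ?W 1" "y \<in> ?W 1" by (rule key[OF that]) simp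
    have oo: "x \<otimes>\<^bsub>Q\<^esub> y = \<zero>\<^bsub>Q\<^esub>" if "x \<in> ?W (-1)" "y \<in> ?W (-1)" by (rule key[OF that]) simp
    show ?thesis using that x0 y0 op po pp oo by (elim UnE) assumption+
  qed
  have ab: "x \<otimes>\<^bsub>Q\<^esub> y = \<zero>\<^bsub>Q\<^esub>" if "x \<in> carrier Q" "y \<in> carrier Q" for x y
    by (rule Q.commuting_generators_abelian[OF Q.local_part_carrier Q.generated_by_local_part comm that])
  have car: "\<exists>a\<in>?W 1. \<exists>b\<in>?W (-1). x = a \<oplus>\<^bsub>Q\<^esub> b" if x: "x \<in> carrier Q" for x
  proof -
    have i1: "lie_ideal Q (?W k)" for k
      unfolding lie_ideal_def
    proof (intro conjI ballI)
      fix x y assume "x \<in> carrier Q" and y: "y \<in> ?W k"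
      then have "x \<otimes>\<^bsub>Q\<^esub> y = \<zero>\<^bsub>Q\<^esub>" by (intro ab) (assumption, rule WD[OF y])
      then show "x \<otimes>\<^bsub>Q\<^esub> y \<in> ?W k" by (simp only:) (rule Q.VD(2))
    qed (rule Q.V_subspace)
    have id: "lie_ideal Q {a \<oplus>\<^bsub>Q\<^esub> b | a b. a \<in> ?W 1 \<and> b \<in> ?W (-1)}" by (rule Q.lie_ideal_sum[OF i1 i1])
    note s = Q.lie_idealD(1)[OF id]
    have "lie_subalgebra Q {a \<oplus>\<^bsub>Q\<^esub> b | a b. a \<in> ?W 1 \<and> b \<in> ?W (-1)}"
    proof (rule Q.lie_subalgebraI[OF s])
      fix x y
      assume x: "x \<in> {a \<oplus>\<^bsub>Q\<^esub> b | a b. a \<in> ?W 1 \<and> b \<in> ?W (-1)}"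
        and y: "y \<in> {a \<oplus>\<^bsub>Q\<^esub> b | a b. a \<in> ?W 1 \<and> b \<in> ?W (-1)}"
      show "x \<otimes>\<^bsub>Q\<^esub> y \<in> {a \<oplus>\<^bsub>Q\<^esub> b | a b. a \<in> ?W 1 \<and> b \<in> ?W (-1)}"
        by (rule Q.lie_idealD(2)[OF id Q.subspaceD(1)[OF s x] y])
    qed
    moreover have "?X \<subseteq> {a \<oplus>\<^bsub>Q\<^esub> b | a b. a \<in> ?W 1 \<and> b \<in> ?W (-1)}"
    proof
      fix x assume x: "x \<in> ?X"
      have xc: "x \<in> carrier Q" using x Q.local_part_carrier by blast
      have z: "\<zero>\<^bsub>Q\<^esub> \<in> ?W k" for k by (rule Q.VD(2))
      have "\<exists>a b. x = a \<oplus>\<^bsub>Q\<^esub> b \<and> a \<in> ?W 1 \<and> b \<in> ?W (-1)"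
      proof (cases "x \<in> ?W 1")
        case True
        then show ?thesis using xc z by (intro exI[of _ x] exI[of _ "\<zero>\<^bsub>Q\<^esub>"] conjI) simp_all
      next
        case False
        have "x \<in> ?W (-1)"
        proof (cases "x \<in> ?W 0")
          case True
          then have "x = \<zero>\<^bsub>Q\<^esub>" unfolding W0 by simp
          then show ?thesis by (simp only:) (rule z)
        next
          case 0: False
          show ?thesis using x
            by (elim UnE) (assumption, rule notE[OF 0], assumption, rule notE[OF False], assumption)
        qed
        then show ?thesis using xc z by (intro exI[of _ "\<zero>\<^bsub>Q\<^esub>"] exI[of _ x] conjI) simp_all
      qed
      then show "x \<in> {a \<oplus>\<^bsub>Q\<^esub> b | a b. a \<in> ?W 1 \<and> b \<in> ?W (-1)}" unfolding mem_Collect_eq .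
    qed
    ultimately have "lie_generated Q ?X \<subseteq> {a \<oplus>\<^bsub>Q\<^esub> b | a b. a \<in> ?W 1 \<and> b \<in> ?W (-1)}"
      by (rule Q.lie_generated_minimal)
    then show ?thesis using x Q.generated_by_local_part by blast
  qed
  have disj: "?W 1 \<inter> ?W (-1) = {\<zero>\<^bsub>Q\<^esub>}"
  proof (intro equalityI subsetI)
    fix x assume "x \<in> ?W 1 \<inter> ?W (-1)"
    then have "x \<in> ?W 1" "x \<in> ?W (-1)" by (rule IntD1, rule IntD2)
    then have "x = \<zero>\<^bsub>Q\<^esub>" using Q.component_disjoint[of x 1 "-1"] by simp
    then show "x \<in> {\<zero>\<^bsub>Q\<^esub>}" by simp
  qed (simp add: Q.VD(2))
  have fb: "Q.family_basis (n + n) (\<lambda>i. if i < n then \<pi> (ee i) else \<pi> (ff (i - n))) (carrier Q)"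
    by (rule Q.family_basis_append[OF Q_e_basis Q_f_basis disj]) (rule car)
  show ?thesis by (rule abelian_symmetric_pc[OF Q.lie_algebra_axioms ab n fb])
qed

section \<open>Contragredient Lie algebras inside a Kac algebra\<close>

lemma (in independent_datum) kac_derived_transitive:
  assumes "C \<in> carrier_mat n n" "\<And>i j. \<lbrakk>i < n; j < n\<rbrakk> \<Longrightarrow> \<alpha> j (\<alpha>\<^sub>c i) = C $$ (i, j)"
  shows "\<exists>V H'. chevalley_transitive (derived_algebra (kac_algebra n H \<alpha> \<alpha>\<^sub>c)) V H' n \<alpha> \<alpha>\<^sub>c hk ek fk C"
proof -
  obtain V H' where c: "chevalley_graded (derived_algebra (kac_algebra n H \<alpha> \<alpha>\<^sub>c)) V H' n \<alpha> \<alpha>\<^sub>c hk ek fk"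
    "transitive_grading (derived_algebra (kac_algebra n H \<alpha> \<alpha>\<^sub>c)) V"
    "complex_space.family_basis H' n \<alpha>\<^sub>c (carrier H')" "\<forall>i<n. \<alpha> i \<in> linear_maps H' complex_line"
    using kac_derived by (elim exE conjE) (rule that)
  have "chevalley_transitive (derived_algebra (kac_algebra n H \<alpha> \<alpha>\<^sub>c)) V H' n \<alpha> \<alpha>\<^sub>c hk ek fk C"
  proof (rule chevalley_transitive.intro[OF c(1)], unfold_locales)
    show "i < n \<Longrightarrow> \<alpha> i \<in> linear_maps H' complex_line" for i using c(4) by simp
  qed (use n_pos c(2,3) assms in simp_all)
  then show ?thesis by (intro exI)
qed

text \<open>\<open>\<complex>\<^sup>2\<^sup>n\<close> is larger than a realization of \<open>C\<close> unless \<open>C = 0\<close>, but it has the independence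
  properties that are used, without any choice of a basis adapted to \<open>C\<close>.\<close>

definition standard_root :: "nat \<Rightarrow> complex mat \<Rightarrow> nat \<Rightarrow> complex vec \<Rightarrow> complex"
  where "standard_root n C j h = (\<Sum>i<n. h $ i * C $$ (i, j)) + h $ (n + j)"

lemma standard_root_coroot:
  assumes "i < n" "j < n"
  shows "standard_root n C j (unit_vec (n + n) i) = C $$ (i, j)"
proof -
  have "(\<Sum>l<n. unit_vec (n + n) i $ l * C $$ (l, j)) = (\<Sum>l<n. if l = i then C $$ (l, j) else 0)"
    using assms by (intro sum.cong) auto
  then show ?thesis using assms by (simp add: standard_root_def)
qed

text \<open>The last n unit vectors are dual to the roots; this gives the independence of the roots
  for every \<open>C\<close>.\<close>

lemma standard_root_dual:
  assumes "k < n" "j < n"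
  shows "standard_root n C j (unit_vec (n + n) (n + k)) = (if k = j then 1 else 0)"
proof -
  have "(\<Sum>l<n. unit_vec (n + n) (n + k) $ l * C $$ (l, j)) = 0"
    using assms by (intro sum.neutral) auto
  then show ?thesis using assms by (auto simp: standard_root_def)
qed

lemma standard_datum:
  assumes n: "0 < n"
  shows "independent_datum (module_vec TYPE(complex) (n + n)) n (standard_root n C) (unit_vec (n + n))"
proof -
  let ?H = "module_vec TYPE(complex) (n + n)"
  interpret vs: vec_space "TYPE(complex)" "n + n" .
  interpret H: complex_space ?H by (rule module_vec_complex_space)
  show ?thesis
  proof unfold_locales
    show "vectorspace.fin_dim complex_ring ?H" by (rule vs.fin_dim)
  next
    fix j assume j: "j < n"
    show "standard_root n C j \<in> linear_maps ?H complex_line"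
      unfolding linear_maps_iff
    proof (intro conjI allI ballI)
      fix x y assume xy: "x \<in> carrier ?H" "y \<in> carrier ?H"
      then have d: "dim_vec x = n + n" "dim_vec y = n + n" by (auto simp: module_vec_simps)
      have "(\<Sum>i<n. (x + y) $ i * C $$ (i, j)) = (\<Sum>i<n. x $ i * C $$ (i, j)) + (\<Sum>i<n. y $ i * C $$ (i, j))"
        unfolding sum.distrib[symmetric] by (rule sum.cong) (use d in \<open>auto simp: algebra_simps\<close>)
      then show "standard_root n C j (x \<oplus>\<^bsub>?H\<^esub> y) =
          standard_root n C j x \<oplus>\<^bsub>complex_line\<^esub> standard_root n C j y"
        using d j by (simp add: standard_root_def module_vec_simps)
    next
      fix c x assume "x \<in> carrier ?H"
      then have d: "dim_vec x = n + n" by (auto simp: module_vec_simps)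
      have "(\<Sum>i<n. (c \<cdot>\<^sub>v x) $ i * C $$ (i, j)) = c * (\<Sum>i<n. x $ i * C $$ (i, j))"
        unfolding sum_distrib_left by (rule sum.cong) (use d in auto)
      then show "standard_root n C j (c \<odot>\<^bsub>?H\<^esub> x) = c \<odot>\<^bsub>complex_line\<^esub> standard_root n C j x"
        using d j by (simp add: standard_root_def module_vec_simps distrib_left)
    qed simp
  next
    show "\<forall>c. (\<forall>h\<in>carrier ?H. (\<Sum>i<n. c i * standard_root n C i h) = 0) \<longrightarrow> (\<forall>i<n. c i = 0)"
    proof (intro allI impI)
      fix c k assume z: "\<forall>h\<in>carrier ?H. (\<Sum>i<n. c i * standard_root n C i h) = 0" and k: "k < n"
      have "(\<Sum>i<n. c i * standard_root n C i (unit_vec (n + n) (n + k))) = (\<Sum>i<n. if i = k then c i else 0)"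
        by (rule sum.cong) (use k in \<open>auto simp: standard_root_dual\<close>)
      then show "c k = 0" using z k by (simp add: module_vec_simps)
    qed
  next
    show "\<forall>c. (\<Oplus>\<^bsub>?H\<^esub>i\<in>{..<n}. c i \<odot>\<^bsub>?H\<^esub> unit_vec (n + n) i) = \<zero>\<^bsub>?H\<^esub> \<longrightarrow> (\<forall>i<n. c i = 0)"
    proof (intro allI impI)
      fix c k assume z: "(\<Oplus>\<^bsub>?H\<^esub>i\<in>{..<n}. c i \<odot>\<^bsub>?H\<^esub> unit_vec (n + n) i) = \<zero>\<^bsub>?H\<^esub>" and k: "k < n"
      have "(\<Oplus>\<^bsub>?H\<^esub>i\<in>{..<n}. c i \<odot>\<^bsub>?H\<^esub> unit_vec (n + n) i) $ k = (\<Sum>i<n. c i * unit_vec (n + n) i $ k)"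
        by (rule lincomb_vec_index) (use k in auto)
      also have "\<dots> = (\<Sum>i<n. if i = k then c i else 0)" by (rule sum.cong) (use k in auto)
      finally show "c k = 0" using z k by (simp add: module_vec_simps)
    qed
  qed (use n in \<open>auto simp: module_vec_simps\<close>)
qed

text \<open>The representative on \<open>contragredient_carrier\<close>: it witnesses the last claim
  of the theorem, and its derived algebra is a copy of G(C).\<close>

definition standard_kac_algebra :: "nat \<Rightarrow> complex mat \<Rightarrow> (complex, contragredient_carrier) module"
  where "standard_kac_algebra n C =
    kac_algebra n (module_vec TYPE(complex) (n + n)) (standard_root n C) (unit_vec (n + n))"

lemma standard_kac_algebra:
  assumes n: "0 < n" and C: "C \<in> carrier_mat n n"
  shows "pc_lie_algebra (standard_kac_algebra n C)"
    and "\<exists>V H \<alpha> \<alpha>\<^sub>c hh ee ff. chevalley_transitive (derived_algebra (standard_kac_algebra n C))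
      V (H :: (complex, complex vec) module) n \<alpha> \<alpha>\<^sub>c hh ee ff C"
proof -
  interpret independent_datum "module_vec TYPE(complex) (n + n)" n "standard_root n C" "unit_vec (n + n)"
    by (rule standard_datum[OF n])
  show "pc_lie_algebra (standard_kac_algebra n C)"
    unfolding standard_kac_algebra_def by (rule kac_algebra_pc)
  obtain V H' where "chevalley_transitive (derived_algebra (standard_kac_algebra n C)) V H' n
      (standard_root n C) (unit_vec (n + n)) hk ek fk C"
    unfolding standard_kac_algebra_def
    using kac_derived_transitive[of C, OF C] standard_root_coroot[of _ n _ C] by (meson that)
  then show "\<exists>V H \<alpha> \<alpha>\<^sub>c hh ee ff. chevalley_transitive (derived_algebra (standard_kac_algebra n C))
      V (H :: (complex, complex vec) module) n \<alpha> \<alpha>\<^sub>c hh ee ff C"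
    by (intro exI)
qed

lemma is_contragredient_lie_algebra: "is_contragredient n C L \<Longrightarrow> lie_algebra L"
  unfolding is_contragredient_def minimal_graded_lie_algebra_def graded_lie_algebra_def by blast

lemma is_contragredient_standard:
  assumes "0 < n" "C \<in> carrier_mat n n"
  shows "is_contragredient n C (derived_algebra (standard_kac_algebra n C))"
proof -
  obtain V H \<alpha> \<alpha>\<^sub>c hh ee ff where "chevalley_transitive (derived_algebra (standard_kac_algebra n C))
      V (H :: (complex, complex vec) module) n \<alpha> \<alpha>\<^sub>c hh ee ff C"
    using standard_kac_algebra(2)[OF assms] by (elim exE) (rule that)
  then interpret chevalley_transitive "derived_algebra (standard_kac_algebra n C)" V H n \<alpha> \<alpha>\<^sub>c hh ee ff C .
  show ?thesis by (rule is_contragredientI[OF transitive coroot_basis C(2)])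
qed

text \<open>The existence half of the description of G(C): the choice that defines
  \<open>contragredient\<close> is made from a nonempty set.\<close>

lemma is_contragredient_contragredient:
  assumes "0 < n" "C \<in> carrier_mat n n"
  shows "is_contragredient n C (contragredient n C)"
  unfolding contragredient_def
  by (rule someI[where P = "is_contragredient n C"]) (rule is_contragredient_standard[OF assms])

lemma contragredient_iso_derived:
  assumes "0 < n" "C \<in> carrier_mat n n"
  shows "contragredient n C \<simeq>\<^sub>L derived_algebra (standard_kac_algebra n C)"
    and "derived_algebra (standard_kac_algebra n C) \<simeq>\<^sub>L contragredient n C"
  by (rule is_contragredient_unique; rule is_contragredient_standard is_contragredient_contragredient;
      rule assms)+

lemma reduced_contragredient_iso_quotient:
  assumes "0 < n" "C \<in> carrier_mat n n"
  defines "P \<equiv> derived_algebra (standard_kac_algebra n C)"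
  shows "reduced_contragredient n C \<simeq>\<^sub>L lie_quotient P (lie_center P)"
proof -
  have l: "lie_algebra (contragredient n C)" "lie_algebra P"
    unfolding P_def by (rule is_contragredient_lie_algebra,
      rule is_contragredient_contragredient is_contragredient_standard, rule assms(1), rule assms(2))+
  obtain f where f: "f \<in> lie_iso (contragredient n C) P"
    using contragredient_iso_derived(1)[OF assms(1,2)] unfolding P_def lie_isomorphic_def by blast
  note c = lie_iso_center[OF l f]
  have "lie_quotient (contragredient n C) (lie_center (contragredient n C)) \<simeq>\<^sub>L
      lie_quotient P (f ` lie_center (contragredient n C))"
    by (rule lie_iso_quotient[OF l f lie_algebra.center_ideal[OF l(1)]])
      (simp only: c lie_algebra.center_ideal[OF l(2)])
  then show ?thesis unfolding c reduced_contragredient_def .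
qed

lemma contragredient_center_trivial:
  assumes "0 < n" "C \<in> carrier_mat n n" "invertible_mat C"
  shows "lie_center (contragredient n C) = {\<zero>\<^bsub>contragredient n C\<^esub>}"
proof -
  let ?G = "contragredient n C" and ?P = "derived_algebra (standard_kac_algebra n C)"
  obtain V H \<alpha> \<alpha>\<^sub>c hh ee ff where "chevalley_transitive ?P
      V (H :: (complex, complex vec) module) n \<alpha> \<alpha>\<^sub>c hh ee ff C"
    using standard_kac_algebra(2)[OF assms(1,2)] by (elim exE) (rule that)
  then interpret P: chevalley_transitive ?P V H n \<alpha> \<alpha>\<^sub>c hh ee ff C .
  interpret G: lie_algebra ?G
    by (rule is_contragredient_lie_algebra[OF is_contragredient_contragredient[OF assms(1,2)]])
  obtain f where f: "f \<in> lie_iso ?P ?G"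
    using contragredient_iso_derived(2)[OF assms(1,2)] unfolding lie_isomorphic_def by blast
  have "f \<zero>\<^bsub>?P\<^esub> = \<zero>\<^bsub>?G\<^esub>"
    using f by (intro linear_map_zero[OF P.complex_space_axioms G.complex_space_axioms])
      (simp add: lie_iso_def lie_hom_def)
  then show ?thesis
    using lie_iso_center[OF P.lie_algebra_axioms G.lie_algebra_axioms f] P.center_trivial[OF assms(3)] by simp
qed

lemma contragredient_iso_reduced:
  assumes "0 < n" "C \<in> carrier_mat n n" "invertible_mat C"
  shows "contragredient n C \<simeq>\<^sub>L reduced_contragredient n C"
  unfolding reduced_contragredient_def contragredient_center_trivial[OF assms]
  by (rule quotient_by_zero is_contragredient_lie_algebra is_contragredient_contragredient assms)+

lemma contragredient_invertible_pc:
  assumes "0 < n" "C \<in> carrier_mat n n" "invertible_mat C"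
  shows "pc_lie_algebra (derived_algebra (standard_kac_algebra n C))"
proof -
  obtain V H \<alpha> \<alpha>\<^sub>c hh ee ff where "chevalley_transitive (derived_algebra (standard_kac_algebra n C))
      V (H :: (complex, complex vec) module) n \<alpha> \<alpha>\<^sub>c hh ee ff C"
    using standard_kac_algebra(2)[OF assms(1,2)] by (elim exE) (rule that)
  then show ?thesis by (rule chevalley_transitive.invertible_pc) (rule assms(3))
qed

text \<open>For n = 1 and C = 0 the reduced algebra is spanned by the images of e and f and has
  dimension 2, while a PC Lie algebra has dimension at least r + 2n, which is at least 3; hence the
  exclusion \<open>ne\<close>. For larger n the zero matrix is treated by regrading.\<close>

lemma reduced_symmetric_pc:
  assumes "0 < n" "C \<in> carrier_mat n n" and s: "has_real_symmetrization n C" and ne: "\<not> (n = 1 \<and> C = 0\<^sub>m 1 1)"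
  defines "P \<equiv> derived_algebra (standard_kac_algebra n C)"
  shows "symmetric_pc_lie_algebra (lie_quotient P (lie_center P))"
proof -
  obtain V H \<alpha> \<alpha>\<^sub>c hh ee ff where "chevalley_transitive P
      V (H :: (complex, complex vec) module) n \<alpha> \<alpha>\<^sub>c hh ee ff C"
    using standard_kac_algebra(2)[OF assms(1,2)] unfolding P_def[symmetric] by (elim exE) (rule that)
  then interpret P: chevalley_transitive P V H n \<alpha> \<alpha>\<^sub>c hh ee ff C .
  show ?thesis
  proof (cases "C = 0\<^sub>m n n")
    case True
    then have "n \<noteq> 1" using ne by blast
    then have "2 \<le> n" using assms(1) by simp
    then show ?thesis by (rule P.quotient_zero_pc[OF True])
  next
    case False
    obtain \<Gamma> S where g: "\<Gamma> \<in> carrier_mat n n" "diagonal_mat \<Gamma>" "invertible_mat \<Gamma>"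
      "S \<in> carrier_mat n n" "transpose_mat S = S" "C = \<Gamma> * S"
      using s unfolding has_real_symmetrization_def by (elim exE conjE) (rule that)
    show ?thesis by (rule P.quotient_symmetric_pc[OF g False])
  qed
qed

lemma realization_kac_algebra_pc:
  assumes "0 < n" "realization n C H \<alpha> \<alpha>\<^sub>c"
  shows "pc_lie_algebra (kac_algebra n H \<alpha> \<alpha>\<^sub>c)"
proof (rule independent_datum.kac_algebra_pc)
  note r = assms(2)[unfolded realization_def]
  interpret complex_space H using r by (simp add: complex_space_def)
  show "independent_datum H n \<alpha> \<alpha>\<^sub>c" by unfold_locales (use r assms(1) in simp_all)
qed

theorem theorem2p1:
  shows
    "(\<forall>n C. 0 < n \<and> C \<in> carrier_mat n n \<and> invertible_mat C \<longrightarrow>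
        contragredient n C \<simeq>\<^sub>L reduced_contragredient n C \<and>
        (\<exists>P :: (complex, contragredient_carrier) module.
          pc_lie_algebra P \<and> contragredient n C \<simeq>\<^sub>L P)) \<and>
     (\<forall>n C. 0 < n \<and> C \<in> carrier_mat n n \<and> has_real_symmetrization n C \<and>
        \<not> (n = 1 \<and> C = 0\<^sub>m 1 1) \<longrightarrow>
        (\<exists>P :: (complex, contragredient_carrier set) module.
          symmetric_pc_lie_algebra P \<and> reduced_contragredient n C \<simeq>\<^sub>L P)) \<and>
     (\<forall>n C (\<hh> :: (complex, 'h) module) \<alpha> \<alpha>\<^sub>c.
        0 < n \<and> C \<in> carrier_mat n n \<and> realization n C \<hh> \<alpha> \<alpha>\<^sub>c \<longrightarrow>
        (\<exists>P :: (complex, 'h kac_generator lie_term set set) module.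
          pc_lie_algebra P \<and> kac_algebra n \<hh> \<alpha> \<alpha>\<^sub>c \<simeq>\<^sub>L P)) \<and>
     (\<forall>K :: (complex, 'h kac_generator lie_term set set) module. kac_moody_algebra K \<longrightarrow>
        (\<exists>P :: (complex, 'h kac_generator lie_term set set) module.
          pc_lie_algebra P \<and> K \<simeq>\<^sub>L P)) \<and>
     (\<forall>n C. 0 < n \<and> C \<in> carrier_mat n n \<longrightarrow>
        (\<exists>P :: (complex, contragredient_carrier) module.
          pc_lie_algebra P \<and> derived_algebra P \<simeq>\<^sub>L contragredient n C))"
proof (intro conjI allI impI)
  fix n and C :: "complex mat"
  assume a: "0 < n \<and> C \<in> carrier_mat n n \<and> invertible_mat C"
  show "contragredient n C \<simeq>\<^sub>L reduced_contragredient n C"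
    by (rule contragredient_iso_reduced) (use a in simp_all)
  show "\<exists>P :: (complex, contragredient_carrier) module. pc_lie_algebra P \<and> contragredient n C \<simeq>\<^sub>L P"
    using contragredient_invertible_pc[of n C] contragredient_iso_derived(1)[of n C] a by blast
next
  fix n and C :: "complex mat"
  assume a: "0 < n \<and> C \<in> carrier_mat n n \<and> has_real_symmetrization n C \<and> \<not> (n = 1 \<and> C = 0\<^sub>m 1 1)"
  show "\<exists>P :: (complex, contragredient_carrier set) module.
      symmetric_pc_lie_algebra P \<and> reduced_contragredient n C \<simeq>\<^sub>L P"
    using reduced_symmetric_pc[of n C] reduced_contragredient_iso_quotient[of n C] a by blast
next
  fix n C \<alpha> \<alpha>\<^sub>c and \<hh> :: "(complex, 'h) module"
  assume "0 < n \<and> C \<in> carrier_mat n n \<and> realization n C \<hh> \<alpha> \<alpha>\<^sub>c"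
  then have "pc_lie_algebra (kac_algebra n \<hh> \<alpha> \<alpha>\<^sub>c)" by (elim conjE) (rule realization_kac_algebra_pc)
  then show "\<exists>P :: (complex, 'h kac_generator lie_term set set) module.
      pc_lie_algebra P \<and> kac_algebra n \<hh> \<alpha> \<alpha>\<^sub>c \<simeq>\<^sub>L P"
    using lie_isomorphic_refl by blast
next
  fix K :: "(complex, 'h kac_generator lie_term set set) module"
  assume "kac_moody_algebra K"
  then have "pc_lie_algebra K"
    unfolding kac_moody_algebra_def using realization_kac_algebra_pc by blast
  then show "\<exists>P :: (complex, 'h kac_generator lie_term set set) module. pc_lie_algebra P \<and> K \<simeq>\<^sub>L P"
    using lie_isomorphic_refl by blast
next
  fix n and C :: "complex mat"
  assume a: "0 < n \<and> C \<in> carrier_mat n n"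
  show "\<exists>P :: (complex, contragredient_carrier) module.
      pc_lie_algebra P \<and> derived_algebra P \<simeq>\<^sub>L contragredient n C"
    using standard_kac_algebra(1)[of n C] contragredient_iso_derived(2)[of n C] a by blast
qed

end
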